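(* Let $\mathcal{C}$ be an exact Mal'tsev category with coequalizers, and let $f:(X,R,S)\to (X',R',S')$ be a fibration in $2\text{-}\mathbf{Eq}(\mathcal{C})$. Then the following conditions are equivalent: (1) $f$ is a $\Gamma_{\mathcal{F}}$-central extension; (2) $f$ is a $\Gamma_{\mathcal{F}}$-normal extension; (3) $[Eq[f],R\vee S]=\Delta_{X}$.
   Context: A Mal'tsev category is a finitely complete category in which every reflexive relation is an equivalence relation; "exact" means Barr exact. $Eq[f]$ denotes the kernel pair of $f$ in $\mathcal C$, $\Delta_X$ the smallest equivalence relation on $X$, and $\wedge,\vee$ the meet and join of equivalence relations on an object. For a regular epimorphism $q$ with domain $X$ and an equivalence relation $R$ on $X$, $q(R)$ is the direct (regular) image of $R$ along $q$; it is an equivalence relation. Centralization and commutator. Equivalence relations $R,S$ on $X$ centralize each other if there is a (necessarily unique) morphism $p:R\times_X S\to X$ with $p(x,y,y)=x$ and $p(y,y,z)=z$ (in generalized elements), where $R\times_X S$ is the pullback of the second projection of $R$ and the first projection of $S$ (elements $(x,y,z)$ with $xRy$, $ySz$). The commutator $[R,S]$ is the smallest equivalence relation on $X$ whose coequalizer $q$ is such that $q(R)$ and $q(S)$ centralize each other. The category $2\text{-}\mathbf{Eq}(\mathcal C)$. Objects are triples $(X,R,S)$ with $R,S$ equivalence relations on the object $X$ of $\mathcal C$; morphisms $(X,R,S)\to(X',R',S')$ are morphisms $f:X\to X'$ in $\mathcal C$ with $f(R)\le R'$ and $f(S)\le S'$ (i.e. $f$ restricts to $R\to R'$ and $S\to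 S'$). Limits are computed pointwise, and $f$ is a regular epimorphism there iff $f$ is a regular epimorphism in $\mathcal C$ with $f(R)=R'$ and $f(S)=S'$. $\mathbf{Conn}(\mathcal C)$ is the full subcategory of triples $(X,R,S)$ with $R$ and $S$ centralizing each other; it is reflective, with reflector $I(X,R,S)=(X/[R,S],q(R),q(S))$ and unit the quotient $q=q_{[R,S]}:X\to X/[R,S]$. Fibrations. A fibration is a regular epimorphism $f:(X,R,S)\to(X',R',S')$ in $2\text{-}\mathbf{Eq}(\mathcal C)$ such that $f^{-1}(R')=R$ and $f^{-1}(S')=S$ (equivalently $Eq[f]\le R\wedge S$). $\mathcal F$ is the class of fibrations. Galois structure $\Gamma_{\mathcal F}=(2\text{-}\mathbf{Eq}(\mathcal C),\mathbf{Conn}(\mathcal C),I,\mathcal F)$. Extensions are the elements of $\mathcal F$. For an object $B$, $2\text{-}\mathbf{Eq}(\mathcal C)\downarrow_{\mathcal F}B$ is the full subcategory of the slice category over $B$ whose objects are extensions; an extension $g:A\to B$ is monadic if the pullback functor $g^*$ from $2\text{-}\mathbf{Eq}(\mathcal C)\downarrow_{\mathcal F}B$ to $2\text{-}\mathbf{Eq}(\mathcal C)\downarrow_{\mathcal F}A$ is monadic. An extension $f$ is $\Gamma_{\mathcal F}$-trivial if the naturality square of the unit of the reflection $I$ at $f$ is a pullback; it is $\Gamma_{\mathcal F}$-central if there is a monadic extension $g$ with the same codomain such that the pullback of $f$ along $g$ is $\Gamma_{\mathcal F}$-trivial; it is $\Gamma_{\mathcal F}$-normal if it is monadic and the projections of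 its kernel pair (in $2\text{-}\mathbf{Eq}(\mathcal C)$) are $\Gamma_{\mathcal F}$-trivial. *)

theory Defs
  imports Main
begin

section \<open>Categories, functors, adjunctions\<close>

text \<open>
  Composition is written in the usual (applicative) order. Hom-sets are not required to be
  disjoint, so an arrow need not determine its domain and codomain. In this way the categories
  derived below (slices, algebras, objects with two equivalence relations) share the arrows of the
  underlying category. For the same reason the arrow part of a functor takes the
  domain and the codomain as additional arguments.
\<close>

record ('o, 'm) cat =
  Ob  :: "'o set"
  Hom :: "'o \<Rightarrow> 'o \<Rightarrow> 'm set"
  Idn :: "'o \<Rightarrow> 'm"
  Cmp :: "'m \<Rightarrow> 'm \<Rightarrow> 'm"  (infixl "\<odot>\<index>" 70)

locale category =
  fixes C :: "('o, 'm) cat" (structure)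
  assumes Hom_Ob: "f \<in> Hom C X Y \<Longrightarrow> X \<in> Ob C \<and> Y \<in> Ob C"
    and Idn_Hom: "X \<in> Ob C \<Longrightarrow> Idn C X \<in> Hom C X X"
    and Cmp_Hom: "\<lbrakk>f \<in> Hom C X Y; g \<in> Hom C Y Z\<rbrakk> \<Longrightarrow> g \<odot> f \<in> Hom C X Z"
    and Idn_left: "f \<in> Hom C X Y \<Longrightarrow> Idn C Y \<odot> f = f"
    and Idn_right: "f \<in> Hom C X Y \<Longrightarrow> f \<odot> Idn C X = f"
    and Cmp_assoc: "\<lbrakk>f \<in> Hom C X Y; g \<in> Hom C Y Z; h \<in> Hom C Z W\<rbrakk>
                     \<Longrightarrow> (h \<odot> g) \<odot> f = h \<odot> (g \<odot> f)"

definition full_subcat :: "('o, 'm) cat \<Rightarrow> 'o set \<Rightarrow> ('o, 'm) cat" where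
  "full_subcat C U =
     \<lparr> Ob = Ob C \<inter> U,
       Hom = (\<lambda>X Y. {f \<in> Hom C X Y. X \<in> U \<and> Y \<in> U}),
       Idn = Idn C,
       Cmp = Cmp C \<rparr>"

record ('o1, 'm1, 'o2, 'm2) func =
  FO :: "'o1 \<Rightarrow> 'o2"
  FA :: "'o1 \<Rightarrow> 'o1 \<Rightarrow> 'm1 \<Rightarrow> 'm2"

definition is_functor ::
  "('o1, 'm1) cat \<Rightarrow> ('o2, 'm2) cat \<Rightarrow> ('o1, 'm1, 'o2, 'm2) func \<Rightarrow> bool" where
  "is_functor C D F \<longleftrightarrow>
     (\<forall>X\<in>Ob C. FO F X \<in> Ob D) \<and>
     (\<forall>X Y. \<forall>f\<in>Hom C X Y. FA F X Y f \<in> Hom D (FO F X) (FO F Y)) \<and>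
     (\<forall>X\<in>Ob C. FA F X X (Idn C X) = Idn D (FO F X)) \<and>
     (\<forall>X Y Z. \<forall>f\<in>Hom C X Y. \<forall>g\<in>Hom C Y Z.
        FA F X Z (g \<odot>\<^bsub>C\<^esub> f) = FA F Y Z g \<odot>\<^bsub>D\<^esub> FA F X Y f)"

definition id_func :: "('o, 'm, 'o, 'm) func" where
  "id_func = \<lparr> FO = (\<lambda>X. X), FA = (\<lambda>X Y f. f) \<rparr>"

definition comp_func ::
  "('o2, 'm2, 'o3, 'm3) func \<Rightarrow> ('o1, 'm1, 'o2, 'm2) func \<Rightarrow> ('o1, 'm1, 'o3, 'm3) func" where
  "comp_func G F =
     \<lparr> FO = (\<lambda>X. FO G (FO F X)),
       FA = (\<lambda>X Y f. FA G (FO F X) (FO F Y) (FA F X Y f)) \<rparr>"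

definition is_nat_trans ::
  "('o1, 'm1) cat \<Rightarrow> ('o2, 'm2) cat \<Rightarrow> ('o1, 'm1, 'o2, 'm2) func \<Rightarrow> ('o1, 'm1, 'o2, 'm2) func
    \<Rightarrow> ('o1 \<Rightarrow> 'm2) \<Rightarrow> bool" where
  "is_nat_trans C D F G \<alpha> \<longleftrightarrow>
     (\<forall>X\<in>Ob C. \<alpha> X \<in> Hom D (FO F X) (FO G X)) \<and>
     (\<forall>X Y. \<forall>f\<in>Hom C X Y. \<alpha> Y \<odot>\<^bsub>D\<^esub> FA F X Y f = FA G X Y f \<odot>\<^bsub>D\<^esub> \<alpha> X)"

definition is_iso :: "('o, 'm) cat \<Rightarrow> 'o \<Rightarrow> 'o \<Rightarrow> 'm \<Rightarrow> bool" where
  "is_iso C X Y f \<longleftrightarrow>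
     f \<in> Hom C X Y \<and> (\<exists>g\<in>Hom C Y X. g \<odot>\<^bsub>C\<^esub> f = Idn C X \<and> f \<odot>\<^bsub>C\<^esub> g = Idn C Y)"

definition is_nat_iso ::
  "('o1, 'm1) cat \<Rightarrow> ('o2, 'm2) cat \<Rightarrow> ('o1, 'm1, 'o2, 'm2) func \<Rightarrow> ('o1, 'm1, 'o2, 'm2) func
    \<Rightarrow> ('o1 \<Rightarrow> 'm2) \<Rightarrow> bool" where
  "is_nat_iso C D F G \<alpha> \<longleftrightarrow>
     is_nat_trans C D F G \<alpha> \<and> (\<forall>X\<in>Ob C. is_iso D (FO F X) (FO G X) (\<alpha> X))"

definition is_equivalence ::
  "('o1, 'm1) cat \<Rightarrow> ('o2, 'm2) cat \<Rightarrow> ('o1, 'm1, 'o2, 'm2) func \<Rightarrow> bool" where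
  "is_equivalence C D F \<longleftrightarrow>
     is_functor C D F \<and>
     (\<exists>G \<alpha> \<beta>. is_functor D C G \<and>
        is_nat_iso C C id_func (comp_func G F) \<alpha> \<and>
        is_nat_iso D D (comp_func F G) id_func \<beta>)"

text \<open>The functor \<open>F : X \<rightarrow> D\<close> is left adjoint to \<open>U : D \<rightarrow> X\<close>, with unit \<open>\<eta>\<close> and counit \<open>\<epsilon>\<close>.\<close>

definition is_adjunction ::
  "('o1, 'm1) cat \<Rightarrow> ('o2, 'm2) cat \<Rightarrow> ('o1, 'm1, 'o2, 'm2) func \<Rightarrow> ('o2, 'm2, 'o1, 'm1) func
    \<Rightarrow> ('o1 \<Rightarrow> 'm1) \<Rightarrow> ('o2 \<Rightarrow> 'm2) \<Rightarrow> bool" where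
  "is_adjunction X D F U \<eta> \<epsilon> \<longleftrightarrow>
     is_functor X D F \<and> is_functor D X U \<and>
     is_nat_trans X X id_func (comp_func U F) \<eta> \<and>
     is_nat_trans D D (comp_func F U) id_func \<epsilon> \<and>
     (\<forall>A\<in>Ob X. \<epsilon> (FO F A) \<odot>\<^bsub>D\<^esub> FA F A (FO U (FO F A)) (\<eta> A) = Idn D (FO F A)) \<and>
     (\<forall>B\<in>Ob D. FA U (FO F (FO U B)) B (\<epsilon> B) \<odot>\<^bsub>X\<^esub> \<eta> (FO U B) = Idn X (FO U B))"

text \<open>The Eilenberg--Moore category of the monad \<open>(T, \<eta>, \<mu>)\<close> on \<open>X\<close>.\<close>

definition is_algebra ::
  "('o, 'm) cat \<Rightarrow> ('o, 'm, 'o, 'm) func \<Rightarrow> ('o \<Rightarrow> 'm) \<Rightarrow> ('o \<Rightarrow> 'm) \<Rightarrow> 'o \<Rightarrow> 'm \<Rightarrow> bool" where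
  "is_algebra X T \<eta> \<mu> A a \<longleftrightarrow>
     A \<in> Ob X \<and> a \<in> Hom X (FO T A) A \<and>
     a \<odot>\<^bsub>X\<^esub> \<eta> A = Idn X A \<and>
     a \<odot>\<^bsub>X\<^esub> \<mu> A = a \<odot>\<^bsub>X\<^esub> FA T (FO T A) A a"

definition EM ::
  "('o, 'm) cat \<Rightarrow> ('o, 'm, 'o, 'm) func \<Rightarrow> ('o \<Rightarrow> 'm) \<Rightarrow> ('o \<Rightarrow> 'm) \<Rightarrow> ('o \<times> 'm, 'm) cat" where
  "EM X T \<eta> \<mu> =
     \<lparr> Ob = {(A, a). is_algebra X T \<eta> \<mu> A a},
       Hom = (\<lambda>(A, a) (B, b).
         {h \<in> Hom X A B. is_algebra X T \<eta> \<mu> A a \<and> is_algebra X T \<eta> \<mu> B b \<and>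
                         h \<odot>\<^bsub>X\<^esub> a = b \<odot>\<^bsub>X\<^esub> FA T A B h}),
       Idn = (\<lambda>(A, a). Idn X A),
       Cmp = Cmp X \<rparr>"

definition comparison ::
  "('o2, 'm2, 'o1, 'm1) func \<Rightarrow> ('o1, 'm1, 'o2, 'm2) func \<Rightarrow> ('o2 \<Rightarrow> 'm2)
    \<Rightarrow> ('o2, 'm2, 'o1 \<times> 'm1, 'm1) func" where
  "comparison U F \<epsilon> =
     \<lparr> FO = (\<lambda>B. (FO U B, FA U (FO F (FO U B)) B (\<epsilon> B))),
       FA = FA U \<rparr>"

definition is_monadic ::
  "('o2, 'm2) cat \<Rightarrow> ('o1, 'm1) cat \<Rightarrow> ('o2, 'm2, 'o1, 'm1) func \<Rightarrow> bool" where
  "is_monadic D X U \<longleftrightarrow>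
     (\<exists>F \<eta> \<epsilon>. is_adjunction X D F U \<eta> \<epsilon> \<and>
        is_equivalence D
          (EM X (comp_func U F) \<eta> (\<lambda>A. FA U (FO F (FO U (FO F A))) (FO F A) (\<epsilon> (FO F A))))
          (comparison U F \<epsilon>))"


section \<open>Limits, coequalizers, exactness\<close>

definition is_cone ::
  "('j, 'n) cat \<Rightarrow> ('o, 'm) cat \<Rightarrow> ('j, 'n, 'o, 'm) func \<Rightarrow> 'o \<Rightarrow> ('j \<Rightarrow> 'm) \<Rightarrow> bool" where
  "is_cone J C D L \<pi> \<longleftrightarrow>
     L \<in> Ob C \<and> (\<forall>i\<in>Ob J. \<pi> i \<in> Hom C L (FO D i)) \<and>
     (\<forall>i j. \<forall>u\<in>Hom J i j. FA D i j u \<odot>\<^bsub>C\<^esub> \<pi> i = \<pi> j)"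

definition is_limit ::
  "('j, 'n) cat \<Rightarrow> ('o, 'm) cat \<Rightarrow> ('j, 'n, 'o, 'm) func \<Rightarrow> 'o \<Rightarrow> ('j \<Rightarrow> 'm) \<Rightarrow> bool" where
  "is_limit J C D L \<pi> \<longleftrightarrow>
     is_cone J C D L \<pi> \<and>
     (\<forall>M \<sigma>. is_cone J C D M \<sigma> \<longrightarrow>
        (\<exists>!h. h \<in> Hom C M L \<and> (\<forall>i\<in>Ob J. \<pi> i \<odot>\<^bsub>C\<^esub> h = \<sigma> i)))"

text \<open>Every finite category is isomorphic to one whose objects and arrows are natural numbers.\<close>

locale finitely_complete = category C for C :: "('o, 'm) cat" (structure) +
  assumes finite_limits:
    "\<And>(J :: (nat, nat) cat) D.
       \<lbrakk>category J; finite (Ob J); \<And>i j. finite (Hom J i j); is_functor J C D\<rbrakk>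
       \<Longrightarrow> \<exists>L \<pi>. is_limit J C D L \<pi>"

text \<open>
  \<open>is_pullback C A B D f g P p q\<close>: the span \<open>p : P \<rightarrow> A\<close>, \<open>q : P \<rightarrow> B\<close> is a pullback of the
  cospan \<open>f : A \<rightarrow> D\<close>, \<open>g : B \<rightarrow> D\<close>.
\<close>

definition is_pullback ::
  "('o, 'm) cat \<Rightarrow> 'o \<Rightarrow> 'o \<Rightarrow> 'o \<Rightarrow> 'm \<Rightarrow> 'm \<Rightarrow> 'o \<Rightarrow> 'm \<Rightarrow> 'm \<Rightarrow> bool" where
  "is_pullback C A B D f g P p q \<longleftrightarrow>
     f \<in> Hom C A D \<and> g \<in> Hom C B D \<and> p \<in> Hom C P A \<and> q \<in> Hom C P B \<and>
     f \<odot>\<^bsub>C\<^esub> p = g \<odot>\<^bsub>C\<^esub> q \<and>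
     (\<forall>Z a b. a \<in> Hom C Z A \<and> b \<in> Hom C Z B \<and> f \<odot>\<^bsub>C\<^esub> a = g \<odot>\<^bsub>C\<^esub> b \<longrightarrow>
        (\<exists>!h. h \<in> Hom C Z P \<and> p \<odot>\<^bsub>C\<^esub> h = a \<and> q \<odot>\<^bsub>C\<^esub> h = b))"

definition is_kernel_pair ::
  "('o, 'm) cat \<Rightarrow> 'o \<Rightarrow> 'o \<Rightarrow> 'm \<Rightarrow> 'o \<Rightarrow> 'm \<Rightarrow> 'm \<Rightarrow> bool" where
  "is_kernel_pair C X Y f P p q \<longleftrightarrow> is_pullback C X X Y f f P p q"

definition is_coequalizer ::
  "('o, 'm) cat \<Rightarrow> 'o \<Rightarrow> 'o \<Rightarrow> 'm \<Rightarrow> 'm \<Rightarrow> 'o \<Rightarrow> 'm \<Rightarrow> bool" where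
  "is_coequalizer C Z X u v Q q \<longleftrightarrow>
     u \<in> Hom C Z X \<and> v \<in> Hom C Z X \<and> q \<in> Hom C X Q \<and> q \<odot>\<^bsub>C\<^esub> u = q \<odot>\<^bsub>C\<^esub> v \<and>
     (\<forall>Y h. h \<in> Hom C X Y \<and> h \<odot>\<^bsub>C\<^esub> u = h \<odot>\<^bsub>C\<^esub> v \<longrightarrow>
        (\<exists>!k. k \<in> Hom C Q Y \<and> k \<odot>\<^bsub>C\<^esub> q = h))"

definition has_coequalizers :: "('o, 'm) cat \<Rightarrow> bool" where
  "has_coequalizers C \<longleftrightarrow>
     (\<forall>Z X. \<forall>u\<in>Hom C Z X. \<forall>v\<in>Hom C Z X. \<exists>Q q. is_coequalizer C Z X u v Q q)"

definition is_regular_epi :: "('o, 'm) cat \<Rightarrow> 'o \<Rightarrow> 'o \<Rightarrow> 'm \<Rightarrow> bool" where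
  "is_regular_epi C X Y f \<longleftrightarrow> (\<exists>Z u v. is_coequalizer C Z X u v Y f)"

text \<open>
  An internal relation on \<open>X\<close> is given by a representing jointly monic span \<open>(R, r0, r1)\<close>, and
  \<open>elems C R Z\<close> is the relation it induces on generalized elements \<open>Z \<rightarrow> X\<close>.
  Relations are compared as subobjects of \<open>X \<times> X\<close>, hence equality is \<open>rel_eq\<close>.
\<close>

type_synonym ('o, 'm) span = "'o \<times> 'm \<times> 'm"

abbreviation apex :: "('o, 'm) span \<Rightarrow> 'o" where "apex R \<equiv> fst R"
abbreviation leg0 :: "('o, 'm) span \<Rightarrow> 'm" where "leg0 R \<equiv> fst (snd R)"
abbreviation leg1 :: "('o, 'm) span \<Rightarrow> 'm" where "leg1 R \<equiv> snd (snd R)"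

definition elems :: "('o, 'm) cat \<Rightarrow> ('o, 'm) span \<Rightarrow> 'o \<Rightarrow> ('m \<times> 'm) set" where
  "elems C R Z = (\<lambda>w. (leg0 R \<odot>\<^bsub>C\<^esub> w, leg1 R \<odot>\<^bsub>C\<^esub> w)) ` Hom C Z (apex R)"

definition is_relation :: "('o, 'm) cat \<Rightarrow> 'o \<Rightarrow> ('o, 'm) span \<Rightarrow> bool" where
  "is_relation C X R \<longleftrightarrow>
     leg0 R \<in> Hom C (apex R) X \<and> leg1 R \<in> Hom C (apex R) X \<and>
     (\<forall>Z. inj_on (\<lambda>w. (leg0 R \<odot>\<^bsub>C\<^esub> w, leg1 R \<odot>\<^bsub>C\<^esub> w)) (Hom C Z (apex R)))"

definition is_reflexive_rel :: "('o, 'm) cat \<Rightarrow> 'o \<Rightarrow> ('o, 'm) span \<Rightarrow> bool" where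
  "is_reflexive_rel C X R \<longleftrightarrow>
     is_relation C X R \<and> (\<forall>Z\<in>Ob C. refl_on (Hom C Z X) (elems C R Z))"

definition is_equiv_rel :: "('o, 'm) cat \<Rightarrow> 'o \<Rightarrow> ('o, 'm) span \<Rightarrow> bool" where
  "is_equiv_rel C X R \<longleftrightarrow>
     is_relation C X R \<and> (\<forall>Z\<in>Ob C. equiv (Hom C Z X) (elems C R Z))"

definition rel_le :: "('o, 'm) cat \<Rightarrow> ('o, 'm) span \<Rightarrow> ('o, 'm) span \<Rightarrow> bool" where
  "rel_le C R S \<longleftrightarrow>
     (\<exists>h\<in>Hom C (apex R) (apex S). leg0 S \<odot>\<^bsub>C\<^esub> h = leg0 R \<and> leg1 S \<odot>\<^bsub>C\<^esub> h = leg1 R)"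

definition rel_eq :: "('o, 'm) cat \<Rightarrow> ('o, 'm) span \<Rightarrow> ('o, 'm) span \<Rightarrow> bool" where
  "rel_eq C R S \<longleftrightarrow> rel_le C R S \<and> rel_le C S R"

locale regular_category = finitely_complete C for C :: "('o, 'm) cat" (structure) +
  assumes kernel_pair_coequalizer:
      "is_kernel_pair C X Y f P p q \<Longrightarrow> \<exists>Q c. is_coequalizer C P X p q Q c"
    and regular_epi_stable:
      "\<lbrakk>is_pullback C A B D f g P p q; is_regular_epi C A D f\<rbrakk> \<Longrightarrow> is_regular_epi C P B q"

locale exact_category = regular_category C for C :: "('o, 'm) cat" (structure) +
  assumes equiv_rel_effective:
    "is_equiv_rel C X (R, r0, r1) \<Longrightarrow> \<exists>Y f. is_kernel_pair C X Y f R r0 r1"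

locale maltsev_category = finitely_complete C for C :: "('o, 'm) cat" (structure) +
  assumes reflexive_imp_equiv: "is_reflexive_rel C X R \<Longrightarrow> is_equiv_rel C X R"


section \<open>The calculus of equivalence relations\<close>

text \<open>
  Kernel pairs, quotients, direct images, joins and commutators are determined only up to
  isomorphism; the functions below choose a representative. They are meaningful only where the
  chosen object exists.
\<close>

definition diag_rel :: "('o, 'm) cat \<Rightarrow> 'o \<Rightarrow> ('o, 'm) span" where
  "diag_rel C X = (X, Idn C X, Idn C X)"

definition ker_rel :: "('o, 'm) cat \<Rightarrow> 'o \<Rightarrow> 'o \<Rightarrow> 'm \<Rightarrow> ('o, 'm) span" where
  "ker_rel C X Y f = (SOME (P, p, q). is_kernel_pair C X Y f P p q)"

definition quot :: "('o, 'm) cat \<Rightarrow> 'o \<Rightarrow> ('o, 'm) span \<Rightarrow> 'o \<times> 'm" where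
  "quot C X K = (SOME (Q, q). is_coequalizer C (apex K) X (leg0 K) (leg1 K) Q q)"

text \<open>
  \<open>T\<close> is the direct image of \<open>R\<close> along \<open>f : X \<rightarrow> Y\<close> if \<open>R \<rightarrow> X \<times> X \<rightarrow> Y \<times> Y\<close> factors as a regular
  epimorphism \<open>R \<rightarrow> T\<close> followed by the monomorphism \<open>T \<rightarrow> Y \<times> Y\<close>.
\<close>

definition is_direct_image ::
  "('o, 'm) cat \<Rightarrow> 'o \<Rightarrow> 'm \<Rightarrow> ('o, 'm) span \<Rightarrow> ('o, 'm) span \<Rightarrow> bool" where
  "is_direct_image C Y f R T \<longleftrightarrow>
     is_relation C Y T \<and>
     (\<exists>e. is_regular_epi C (apex R) (apex T) e \<and>
          leg0 T \<odot>\<^bsub>C\<^esub> e = f \<odot>\<^bsub>C\<^esub> leg0 R \<and> leg1 T \<odot>\<^bsub>C\<^esub> e = f \<odot>\<^bsub>C\<^esub> leg1 R)"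

definition dir_image ::
  "('o, 'm) cat \<Rightarrow> 'o \<Rightarrow> 'm \<Rightarrow> ('o, 'm) span \<Rightarrow> ('o, 'm) span" where
  "dir_image C Y f R = (SOME T. is_direct_image C Y f R T)"

text \<open>
  \<open>T\<close> is the inverse image of \<open>R'\<close> along \<open>f : X \<rightarrow> X'\<close>: the pullback of \<open>R' \<rightarrow> X' \<times> X'\<close> along
  \<open>f \<times> f\<close>, with an arrow into \<open>X \<times> X\<close> written as a pair of arrows into \<open>X\<close>.
\<close>

definition is_inverse_image ::
  "('o, 'm) cat \<Rightarrow> 'o \<Rightarrow> 'm \<Rightarrow> ('o, 'm) span \<Rightarrow> ('o, 'm) span \<Rightarrow> bool" where
  "is_inverse_image C X f R' T \<longleftrightarrow>
     leg0 T \<in> Hom C (apex T) X \<and> leg1 T \<in> Hom C (apex T) X \<and>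
     (\<exists>h\<in>Hom C (apex T) (apex R').
        leg0 R' \<odot>\<^bsub>C\<^esub> h = f \<odot>\<^bsub>C\<^esub> leg0 T \<and> leg1 R' \<odot>\<^bsub>C\<^esub> h = f \<odot>\<^bsub>C\<^esub> leg1 T \<and>
        (\<forall>Z x y w. x \<in> Hom C Z X \<and> y \<in> Hom C Z X \<and> w \<in> Hom C Z (apex R') \<and>
             leg0 R' \<odot>\<^bsub>C\<^esub> w = f \<odot>\<^bsub>C\<^esub> x \<and> leg1 R' \<odot>\<^bsub>C\<^esub> w = f \<odot>\<^bsub>C\<^esub> y \<longrightarrow>
           (\<exists>!u. u \<in> Hom C Z (apex T) \<and>
                 leg0 T \<odot>\<^bsub>C\<^esub> u = x \<and> leg1 T \<odot>\<^bsub>C\<^esub> u = y \<and> h \<odot>\<^bsub>C\<^esub> u = w)))"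

definition is_join ::
  "('o, 'm) cat \<Rightarrow> 'o \<Rightarrow> ('o, 'm) span \<Rightarrow> ('o, 'm) span \<Rightarrow> ('o, 'm) span \<Rightarrow> bool" where
  "is_join C X R S J \<longleftrightarrow>
     is_equiv_rel C X J \<and> rel_le C R J \<and> rel_le C S J \<and>
     (\<forall>K. is_equiv_rel C X K \<and> rel_le C R K \<and> rel_le C S K \<longrightarrow> rel_le C J K)"

definition rel_join ::
  "('o, 'm) cat \<Rightarrow> 'o \<Rightarrow> ('o, 'm) span \<Rightarrow> ('o, 'm) span \<Rightarrow> ('o, 'm) span" where
  "rel_join C X R S = (SOME J. is_join C X R S J)"

text \<open>
  A generalized element \<open>u : Z \<rightarrow> P\<close> of the pullback \<open>P\<close> of \<open>leg1 R\<close> and \<open>leg0 S\<close> is the triple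
  \<open>(x, y, z)\<close> with \<open>x = leg0 R \<cdot> a \<cdot> u\<close>, \<open>y = leg1 R \<cdot> a \<cdot> u = leg0 S \<cdot> b \<cdot> u\<close>, \<open>z = leg1 S \<cdot> b \<cdot> u\<close>;
  the last two conditions read \<open>p (x, y, y) = x\<close> and \<open>p (y, y, z) = z\<close>.
\<close>

definition centralizes ::
  "('o, 'm) cat \<Rightarrow> 'o \<Rightarrow> ('o, 'm) span \<Rightarrow> ('o, 'm) span \<Rightarrow> bool" where
  "centralizes C X R S \<longleftrightarrow>
     (\<exists>P a b p. is_pullback C (apex R) (apex S) X (leg1 R) (leg0 S) P a b \<and> p \<in> Hom C P X \<and>
        (\<forall>Z. \<forall>u\<in>Hom C Z P.
           leg0 S \<odot>\<^bsub>C\<^esub> (b \<odot>\<^bsub>C\<^esub> u) = leg1 S \<odot>\<^bsub>C\<^esub> (b \<odot>\<^bsub>C\<^esub> u) \<longrightarrow>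
             p \<odot>\<^bsub>C\<^esub> u = leg0 R \<odot>\<^bsub>C\<^esub> (a \<odot>\<^bsub>C\<^esub> u)) \<and>
        (\<forall>Z. \<forall>u\<in>Hom C Z P.
           leg0 R \<odot>\<^bsub>C\<^esub> (a \<odot>\<^bsub>C\<^esub> u) = leg1 R \<odot>\<^bsub>C\<^esub> (a \<odot>\<^bsub>C\<^esub> u) \<longrightarrow>
             p \<odot>\<^bsub>C\<^esub> u = leg1 S \<odot>\<^bsub>C\<^esub> (b \<odot>\<^bsub>C\<^esub> u)))"

definition quot_centralizes ::
  "('o, 'm) cat \<Rightarrow> 'o \<Rightarrow> ('o, 'm) span \<Rightarrow> ('o, 'm) span \<Rightarrow> ('o, 'm) span \<Rightarrow> bool" where
  "quot_centralizes C X R S K \<longleftrightarrow>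
     (let (Q, q) = quot C X K in centralizes C Q (dir_image C Q q R) (dir_image C Q q S))"

definition is_commutator ::
  "('o, 'm) cat \<Rightarrow> 'o \<Rightarrow> ('o, 'm) span \<Rightarrow> ('o, 'm) span \<Rightarrow> ('o, 'm) span \<Rightarrow> bool" where
  "is_commutator C X R S K \<longleftrightarrow>
     is_equiv_rel C X K \<and> quot_centralizes C X R S K \<and>
     (\<forall>L. is_equiv_rel C X L \<and> quot_centralizes C X R S L \<longrightarrow> rel_le C K L)"

definition commutator ::
  "('o, 'm) cat \<Rightarrow> 'o \<Rightarrow> ('o, 'm) span \<Rightarrow> ('o, 'm) span \<Rightarrow> ('o, 'm) span" where
  "commutator C X R S = (SOME K. is_commutator C X R S K)"


section \<open>Categorical Galois theory\<close>

text \<open>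
  \<open>Sub\<close> is a full reflective subcategory of \<open>Tot\<close>, with reflector \<open>Refl\<close> and unit \<open>Unit\<close>;
  \<open>Ext A B f\<close> says that \<open>f : A \<rightarrow> B\<close> is an extension. The record carries these data only, and
  does not assert that they form a reflection.
\<close>

record ('o, 'm) galois_structure =
  Tot  :: "('o, 'm) cat"
  Sub  :: "('o, 'm) cat"
  Refl :: "('o, 'm, 'o, 'm) func"
  Unit :: "'o \<Rightarrow> 'm"
  Ext  :: "'o \<Rightarrow> 'o \<Rightarrow> 'm \<Rightarrow> bool"

definition ext_slice :: "('o, 'm) galois_structure \<Rightarrow> 'o \<Rightarrow> ('o \<times> 'm, 'm) cat" where
  "ext_slice G B =
     \<lparr> Ob = {(Y, f). f \<in> Hom (Tot G) Y B \<and> Ext G Y B f},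
       Hom = (\<lambda>(Y, f) (Y', f').
         {h \<in> Hom (Tot G) Y Y'.
            f \<in> Hom (Tot G) Y B \<and> Ext G Y B f \<and> f' \<in> Hom (Tot G) Y' B \<and> Ext G Y' B f' \<and>
            f' \<odot>\<^bsub>Tot G\<^esub> h = f}),
       Idn = (\<lambda>(Y, f). Idn (Tot G) Y),
       Cmp = Cmp (Tot G) \<rparr>"

definition chosen_pullback ::
  "('o, 'm) cat \<Rightarrow> 'o \<Rightarrow> 'o \<Rightarrow> 'o \<Rightarrow> 'm \<Rightarrow> 'm \<Rightarrow> 'o \<times> 'm \<times> 'm" where
  "chosen_pullback C A B D f g = (SOME (P, p, q). is_pullback C A B D f g P p q)"

text \<open>The pullback functor along \<open>g : A \<rightarrow> B\<close>, from extensions of \<open>B\<close> to extensions of \<open>A\<close>.\<close>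

definition pullback_functor ::
  "('o, 'm) galois_structure \<Rightarrow> 'o \<Rightarrow> 'o \<Rightarrow> 'm \<Rightarrow> ('o \<times> 'm, 'm, 'o \<times> 'm, 'm) func" where
  "pullback_functor G A B g =
     \<lparr> FO = (\<lambda>(Y, f). let (P, p, q) = chosen_pullback (Tot G) Y A B f g in (P, q)),
       FA = (\<lambda>(Y, f) (Y', f') h.
         let (P, p, q) = chosen_pullback (Tot G) Y A B f g;
             (P', p', q') = chosen_pullback (Tot G) Y' A B f' g
         in THE k. k \<in> Hom (Tot G) P P' \<and> p' \<odot>\<^bsub>Tot G\<^esub> k = h \<odot>\<^bsub>Tot G\<^esub> p \<and> q' \<odot>\<^bsub>Tot G\<^esub> k = q) \<rparr>"

definition monadic_ext :: "('o, 'm) galois_structure \<Rightarrow> 'o \<Rightarrow> 'o \<Rightarrow> 'm \<Rightarrow> bool" where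
  "monadic_ext G A B g \<longleftrightarrow>
     Ext G A B g \<and> is_monadic (ext_slice G B) (ext_slice G A) (pullback_functor G A B g)"

definition trivial_ext :: "('o, 'm) galois_structure \<Rightarrow> 'o \<Rightarrow> 'o \<Rightarrow> 'm \<Rightarrow> bool" where
  "trivial_ext G A B f \<longleftrightarrow>
     Ext G A B f \<and>
     is_pullback (Tot G) B (FO (Refl G) A) (FO (Refl G) B)
       (Unit G B) (FA (Refl G) A B f) A f (Unit G A)"

definition central_ext :: "('o, 'm) galois_structure \<Rightarrow> 'o \<Rightarrow> 'o \<Rightarrow> 'm \<Rightarrow> bool" where
  "central_ext G A B f \<longleftrightarrow>
     Ext G A B f \<and>
     (\<exists>E g P p q. monadic_ext G E B g \<and> is_pullback (Tot G) A E B f g P p q \<and> trivial_ext G P E q)"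

definition normal_ext :: "('o, 'm) galois_structure \<Rightarrow> 'o \<Rightarrow> 'o \<Rightarrow> 'm \<Rightarrow> bool" where
  "normal_ext G A B f \<longleftrightarrow>
     monadic_ext G A B f \<and>
     (\<exists>P p q. is_kernel_pair (Tot G) A B f P p q \<and> trivial_ext G P A p \<and> trivial_ext G P A q)"


section \<open>Pairs of equivalence relations\<close>

type_synonym ('o, 'm) two_eq = "'o \<times> ('o, 'm) span \<times> ('o, 'm) span"

text \<open>The arrow \<open>f\<close> restricts to an arrow \<open>R \<rightarrow> R'\<close>.\<close>

definition restricts ::
  "('o, 'm) cat \<Rightarrow> 'm \<Rightarrow> ('o, 'm) span \<Rightarrow> ('o, 'm) span \<Rightarrow> bool" where
  "restricts C f R R' \<longleftrightarrow>
     (\<exists>h\<in>Hom C (apex R) (apex R').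
        leg0 R' \<odot>\<^bsub>C\<^esub> h = f \<odot>\<^bsub>C\<^esub> leg0 R \<and> leg1 R' \<odot>\<^bsub>C\<^esub> h = f \<odot>\<^bsub>C\<^esub> leg1 R)"

definition two_eq_obs :: "('o, 'm) cat \<Rightarrow> ('o, 'm) two_eq set" where
  "two_eq_obs C = {(X, R, S). X \<in> Ob C \<and> is_equiv_rel C X R \<and> is_equiv_rel C X S}"

definition TwoEq :: "('o, 'm) cat \<Rightarrow> (('o, 'm) two_eq, 'm) cat" where
  "TwoEq C =
     \<lparr> Ob = two_eq_obs C,
       Hom = (\<lambda>(X, R, S) (X', R', S').
         {f \<in> Hom C X X'. (X, R, S) \<in> two_eq_obs C \<and> (X', R', S') \<in> two_eq_obs C \<and>
                          restricts C f R R' \<and> restricts C f S S'}),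
       Idn = (\<lambda>(X, R, S). Idn C X),
       Cmp = Cmp C \<rparr>"

definition Conn :: "('o, 'm) cat \<Rightarrow> (('o, 'm) two_eq, 'm) cat" where
  "Conn C = full_subcat (TwoEq C) {(X, R, S). centralizes C X R S}"

fun conn_ob :: "('o, 'm) cat \<Rightarrow> ('o, 'm) two_eq \<Rightarrow> ('o, 'm) two_eq" where
  "conn_ob C (X, R, S) =
     (let (Q, q) = quot C X (commutator C X R S) in (Q, dir_image C Q q R, dir_image C Q q S))"

fun conn_unit :: "('o, 'm) cat \<Rightarrow> ('o, 'm) two_eq \<Rightarrow> 'm" where
  "conn_unit C (X, R, S) = snd (quot C X (commutator C X R S))"

definition conn_reflector :: "('o, 'm) cat \<Rightarrow> (('o, 'm) two_eq, 'm, ('o, 'm) two_eq, 'm) func" where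
  "conn_reflector C =
     \<lparr> FO = conn_ob C,
       FA = (\<lambda>A B f. THE h. h \<in> Hom (Conn C) (conn_ob C A) (conn_ob C B) \<and>
                            h \<odot>\<^bsub>C\<^esub> conn_unit C A = conn_unit C B \<odot>\<^bsub>C\<^esub> f) \<rparr>"

fun fibration :: "('o, 'm) cat \<Rightarrow> ('o, 'm) two_eq \<Rightarrow> ('o, 'm) two_eq \<Rightarrow> 'm \<Rightarrow> bool" where
  "fibration C (X, R, S) (X', R', S') f \<longleftrightarrow>
     is_regular_epi (TwoEq C) (X, R, S) (X', R', S') f \<and>
     is_inverse_image C X f R' R \<and> is_inverse_image C X f S' S"

definition Gamma_F :: "('o, 'm) cat \<Rightarrow> (('o, 'm) two_eq, 'm) galois_structure" where
  "Gamma_F C =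
     \<lparr> Tot = TwoEq C,
       Sub = Conn C,
       Refl = conn_reflector C,
       Unit = conn_unit C,
       Ext = fibration C \<rparr>"

end

theory Submission
  imports Defs
begin

text \<open>
  Relations are handled through generalized elements, and a regular epimorphism is a cover along which
  statements about elements are local. For equivalence relations \<open>R\<close>, \<open>S\<close> on \<open>X\<close>, consider equivalence relations
  \<open>\<Theta>\<close> on the object \<open>R\<close> that contain the pairs \<open>((y, y), (z, z))\<close> with \<open>y S z\<close>. By the Mal'tsev property (every
  relation is difunctional) such a \<open>\<Theta>\<close> transports \<open>(x, y)\<close> along \<open>y S z\<close> to some \<open>(w, z)\<close>, and \<open>R\<close>, \<open>S\<close> centralize
  each other iff for some \<open>\<Theta>\<close> this \<open>w\<close> is unique (\<open>\<Theta>\<close> is discrete). For the least \<open>\<Theta>\<close>, the commutator consists of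
  the pairs \<open>(x, w)\<close> with \<open>(x, y) \<Theta> (w, y)\<close>.

  A fibration \<open>f\<close> is trivial iff \<open>Eq[f]\<close> meets the commutator \<open>[R, S]\<close> in the diagonal. If the pullback \<open>q\<close> of \<open>f\<close>
  along some fibration is trivial, then the transports for \<open>[R, S]\<close> and for \<open>[S, R]\<close> restrict to discrete transports
  on \<open>Eq[q]\<close>; their images on \<open>Eq[f]\<close> compose to a discrete transport along \<open>R \<or> S = R \<circ> S\<close>. Conversely, a
  discrete transport \<open>\<Theta>\<close> on \<open>Eq[f]\<close> along \<open>R \<or> S\<close> contains the commutator of the two relations of the kernel pair
  object and meets the kernels of both projections in the diagonal, so that these are trivial. Every
  fibration is monadic because the action of the monad defines a reflexive, hence effective, relation.
\<close>


section \<open>Elementary category theory and finite limits\<close>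


text \<open>An arrow p does not restrict, intersect or pass to quotients easily; an equivalence
  relation \<Theta> on R does. Inverse images, meets, images and generated relations of equivalence
  relations are again of this kind, and by the Mal'tsev property such claims reduce to reflexivity.
  So p serves only to translate \<open>centralizes\<close> into a discrete \<Theta> and back. Two
  obstacles shape the rest. Discreteness compares elements of R with the same end point, while after
  taking an image the end points agree only modulo the quotient map; one more transport, along S met
  with the kernel of that map, repairs this. Moreover \<Theta> lives on R, with S as a mere
  parameter, while the central case needs transports on both relations, measured by the same
  commutator [R, S]; the single arrow p on the quotient by [R, S] supplies both.\<close>

context category
begin

lemma Ob_dom: "f \<in> Hom C X Y \<Longrightarrow> X \<in> Ob C"
  and Ob_cod: "f \<in> Hom C X Y \<Longrightarrow> Y \<in> Ob C"
  using Hom_Ob by blast+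

text \<open>Evaluates a commuting triangle at a generalized element h. Arrows do not determine their
  domains, so each use of associativity needs explicit typing facts; this form and the one for
  squares package them.\<close>

lemma Cmp_reassoc:
  assumes "p \<in> Hom C P A" "f \<in> Hom C A D" "f \<odot> p = k" "h \<in> Hom C Z P"
  shows "f \<odot> (p \<odot> h) = k \<odot> h"
  using Cmp_assoc[OF assms(4,1,2)] assms(3) by simp

lemma Cmp_square:
  assumes "p \<in> Hom C P A" "f \<in> Hom C A D" "q \<in> Hom C P B" "g \<in> Hom C B D" "f \<odot> p = g \<odot> q"
    and "h \<in> Hom C Z P"
  shows "f \<odot> (p \<odot> h) = g \<odot> (q \<odot> h)"
  using Cmp_assoc[OF assms(6,1,2)] Cmp_assoc[OF assms(6,3,4)] assms(5) by simp

lemma pullback_lift: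
  assumes "is_pullback C A B D f g P p q" "a \<in> Hom C Z A" "b \<in> Hom C Z B" "f \<odot> a = g \<odot> b"
  obtains h where "h \<in> Hom C Z P" "p \<odot> h = a" "q \<odot> h = b"
  using assms unfolding is_pullback_def by metis

lemma pullback_Hom:
  assumes "is_pullback C A B D f g P p q"
  shows "f \<in> Hom C A D" "g \<in> Hom C B D" "p \<in> Hom C P A" "q \<in> Hom C P B" "f \<odot> p = g \<odot> q"
  using assms unfolding is_pullback_def by auto

lemma pullback_unique:
  assumes pb: "is_pullback C A B D f g P p q" and h: "h \<in> Hom C Z P" and k: "k \<in> Hom C Z P"
    and "p \<odot> h = p \<odot> k" "q \<odot> h = q \<odot> k"
  shows "h = k"
proof -
  note t = pullback_Hom[OF pb]
  have "p \<odot> h \<in> Hom C Z A" "q \<odot> h \<in> Hom C Z B" using t h Cmp_Hom by blast+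
  moreover have "f \<odot> (p \<odot> h) = g \<odot> (q \<odot> h)"
    using t h by (simp flip: Cmp_assoc)
  ultimately have "\<exists>!l. l \<in> Hom C Z P \<and> p \<odot> l = p \<odot> h \<and> q \<odot> l = q \<odot> h"
    using pb unfolding is_pullback_def by blast
  with assms show ?thesis by metis
qed

lemma pullback_square:
  assumes "is_pullback C A B D f g P p q" "h \<in> Hom C Z P"
  shows "f \<odot> (p \<odot> h) = g \<odot> (q \<odot> h)"
  using pullback_Hom[OF assms(1)] assms(2) by (simp flip: Cmp_assoc)

lemma is_pullbackI:
  assumes "f \<in> Hom C A D" "g \<in> Hom C B D" "p \<in> Hom C P A" "q \<in> Hom C P B" "f \<odot> p = g \<odot> q"
    and "\<And>Z a b. a \<in> Hom C Z A \<Longrightarrow> b \<in> Hom C Z B \<Longrightarrow> f \<odot> a = g \<odot> b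
           \<Longrightarrow> \<exists>h. h \<in> Hom C Z P \<and> p \<odot> h = a \<and> q \<odot> h = b"
    and "\<And>Z h k. h \<in> Hom C Z P \<Longrightarrow> k \<in> Hom C Z P \<Longrightarrow> p \<odot> h = p \<odot> k \<Longrightarrow> q \<odot> h = q \<odot> k \<Longrightarrow> h = k"
  shows "is_pullback C A B D f g P p q"
  unfolding is_pullback_def
proof (intro conjI allI impI)
  fix Z a b assume "a \<in> Hom C Z A \<and> b \<in> Hom C Z B \<and> f \<odot> a = g \<odot> b"
  then obtain h where "h \<in> Hom C Z P \<and> p \<odot> h = a \<and> q \<odot> h = b" using assms(6) by blast
  then show "\<exists>!h. h \<in> Hom C Z P \<and> p \<odot> h = a \<and> q \<odot> h = b" using assms(7) by metis
qed (use assms in auto)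

section \<open>Regular epimorphisms and their orthogonality to monomorphisms\<close>

lemma regular_epi_Hom: "is_regular_epi C X Y f \<Longrightarrow> f \<in> Hom C X Y"
  unfolding is_regular_epi_def is_coequalizer_def by auto

lemma regular_epi_factor:
  assumes "is_regular_epi C X Y e" "h \<in> Hom C X W"
    and "\<And>Z u v. u \<in> Hom C Z X \<Longrightarrow> v \<in> Hom C Z X \<Longrightarrow> e \<odot> u = e \<odot> v \<Longrightarrow> h \<odot> u = h \<odot> v"
  obtains k where "k \<in> Hom C Y W" "k \<odot> e = h"
  using assms unfolding is_regular_epi_def is_coequalizer_def by metis

lemma regular_epi_cancel:
  assumes "is_regular_epi C X Y e" "a \<in> Hom C Y W" "b \<in> Hom C Y W" "a \<odot> e = b \<odot> e"
  shows "a = b"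
proof -
  obtain Z u v where c: "is_coequalizer C Z X u v Y e"
    using assms(1) unfolding is_regular_epi_def by blast
  then have t: "u \<in> Hom C Z X" "v \<in> Hom C Z X" "e \<in> Hom C X Y" "e \<odot> u = e \<odot> v"
    unfolding is_coequalizer_def by auto
  have "a \<odot> e \<in> Hom C X W" using t assms Cmp_Hom by blast
  moreover have "(a \<odot> e) \<odot> u = (a \<odot> e) \<odot> v"
    using t assms by (metis Cmp_assoc)
  ultimately have "\<exists>!k. k \<in> Hom C Y W \<and> k \<odot> e = a \<odot> e"
    using c unfolding is_coequalizer_def by blast
  with assms show ?thesis by metis
qed

lemma regular_epi_Idn: "X \<in> Ob C \<Longrightarrow> is_regular_epi C X X (Idn C X)"
  unfolding is_regular_epi_def is_coequalizer_def
  by (rule exI[of _ X], rule exI[of _ "Idn C X"], rule exI[of _ "Idn C X"])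
     (auto simp: Idn_Hom Idn_right)

definition mono :: "'o \<Rightarrow> 'o \<Rightarrow> 'm \<Rightarrow> bool" where
  "mono X Y m \<longleftrightarrow> m \<in> Hom C X Y \<and>
     (\<forall>Z. \<forall>u\<in>Hom C Z X. \<forall>v\<in>Hom C Z X. m \<odot> u = m \<odot> v \<longrightarrow> u = v)"

text \<open>Orthogonality: since m is monic, u identifies whatever e identifies, so u descends along
  e to the diagonal v.\<close>

lemma regular_epi_mono_factor:
  assumes e: "is_regular_epi C Z' Z e" and m: "mono S W m"
    and "w \<in> Hom C Z W" "u \<in> Hom C Z' S" "w \<odot> e = m \<odot> u"
  obtains v where "v \<in> Hom C Z S" "m \<odot> v = w" "v \<odot> e = u"
proof -
  note eh = regular_epi_Hom[OF e]
  have mh: "m \<in> Hom C S W" using m mono_def by blast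
  have "u \<odot> a = u \<odot> b" if t: "a \<in> Hom C T Z'" "b \<in> Hom C T Z'" "e \<odot> a = e \<odot> b" for T a b
  proof -
    have "m \<odot> (u \<odot> a) = (w \<odot> e) \<odot> a" "m \<odot> (u \<odot> b) = (w \<odot> e) \<odot> b"
      using t assms(3,4,5) eh mh by (simp_all flip: Cmp_assoc)
    moreover have "(w \<odot> e) \<odot> a = (w \<odot> e) \<odot> b"
      using t assms(3) eh by (simp add: Cmp_assoc)
    ultimately have "m \<odot> (u \<odot> a) = m \<odot> (u \<odot> b)" by simp
    moreover have "u \<odot> a \<in> Hom C T S" "u \<odot> b \<in> Hom C T S" using t assms Cmp_Hom by blast+
    ultimately show ?thesis using m unfolding mono_def by blast
  qed
  then obtain v where v: "v \<in> Hom C Z S" "v \<odot> e = u"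
    using regular_epi_factor[OF e assms(4)] by metis
  have "(m \<odot> v) \<odot> e = w \<odot> e" using v assms eh mh by (metis Cmp_assoc)
  then have "m \<odot> v = w" using regular_epi_cancel[OF e] v mh assms Cmp_Hom by metis
  with v that show ?thesis by blast
qed

text \<open>The same parallel pair is coequalized; factorizations are carried over along the inverse
  j.\<close>

lemma regular_epi_iso:
  assumes e: "is_regular_epi C X Y e" and i: "is_iso C Y W i"
  shows "is_regular_epi C X W (i \<odot> e)"
proof -
  obtain Z u v where c: "is_coequalizer C Z X u v Y e"
    using assms(1) unfolding is_regular_epi_def by blast
  obtain j where j: "j \<in> Hom C W Y" "j \<odot> i = Idn C Y" "i \<odot> j = Idn C W" and ih: "i \<in> Hom C Y W"
    using i unfolding is_iso_def by blast
  have t: "u \<in> Hom C Z X" "v \<in> Hom C Z X" "e \<in> Hom C X Y" "e \<odot> u = e \<odot> v"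
    using c unfolding is_coequalizer_def by auto
  have "\<exists>!k. k \<in> Hom C W T \<and> k \<odot> (i \<odot> e) = h" if h: "h \<in> Hom C X T" "h \<odot> u = h \<odot> v" for T h
  proof -
    obtain k where k: "k \<in> Hom C Y T" "k \<odot> e = h"
      using c h unfolding is_coequalizer_def by metis
    have "(k \<odot> j) \<odot> (i \<odot> e) = ((k \<odot> j) \<odot> i) \<odot> e" using k j ih t Cmp_assoc Cmp_Hom by metis
    also have "\<dots> = (k \<odot> (j \<odot> i)) \<odot> e" using k j ih t Cmp_assoc by metis
    also have "\<dots> = h" using j k Idn_right by metis
    finally have 1: "(k \<odot> j) \<odot> (i \<odot> e) = h" .
    have 2: "k \<odot> j \<in> Hom C W T" using k j Cmp_Hom by metis
    have 3: "l = k \<odot> j" if l: "l \<in> Hom C W T" "l \<odot> (i \<odot> e) = h" for l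
    proof -
      have "(l \<odot> i) \<odot> e = k \<odot> e" using l k ih t Cmp_assoc by metis
      then have "l \<odot> i = k" using regular_epi_cancel[OF e] l k ih Cmp_Hom by metis
      then have "k \<odot> j = l \<odot> (i \<odot> j)" using l ih j Cmp_assoc by metis
      then show ?thesis using j l Idn_right by metis
    qed
    show ?thesis using 1 2 3 by metis
  qed
  moreover have "(i \<odot> e) \<odot> u = (i \<odot> e) \<odot> v" using t ih Cmp_assoc by metis
  moreover have "i \<odot> e \<in> Hom C X W" using t ih Cmp_Hom by metis
  ultimately have "is_coequalizer C Z X u v W (i \<odot> e)"
    using t unfolding is_coequalizer_def by blast
  then show ?thesis unfolding is_regular_epi_def by blast
qed

lemma mono_split_iso:
  assumes m: "mono X Y m" and s: "s \<in> Hom C Y X" "m \<odot> s = Idn C Y"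
  shows "is_iso C X Y m"
proof -
  have mh: "m \<in> Hom C X Y" using m mono_def by blast
  have "m \<odot> (s \<odot> m) = m \<odot> Idn C X" using mh s Cmp_assoc Idn_left Idn_right by metis
  moreover have "s \<odot> m \<in> Hom C X X" using s mh Cmp_Hom by metis
  moreover have "Idn C X \<in> Hom C X X" using mh Ob_dom Idn_Hom by blast
  ultimately have "s \<odot> m = Idn C X" using m unfolding mono_def by blast
  then show ?thesis unfolding is_iso_def using mh s by blast
qed

end

context finitely_complete
begin

lemma pullback_exists:
  assumes f: "f \<in> Hom C A D" and g: "g \<in> Hom C B D"
  obtains P p q where "is_pullback C A B D f g P p q"
proof -
  \<comment> \<open>The cospan shape 0 -> 2 <- 1 as a thin category: every non-empty hom-set is {0},
    so the arrow part of the diagram has to read f or g off the objects.\<close>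
  define le where "le i j \<longleftrightarrow> i \<in> {0,1,2::nat} \<and> j \<in> {0,1,2} \<and> (i = j \<or> j = 2)" for i j
  define J :: "(nat, nat) cat" where
    "J = \<lparr>Ob = {0,1,2}, Hom = (\<lambda>i j. if le i j then {0} else {}), Idn = (\<lambda>_. 0), Cmp = (\<lambda>_ _. 0)\<rparr>"
  define F :: "(nat, nat, 'o, 'm) func" where
    "F = \<lparr>FO = (\<lambda>i. if i = 0 then A else if i = 1 then B else D),
          FA = (\<lambda>i j _. if i = j then Idn C (if i = 0 then A else if i = 1 then B else D)
                   else if i = 0 then f else g)\<rparr>"
  have J: "Ob J = {0,1,2}" "Hom J i j = (if le i j then {0} else {})" "Idn J i = 0" "Cmp J u v = 0" for i j u v
    by (auto simp: J_def)
  have F: "FO F 0 = A" "FO F 1 = B" "FO F 2 = D" "FA F i i u = Idn C (FO F i)"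
     "FA F 0 2 u = f" "FA F 1 2 u = g" for i u
    by (auto simp: F_def)
  have obs: "A \<in> Ob C" "B \<in> Ob C" "D \<in> Ob C" using f g Ob_dom Ob_cod by blast+
  have "category J"
    by unfold_locales (auto simp: J le_def split: if_splits)
  moreover have "is_functor J C F"
    unfolding is_functor_def using f g obs
    by (auto simp: J F_def le_def Idn_Hom Idn_left[OF Idn_Hom] Idn_left Idn_right split: if_splits)
  moreover have "finite (Ob J)" "\<And>i j. finite (Hom J i j)" by (auto simp: J)
  ultimately obtain L \<pi> where L: "is_limit J C F L \<pi>" using finite_limits by blast
  have cone: "is_cone J C F M \<sigma> \<longleftrightarrow> \<sigma> 0 \<in> Hom C M A \<and> \<sigma> 1 \<in> Hom C M B \<and> \<sigma> 2 \<in> Hom C M D \<and>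
     f \<odot> \<sigma> 0 = \<sigma> 2 \<and> g \<odot> \<sigma> 1 = \<sigma> 2" for M \<sigma>
    unfolding is_cone_def
  proof (intro iffI conjI allI ballI; (elim conjE)?)
    fix i j u assume h: "\<sigma> 0 \<in> Hom C M A" "\<sigma> 1 \<in> Hom C M B" "\<sigma> 2 \<in> Hom C M D"
      "f \<odot> \<sigma> 0 = \<sigma> 2" "g \<odot> \<sigma> 1 = \<sigma> 2" "u \<in> Hom J i j"
    then show "FA F i j u \<odot> \<sigma> i = \<sigma> j"
      by (auto simp: J le_def F_def Idn_left split: if_splits)
  next
    assume h: "\<forall>i j. \<forall>u\<in>Hom J i j. FA F i j u \<odot> \<sigma> i = \<sigma> j"
    have "0 \<in> Hom J 0 2" "0 \<in> Hom J 1 2" by (auto simp: J le_def)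
    with h F show "f \<odot> \<sigma> 0 = \<sigma> 2" "g \<odot> \<sigma> 1 = \<sigma> 2" by metis+
  qed (auto simp: J F_def Ob_dom)
  have c: "\<pi> 0 \<in> Hom C L A" "\<pi> 1 \<in> Hom C L B" "f \<odot> \<pi> 0 = g \<odot> \<pi> 1" "\<pi> 2 = f \<odot> \<pi> 0"
    using L cone unfolding is_limit_def by metis+
  have "\<exists>!h. h \<in> Hom C Z L \<and> \<pi> 0 \<odot> h = a \<and> \<pi> 1 \<odot> h = b"
    if ab: "a \<in> Hom C Z A" "b \<in> Hom C Z B" "f \<odot> a = g \<odot> b" for Z a b
  proof -
    define \<sigma> where "\<sigma> i = (if i = 0 then a else if i = (1::nat) then b else f \<odot> a)" for i
    have "is_cone J C F Z \<sigma>" using ab Cmp_Hom[OF ab(1) f] by (simp add: cone \<sigma>_def)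
    then have ex: "\<exists>!h. h \<in> Hom C Z L \<and> (\<forall>i\<in>Ob J. \<pi> i \<odot> h = \<sigma> i)"
      using L unfolding is_limit_def by blast
    have eq: "(h \<in> Hom C Z L \<and> (\<forall>i\<in>Ob J. \<pi> i \<odot> h = \<sigma> i)) \<longleftrightarrow> (h \<in> Hom C Z L \<and> \<pi> 0 \<odot> h = a \<and> \<pi> 1 \<odot> h = b)"
      for h
      using Cmp_assoc[OF _ c(1) f, of h Z] by (auto simp: J \<sigma>_def c(4))
    show ?thesis using ex unfolding eq .
  qed
  then have "is_pullback C A B D f g L (\<pi> 0) (\<pi> 1)"
    unfolding is_pullback_def using c f g by blast
  then show ?thesis using that by blast
qed

text \<open>Existence and joint monicity are stated separately: images use the first to form W -> A
  x B, and both images and meets use the second to compare elements.\<close>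

lemma product_exists:
  assumes "A \<in> Ob C" "B \<in> Ob C"
  obtains P p q where "p \<in> Hom C P A" "q \<in> Hom C P B"
    "\<forall>Z a b. a \<in> Hom C Z A \<and> b \<in> Hom C Z B \<longrightarrow> (\<exists>h. h \<in> Hom C Z P \<and> p \<odot> h = a \<and> q \<odot> h = b)"
    "\<forall>Z h k. h \<in> Hom C Z P \<and> k \<in> Hom C Z P \<and> p \<odot> h = p \<odot> k \<and> q \<odot> h = q \<odot> k \<longrightarrow> h = k"
proof -
  define J :: "(nat, nat) cat" where
    "J = \<lparr>Ob = {0,1}, Hom = (\<lambda>i j. if i = j \<and> i \<in> {0,1} then {0} else {}), Idn = (\<lambda>_. 0), Cmp = (\<lambda>_ _. 0)\<rparr>"
  define F :: "(nat, nat, 'o, 'm) func" where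
    "F = \<lparr>FO = (\<lambda>i. if i = 0 then A else B), FA = (\<lambda>i j _. Idn C (if i = 0 then A else B))\<rparr>"
  have "category J" by unfold_locales (auto simp: J_def split: if_splits)
  moreover have "is_functor J C F"
    unfolding is_functor_def using assms by (auto simp: J_def F_def Idn_Hom Idn_left[OF Idn_Hom] split: if_splits)
  moreover have "finite (Ob J)" "\<And>i j. finite (Hom J i j)" by (auto simp: J_def)
  ultimately obtain L \<pi> where L: "is_limit J C F L \<pi>" using finite_limits by blast
  have cone: "is_cone J C F M \<sigma> \<longleftrightarrow> \<sigma> 0 \<in> Hom C M A \<and> \<sigma> 1 \<in> Hom C M B" for M \<sigma>
    unfolding is_cone_def by (auto simp: J_def F_def Idn_left Ob_dom split: if_splits)
  have c: "\<pi> 0 \<in> Hom C L A" "\<pi> 1 \<in> Hom C L B"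
    using L cone unfolding is_limit_def by metis+
  have "\<exists>!h. h \<in> Hom C Z L \<and> \<pi> 0 \<odot> h = a \<and> \<pi> 1 \<odot> h = b"
    if ab: "a \<in> Hom C Z A" "b \<in> Hom C Z B" for Z a b
  proof -
    define \<sigma> where "\<sigma> i = (if i = 0 then a else b)" for i :: nat
    have "is_cone J C F Z \<sigma>" using ab by (auto simp: cone \<sigma>_def)
    then have ex: "\<exists>!h. h \<in> Hom C Z L \<and> (\<forall>i\<in>Ob J. \<pi> i \<odot> h = \<sigma> i)"
      using L unfolding is_limit_def by blast
    have eq: "(h \<in> Hom C Z L \<and> (\<forall>i\<in>Ob J. \<pi> i \<odot> h = \<sigma> i)) \<longleftrightarrow> (h \<in> Hom C Z L \<and> \<pi> 0 \<odot> h = a \<and> \<pi> 1 \<odot> h = b)"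
      for h by (auto simp: J_def \<sigma>_def)
    show ?thesis using ex unfolding eq .
  qed
  note univ = this
  show ?thesis
  proof (rule that[OF c]; intro allI impI; (elim conjE)?)
    fix Z h k assume "h \<in> Hom C Z L" "k \<in> Hom C Z L" "\<pi> 0 \<odot> h = \<pi> 0 \<odot> k" "\<pi> 1 \<odot> h = \<pi> 1 \<odot> k"
    with univ[OF Cmp_Hom[OF _ c(1)] Cmp_Hom[OF _ c(2)], of h Z h] show "h = k" by metis
  qed (use univ in blast)
qed

end

section \<open>Internal relations and regular epimorphisms\<close>


context category
begin

text \<open>\<open>is_relation\<close> covers relations on one object only; composites, graphs and
  difunctionality require relations from A to B.\<close>

definition rel :: "'o \<Rightarrow> 'o \<Rightarrow> ('o, 'm) span \<Rightarrow> bool" where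
  "rel A B R \<longleftrightarrow> leg0 R \<in> Hom C (apex R) A \<and> leg1 R \<in> Hom C (apex R) B \<and>
     (\<forall>Z. \<forall>u\<in>Hom C Z (apex R). \<forall>v\<in>Hom C Z (apex R).
        leg0 R \<odot> u = leg0 R \<odot> v \<and> leg1 R \<odot> u = leg1 R \<odot> v \<longrightarrow> u = v)"

definition mem :: "('o, 'm) span \<Rightarrow> 'o \<Rightarrow> 'm \<Rightarrow> 'm \<Rightarrow> bool" where
  "mem R Z a b \<longleftrightarrow> (\<exists>w\<in>Hom C Z (apex R). leg0 R \<odot> w = a \<and> leg1 R \<odot> w = b)"

lemma mem_elems: "mem R Z a b \<longleftrightarrow> (a, b) \<in> elems C R Z"
  unfolding mem_def elems_def by auto

lemma is_relation_rel: "is_relation C X R \<longleftrightarrow> rel X X R"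
  unfolding is_relation_def rel_def inj_on_def by auto

lemma rel_leg: "rel A B R \<Longrightarrow> leg0 R \<in> Hom C (apex R) A" "rel A B R \<Longrightarrow> leg1 R \<in> Hom C (apex R) B"
  unfolding rel_def by auto

lemma rel_joint_mono:
  "rel A B R \<Longrightarrow> u \<in> Hom C Z (apex R) \<Longrightarrow> v \<in> Hom C Z (apex R) \<Longrightarrow> leg0 R \<odot> u = leg0 R \<odot> v
    \<Longrightarrow> leg1 R \<odot> u = leg1 R \<odot> v \<Longrightarrow> u = v"
  unfolding rel_def by blast

lemma memE:
  assumes "mem R Z a b"
  obtains w where "w \<in> Hom C Z (apex R)" "leg0 R \<odot> w = a" "leg1 R \<odot> w = b"
  using assms unfolding mem_def by blast

lemma memI: "w \<in> Hom C Z (apex R) \<Longrightarrow> mem R Z (leg0 R \<odot> w) (leg1 R \<odot> w)"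
  unfolding mem_def by blast

lemma mem_Hom:
  assumes "rel A B R" "mem R Z a b"
  shows "a \<in> Hom C Z A" "b \<in> Hom C Z B"
  using assms Cmp_Hom rel_leg unfolding mem_def by metis+

lemma mem_reindex:
  assumes "rel A B R" "mem R Z a b" "e \<in> Hom C Z' Z"
  shows "mem R Z' (a \<odot> e) (b \<odot> e)"
proof -
  obtain w where w: "w \<in> Hom C Z (apex R)" "leg0 R \<odot> w = a" "leg1 R \<odot> w = b"
    using assms(2) by (rule memE)
  then have "(leg0 R \<odot> w) \<odot> e = leg0 R \<odot> (w \<odot> e)" "(leg1 R \<odot> w) \<odot> e = leg1 R \<odot> (w \<odot> e)"
    using Cmp_assoc[OF assms(3) w(1)] rel_leg[OF assms(1)] by blast+
  with w show ?thesis using memI[OF Cmp_Hom[OF assms(3) w(1)]] by simp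
qed

lemma mem_generic:
  assumes "rel A B R"
  shows "mem R (apex R) (leg0 R) (leg1 R)"
  unfolding mem_def using rel_leg[OF assms] Idn_Hom Idn_right Ob_dom by metis

text \<open>A regular epimorphism is orthogonal to jointly monic spans, so a factorization through R
  found on a cover descends. This is why existence on a cover is enough to prove membership.\<close>

lemma mem_local:
  assumes R: "rel A B R" and e: "is_regular_epi C Z' Z e" and a: "a \<in> Hom C Z A" and b: "b \<in> Hom C Z B"
    and m: "mem R Z' (a \<odot> e) (b \<odot> e)"
  shows "mem R Z a b"
proof -
  note eh = regular_epi_Hom[OF e] and l = rel_leg[OF R]
  obtain w where w: "w \<in> Hom C Z' (apex R)" "leg0 R \<odot> w = a \<odot> e" "leg1 R \<odot> w = b \<odot> e"
    using m by (rule memE)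
  have "w \<odot> u = w \<odot> v" if uv: "u \<in> Hom C T Z'" "v \<in> Hom C T Z'" "e \<odot> u = e \<odot> v" for T u v
  proof (rule rel_joint_mono[OF R])
    have "leg0 R \<odot> (w \<odot> u) = (leg0 R \<odot> w) \<odot> u" "leg0 R \<odot> (w \<odot> v) = (leg0 R \<odot> w) \<odot> v"
       "leg1 R \<odot> (w \<odot> u) = (leg1 R \<odot> w) \<odot> u" "leg1 R \<odot> (w \<odot> v) = (leg1 R \<odot> w) \<odot> v"
      using w(1) l uv by (simp_all add: Cmp_assoc)
    then show "leg0 R \<odot> (w \<odot> u) = leg0 R \<odot> (w \<odot> v)" "leg1 R \<odot> (w \<odot> u) = leg1 R \<odot> (w \<odot> v)"
      using w uv eh a b by (simp_all add: Cmp_assoc)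
  qed (use uv w Cmp_Hom in blast)+
  then obtain k where k: "k \<in> Hom C Z (apex R)" "k \<odot> e = w"
    using regular_epi_factor[OF e w(1)] by metis
  have "(leg0 R \<odot> k) \<odot> e = a \<odot> e" "(leg1 R \<odot> k) \<odot> e = b \<odot> e"
    using k w l eh by (simp_all add: Cmp_assoc)
  then have "leg0 R \<odot> k = a" "leg1 R \<odot> k = b"
    using regular_epi_cancel[OF e Cmp_Hom[OF k(1) l(1)] a] regular_epi_cancel[OF e Cmp_Hom[OF k(1) l(2)] b] by auto
  then show ?thesis using memI[OF k(1)] by simp
qed

text \<open>Yoneda: every element of R is a reindexing of the generic one, the pair of legs indexed
  by the apex.\<close>

lemma rel_le_iff:
  assumes "rel A B R" "rel A B S"
  shows "rel_le C R S \<longleftrightarrow> (\<forall>Z a b. mem R Z a b \<longrightarrow> mem S Z a b)"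
proof
  assume "rel_le C R S"
  then obtain h where h: "h \<in> Hom C (apex R) (apex S)" "leg0 S \<odot> h = leg0 R" "leg1 S \<odot> h = leg1 R"
    unfolding rel_le_def by blast
  then have "mem S (apex R) (leg0 R) (leg1 R)" using memI by metis
  then show "\<forall>Z a b. mem R Z a b \<longrightarrow> mem S Z a b"
    using mem_reindex[OF assms(2)] by (metis memE)
next
  assume "\<forall>Z a b. mem R Z a b \<longrightarrow> mem S Z a b"
  then show "rel_le C R S" using mem_generic[OF assms(1)] unfolding rel_le_def mem_def by blast
qed

lemma rel_eq_iff:
  assumes "rel A B R" "rel A B S"
  shows "rel_eq C R S \<longleftrightarrow> (\<forall>Z a b. mem R Z a b \<longleftrightarrow> mem S Z a b)"
  unfolding rel_eq_def rel_le_iff[OF assms] rel_le_iff[OF assms(2,1)] by blast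

lemma restricts_iff:
  assumes "rel X X R" "rel Y Y R'" "f \<in> Hom C X Y"
  shows "restricts C f R R' \<longleftrightarrow> (\<forall>Z a b. mem R Z a b \<longrightarrow> mem R' Z (f \<odot> a) (f \<odot> b))"
proof
  assume "restricts C f R R'"
  then obtain h where h: "h \<in> Hom C (apex R) (apex R')" "leg0 R' \<odot> h = f \<odot> leg0 R" "leg1 R' \<odot> h = f \<odot> leg1 R"
    unfolding restricts_def by blast
  then have 1: "mem R' (apex R) (f \<odot> leg0 R) (f \<odot> leg1 R)" using memI by metis
  show "\<forall>Z a b. mem R Z a b \<longrightarrow> mem R' Z (f \<odot> a) (f \<odot> b)"
  proof (intro allI impI)
    fix Z a b assume "mem R Z a b"
    then obtain w where w: "w \<in> Hom C Z (apex R)" "leg0 R \<odot> w = a" "leg1 R \<odot> w = b" by (rule memE)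
    have "(f \<odot> leg0 R) \<odot> w = f \<odot> a" "(f \<odot> leg1 R) \<odot> w = f \<odot> b"
      using w rel_leg[OF assms(1)] assms(3) by (simp_all add: Cmp_assoc)
    then show "mem R' Z (f \<odot> a) (f \<odot> b)" using mem_reindex[OF assms(2) 1 w(1)] by simp
  qed
next
  assume "\<forall>Z a b. mem R Z a b \<longrightarrow> mem R' Z (f \<odot> a) (f \<odot> b)"
  then show "restricts C f R R'" using mem_generic[OF assms(1)] unfolding restricts_def mem_def by blast
qed

lemma equiv_rel_rel: "is_equiv_rel C X R \<Longrightarrow> rel X X R"
  unfolding is_equiv_rel_def is_relation_rel by simp

lemma equiv_rel_refl: "is_equiv_rel C X R \<Longrightarrow> x \<in> Hom C Z X \<Longrightarrow> mem R Z x x"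
  using Ob_dom unfolding is_equiv_rel_def mem_elems equiv_def refl_on_def by blast

lemma mem_Ob: "mem R Z a b \<Longrightarrow> Z \<in> Ob C"
  unfolding mem_def using Ob_dom by blast

lemma equiv_rel_sym: "is_equiv_rel C X R \<Longrightarrow> mem R Z x y \<Longrightarrow> mem R Z y x"
  using mem_Ob[of R Z x y] unfolding is_equiv_rel_def mem_elems equiv_def sym_def by blast

lemma equiv_rel_trans: "is_equiv_rel C X R \<Longrightarrow> mem R Z x y \<Longrightarrow> mem R Z y z \<Longrightarrow> mem R Z x z"
  using mem_Ob[of R Z x y] unfolding is_equiv_rel_def mem_elems equiv_def trans_def by blast

lemma equiv_relI:
  assumes "rel X X R" "\<And>Z x. x \<in> Hom C Z X \<Longrightarrow> mem R Z x x"
    "\<And>Z x y. mem R Z x y \<Longrightarrow> mem R Z y x" "\<And>Z x y z. mem R Z x y \<Longrightarrow> mem R Z y z \<Longrightarrow> mem R Z x z"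
  shows "is_equiv_rel C X R"
  unfolding is_equiv_rel_def is_relation_rel
proof (intro conjI ballI equivI)
  fix Z
  show "elems C R Z \<subseteq> Hom C Z X \<times> Hom C Z X" using mem_Hom[OF assms(1)] mem_elems by (auto simp: subset_eq)
  show "refl_on (Hom C Z X) (elems C R Z)" using assms(2) mem_elems by (auto simp: refl_on_def)
  show "sym (elems C R Z)" unfolding sym_def using assms(3) mem_elems by blast
  show "trans (elems C R Z)" unfolding trans_def using assms(4) mem_elems by blast
qed (rule assms(1))

lemma equiv_rel_diagonal:
  assumes R: "is_equiv_rel C X R" and "x \<in> Hom C Z X"
  obtains r where "r \<in> Hom C Z (apex R)" "leg0 R \<odot> r = x" "leg1 R \<odot> r = x"
  using equiv_rel_refl[OF assms] by (rule memE)

lemma rel_diag: "X \<in> Ob C \<Longrightarrow> rel X X (diag_rel C X)"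
  unfolding rel_def diag_rel_def by (auto simp: Idn_Hom) (metis Idn_left)

lemma mem_diag: "X \<in> Ob C \<Longrightarrow> mem (diag_rel C X) Z a b \<longleftrightarrow> a \<in> Hom C Z X \<and> a = b"
  unfolding mem_def diag_rel_def by (auto simp: Idn_left)

lemma equiv_rel_diag: "X \<in> Ob C \<Longrightarrow> is_equiv_rel C X (diag_rel C X)"
  by (rule equiv_relI) (auto simp: mem_diag rel_diag)

section \<open>Inverse images in terms of elements\<close>

lemma inverse_imageD:
  assumes T: "is_inverse_image C X f R' T" and R': "rel X' X' R'" and f: "f \<in> Hom C X X'"
    and Trel: "rel X X T"
    and ab: "a \<in> Hom C Z X" "b \<in> Hom C Z X"
  shows "mem T Z a b \<longleftrightarrow> mem R' Z (f \<odot> a) (f \<odot> b)"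
proof
  assume "mem T Z a b"
  moreover have "restricts C f T R'" using T unfolding is_inverse_image_def restricts_def by blast
  ultimately show "mem R' Z (f \<odot> a) (f \<odot> b)" using restricts_iff[OF Trel R' f] by blast
next
  assume "mem R' Z (f \<odot> a) (f \<odot> b)"
  then obtain w where "w \<in> Hom C Z (apex R')" "leg0 R' \<odot> w = f \<odot> a" "leg1 R' \<odot> w = f \<odot> b" by (rule memE)
  then show "mem T Z a b" using T ab unfolding is_inverse_image_def mem_def by metis
qed

text \<open>R' is jointly monic, so the arrow into its apex demanded by the pullback is forced and
  membership alone decides.\<close>

lemma inverse_imageI:
  assumes R': "rel X' X' R'" and f: "f \<in> Hom C X X'" and T: "rel X X T"
    and m: "\<And>Z a b. a \<in> Hom C Z X \<Longrightarrow> b \<in> Hom C Z X \<Longrightarrow> mem T Z a b \<longleftrightarrow> mem R' Z (f \<odot> a) (f \<odot> b)"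
  shows "is_inverse_image C X f R' T"
proof -
  have "restricts C f T R'" using restricts_iff[OF T R' f] m mem_Hom[OF T] by blast
  then obtain h where h: "h \<in> Hom C (apex T) (apex R')" "leg0 R' \<odot> h = f \<odot> leg0 T" "leg1 R' \<odot> h = f \<odot> leg1 T"
    unfolding restricts_def by blast
  note l = rel_leg[OF T] rel_leg[OF R']
  have "\<exists>!u. u \<in> Hom C Z (apex T) \<and> leg0 T \<odot> u = x \<and> leg1 T \<odot> u = y \<and> h \<odot> u = w"
    if t: "x \<in> Hom C Z X" "y \<in> Hom C Z X" "w \<in> Hom C Z (apex R')"
      "leg0 R' \<odot> w = f \<odot> x" "leg1 R' \<odot> w = f \<odot> y" for Z x y w
  proof -
    have "mem T Z x y" using m[OF t(1,2)] memI[OF t(3)] t by simp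
    then obtain u where u: "u \<in> Hom C Z (apex T)" "leg0 T \<odot> u = x" "leg1 T \<odot> u = y" by (rule memE)
    have hu: "h \<odot> u \<in> Hom C Z (apex R')" using u h Cmp_Hom by blast
    have "leg0 R' \<odot> (h \<odot> u) = leg0 R' \<odot> w"
    proof -
      have "leg0 R' \<odot> (h \<odot> u) = (leg0 R' \<odot> h) \<odot> u" using l u(1) h(1) by (simp add: Cmp_assoc)
      also have "\<dots> = f \<odot> x" unfolding h(2) using l u f by (simp add: Cmp_assoc)
      finally show ?thesis using t by simp
    qed
    moreover have "leg1 R' \<odot> (h \<odot> u) = leg1 R' \<odot> w"
    proof -
      have "leg1 R' \<odot> (h \<odot> u) = (leg1 R' \<odot> h) \<odot> u" using l u(1) h(1) by (simp add: Cmp_assoc)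
      also have "\<dots> = f \<odot> y" unfolding h(3) using l u f by (simp add: Cmp_assoc)
      finally show ?thesis using t by simp
    qed
    ultimately have "h \<odot> u = w" using rel_joint_mono[OF R' hu t(3)] by blast
    then show ?thesis using u rel_joint_mono[OF T] by metis
  qed
  then show ?thesis unfolding is_inverse_image_def using h l by blast
qed

end

context regular_category
begin

text \<open>The cover is the pullback of e along y. Internally e is surjective, but preimages of
  generalized elements exist only locally.\<close>

lemma regular_epi_lift:
  assumes e: "is_regular_epi C X Y e" and y: "y \<in> Hom C Z Y"
  obtains Z' e' x where "is_regular_epi C Z' Z e'" "x \<in> Hom C Z' X" "e \<odot> x = y \<odot> e'"
proof -
  obtain P p q where pb: "is_pullback C X Z Y e y P p q"
    using pullback_exists[OF regular_epi_Hom[OF e] y] .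
  show ?thesis using that[OF regular_epi_stable[OF pb e]] pullback_Hom[OF pb] by blast
qed

text \<open>The coequalizer c of the kernel pair of W -> A x B is the image of the span; the work
  lies in showing that the induced legs are jointly monic.\<close>

lemma span_image:
  assumes u: "u \<in> Hom C W A" and v: "v \<in> Hom C W B"
  obtains T e where "rel A B T" "is_regular_epi C W (apex T) e" "leg0 T \<odot> e = u" "leg1 T \<odot> e = v"
proof -
  obtain P p q where P: "p \<in> Hom C P A" "q \<in> Hom C P B"
    "\<forall>Z a b. a \<in> Hom C Z A \<and> b \<in> Hom C Z B \<longrightarrow> (\<exists>h. h \<in> Hom C Z P \<and> p \<odot> h = a \<and> q \<odot> h = b)"
    "\<forall>Z h k. h \<in> Hom C Z P \<and> k \<in> Hom C Z P \<and> p \<odot> h = p \<odot> k \<and> q \<odot> h = q \<odot> k \<longrightarrow> h = k"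
    using product_exists[OF Ob_cod[OF u] Ob_cod[OF v]] .
  obtain f where f: "f \<in> Hom C W P" "p \<odot> f = u" "q \<odot> f = v" using P(3) u v by blast
  have eqf: "f \<odot> a = f \<odot> b" if "a \<in> Hom C Z W" "b \<in> Hom C Z W" "u \<odot> a = u \<odot> b" "v \<odot> a = v \<odot> b" for Z a b
  proof (rule P(4)[rule_format], intro conjI)
    show "p \<odot> (f \<odot> a) = p \<odot> (f \<odot> b)" "q \<odot> (f \<odot> a) = q \<odot> (f \<odot> b)"
      using that f P(1,2) by (simp_all flip: Cmp_assoc)
  qed (use that f Cmp_Hom in blast)+
  obtain K k1 k2 where K: "is_pullback C W W P f f K k1 k2" using pullback_exists[OF f(1) f(1)] .
  note k = pullback_Hom[OF K]
  obtain Q c where c: "is_coequalizer C K W k1 k2 Q c"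
    using kernel_pair_coequalizer[of W P f K k1 k2] K unfolding is_kernel_pair_def by blast
  then have ce: "is_regular_epi C W Q c" unfolding is_regular_epi_def by blast
  note ch = regular_epi_Hom[OF ce]
  have ck: "c \<odot> k1 = c \<odot> k2" using c unfolding is_coequalizer_def by blast
  have cab: "c \<odot> a = c \<odot> b" if ab: "a \<in> Hom C Z W" "b \<in> Hom C Z W" "u \<odot> a = u \<odot> b" "v \<odot> a = v \<odot> b" for Z a b
  proof -
    obtain h where "h \<in> Hom C Z K" "k1 \<odot> h = a" "k2 \<odot> h = b"
      using pullback_lift[OF K ab(1,2) eqf[OF ab]] .
    then show ?thesis using Cmp_square[OF k(3) ch k(4) ch ck] by metis
  qed
  have "u \<odot> k1 = u \<odot> k2" "v \<odot> k1 = v \<odot> k2"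
    using Cmp_reassoc[OF f(1) P(1) f(2)] Cmp_reassoc[OF f(1) P(2) f(3)] k(3,4,5) by metis+
  then obtain m0 m1 where m: "m0 \<in> Hom C Q A" "m0 \<odot> c = u" "m1 \<in> Hom C Q B" "m1 \<odot> c = v"
    using c u v unfolding is_coequalizer_def by metis
  \<comment> \<open>Both elements of Q are lifted to W over two successive covers. There equality of
    the legs is equality in A x B, so c identifies the lifts, and the covers can be
    cancelled.\<close>
  have jm: "a = b" if ab: "a \<in> Hom C Z Q" "b \<in> Hom C Z Q" "m0 \<odot> a = m0 \<odot> b" "m1 \<odot> a = m1 \<odot> b" for Z a b
  proof -
    obtain Z1 e1 x where 1: "is_regular_epi C Z1 Z e1" "x \<in> Hom C Z1 W" "c \<odot> x = a \<odot> e1"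
      using regular_epi_lift[OF ce ab(1)] .
    note e1 = regular_epi_Hom[OF 1(1)]
    have be: "b \<odot> e1 \<in> Hom C Z1 Q" using ab(2) e1 Cmp_Hom by blast
    obtain Z2 e2 y where 2: "is_regular_epi C Z2 Z1 e2" "y \<in> Hom C Z2 W" "c \<odot> y = (b \<odot> e1) \<odot> e2"
      using regular_epi_lift[OF ce be] .
    note e2 = regular_epi_Hom[OF 2(1)]
    have e12: "e1 \<odot> e2 \<in> Hom C Z2 Z" using e1 e2 Cmp_Hom by blast
    have x2: "x \<odot> e2 \<in> Hom C Z2 W" using 1 e2 Cmp_Hom by blast
    have cx: "c \<odot> (x \<odot> e2) = a \<odot> (e1 \<odot> e2)"
    proof -
      have "c \<odot> (x \<odot> e2) = (c \<odot> x) \<odot> e2" using ch 1(2) e2 by (simp add: Cmp_assoc)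
      then show ?thesis using 1(3) ab(1) e1 e2 by (simp add: Cmp_assoc)
    qed
    have cy: "c \<odot> y = b \<odot> (e1 \<odot> e2)" using 2(3) ab(2) e1 e2 by (simp add: Cmp_assoc)
    have ux: "u \<odot> (x \<odot> e2) = m0 \<odot> (a \<odot> (e1 \<odot> e2))" "v \<odot> (x \<odot> e2) = m1 \<odot> (a \<odot> (e1 \<odot> e2))"
      unfolding cx[symmetric] m(2)[symmetric] m(4)[symmetric] using m(1,3) ch x2 by (simp_all add: Cmp_assoc)
    have uy: "u \<odot> y = m0 \<odot> (b \<odot> (e1 \<odot> e2))" "v \<odot> y = m1 \<odot> (b \<odot> (e1 \<odot> e2))"
      unfolding cy[symmetric] m(2)[symmetric] m(4)[symmetric] using m(1,3) ch 2(2) by (simp_all add: Cmp_assoc)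
    have "m0 \<odot> (a \<odot> (e1 \<odot> e2)) = m0 \<odot> (b \<odot> (e1 \<odot> e2))" "m1 \<odot> (a \<odot> (e1 \<odot> e2)) = m1 \<odot> (b \<odot> (e1 \<odot> e2))"
      using ab e12 m(1,3) by (simp_all flip: Cmp_assoc[where f = "e1 \<odot> e2"])
    then have "c \<odot> (x \<odot> e2) = c \<odot> y" using cab[OF x2 2(2)] ux uy by simp
    then have "(a \<odot> e1) \<odot> e2 = (b \<odot> e1) \<odot> e2" using cx cy ab e1 e2 by (simp add: Cmp_assoc)
    then have "a \<odot> e1 = b \<odot> e1"
      using regular_epi_cancel[OF 2(1) Cmp_Hom[OF e1 ab(1)] be] by blast
    then show "a = b" using regular_epi_cancel[OF 1(1) ab(1,2)] by blast
  qed
  have "rel A B (Q, m0, m1)" unfolding rel_def using m jm by auto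
  then show ?thesis using that[of "(Q, m0, m1)" c] ce m by auto
qed

text \<open>Take the image of the span (f, f). Its legs agree after a regular epimorphism, hence
  agree, and a jointly monic pair of equal legs is a monomorphism.\<close>

lemma regular_epi_mono_factorization:
  assumes f: "f \<in> Hom C X Y"
  obtains I e m where "is_regular_epi C X I e" "mono I Y m" "m \<odot> e = f"
proof -
  obtain T e where T: "rel Y Y T" "is_regular_epi C X (apex T) e" "leg0 T \<odot> e = f" "leg1 T \<odot> e = f"
    using span_image[OF f f] .
  have "leg0 T = leg1 T" using regular_epi_cancel[OF T(2) rel_leg[OF T(1)]] T by simp
  then have "mono (apex T) Y (leg0 T)" using T(1) unfolding mono_def rel_def by auto
  with T that show ?thesis by blast
qed

text \<open>Factor g = m e. Orthogonality of g f to m yields a section of the monomorphism m, which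
  is therefore invertible.\<close>

lemma regular_epi_right_cancel:
  assumes fg: "is_regular_epi C X Z (g \<odot> f)" and f: "f \<in> Hom C X Y" and g: "g \<in> Hom C Y Z"
  shows "is_regular_epi C Y Z g"
proof -
  obtain I e m where I: "is_regular_epi C Y I e" "mono I Z m" "m \<odot> e = g"
    using regular_epi_mono_factorization[OF g] .
  note eh = regular_epi_Hom[OF I(1)]
  have mh: "m \<in> Hom C I Z" using I mono_def by blast
  have Z: "Z \<in> Ob C" using g Ob_cod by blast
  have "Idn C Z \<odot> (g \<odot> f) = m \<odot> (e \<odot> f)"
    using Cmp_reassoc[OF eh mh I(3) f] Idn_left[OF Cmp_Hom[OF f g]] by simp
  then obtain s where "s \<in> Hom C Z I" "m \<odot> s = Idn C Z"
    using regular_epi_mono_factor[OF fg I(2) Idn_Hom[OF Z] Cmp_Hom[OF f eh]] by metis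
  then have "is_iso C I Z m" using mono_split_iso[OF I(2)] by blast
  then show ?thesis using regular_epi_iso[OF I(1)] I(3) by metis
qed

text \<open>Orthogonality is applied first to f and then to g; this splits the monic part m of g
  f.\<close>

lemma regular_epi_Cmp:
  assumes f: "is_regular_epi C X Y f" and g: "is_regular_epi C Y Z g"
  shows "is_regular_epi C X Z (g \<odot> f)"
proof -
  note fh = regular_epi_Hom[OF f] and gh = regular_epi_Hom[OF g]
  obtain I e m where I: "is_regular_epi C X I e" "mono I Z m" "m \<odot> e = g \<odot> f"
    using regular_epi_mono_factorization[OF Cmp_Hom[OF fh gh]] .
  note eh = regular_epi_Hom[OF I(1)]
  have Z: "Z \<in> Ob C" using gh Ob_cod by blast
  obtain v where v: "v \<in> Hom C Y I" "m \<odot> v = g" "v \<odot> f = e"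
    using regular_epi_mono_factor[OF f I(2) gh eh I(3)[symmetric]] .
  have "Idn C Z \<odot> g = m \<odot> v" using v gh Idn_left by simp
  then obtain s where "s \<in> Hom C Z I" "m \<odot> s = Idn C Z"
    using regular_epi_mono_factor[OF g I(2) Idn_Hom[OF Z] v(1)] by metis
  then have "is_iso C I Z m" using mono_split_iso[OF I(2)] by blast
  then show ?thesis using regular_epi_iso[OF I(1)] I(3) by metis
qed

lemma regular_epi_if_lift:
  assumes f: "f \<in> Hom C X Y" and e: "is_regular_epi C Z Y e" and "x \<in> Hom C Z X" "f \<odot> x = e"
  shows "is_regular_epi C X Y f"
  using regular_epi_right_cancel[of Z Y f x X] assms by simp

lemma image_mem:
  assumes T: "rel A B T" "is_regular_epi C W (apex T) c" "leg0 T \<odot> c = u" "leg1 T \<odot> c = v"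
  shows "mem T Z a b \<longleftrightarrow> a \<in> Hom C Z A \<and> b \<in> Hom C Z B \<and>
      (\<exists>Z' e w. is_regular_epi C Z' Z e \<and> w \<in> Hom C Z' W \<and> u \<odot> w = a \<odot> e \<and> v \<odot> w = b \<odot> e)"
proof -
  note ch = regular_epi_Hom[OF T(2)] and l = rel_leg[OF T(1)]
  have legs: "leg0 T \<odot> (c \<odot> w) = u \<odot> w" "leg1 T \<odot> (c \<odot> w) = v \<odot> w" if "w \<in> Hom C Z W" for Z w
    using Cmp_reassoc[OF ch l(1) T(3) that] Cmp_reassoc[OF ch l(2) T(4) that] by auto
  show ?thesis
  proof (intro iffI conjI; (elim conjE exE)?)
    assume m: "mem T Z a b"
    then obtain t where t: "t \<in> Hom C Z (apex T)" "leg0 T \<odot> t = a" "leg1 T \<odot> t = b" by (rule memE)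
    obtain Z' e w where w: "is_regular_epi C Z' Z e" "w \<in> Hom C Z' W" "c \<odot> w = t \<odot> e"
      using regular_epi_lift[OF T(2) t(1)] .
    have "leg0 T \<odot> (t \<odot> e) = a \<odot> e" "leg1 T \<odot> (t \<odot> e) = b \<odot> e"
      using Cmp_reassoc[OF t(1) l(1) t(2) regular_epi_Hom[OF w(1)]]
        Cmp_reassoc[OF t(1) l(2) t(3) regular_epi_Hom[OF w(1)]] by auto
    then have "u \<odot> w = a \<odot> e" "v \<odot> w = b \<odot> e" using legs[OF w(2)] w(3) by auto
    then show "\<exists>Z' e w. is_regular_epi C Z' Z e \<and> w \<in> Hom C Z' W \<and> u \<odot> w = a \<odot> e \<and> v \<odot> w = b \<odot> e"
      using w by blast
  next
    fix Z' e w assume h: "a \<in> Hom C Z A" "b \<in> Hom C Z B" "is_regular_epi C Z' Z e" "w \<in> Hom C Z' W" "u \<odot> w = a \<odot> e" "v \<odot> w = b \<odot> e"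
    have "mem T Z' (a \<odot> e) (b \<odot> e)"
      using memI[OF Cmp_Hom[OF h(4) ch]] legs[OF h(4)] h by simp
    then show "mem T Z a b" using mem_local[OF T(1) h(3,1,2)] by blast
  qed (use mem_Hom[OF T(1)] in blast)+
qed

lemma image_rel:
  assumes u: "u \<in> Hom C W A" and v: "v \<in> Hom C W B"
  obtains T where "rel A B T"
    "\<forall>Z a b. mem T Z a b \<longleftrightarrow> a \<in> Hom C Z A \<and> b \<in> Hom C Z B \<and>
      (\<exists>Z' e w. is_regular_epi C Z' Z e \<and> w \<in> Hom C Z' W \<and> u \<odot> w = a \<odot> e \<and> v \<odot> w = b \<odot> e)"
proof -
  obtain T e where T: "rel A B T" "is_regular_epi C W (apex T) e" "leg0 T \<odot> e = u" "leg1 T \<odot> e = v"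
    using span_image[OF u v] .
  show ?thesis by (rule that[OF T(1)]) (use image_mem[OF T] in blast)
qed

text \<open>The direct image described by its elements. Any relation with this membership qualifies,
  so a regular epimorphism between the apexes need not be exhibited.\<close>

definition image_of :: "'o \<Rightarrow> 'm \<Rightarrow> ('o, 'm) span \<Rightarrow> ('o, 'm) span \<Rightarrow> bool" where
  "image_of Y q R T \<longleftrightarrow> rel Y Y T \<and> (\<forall>Z a b. mem T Z a b \<longleftrightarrow> a \<in> Hom C Z Y \<and> b \<in> Hom C Z Y \<and>
      (\<exists>Z' e x y. is_regular_epi C Z' Z e \<and> mem R Z' x y \<and> q \<odot> x = a \<odot> e \<and> q \<odot> y = b \<odot> e))"

lemma direct_image_image_of:
  assumes R: "rel X X R" and q: "q \<in> Hom C X Y" and T: "is_direct_image C Y q R T"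
  shows "image_of Y q R T"
proof -
  obtain c where c: "rel Y Y T" "is_regular_epi C (apex R) (apex T) c"
     "leg0 T \<odot> c = q \<odot> leg0 R" "leg1 T \<odot> c = q \<odot> leg1 R"
    using T unfolding is_direct_image_def is_relation_rel by blast
  note l = rel_leg[OF R]
  have "(\<exists>w. w \<in> Hom C Z (apex R) \<and> (q \<odot> leg0 R) \<odot> w = a \<and> (q \<odot> leg1 R) \<odot> w = b) \<longleftrightarrow>
      (\<exists>x y. mem R Z x y \<and> q \<odot> x = a \<and> q \<odot> y = b)" for Z a b
    using Cmp_assoc[OF _ l(1) q] Cmp_assoc[OF _ l(2) q] unfolding mem_def by metis
  note key = this
  have "mem T Z a b \<longleftrightarrow> a \<in> Hom C Z Y \<and> b \<in> Hom C Z Y \<and> (\<exists>Z' e. is_regular_epi C Z' Z e \<and>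
      (\<exists>x y. mem R Z' x y \<and> q \<odot> x = a \<odot> e \<and> q \<odot> y = b \<odot> e))" for Z a b
    unfolding key[symmetric] image_mem[OF c] by blast
  then show ?thesis unfolding image_of_def using c(1) by blast
qed

lemma dir_image_image_of:
  assumes R: "rel X X R" and q: "q \<in> Hom C X Y"
  shows "image_of Y q R (dir_image C Y q R)"
proof -
  note l = rel_leg[OF R]
  obtain T e where "rel Y Y T" "is_regular_epi C (apex R) (apex T) e" "leg0 T \<odot> e = q \<odot> leg0 R"
     "leg1 T \<odot> e = q \<odot> leg1 R"
    using span_image[OF Cmp_Hom[OF l(1) q] Cmp_Hom[OF l(2) q]] .
  then have "is_direct_image C Y q R T" unfolding is_direct_image_def is_relation_rel by blast
  then have "is_direct_image C Y q R (dir_image C Y q R)" unfolding dir_image_def by (rule someI)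
  then show ?thesis by (rule direct_image_image_of[OF R q])
qed

lemma image_of_rel: "image_of Y q R T \<Longrightarrow> rel Y Y T"
  unfolding image_of_def by blast

lemma image_ofE:
  assumes "image_of Y q R T" "mem T Z a b"
  obtains Z' e x y where "is_regular_epi C Z' Z e" "mem R Z' x y" "q \<odot> x = a \<odot> e" "q \<odot> y = b \<odot> e"
  using assms unfolding image_of_def by metis

lemma image_of_local:
  assumes "image_of Y q R T" "is_regular_epi C Z' Z e" "mem R Z' x y" "q \<odot> x = a \<odot> e" "q \<odot> y = b \<odot> e"
    "a \<in> Hom C Z Y" "b \<in> Hom C Z Y"
  shows "mem T Z a b"
  using assms unfolding image_of_def by blast

lemma image_ofI:
  assumes R: "rel X X R" and q: "q \<in> Hom C X Y" and "image_of Y q R T" "mem R Z x y"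
  shows "mem T Z (q \<odot> x) (q \<odot> y)"
proof -
  have h: "q \<odot> x \<in> Hom C Z Y" "q \<odot> y \<in> Hom C Z Y" using mem_Hom[OF R assms(4)] q Cmp_Hom by blast+
  show ?thesis
    using image_of_local[OF assms(3) regular_epi_Idn[OF mem_Ob[OF assms(4)]] assms(4) _ _ h] Idn_right h by metis
qed

end

section \<open>Operations on relations\<close>


context finitely_complete
begin

text \<open>Two successive pullbacks, first along f and then along g, give the inverse image along f
  x g without a product object.\<close>

lemma inverse_rel:
  assumes D: "rel A B D" and f: "f \<in> Hom C A' A" and g: "g \<in> Hom C B' B"
  obtains T where "rel A' B' T"
    "\<forall>Z a b. mem T Z a b \<longleftrightarrow> a \<in> Hom C Z A' \<and> b \<in> Hom C Z B' \<and> mem D Z (f \<odot> a) (g \<odot> b)"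
proof -
  note l = rel_leg[OF D]
  obtain V a1 d1 where V: "is_pullback C A' (apex D) A f (leg0 D) V a1 d1"
    using pullback_exists[OF f l(1)] .
  note v = pullback_Hom[OF V]
  have d1': "leg1 D \<odot> d1 \<in> Hom C V B" using v l Cmp_Hom by blast
  obtain W w1 b1 where W: "is_pullback C V B' B (leg1 D \<odot> d1) g W w1 b1"
    using pullback_exists[OF d1' g] .
  note w = pullback_Hom[OF W]
  define T where "T = (W, a1 \<odot> w1, b1)"
  have T: "apex T = W" "leg0 T = a1 \<odot> w1" "leg1 T = b1" by (auto simp: T_def)
  have sq: "f \<odot> (a1 \<odot> (w1 \<odot> u)) = leg0 D \<odot> (d1 \<odot> (w1 \<odot> u))"
    "g \<odot> (b1 \<odot> u) = leg1 D \<odot> (d1 \<odot> (w1 \<odot> u))" if u: "u \<in> Hom C Z W" for Z u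
  proof -
    have wu: "w1 \<odot> u \<in> Hom C Z V" using u w Cmp_Hom by blast
    show "f \<odot> (a1 \<odot> (w1 \<odot> u)) = leg0 D \<odot> (d1 \<odot> (w1 \<odot> u))" using pullback_square[OF V wu] .
    show "g \<odot> (b1 \<odot> u) = leg1 D \<odot> (d1 \<odot> (w1 \<odot> u))"
      using pullback_square[OF W u] Cmp_assoc[OF wu v(4) l(2)] by simp
  qed
  have ass: "(a1 \<odot> w1) \<odot> u = a1 \<odot> (w1 \<odot> u)" if "u \<in> Hom C Z W" for Z u
    using Cmp_assoc[OF that w(3) v(3)] .
  have "rel A' B' T"
    unfolding rel_def T
  proof (intro conjI ballI allI impI; (elim conjE)?)
    show "a1 \<odot> w1 \<in> Hom C W A'" "b1 \<in> Hom C W B'" using v w Cmp_Hom by blast+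
    fix Z u u' assume h: "u \<in> Hom C Z W" "u' \<in> Hom C Z W" "(a1 \<odot> w1) \<odot> u = (a1 \<odot> w1) \<odot> u'" "b1 \<odot> u = b1 \<odot> u'"
    have wu: "w1 \<odot> u \<in> Hom C Z V" "w1 \<odot> u' \<in> Hom C Z V" using h w Cmp_Hom by blast+
    have "d1 \<odot> (w1 \<odot> u) = d1 \<odot> (w1 \<odot> u')"
      using rel_joint_mono[OF D Cmp_Hom[OF wu(1) v(4)] Cmp_Hom[OF wu(2) v(4)]]
        sq[OF h(1)] sq[OF h(2)] h ass by simp
    then have "w1 \<odot> u = w1 \<odot> u'" using pullback_unique[OF V wu] h ass by simp
    then show "u = u'" using pullback_unique[OF W h(1,2)] h by simp
  qed
  moreover have "mem T Z a b \<longleftrightarrow> a \<in> Hom C Z A' \<and> b \<in> Hom C Z B' \<and> mem D Z (f \<odot> a) (g \<odot> b)" for Z a b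
  proof
    assume m: "mem T Z a b"
    then obtain u where u: "u \<in> Hom C Z W" "a1 \<odot> (w1 \<odot> u) = a" "b1 \<odot> u = b"
      using ass unfolding mem_def T by auto
    have "mem D Z (leg0 D \<odot> (d1 \<odot> (w1 \<odot> u))) (leg1 D \<odot> (d1 \<odot> (w1 \<odot> u)))"
      using u w v Cmp_Hom by (intro memI) blast
    then show "a \<in> Hom C Z A' \<and> b \<in> Hom C Z B' \<and> mem D Z (f \<odot> a) (g \<odot> b)"
      using sq[OF u(1)] u mem_Hom[OF \<open>rel A' B' T\<close> m] by simp
  next
    assume h: "a \<in> Hom C Z A' \<and> b \<in> Hom C Z B' \<and> mem D Z (f \<odot> a) (g \<odot> b)"
    then obtain d where d: "d \<in> Hom C Z (apex D)" "leg0 D \<odot> d = f \<odot> a" "leg1 D \<odot> d = g \<odot> b"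
      by (auto elim: memE)
    obtain k where k: "k \<in> Hom C Z V" "a1 \<odot> k = a" "d1 \<odot> k = d"
      using pullback_lift[OF V] h d by metis
    have "(leg1 D \<odot> d1) \<odot> k = g \<odot> b" using Cmp_assoc[OF k(1) v(4) l(2)] k d by simp
    then obtain u where u: "u \<in> Hom C Z W" "w1 \<odot> u = k" "b1 \<odot> u = b"
      using pullback_lift[OF W k(1)] h by metis
    then show "mem T Z a b" using memI[of u Z T] ass[OF u(1)] k unfolding T by simp
  qed
  ultimately show ?thesis using that by blast
qed

text \<open>This is the pullback of f and g viewed as a relation, obtained as the inverse image of
  the diagonal of D.\<close>

lemma eq_rel:
  assumes f: "f \<in> Hom C A D" and g: "g \<in> Hom C B D"
  obtains T where "rel A B T"
    "\<forall>Z a b. mem T Z a b \<longleftrightarrow> a \<in> Hom C Z A \<and> b \<in> Hom C Z B \<and> f \<odot> a = g \<odot> b"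
proof -
  have D: "D \<in> Ob C" using f Ob_cod by blast
  obtain T where "rel A B T"
    "\<forall>Z a b. mem T Z a b \<longleftrightarrow> a \<in> Hom C Z A \<and> b \<in> Hom C Z B \<and> mem (diag_rel C D) Z (f \<odot> a) (g \<odot> b)"
    using inverse_rel[OF rel_diag[OF D] f g] .
  then show ?thesis using that mem_diag[OF D] Cmp_Hom f g by metis
qed

text \<open>Both relations map into one product A x B; their pullback over it is the
  intersection.\<close>

lemma meet_rel:
  assumes R: "rel A B R" and S: "rel A B S"
  obtains T where "rel A B T" "\<forall>Z a b. mem T Z a b \<longleftrightarrow> mem R Z a b \<and> mem S Z a b"
proof -
  note l = rel_leg[OF R] and m = rel_leg[OF S]
  obtain P p q where P: "p \<in> Hom C P A" "q \<in> Hom C P B"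
    "\<forall>Z a b. a \<in> Hom C Z A \<and> b \<in> Hom C Z B \<longrightarrow> (\<exists>h. h \<in> Hom C Z P \<and> p \<odot> h = a \<and> q \<odot> h = b)"
    "\<forall>Z h k. h \<in> Hom C Z P \<and> k \<in> Hom C Z P \<and> p \<odot> h = p \<odot> k \<and> q \<odot> h = q \<odot> k \<longrightarrow> h = k"
    using product_exists[OF Ob_cod[OF l(1)] Ob_cod[OF l(2)]] .
  obtain r where r: "r \<in> Hom C (apex R) P" "p \<odot> r = leg0 R" "q \<odot> r = leg1 R" using P(3) l by blast
  obtain s where s: "s \<in> Hom C (apex S) P" "p \<odot> s = leg0 S" "q \<odot> s = leg1 S" using P(3) m by blast
  obtain W w1 w2 where W: "is_pullback C (apex R) (apex S) P r s W w1 w2"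
    using pullback_exists[OF r(1) s(1)] .
  note w = pullback_Hom[OF W]
  define T where "T = (W, leg0 R \<odot> w1, leg1 R \<odot> w1)"
  have T: "apex T = W" "leg0 T = leg0 R \<odot> w1" "leg1 T = leg1 R \<odot> w1" by (auto simp: T_def)
  have ass: "(leg0 R \<odot> w1) \<odot> u = leg0 R \<odot> (w1 \<odot> u)" "(leg1 R \<odot> w1) \<odot> u = leg1 R \<odot> (w1 \<odot> u)"
    if "u \<in> Hom C Z W" for Z u
    using Cmp_assoc[OF that w(3)] l by blast+
  have sq: "leg0 R \<odot> (w1 \<odot> u) = leg0 S \<odot> (w2 \<odot> u)" "leg1 R \<odot> (w1 \<odot> u) = leg1 S \<odot> (w2 \<odot> u)"
    if u: "u \<in> Hom C Z W" for Z u
  proof -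
    have wu: "w1 \<odot> u \<in> Hom C Z (apex R)" "w2 \<odot> u \<in> Hom C Z (apex S)" using u w Cmp_Hom by blast+
    show "leg0 R \<odot> (w1 \<odot> u) = leg0 S \<odot> (w2 \<odot> u)"
      using Cmp_reassoc[OF r(1) P(1) r(2) wu(1)] Cmp_reassoc[OF s(1) P(1) s(2) wu(2)]
        pullback_square[OF W u] by simp
    show "leg1 R \<odot> (w1 \<odot> u) = leg1 S \<odot> (w2 \<odot> u)"
      using Cmp_reassoc[OF r(1) P(2) r(3) wu(1)] Cmp_reassoc[OF s(1) P(2) s(3) wu(2)]
        pullback_square[OF W u] by simp
  qed
  have "rel A B T"
    unfolding rel_def T
  proof (intro conjI ballI allI impI; (elim conjE)?)
    show "leg0 R \<odot> w1 \<in> Hom C W A" "leg1 R \<odot> w1 \<in> Hom C W B" using l w Cmp_Hom by blast+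
    fix Z u v assume h: "u \<in> Hom C Z W" "v \<in> Hom C Z W" "(leg0 R \<odot> w1) \<odot> u = (leg0 R \<odot> w1) \<odot> v"
      "(leg1 R \<odot> w1) \<odot> u = (leg1 R \<odot> w1) \<odot> v"
    have wu: "w1 \<odot> u \<in> Hom C Z (apex R)" "w1 \<odot> v \<in> Hom C Z (apex R)"
       "w2 \<odot> u \<in> Hom C Z (apex S)" "w2 \<odot> v \<in> Hom C Z (apex S)" using h w Cmp_Hom by blast+
    have "w1 \<odot> u = w1 \<odot> v" using rel_joint_mono[OF R wu(1,2)] h ass by simp
    moreover have "w2 \<odot> u = w2 \<odot> v" using rel_joint_mono[OF S wu(3,4)] h ass sq by metis
    ultimately show "u = v" using pullback_unique[OF W h(1,2)] by blast
  qed
  moreover have "mem T Z a b \<longleftrightarrow> mem R Z a b \<and> mem S Z a b" for Z a b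
  proof
    assume "mem T Z a b"
    then obtain u where u: "u \<in> Hom C Z W" "leg0 R \<odot> (w1 \<odot> u) = a" "leg1 R \<odot> (w1 \<odot> u) = b"
      using ass unfolding mem_def T by auto
    have wu: "w1 \<odot> u \<in> Hom C Z (apex R)" "w2 \<odot> u \<in> Hom C Z (apex S)" using u w Cmp_Hom by blast+
    show "mem R Z a b \<and> mem S Z a b" using memI[of "w1 \<odot> u" Z R] memI[of "w2 \<odot> u" Z S] wu sq[OF u(1)] u by simp
  next
    assume h: "mem R Z a b \<and> mem S Z a b"
    then obtain x where x: "x \<in> Hom C Z (apex R)" "leg0 R \<odot> x = a" "leg1 R \<odot> x = b" by (auto elim: memE)
    obtain y where y: "y \<in> Hom C Z (apex S)" "leg0 S \<odot> y = a" "leg1 S \<odot> y = b" using h by (auto elim: memE)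
    have "p \<odot> (r \<odot> x) = p \<odot> (s \<odot> y)" "q \<odot> (r \<odot> x) = q \<odot> (s \<odot> y)"
      using Cmp_reassoc[OF r(1) P(1) r(2) x(1)] Cmp_reassoc[OF s(1) P(1) s(2) y(1)]
         Cmp_reassoc[OF r(1) P(2) r(3) x(1)] Cmp_reassoc[OF s(1) P(2) s(3) y(1)] x y by simp_all
    then have "r \<odot> x = s \<odot> y" using P(4) Cmp_Hom[OF x(1) r(1)] Cmp_Hom[OF y(1) s(1)] by blast
    then obtain u where "u \<in> Hom C Z W" "w1 \<odot> u = x" "w2 \<odot> u = y"
      using pullback_lift[OF W x(1) y(1)] by metis
    then show "mem T Z a b" using memI[of u Z T] ass x unfolding T by simp
  qed
  ultimately show ?thesis using that by blast
qed

end

context regular_category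
begin

text \<open>The composite is the image of the pullback of R and S over B, which is why the middle
  element b exists only on a cover. The last clause is the case of the identity cover.\<close>

lemma comp_rel:
  assumes R: "rel A B R" and S: "rel B D S"
  obtains T where "rel A D T"
    "\<forall>Z a c. mem T Z a c \<longleftrightarrow> a \<in> Hom C Z A \<and> c \<in> Hom C Z D \<and>
      (\<exists>Z' e b. is_regular_epi C Z' Z e \<and> mem R Z' (a \<odot> e) b \<and> mem S Z' b (c \<odot> e))"
    "\<forall>Z a b c. mem R Z a b \<and> mem S Z b c \<longrightarrow> mem T Z a c"
proof -
  note l = rel_leg[OF R] and m = rel_leg[OF S]
  obtain W w1 w2 where W: "is_pullback C (apex R) (apex S) B (leg1 R) (leg0 S) W w1 w2"
    using pullback_exists[OF l(2) m(1)] .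
  note w = pullback_Hom[OF W]
  obtain T where T: "rel A D T" "\<forall>Z a c. mem T Z a c \<longleftrightarrow> a \<in> Hom C Z A \<and> c \<in> Hom C Z D \<and>
      (\<exists>Z' e u. is_regular_epi C Z' Z e \<and> u \<in> Hom C Z' W \<and> (leg0 R \<odot> w1) \<odot> u = a \<odot> e \<and> (leg1 S \<odot> w2) \<odot> u = c \<odot> e)"
    using image_rel[OF Cmp_Hom[OF w(3) l(1)] Cmp_Hom[OF w(4) m(2)]] .
  have "(\<exists>u. u \<in> Hom C Z W \<and> (leg0 R \<odot> w1) \<odot> u = a \<and> (leg1 S \<odot> w2) \<odot> u = c) \<longleftrightarrow>
    (\<exists>b. mem R Z a b \<and> mem S Z b c)" for Z a c
  proof safe
    fix u assume u: "u \<in> Hom C Z W"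
    have wu: "w1 \<odot> u \<in> Hom C Z (apex R)" "w2 \<odot> u \<in> Hom C Z (apex S)" using u w Cmp_Hom by blast+
    show "\<exists>b. mem R Z ((leg0 R \<odot> w1) \<odot> u) b \<and> mem S Z b ((leg1 S \<odot> w2) \<odot> u)"
      using memI[OF wu(1)] memI[OF wu(2)] pullback_square[OF W u] Cmp_assoc[OF u w(3) l(1)] Cmp_assoc[OF u w(4) m(2)]
      by metis
  next
    fix b assume "mem R Z a b" "mem S Z b c"
    then obtain x y where xy: "x \<in> Hom C Z (apex R)" "leg0 R \<odot> x = a" "leg1 R \<odot> x = b"
       "y \<in> Hom C Z (apex S)" "leg0 S \<odot> y = b" "leg1 S \<odot> y = c" by (auto elim!: memE)
    obtain u where u: "u \<in> Hom C Z W" "w1 \<odot> u = x" "w2 \<odot> u = y"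
      using pullback_lift[OF W xy(1,4)] xy by metis
    then show "\<exists>u. u \<in> Hom C Z W \<and> (leg0 R \<odot> w1) \<odot> u = a \<and> (leg1 S \<odot> w2) \<odot> u = c"
      using Cmp_assoc[OF u(1) w(3) l(1)] Cmp_assoc[OF u(1) w(4) m(2)] xy by metis
  qed
  note key = this
  have mem: "mem T Z a c \<longleftrightarrow> a \<in> Hom C Z A \<and> c \<in> Hom C Z D \<and>
      (\<exists>Z' e. is_regular_epi C Z' Z e \<and> (\<exists>b. mem R Z' (a \<odot> e) b \<and> mem S Z' b (c \<odot> e)))" for Z a c
    unfolding key[symmetric] T(2)[rule_format] by blast
  show ?thesis
  proof (rule that[OF T(1)])
    show "\<forall>Z a c. mem T Z a c \<longleftrightarrow> a \<in> Hom C Z A \<and> c \<in> Hom C Z D \<and>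
      (\<exists>Z' e b. is_regular_epi C Z' Z e \<and> mem R Z' (a \<odot> e) b \<and> mem S Z' b (c \<odot> e))"
      unfolding mem by blast
    show "\<forall>Z a b c. mem R Z a b \<and> mem S Z b c \<longrightarrow> mem T Z a c"
    proof (intro allI impI, elim conjE)
      fix Z a b c assume h: "mem R Z a b" "mem S Z b c"
      have "a \<in> Hom C Z A" "c \<in> Hom C Z D" using mem_Hom[OF R h(1)] mem_Hom[OF S h(2)] by blast+
      then show "mem T Z a c"
        unfolding mem using h regular_epi_Idn[OF mem_Ob[OF h(1)]] Idn_right by metis
    qed
  qed
qed

text \<open>A functional relation is an arrow: uniqueness makes the local choice t0 respect the
  kernel pair of e, so t0 descends to A. \<Phi> is any predicate stable under reindexing, not a
  represented relation, so it may be described with auxiliary elements.\<close>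

lemma unique_choice:
  assumes loc: "is_regular_epi C Z0 A e" "t0 \<in> Hom C Z0 T" "\<Phi> Z0 e t0"
    and re: "\<And>Z u t Z' k. u \<in> Hom C Z A \<Longrightarrow> t \<in> Hom C Z T \<Longrightarrow> \<Phi> Z u t \<Longrightarrow> k \<in> Hom C Z' Z
        \<Longrightarrow> \<Phi> Z' (u \<odot> k) (t \<odot> k)"
    and uniq: "\<And>Z u t t'. u \<in> Hom C Z A \<Longrightarrow> t \<in> Hom C Z T \<Longrightarrow> t' \<in> Hom C Z T \<Longrightarrow> \<Phi> Z u t \<Longrightarrow> \<Phi> Z u t' \<Longrightarrow> t = t'"
  obtains p where "p \<in> Hom C A T"
    "\<forall>Z u t. u \<in> Hom C Z A \<and> t \<in> Hom C Z T \<and> \<Phi> Z u t \<longrightarrow> p \<odot> u = t"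
    "\<forall>Z u. u \<in> Hom C Z A \<longrightarrow> (\<exists>Z' e. is_regular_epi C Z' Z e \<and> \<Phi> Z' (u \<odot> e) (p \<odot> (u \<odot> e)))"
proof -
  note eh = regular_epi_Hom[OF loc(1)]
  have "t0 \<odot> u = t0 \<odot> v" if uv: "u \<in> Hom C Z Z0" "v \<in> Hom C Z Z0" "e \<odot> u = e \<odot> v" for Z u v
  proof (rule uniq)
    show "e \<odot> u \<in> Hom C Z A" "t0 \<odot> u \<in> Hom C Z T" "t0 \<odot> v \<in> Hom C Z T"
      using uv eh loc Cmp_Hom by blast+
    show "\<Phi> Z (e \<odot> u) (t0 \<odot> u)" "\<Phi> Z (e \<odot> u) (t0 \<odot> v)"
      using re[OF eh loc(2,3)] uv by (blast, metis)
  qed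
  then obtain p where p: "p \<in> Hom C A T" "p \<odot> e = t0"
    using regular_epi_factor[OF loc(1,2)] by metis
  have "p \<odot> u = t" if h: "u \<in> Hom C Z A" "t \<in> Hom C Z T" "\<Phi> Z u t" for Z u t
  proof -
    obtain Z' e' x where x: "is_regular_epi C Z' Z e'" "x \<in> Hom C Z' Z0" "e \<odot> x = u \<odot> e'"
      using regular_epi_lift[OF loc(1) h(1)] .
    note e' = regular_epi_Hom[OF x(1)]
    have "\<Phi> Z' (u \<odot> e') (t \<odot> e')" "\<Phi> Z' (u \<odot> e') (t0 \<odot> x)"
      using re[OF h e'] re[OF eh loc(2,3) x(2)] x(3) by auto
    moreover have H: "u \<odot> e' \<in> Hom C Z' A" "t \<odot> e' \<in> Hom C Z' T" "t0 \<odot> x \<in> Hom C Z' T"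
      using e' h x loc Cmp_Hom by blast+
    ultimately have "t \<odot> e' = t0 \<odot> x" using uniq by blast
    also have "\<dots> = p \<odot> (e \<odot> x)" using Cmp_reassoc[OF eh p x(2)] by simp
    also have "\<dots> = (p \<odot> u) \<odot> e'" using x(3) Cmp_assoc[OF e' h(1) p(1)] by simp
    finally show ?thesis using regular_epi_cancel[OF x(1) h(2) Cmp_Hom[OF h(1) p(1)]] by simp
  qed
  moreover have "\<exists>Z' e. is_regular_epi C Z' Z e \<and> \<Phi> Z' (u \<odot> e) (p \<odot> (u \<odot> e))" if u: "u \<in> Hom C Z A" for Z u
  proof -
    obtain Z' e' x where x: "is_regular_epi C Z' Z e'" "x \<in> Hom C Z' Z0" "e \<odot> x = u \<odot> e'"
      using regular_epi_lift[OF loc(1) u] .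
    have "\<Phi> Z' (e \<odot> x) (t0 \<odot> x)" using re[OF eh loc(2,3) x(2)] .
    moreover have "t0 \<odot> x = p \<odot> (e \<odot> x)" using Cmp_reassoc[OF eh p x(2)] by simp
    ultimately show ?thesis using x(1,3) by metis
  qed
  ultimately show ?thesis using that p(1) by blast
qed

end

section \<open>Relations in exact Mal'tsev categories\<close>


locale exact_maltsev = exact_category C + maltsev_category C for C :: "('o, 'm) cat" (structure) +
  assumes coequalizers: "has_coequalizers C"
begin

lemma reflexive_equiv:
  "rel X X R \<Longrightarrow> (\<And>Z x. x \<in> Hom C Z X \<Longrightarrow> mem R Z x x) \<Longrightarrow> is_equiv_rel C X R"
  using reflexive_imp_equiv[of X R] unfolding is_reflexive_rel_def is_relation_rel mem_elems refl_on_def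
  by blast

text \<open>Consider on D itself the relation T with (x, y) T (x', y') iff x D y'. It is reflexive,
  hence transitive; passing from (a, b) over (a', b) to (a', b') gives the claim.\<close>

lemma difunctional:
  assumes D: "rel A B D" and m: "mem D Z a b" "mem D Z a' b" "mem D Z a' b'"
  shows "mem D Z a b'"
proof -
  obtain T where T: "rel (apex D) (apex D) T" "\<forall>Z u v. mem T Z u v \<longleftrightarrow>
      u \<in> Hom C Z (apex D) \<and> v \<in> Hom C Z (apex D) \<and> mem D Z (leg0 D \<odot> u) (leg1 D \<odot> v)"
    using inverse_rel[OF D rel_leg[OF D]] .
  have eq: "is_equiv_rel C (apex D) T"
    using reflexive_equiv[OF T(1)] T(2) memI by blast
  obtain u v w where uvw: "u \<in> Hom C Z (apex D)" "leg0 D \<odot> u = a" "leg1 D \<odot> u = b"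
    "v \<in> Hom C Z (apex D)" "leg0 D \<odot> v = a'" "leg1 D \<odot> v = b"
    "w \<in> Hom C Z (apex D)" "leg0 D \<odot> w = a'" "leg1 D \<odot> w = b'"
    using m by (auto elim!: memE)
  have "mem T Z u v" "mem T Z v w" using T(2) uvw m by auto
  then have "mem T Z u w" by (rule equiv_rel_trans[OF eq])
  then show ?thesis using T(2) uvw by auto
qed

text \<open>Exactness presents K as the kernel pair of some f. As f factors through the coequalizer
  q of K, the arrow q identifies no more than f does.\<close>

lemma equiv_rel_quot:
  assumes K: "is_equiv_rel C X K" and Q: "quot C X K = (Q, q)"
  shows "is_regular_epi C X Q q"
    and "a \<in> Hom C Z X \<Longrightarrow> b \<in> Hom C Z X \<Longrightarrow> mem K Z a b \<longleftrightarrow> q \<odot> a = q \<odot> b"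
proof -
  have K': "is_equiv_rel C X (apex K, leg0 K, leg1 K)" using K by simp
  obtain Y f where f: "is_kernel_pair C X Y f (apex K) (leg0 K) (leg1 K)"
    using equiv_rel_effective[OF K'] by blast
  obtain Q' q' where "is_coequalizer C (apex K) X (leg0 K) (leg1 K) Q' q'"
    using kernel_pair_coequalizer[OF f] by blast
  then have ex: "case (Q', q') of (Q, q) \<Rightarrow> is_coequalizer C (apex K) X (leg0 K) (leg1 K) Q q" by simp
  have c: "is_coequalizer C (apex K) X (leg0 K) (leg1 K) Q q"
    using someI[where P = "\<lambda>(Q, q). is_coequalizer C (apex K) X (leg0 K) (leg1 K) Q q", OF ex] Q
    unfolding quot_def by simp
  then show reg: "is_regular_epi C X Q q" unfolding is_regular_epi_def by blast
  note qh = regular_epi_Hom[OF reg] and l = rel_leg[OF equiv_rel_rel[OF K]]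
  have pb: "is_pullback C X X Y f f (apex K) (leg0 K) (leg1 K)" using f unfolding is_kernel_pair_def .
  note t = pullback_Hom[OF pb]
  obtain k where k: "k \<in> Hom C Q Y" "k \<odot> q = f" using c t unfolding is_coequalizer_def by metis
  assume a: "a \<in> Hom C Z X" and b: "b \<in> Hom C Z X"
  show "mem K Z a b \<longleftrightarrow> q \<odot> a = q \<odot> b"
  proof
    assume "mem K Z a b"
    then obtain w where w: "w \<in> Hom C Z (apex K)" "leg0 K \<odot> w = a" "leg1 K \<odot> w = b" by (rule memE)
    have "q \<odot> leg0 K = q \<odot> leg1 K" using c unfolding is_coequalizer_def by blast
    from Cmp_square[OF l(1) qh l(2) qh this w(1)] w show "q \<odot> a = q \<odot> b" by simp
  next
    assume "q \<odot> a = q \<odot> b"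
    then have "f \<odot> a = f \<odot> b" using Cmp_reassoc[OF qh k a] Cmp_reassoc[OF qh k b] by simp
    then show "mem K Z a b" using pullback_lift[OF pb a b] unfolding mem_def by metis
  qed
qed

text \<open>D is the kernel pair of the coequalizer of u and v. Every K containing the pair has a
  quotient map that factors through this coequalizer, hence K contains D.\<close>

lemma equiv_closure:
  assumes u: "u \<in> Hom C Z0 X" and v: "v \<in> Hom C Z0 X"
  obtains D where "is_equiv_rel C X D" "mem D Z0 u v"
    "\<forall>K Z a b. is_equiv_rel C X K \<and> mem K Z0 u v \<and> mem D Z a b \<longrightarrow> mem K Z a b"
proof -
  obtain Q c where c: "is_coequalizer C Z0 X u v Q c"
    using coequalizers u v unfolding has_coequalizers_def by blast
  then have ch: "c \<in> Hom C X Q" "c \<odot> u = c \<odot> v" unfolding is_coequalizer_def by auto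
  obtain D where D: "rel X X D"
    "\<forall>Z a b. mem D Z a b \<longleftrightarrow> a \<in> Hom C Z X \<and> b \<in> Hom C Z X \<and> c \<odot> a = c \<odot> b"
    using eq_rel[OF ch(1) ch(1)] .
  show ?thesis
  proof (rule that)
    show "is_equiv_rel C X D" using reflexive_equiv[OF D(1)] D(2) by blast
    show "mem D Z0 u v" using D(2) u v ch by blast
    show "\<forall>K Z a b. is_equiv_rel C X K \<and> mem K Z0 u v \<and> mem D Z a b \<longrightarrow> mem K Z a b"
    proof (intro allI impI, elim conjE)
      fix K Z a b assume K: "is_equiv_rel C X K" "mem K Z0 u v" and ab: "mem D Z a b"
      obtain Q' q where q: "quot C X K = (Q', q)" by (cases "quot C X K")
      note Q = equiv_rel_quot[OF K(1) q]
      note qh = regular_epi_Hom[OF Q(1)]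
      have "q \<odot> u = q \<odot> v" using Q(2)[OF u v] K by blast
      then obtain k where k: "k \<in> Hom C Q Q'" "k \<odot> c = q"
        using c qh unfolding is_coequalizer_def by metis
      have h: "a \<in> Hom C Z X" "b \<in> Hom C Z X" "c \<odot> a = c \<odot> b" using D(2) ab by blast+
      then have "q \<odot> a = q \<odot> b"
        using Cmp_reassoc[OF ch(1) k h(1)] Cmp_reassoc[OF ch(1) k h(2)] by simp
      then show "mem K Z a b" using Q(2)[OF h(1,2)] by blast
    qed
  qed
qed

lemma equiv_rel_image:
  assumes q: "is_regular_epi C X Y q" and R: "is_equiv_rel C X R" and T: "image_of Y q R T"
  shows "is_equiv_rel C Y T"
proof (rule reflexive_equiv[OF image_of_rel[OF T]])
  fix Z y assume y: "y \<in> Hom C Z Y"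
  obtain Z' e x where "is_regular_epi C Z' Z e" "x \<in> Hom C Z' X" "q \<odot> x = y \<odot> e"
    using regular_epi_lift[OF q y] .
  then show "mem T Z y y" using image_of_local[OF T] equiv_rel_refl[OF R] y by blast
qed

lemma equiv_rel_comp:
  assumes R: "is_equiv_rel C X R" and S: "is_equiv_rel C X S"
  obtains J where "is_equiv_rel C X J"
    "\<forall>Z a c. mem J Z a c \<longleftrightarrow> a \<in> Hom C Z X \<and> c \<in> Hom C Z X \<and>
      (\<exists>Z' e b. is_regular_epi C Z' Z e \<and> mem R Z' (a \<odot> e) b \<and> mem S Z' b (c \<odot> e))"
    "\<forall>Z a b c. mem R Z a b \<and> mem S Z b c \<longrightarrow> mem J Z a c"
proof -
  obtain J where J: "rel X X J"
    "\<forall>Z a c. mem J Z a c \<longleftrightarrow> a \<in> Hom C Z X \<and> c \<in> Hom C Z X \<and>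
      (\<exists>Z' e b. is_regular_epi C Z' Z e \<and> mem R Z' (a \<odot> e) b \<and> mem S Z' b (c \<odot> e))"
    "\<forall>Z a b c. mem R Z a b \<and> mem S Z b c \<longrightarrow> mem J Z a c"
    using comp_rel[OF equiv_rel_rel[OF R] equiv_rel_rel[OF S]] .
  have "is_equiv_rel C X J"
    using reflexive_equiv[OF J(1)] J(3) equiv_rel_refl[OF R] equiv_rel_refl[OF S] by blast
  with that J(2,3) show ?thesis by blast
qed

lemma equiv_rel_meet:
  assumes R: "is_equiv_rel C X R" and S: "is_equiv_rel C X S"
  obtains T where "is_equiv_rel C X T" "\<forall>Z a b. mem T Z a b \<longleftrightarrow> mem R Z a b \<and> mem S Z a b"
proof -
  obtain T where T: "rel X X T" "\<forall>Z a b. mem T Z a b \<longleftrightarrow> mem R Z a b \<and> mem S Z a b"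
    using meet_rel[OF equiv_rel_rel[OF R] equiv_rel_rel[OF S]] .
  moreover have "is_equiv_rel C X T"
    using reflexive_equiv[OF T(1)] T(2) equiv_rel_refl[OF R] equiv_rel_refl[OF S] by blast
  ultimately show ?thesis using that by blast
qed

lemma equiv_rel_inverse:
  assumes R: "is_equiv_rel C Y R" and f: "f \<in> Hom C X Y"
  obtains T where "is_equiv_rel C X T"
    "\<forall>Z a b. mem T Z a b \<longleftrightarrow> a \<in> Hom C Z X \<and> b \<in> Hom C Z X \<and> mem R Z (f \<odot> a) (f \<odot> b)"
proof -
  obtain T where T: "rel X X T"
    "\<forall>Z a b. mem T Z a b \<longleftrightarrow> a \<in> Hom C Z X \<and> b \<in> Hom C Z X \<and> mem R Z (f \<odot> a) (f \<odot> b)"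
    using inverse_rel[OF equiv_rel_rel[OF R] f f] .
  moreover have "is_equiv_rel C X T"
    using reflexive_equiv[OF T(1)] T(2) equiv_rel_refl[OF R] Cmp_Hom f by blast
  ultimately show ?thesis using that by blast
qed

lemma equiv_rel_kernel:
  assumes f: "f \<in> Hom C X Y"
  obtains T where "is_equiv_rel C X T"
    "\<forall>Z a b. mem T Z a b \<longleftrightarrow> a \<in> Hom C Z X \<and> b \<in> Hom C Z X \<and> f \<odot> a = f \<odot> b"
proof -
  obtain T where T: "rel X X T"
    "\<forall>Z a b. mem T Z a b \<longleftrightarrow> a \<in> Hom C Z X \<and> b \<in> Hom C Z X \<and> f \<odot> a = f \<odot> b"
    using eq_rel[OF f f] .
  moreover have "is_equiv_rel C X T"
    using reflexive_equiv[OF T(1)] T(2) by blast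
  ultimately show ?thesis using that by blast
qed

text \<open>The composite of R and S is an equivalence relation because it is reflexive, and
  transitivity of any K above R and S keeps it below K; so one step in R and one in S reach
  everything in the join.\<close>

lemma rel_join:
  assumes R: "is_equiv_rel C X R" and S: "is_equiv_rel C X S"
  shows "is_equiv_rel C X (rel_join C X R S)"
    and "mem (rel_join C X R S) Z a c \<longleftrightarrow> a \<in> Hom C Z X \<and> c \<in> Hom C Z X \<and>
      (\<exists>Z' e b. is_regular_epi C Z' Z e \<and> mem R Z' (a \<odot> e) b \<and> mem S Z' b (c \<odot> e))"
proof -
  obtain J where J: "is_equiv_rel C X J"
    "\<forall>Z a c. mem J Z a c \<longleftrightarrow> a \<in> Hom C Z X \<and> c \<in> Hom C Z X \<and>
      (\<exists>Z' e b. is_regular_epi C Z' Z e \<and> mem R Z' (a \<odot> e) b \<and> mem S Z' b (c \<odot> e))"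
    "\<forall>Z a b c. mem R Z a b \<and> mem S Z b c \<longrightarrow> mem J Z a c"
    using equiv_rel_comp[OF R S] .
  note le = rel_le_iff[OF equiv_rel_rel equiv_rel_rel]
  have "rel_le C R J" unfolding le[OF R J(1)]
    using J(3) equiv_rel_refl[OF S] mem_Hom[OF equiv_rel_rel[OF R]] by blast
  moreover have "rel_le C S J" unfolding le[OF S J(1)]
    using J(3) equiv_rel_refl[OF R] mem_Hom[OF equiv_rel_rel[OF S]] by blast
  moreover have min: "rel_le C J K" if K: "is_equiv_rel C X K" "rel_le C R K" "rel_le C S K" for K
    unfolding le[OF J(1) K(1)]
  proof (intro allI impI)
    fix Z a c assume "mem J Z a c"
    then obtain Z' e b where h: "a \<in> Hom C Z X" "c \<in> Hom C Z X" "is_regular_epi C Z' Z e"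
       "mem R Z' (a \<odot> e) b" "mem S Z' b (c \<odot> e)" using J(2) by blast
    then have "mem K Z' (a \<odot> e) (c \<odot> e)"
      using K(2,3) equiv_rel_trans[OF K(1)] unfolding le[OF R K(1)] le[OF S K(1)] by blast
    then show "mem K Z a c" using mem_local[OF equiv_rel_rel[OF K(1)] h(3,1,2)] by blast
  qed
  ultimately have "is_join C X R S J" unfolding is_join_def using J(1) by blast
  then have j: "is_join C X R S (rel_join C X R S)" unfolding rel_join_def by (rule someI)
  then show eq: "is_equiv_rel C X (rel_join C X R S)" unfolding is_join_def by blast
  have "rel_le C J (rel_join C X R S)" "rel_le C (rel_join C X R S) J"
    using j \<open>is_join C X R S J\<close> unfolding is_join_def by blast+
  then show "mem (rel_join C X R S) Z a c \<longleftrightarrow> a \<in> Hom C Z X \<and> c \<in> Hom C Z X \<and>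
      (\<exists>Z' e b. is_regular_epi C Z' Z e \<and> mem R Z' (a \<odot> e) b \<and> mem S Z' b (c \<odot> e))"
    unfolding le[OF J(1) eq] le[OF eq J(1)] using J(2) by blast
qed

text \<open>With d the diagonal of R, this asks that \<Theta> contain (d y, d z) whenever y S z.
  Diagonal elements are recognized by their equal legs, so no arrow d has to be chosen and the
  condition passes easily to restrictions, meets and images.\<close>

definition lifts_diagonally :: "('o, 'm) span \<Rightarrow> ('o, 'm) span \<Rightarrow> ('o, 'm) span \<Rightarrow> bool" where
  "lifts_diagonally R S \<Theta> \<longleftrightarrow>
     (\<forall>Z r s. r \<in> Hom C Z (apex R) \<and> s \<in> Hom C Z (apex R) \<and> leg0 R \<odot> r = leg1 R \<odot> r \<and>
        leg0 R \<odot> s = leg1 R \<odot> s \<and> mem S Z (leg1 R \<odot> r) (leg1 R \<odot> s) \<longrightarrow> mem \<Theta> Z r s)"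

text \<open>The last clause bounds \<Theta> from above by the inverse image of S along
  \<open>leg1 R\<close>. It keeps track of the end points when transports along two relations are
  combined.\<close>

definition transport :: "('o, 'm) span \<Rightarrow> ('o, 'm) span \<Rightarrow> ('o, 'm) span \<Rightarrow> bool" where
  "transport R S \<Theta> \<longleftrightarrow> is_equiv_rel C (apex R) \<Theta> \<and> lifts_diagonally R S \<Theta> \<and>
     (\<forall>Z r s. mem \<Theta> Z r s \<longrightarrow> mem S Z (leg1 R \<odot> r) (leg1 R \<odot> s))"

text \<open>\<Theta> meets the kernel pair of \<open>leg1 R\<close> in the diagonal: transporting an
  element of R to a given end point has at most one result.\<close>

definition discrete :: "('o, 'm) span \<Rightarrow> ('o, 'm) span \<Rightarrow> bool" where
  "discrete R \<Theta> \<longleftrightarrow> (\<forall>Z r s. mem \<Theta> Z r s \<and> leg1 R \<odot> r = leg1 R \<odot> s \<longrightarrow> r = s)"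

text \<open>Let a V s mean that a is \<Theta>-related, on a cover, to an element whose end point is
  that of s. With y the end point of a, the trivial step (y, y) is lifted from a and from the
  diagonal element at y by reflexivity, and the step (y, z) from the diagonal element by a diagonal
  pair. Difunctionality of V lifts (y, z) from a.\<close>

lemma transport_exists:
  assumes R: "is_equiv_rel C X R" and S: "is_equiv_rel C X S"
    and \<Theta>: "is_equiv_rel C (apex R) \<Theta>" and lift: "lifts_diagonally R S \<Theta>"
    and a: "a \<in> Hom C Z (apex R)" and m: "mem S Z (leg1 R \<odot> a) z"
  obtains Z' e b where "is_regular_epi C Z' Z e" "mem \<Theta> Z' (a \<odot> e) b" "leg1 R \<odot> b = z \<odot> e"
proof -
  note Rr = equiv_rel_rel[OF R] and Sr = equiv_rel_rel[OF S]
  note lR = rel_leg[OF Rr] and lS = rel_leg[OF Sr]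
  obtain V0 where V0: "rel (apex R) (apex S) V0" "\<forall>Z b s. mem V0 Z b s \<longleftrightarrow>
       b \<in> Hom C Z (apex R) \<and> s \<in> Hom C Z (apex S) \<and> leg1 R \<odot> b = leg1 S \<odot> s"
    using eq_rel[OF lR(2) lS(2)] .
  obtain V where V: "rel (apex R) (apex S) V"
    "\<forall>Z a s. mem V Z a s \<longleftrightarrow> a \<in> Hom C Z (apex R) \<and> s \<in> Hom C Z (apex S) \<and>
      (\<exists>Z' e b. is_regular_epi C Z' Z e \<and> mem \<Theta> Z' (a \<odot> e) b \<and> mem V0 Z' b (s \<odot> e))"
    "\<forall>Z a b s. mem \<Theta> Z a b \<and> mem V0 Z b s \<longrightarrow> mem V Z a s"
    using comp_rel[OF equiv_rel_rel[OF \<Theta>] V0(1)] .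
  have yz: "leg1 R \<odot> a \<in> Hom C Z X" "z \<in> Hom C Z X" using mem_Hom[OF Sr m] .
  obtain s where s: "s \<in> Hom C Z (apex S)" "leg0 S \<odot> s = leg1 R \<odot> a" "leg1 S \<odot> s = z"
    using m by (rule memE)
  obtain ry where ry: "ry \<in> Hom C Z (apex R)" "leg0 R \<odot> ry = leg1 R \<odot> a" "leg1 R \<odot> ry = leg1 R \<odot> a"
    using equiv_rel_diagonal[OF R yz(1)] .
  obtain rz where rz: "rz \<in> Hom C Z (apex R)" "leg0 R \<odot> rz = z" "leg1 R \<odot> rz = z"
    using equiv_rel_diagonal[OF R yz(2)] .
  obtain sy where sy: "sy \<in> Hom C Z (apex S)" "leg0 S \<odot> sy = leg1 R \<odot> a" "leg1 S \<odot> sy = leg1 R \<odot> a"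
    using equiv_rel_diagonal[OF S yz(1)] .
  have "mem \<Theta> Z ry rz" using lift ry rz m unfolding lifts_diagonally_def by metis
  then have "mem V Z ry s" using V(3) V0(2) rz s by metis
  moreover have "mem V Z a sy" using V(3) V0(2) equiv_rel_refl[OF \<Theta> a] a sy by metis
  moreover have "mem V Z ry sy" using V(3) V0(2) equiv_rel_refl[OF \<Theta> ry(1)] ry sy by metis
  ultimately have "mem V Z a s" using difunctional[OF V(1)] by blast
  then obtain Z' e b where b: "is_regular_epi C Z' Z e" "mem \<Theta> Z' (a \<odot> e) b" "leg1 R \<odot> b = leg1 S \<odot> (s \<odot> e)"
    using V(2) V0(2) by blast
  moreover have "leg1 S \<odot> (s \<odot> e) = z \<odot> e" using Cmp_reassoc[OF s(1) lS(2) s(3) regular_epi_Hom[OF b(1)]] .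
  ultimately show ?thesis using that by metis
qed

lemma image_arrow:
  assumes R: "rel X X R" and q: "q \<in> Hom C X Y" and R': "rel Y Y R'"
    and m: "\<And>Z x y. mem R Z x y \<Longrightarrow> mem R' Z (q \<odot> x) (q \<odot> y)"
  obtains \<rho> where "\<rho> \<in> Hom C (apex R) (apex R')"
    "\<forall>Z r. r \<in> Hom C Z (apex R) \<longrightarrow> leg0 R' \<odot> (\<rho> \<odot> r) = q \<odot> (leg0 R \<odot> r) \<and> leg1 R' \<odot> (\<rho> \<odot> r) = q \<odot> (leg1 R \<odot> r)"
proof -
  note l = rel_leg[OF R] and l' = rel_leg[OF R']
  obtain \<rho> where \<rho>: "\<rho> \<in> Hom C (apex R) (apex R')" "leg0 R' \<odot> \<rho> = q \<odot> leg0 R" "leg1 R' \<odot> \<rho> = q \<odot> leg1 R"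
    using m[OF mem_generic[OF R]] by (rule memE)
  show ?thesis
    using that[OF \<rho>(1)] Cmp_square[OF \<rho>(1) l'(1) l(1) q \<rho>(2)] Cmp_square[OF \<rho>(1) l'(2) l(2) q \<rho>(3)] by blast
qed

text \<open>The candidate is the image of \<Delta> under the map \<rho> from R to R'. The last
  assumption is discreteness modulo q, the most that the least transport offers when q kills the
  commutator.\<close>

lemma transport_image:
  assumes q: "is_regular_epi C X Q q" and R: "is_equiv_rel C X R" and S: "is_equiv_rel C X S"
    and R': "image_of Q q R R'" and S': "image_of Q q S S'" and \<Delta>: "transport R S \<Delta>"
    and disc: "\<And>Z a b. mem \<Delta> Z a b \<Longrightarrow> leg1 R \<odot> a = leg1 R \<odot> b \<Longrightarrow> q \<odot> (leg0 R \<odot> a) = q \<odot> (leg0 R \<odot> b)"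
  obtains \<Delta>' where "transport R' S' \<Delta>'" "discrete R' \<Delta>'"
proof -
  note qh = regular_epi_Hom[OF q]
  note Rr = equiv_rel_rel[OF R] and Sr = equiv_rel_rel[OF S]
  note R'r = image_of_rel[OF R'] and S'r = image_of_rel[OF S']
  note lR = rel_leg[OF Rr] and lR' = rel_leg[OF R'r] and lS = rel_leg[OF Sr]
  have \<Delta>eq: "is_equiv_rel C (apex R) \<Delta>" and \<Delta>lift: "lifts_diagonally R S \<Delta>"
    and \<Delta>S: "\<And>Z r s. mem \<Delta> Z r s \<Longrightarrow> mem S Z (leg1 R \<odot> r) (leg1 R \<odot> s)"
    using \<Delta> unfolding transport_def by blast+
  obtain \<rho> where \<rho>: "\<rho> \<in> Hom C (apex R) (apex R')"
    "\<forall>Z r. r \<in> Hom C Z (apex R) \<longrightarrow> leg0 R' \<odot> (\<rho> \<odot> r) = q \<odot> (leg0 R \<odot> r) \<and> leg1 R' \<odot> (\<rho> \<odot> r) = q \<odot> (leg1 R \<odot> r)"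
    using image_arrow[OF Rr qh R'r image_ofI[OF Rr qh R']] .
  have \<rho>eq: "\<rho> \<odot> a = r'" if "a \<in> Hom C Z (apex R)" "r' \<in> Hom C Z (apex R')"
    "q \<odot> (leg0 R \<odot> a) = leg0 R' \<odot> r'" "q \<odot> (leg1 R \<odot> a) = leg1 R' \<odot> r'" for Z a r'
    using rel_joint_mono[OF R'r Cmp_Hom[OF that(1) \<rho>(1)] that(2)] \<rho>(2) that by auto
  have \<rho>lift: "\<exists>Z' e a. is_regular_epi C Z' Z e \<and> a \<in> Hom C Z' (apex R) \<and> \<rho> \<odot> a = r' \<odot> e"
    if r': "r' \<in> Hom C Z (apex R')" for Z r'
  proof -
    obtain Z' e x y where e: "is_regular_epi C Z' Z e" "mem R Z' x y" "q \<odot> x = (leg0 R' \<odot> r') \<odot> e" "q \<odot> y = (leg1 R' \<odot> r') \<odot> e"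
      using image_ofE[OF R' memI[OF r']] .
    obtain a where a: "a \<in> Hom C Z' (apex R)" "leg0 R \<odot> a = x" "leg1 R \<odot> a = y" using e(2) by (rule memE)
    note eh = regular_epi_Hom[OF e(1)]
    have "\<rho> \<odot> a = r' \<odot> e"
      using \<rho>eq[OF a(1) Cmp_Hom[OF eh r']] a e Cmp_assoc[OF eh r' lR'(1)] Cmp_assoc[OF eh r' lR'(2)] by simp
    with e a show ?thesis by blast
  qed
  have R'ob: "apex R' \<in> Ob C" using lR' Ob_dom by blast
  \<comment> \<open>The identity of \<open>apex R'\<close> lifts locally through \<rho>, so a cover
    factors through \<rho>.\<close>
  have \<rho>reg: "is_regular_epi C (apex R) (apex R') \<rho>"
    using \<rho>lift[OF Idn_Hom[OF R'ob]] regular_epi_if_lift[OF \<rho>(1)] regular_epi_Hom Idn_left by metis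
  define \<Delta>' where "\<Delta>' = dir_image C (apex R') \<rho> \<Delta>"
  have im: "image_of (apex R') \<rho> \<Delta> \<Delta>'"
    unfolding \<Delta>'_def using dir_image_image_of[OF equiv_rel_rel[OF \<Delta>eq] \<rho>(1)] .
  note \<Delta>'r = image_of_rel[OF im]
  have "lifts_diagonally R' S' \<Delta>'"
    unfolding lifts_diagonally_def
  proof (intro allI impI, elim conjE)
    fix Z r s assume h: "r \<in> Hom C Z (apex R')" "s \<in> Hom C Z (apex R')" "leg0 R' \<odot> r = leg1 R' \<odot> r"
        "leg0 R' \<odot> s = leg1 R' \<odot> s" "mem S' Z (leg1 R' \<odot> r) (leg1 R' \<odot> s)"
    obtain Z' e y z where e: "is_regular_epi C Z' Z e" "mem S Z' y z" "q \<odot> y = (leg1 R' \<odot> r) \<odot> e" "q \<odot> z = (leg1 R' \<odot> s) \<odot> e"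
      using image_ofE[OF S' h(5)] .
    note eh = regular_epi_Hom[OF e(1)] and yz = mem_Hom[OF Sr e(2)]
    obtain ry where ry: "ry \<in> Hom C Z' (apex R)" "leg0 R \<odot> ry = y" "leg1 R \<odot> ry = y"
      using equiv_rel_diagonal[OF R yz(1)] .
    obtain rz where rz: "rz \<in> Hom C Z' (apex R)" "leg0 R \<odot> rz = z" "leg1 R \<odot> rz = z"
      using equiv_rel_diagonal[OF R yz(2)] .
    have "mem \<Delta> Z' ry rz" using \<Delta>lift ry rz e(2) unfolding lifts_diagonally_def by simp
    moreover have "\<rho> \<odot> ry = r \<odot> e"
      using \<rho>eq[OF ry(1) Cmp_Hom[OF eh h(1)]] ry e h Cmp_assoc[OF eh h(1) lR'(1)] Cmp_assoc[OF eh h(1) lR'(2)] by simp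
    moreover have "\<rho> \<odot> rz = s \<odot> e"
      using \<rho>eq[OF rz(1) Cmp_Hom[OF eh h(2)]] rz e h Cmp_assoc[OF eh h(2) lR'(1)] Cmp_assoc[OF eh h(2) lR'(2)] by simp
    ultimately show "mem \<Delta>' Z r s" using image_of_local[OF im e(1)] h by blast
  qed
  moreover have "mem S' Z (leg1 R' \<odot> r) (leg1 R' \<odot> s)" if m: "mem \<Delta>' Z r s" for Z r s
  proof -
    obtain Z' e a b where e: "is_regular_epi C Z' Z e" "mem \<Delta> Z' a b" "\<rho> \<odot> a = r \<odot> e" "\<rho> \<odot> b = s \<odot> e"
      using image_ofE[OF im m] .
    note eh = regular_epi_Hom[OF e(1)] and ab = mem_Hom[OF equiv_rel_rel[OF \<Delta>eq] e(2)] and rs = mem_Hom[OF \<Delta>'r m]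
    have "q \<odot> (leg1 R \<odot> a) = (leg1 R' \<odot> r) \<odot> e" "q \<odot> (leg1 R \<odot> b) = (leg1 R' \<odot> s) \<odot> e"
      using \<rho>(2) ab e(3,4) Cmp_assoc[OF eh rs(1) lR'(2)] Cmp_assoc[OF eh rs(2) lR'(2)] by metis+
    then show ?thesis
      using image_of_local[OF S' e(1) \<Delta>S[OF e(2)]] Cmp_Hom[OF rs(1) lR'(2)] Cmp_Hom[OF rs(2) lR'(2)] by blast
  qed
  ultimately have tr: "transport R' S' \<Delta>'"
    unfolding transport_def using equiv_rel_image[OF \<rho>reg \<Delta>eq im] by blast
  \<comment> \<open>Preparation for discreteness: lifts a and b of elements with a common end point
    have end points equal only under q. Let S2 be S met with the kernel of q, and \<Theta> the part
    of \<Delta> that preserves start points modulo q. Then \<Theta> can move a to the end point of b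
    while its start point stays fixed modulo q.\<close>
  have q0: "q \<odot> leg0 R \<in> Hom C (apex R) Q" using lR qh Cmp_Hom by blast
  obtain E where E: "is_equiv_rel C (apex R) E" "\<forall>Z a b. mem E Z a b \<longleftrightarrow> a \<in> Hom C Z (apex R) \<and> b \<in> Hom C Z (apex R) \<and>
      (q \<odot> leg0 R) \<odot> a = (q \<odot> leg0 R) \<odot> b" using equiv_rel_kernel[OF q0] .
  obtain \<Theta> where \<Theta>: "is_equiv_rel C (apex R) \<Theta>" "\<forall>Z a b. mem \<Theta> Z a b \<longleftrightarrow> mem \<Delta> Z a b \<and> mem E Z a b"
    using equiv_rel_meet[OF \<Delta>eq E(1)] .
  obtain L where L: "is_equiv_rel C X L" "\<forall>Z a b. mem L Z a b \<longleftrightarrow> a \<in> Hom C Z X \<and> b \<in> Hom C Z X \<and> q \<odot> a = q \<odot> b"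
    using equiv_rel_kernel[OF qh] .
  obtain S2 where S2: "is_equiv_rel C X S2" "\<forall>Z a b. mem S2 Z a b \<longleftrightarrow> mem S Z a b \<and> mem L Z a b"
    using equiv_rel_meet[OF S L(1)] .
  have q0a: "(q \<odot> leg0 R) \<odot> a = q \<odot> (leg0 R \<odot> a)" if "a \<in> Hom C Z (apex R)" for Z a
    using Cmp_assoc[OF that lR(1) qh] .
  have "lifts_diagonally R S2 \<Theta>"
    unfolding lifts_diagonally_def
  proof (intro allI impI, elim conjE)
    fix Z r s assume h: "r \<in> Hom C Z (apex R)" "s \<in> Hom C Z (apex R)" "leg0 R \<odot> r = leg1 R \<odot> r"
        "leg0 R \<odot> s = leg1 R \<odot> s" "mem S2 Z (leg1 R \<odot> r) (leg1 R \<odot> s)"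
    have "mem S Z (leg1 R \<odot> r) (leg1 R \<odot> s)" "q \<odot> (leg1 R \<odot> r) = q \<odot> (leg1 R \<odot> s)"
      using h(5) S2(2) L(2) by blast+
    then have "mem \<Delta> Z r s" "mem E Z r s" using \<Delta>lift h E(2) q0a unfolding lifts_diagonally_def by simp_all
    then show "mem \<Theta> Z r s" using \<Theta>(2) by blast
  qed
  note ex = transport_exists[OF R S2(1) \<Theta>(1) this]
  have "discrete R' \<Delta>'"
    unfolding discrete_def
  proof (intro allI impI, elim conjE)
    fix Z r s assume m: "mem \<Delta>' Z r s" and eq: "leg1 R' \<odot> r = leg1 R' \<odot> s"
    obtain Z' e a b where e: "is_regular_epi C Z' Z e" "mem \<Delta> Z' a b" "\<rho> \<odot> a = r \<odot> e" "\<rho> \<odot> b = s \<odot> e"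
      using image_ofE[OF im m] .
    note eh = regular_epi_Hom[OF e(1)] and ab = mem_Hom[OF equiv_rel_rel[OF \<Delta>eq] e(2)] and rs = mem_Hom[OF \<Delta>'r m]
    have q1: "q \<odot> (leg1 R \<odot> a) = q \<odot> (leg1 R \<odot> b)"
      using \<rho>(2) ab e(3,4) Cmp_assoc[OF eh rs(1) lR'(2)] Cmp_assoc[OF eh rs(2) lR'(2)] eq by metis
    then have "mem S2 Z' (leg1 R \<odot> a) (leg1 R \<odot> b)"
      using S2(2) L(2) \<Delta>S[OF e(2)] Cmp_Hom[OF ab(1) lR(2)] Cmp_Hom[OF ab(2) lR(2)] by blast
    then obtain Z2 d c where c: "is_regular_epi C Z2 Z' d" "mem \<Theta> Z2 (a \<odot> d) c" "leg1 R \<odot> c = (leg1 R \<odot> b) \<odot> d"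
      using ex[OF ab(1)] by metis
    note dh = regular_epi_Hom[OF c(1)]
    have ch: "a \<odot> d \<in> Hom C Z2 (apex R)" "c \<in> Hom C Z2 (apex R)" using mem_Hom[OF equiv_rel_rel[OF \<Theta>(1)] c(2)] .
    have bd: "b \<odot> d \<in> Hom C Z2 (apex R)" using ab dh Cmp_Hom by blast
    have c0: "mem \<Delta> Z2 (a \<odot> d) c" "q \<odot> (leg0 R \<odot> (a \<odot> d)) = q \<odot> (leg0 R \<odot> c)"
      using c(2) \<Theta>(2) E(2) q0a ch by auto
    \<comment> \<open>Now c and b lie over the same end point and are related by \<Delta>, so
      \<open>disc\<close> compares their start points.\<close>
    have "mem \<Delta> Z2 c (b \<odot> d)"
      using equiv_rel_trans[OF \<Delta>eq equiv_rel_sym[OF \<Delta>eq c0(1)] mem_reindex[OF equiv_rel_rel[OF \<Delta>eq] e(2) dh]] .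
    moreover have "leg1 R \<odot> c = leg1 R \<odot> (b \<odot> d)" using c(3) Cmp_assoc[OF dh ab(2) lR(2)] by simp
    ultimately have "q \<odot> (leg0 R \<odot> c) = q \<odot> (leg0 R \<odot> (b \<odot> d))" by (rule disc)
    then have "leg0 R' \<odot> (\<rho> \<odot> (a \<odot> d)) = leg0 R' \<odot> (\<rho> \<odot> (b \<odot> d))" using \<rho>(2) ch bd c0(2) by simp
    then have "(leg0 R' \<odot> (\<rho> \<odot> a)) \<odot> d = (leg0 R' \<odot> (\<rho> \<odot> b)) \<odot> d"
      using Cmp_assoc[OF dh ab(1) \<rho>(1)] Cmp_assoc[OF dh ab(2) \<rho>(1)]
        Cmp_assoc[OF dh Cmp_Hom[OF ab(1) \<rho>(1)] lR'(1)] Cmp_assoc[OF dh Cmp_Hom[OF ab(2) \<rho>(1)] lR'(1)] by simp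
    then have "leg0 R' \<odot> (\<rho> \<odot> a) = leg0 R' \<odot> (\<rho> \<odot> b)"
      using regular_epi_cancel[OF c(1) Cmp_Hom[OF Cmp_Hom[OF ab(1) \<rho>(1)] lR'(1)] Cmp_Hom[OF Cmp_Hom[OF ab(2) \<rho>(1)] lR'(1)]] by blast
    then have "\<rho> \<odot> a = \<rho> \<odot> b"
      using rel_joint_mono[OF R'r Cmp_Hom[OF ab(1) \<rho>(1)] Cmp_Hom[OF ab(2) \<rho>(1)]] \<rho>(2) ab q1 by simp
    then show "r = s" using regular_epi_cancel[OF e(1) rs] e(3,4) by simp
  qed
  with that tr show ?thesis by blast
qed

end

section \<open>Centralization and the commutator\<close>


context exact_maltsev
begin

lemma transportD:
  assumes "transport R S \<Theta>"
  shows "is_equiv_rel C (apex R) \<Theta>" "lifts_diagonally R S \<Theta>"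
    "mem \<Theta> Z r s \<Longrightarrow> mem S Z (leg1 R \<odot> r) (leg1 R \<odot> s)"
  using assms unfolding transport_def by blast+

lemma lifts_diagonallyD:
  "lifts_diagonally R S \<Theta> \<Longrightarrow> r \<in> Hom C Z (apex R) \<Longrightarrow> s \<in> Hom C Z (apex R) \<Longrightarrow> leg0 R \<odot> r = leg1 R \<odot> r
    \<Longrightarrow> leg0 R \<odot> s = leg1 R \<odot> s \<Longrightarrow> mem S Z (leg1 R \<odot> r) (leg1 R \<odot> s) \<Longrightarrow> mem \<Theta> Z r s"
  unfolding lifts_diagonally_def by blast

lemma discreteD: "discrete R \<Theta> \<Longrightarrow> mem \<Theta> Z r s \<Longrightarrow> leg1 R \<odot> r = leg1 R \<odot> s \<Longrightarrow> r = s"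
  unfolding discrete_def by blast

text \<open>p(x, y, z) is the start point of the unique element over z that is \<Theta>-related to
  (x, y). The identity p(x, y, y) = x is reflexivity of \<Theta>, and p(y, y, z) = z comes from the
  diagonal pairs.\<close>

lemma transport_centralizes:
  assumes R: "is_equiv_rel C X R" and S: "is_equiv_rel C X S"
    and \<Theta>: "transport R S \<Theta>" and disc: "discrete R \<Theta>"
  shows "centralizes C X R S"
proof -
  note Rr = equiv_rel_rel[OF R] and Sr = equiv_rel_rel[OF S]
  note lR = rel_leg[OF Rr] and lS = rel_leg[OF Sr]
  note \<Theta>eq = transportD(1)[OF \<Theta>] and \<Theta>lift = transportD(2)[OF \<Theta>]
  note \<Theta>r = equiv_rel_rel[OF \<Theta>eq]
  obtain P a b where P: "is_pullback C (apex R) (apex S) X (leg1 R) (leg0 S) P a b"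
    using pullback_exists[OF lR(2) lS(1)] .
  note h = pullback_Hom[OF P]
  have Pob: "P \<in> Ob C" using h Ob_dom by blast
  have bS: "leg1 S \<odot> b \<in> Hom C P X" using h lS Cmp_Hom by blast
  define \<Phi> where "\<Phi> Z u t \<longleftrightarrow> (\<exists>c. mem \<Theta> Z (a \<odot> u) c \<and> leg1 R \<odot> c = leg1 S \<odot> (b \<odot> u) \<and> t = leg0 R \<odot> c)" for Z u t
  have "mem S P (leg1 R \<odot> a) (leg1 S \<odot> b)" using memI[OF h(4)] h(5) by simp
  then obtain Z0 e c where c: "is_regular_epi C Z0 P e" "mem \<Theta> Z0 (a \<odot> e) c" "leg1 R \<odot> c = (leg1 S \<odot> b) \<odot> e"
    using transport_exists[OF R S \<Theta>eq \<Theta>lift h(3)] by metis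
  note eh = regular_epi_Hom[OF c(1)]
  have cH: "c \<in> Hom C Z0 (apex R)" using mem_Hom[OF \<Theta>r c(2)] by blast
  have loc: "\<Phi> Z0 e (leg0 R \<odot> c)" unfolding \<Phi>_def using c Cmp_assoc[OF eh h(4) lS(2)] by auto
  obtain p where p: "p \<in> Hom C P X" "\<forall>Z u t. u \<in> Hom C Z P \<and> t \<in> Hom C Z X \<and> \<Phi> Z u t \<longrightarrow> p \<odot> u = t"
    "\<forall>Z u. u \<in> Hom C Z P \<longrightarrow> (\<exists>Z' e. is_regular_epi C Z' Z e \<and> \<Phi> Z' (u \<odot> e) (p \<odot> (u \<odot> e)))"
  proof (rule unique_choice[of Z0 P e "leg0 R \<odot> c" X \<Phi>])
    show "is_regular_epi C Z0 P e" "leg0 R \<odot> c \<in> Hom C Z0 X" "\<Phi> Z0 e (leg0 R \<odot> c)"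
      using c loc Cmp_Hom[OF cH lR(1)] by blast+
  next
    fix Z u t Z' k assume uk: "u \<in> Hom C Z P" "t \<in> Hom C Z X" "\<Phi> Z u t" "k \<in> Hom C Z' Z"
    then obtain c where c: "mem \<Theta> Z (a \<odot> u) c" "leg1 R \<odot> c = leg1 S \<odot> (b \<odot> u)" "t = leg0 R \<odot> c"
      unfolding \<Phi>_def by blast
    have cH: "c \<in> Hom C Z (apex R)" using mem_Hom[OF \<Theta>r c(1)] by blast
    have "leg1 R \<odot> (c \<odot> k) = leg1 S \<odot> (b \<odot> (u \<odot> k))"
      using Cmp_assoc[OF uk(4) cH lR(2)] c(2) Cmp_assoc[OF uk(4) Cmp_Hom[OF uk(1) h(4)] lS(2)]
        Cmp_assoc[OF uk(4,1) h(4)] by simp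
    moreover have "mem \<Theta> Z' (a \<odot> (u \<odot> k)) (c \<odot> k)"
      using mem_reindex[OF \<Theta>r c(1) uk(4)] Cmp_assoc[OF uk(4,1) h(3)] by simp
    ultimately show "\<Phi> Z' (u \<odot> k) (t \<odot> k)" unfolding \<Phi>_def using Cmp_assoc[OF uk(4) cH lR(1)] c(3) by blast
  next
    fix Z u t t' assume "\<Phi> Z u t" "\<Phi> Z u t'"
    then obtain c c' where "mem \<Theta> Z (a \<odot> u) c" "leg1 R \<odot> c = leg1 S \<odot> (b \<odot> u)" "t = leg0 R \<odot> c"
       "mem \<Theta> Z (a \<odot> u) c'" "leg1 R \<odot> c' = leg1 S \<odot> (b \<odot> u)" "t' = leg0 R \<odot> c'"
      unfolding \<Phi>_def by blast
    then show "t = t'" using discreteD[OF disc equiv_rel_trans[OF \<Theta>eq equiv_rel_sym[OF \<Theta>eq]]] by metis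
  qed
  have "p \<odot> u = leg0 R \<odot> (a \<odot> u)" if u: "u \<in> Hom C Z P" "leg0 S \<odot> (b \<odot> u) = leg1 S \<odot> (b \<odot> u)" for Z u
  proof -
    have au: "a \<odot> u \<in> Hom C Z (apex R)" using u h Cmp_Hom by blast
    have "\<Phi> Z u (leg0 R \<odot> (a \<odot> u))"
      unfolding \<Phi>_def using equiv_rel_refl[OF \<Theta>eq au] pullback_square[OF P u(1)] u(2) by metis
    then show ?thesis using p(2) u(1) Cmp_Hom[OF au lR(1)] by blast
  qed
  moreover have "p \<odot> u = leg1 S \<odot> (b \<odot> u)" if u: "u \<in> Hom C Z P" "leg0 R \<odot> (a \<odot> u) = leg1 R \<odot> (a \<odot> u)" for Z u
  proof -
    have au: "a \<odot> u \<in> Hom C Z (apex R)" and bu: "b \<odot> u \<in> Hom C Z (apex S)" using u h Cmp_Hom by blast+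
    obtain c where c: "c \<in> Hom C Z (apex R)" "leg0 R \<odot> c = leg1 S \<odot> (b \<odot> u)" "leg1 R \<odot> c = leg1 S \<odot> (b \<odot> u)"
      using equiv_rel_diagonal[OF R Cmp_Hom[OF bu lS(2)]] .
    have "mem \<Theta> Z (a \<odot> u) c"
      using lifts_diagonallyD[OF \<Theta>lift au c(1)] u(2) c memI[OF bu] pullback_square[OF P u(1)] by simp
    then have "\<Phi> Z u (leg1 S \<odot> (b \<odot> u))" unfolding \<Phi>_def using c by metis
    then show ?thesis using p(2) u(1) Cmp_Hom[OF bu lS(2)] by blast
  qed
  ultimately show ?thesis unfolding centralizes_def using P p(1) by blast
qed

text \<open>\<Theta> relates (x, y) to (p(x, y, z), z). The identity p(x, y, y) = x gives
  reflexivity and discreteness, p(y, y, z) = z gives the diagonal pairs, and the Mal'tsev property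
  gives symmetry and transitivity.\<close>

lemma centralizes_transport:
  assumes R: "is_equiv_rel C X R" and S: "is_equiv_rel C X S" and cen: "centralizes C X R S"
  obtains \<Theta> where "transport R S \<Theta>" "discrete R \<Theta>"
proof -
  note Rr = equiv_rel_rel[OF R] and Sr = equiv_rel_rel[OF S]
  note lR = rel_leg[OF Rr] and lS = rel_leg[OF Sr]
  obtain P a b p where P: "is_pullback C (apex R) (apex S) X (leg1 R) (leg0 S) P a b"
    and p: "p \<in> Hom C P X"
    and p0: "\<And>Z u. u \<in> Hom C Z P \<Longrightarrow> leg0 S \<odot> (b \<odot> u) = leg1 S \<odot> (b \<odot> u) \<Longrightarrow> p \<odot> u = leg0 R \<odot> (a \<odot> u)"
    and p1: "\<And>Z u. u \<in> Hom C Z P \<Longrightarrow> leg0 R \<odot> (a \<odot> u) = leg1 R \<odot> (a \<odot> u) \<Longrightarrow> p \<odot> u = leg1 S \<odot> (b \<odot> u)"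
    using cen unfolding centralizes_def by blast
  note h = pullback_Hom[OF P]
  have apR: "apex R \<in> Ob C" using lR Ob_dom by blast
  \<comment> \<open>\<Theta> is built as a composite through the object P of triples: G picks a
    triple u whose R-part is r, and H requires the legs of s to be p u and the last entry of
    u.\<close>
  obtain G where G: "rel (apex R) P G" "\<forall>Z r u. mem G Z r u \<longleftrightarrow> r \<in> Hom C Z (apex R) \<and> u \<in> Hom C Z P \<and>
      Idn C (apex R) \<odot> r = a \<odot> u" using eq_rel[OF Idn_Hom[OF apR] h(3)] .
  have bS: "leg1 S \<odot> b \<in> Hom C P X" using h lS Cmp_Hom by blast
  obtain H0 where H0: "rel P (apex R) H0" "\<forall>Z u r. mem H0 Z u r \<longleftrightarrow> u \<in> Hom C Z P \<and> r \<in> Hom C Z (apex R) \<and>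
      p \<odot> u = leg0 R \<odot> r" using eq_rel[OF p lR(1)] .
  obtain H1 where H1: "rel P (apex R) H1" "\<forall>Z u r. mem H1 Z u r \<longleftrightarrow> u \<in> Hom C Z P \<and> r \<in> Hom C Z (apex R) \<and>
      (leg1 S \<odot> b) \<odot> u = leg1 R \<odot> r" using eq_rel[OF bS lR(2)] .
  obtain H where H: "rel P (apex R) H" "\<forall>Z u r. mem H Z u r \<longleftrightarrow> mem H0 Z u r \<and> mem H1 Z u r"
    using meet_rel[OF H0(1) H1(1)] .
  obtain \<Theta> where \<Theta>: "rel (apex R) (apex R) \<Theta>"
    "\<forall>Z r s. mem \<Theta> Z r s \<longleftrightarrow> r \<in> Hom C Z (apex R) \<and> s \<in> Hom C Z (apex R) \<and>
      (\<exists>Z' e u. is_regular_epi C Z' Z e \<and> mem G Z' (r \<odot> e) u \<and> mem H Z' u (s \<odot> e))"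
    "\<forall>Z r u s. mem G Z r u \<and> mem H Z u s \<longrightarrow> mem \<Theta> Z r s"
    using comp_rel[OF G(1) H(1)] .
  have intro: "mem \<Theta> Z (a \<odot> u) s" if "u \<in> Hom C Z P" "s \<in> Hom C Z (apex R)"
    "p \<odot> u = leg0 R \<odot> s" "leg1 S \<odot> (b \<odot> u) = leg1 R \<odot> s" for Z u s
  proof -
    have "mem H Z u s" using H(2) H0(2) H1(2) that Cmp_assoc[OF that(1) h(4) lS(2)] by simp
    moreover have "mem G Z (a \<odot> u) u" using G(2) that Cmp_Hom[OF that(1) h(3)] Idn_left by simp
    ultimately show ?thesis using \<Theta>(3) by blast
  qed
  have elim: "\<exists>Z' e u. is_regular_epi C Z' Z e \<and> u \<in> Hom C Z' P \<and> r \<odot> e = a \<odot> u \<and> p \<odot> u = leg0 R \<odot> (s \<odot> e) \<and>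
       leg1 S \<odot> (b \<odot> u) = leg1 R \<odot> (s \<odot> e)" if m: "mem \<Theta> Z r s" for Z r s
  proof -
    obtain Z' e u where u: "is_regular_epi C Z' Z e" "mem G Z' (r \<odot> e) u" "mem H Z' u (s \<odot> e)"
      using \<Theta>(2) m by blast
    have uH: "u \<in> Hom C Z' P" using u(2) G(2) by blast
    have "r \<odot> e = a \<odot> u" using u(2) G(2) Idn_left by metis
    moreover have "p \<odot> u = leg0 R \<odot> (s \<odot> e)" using u(3) H(2) H0(2) by blast
    moreover have "leg1 S \<odot> (b \<odot> u) = leg1 R \<odot> (s \<odot> e)"
      using u(3) H(2) H1(2) Cmp_assoc[OF uH h(4) lS(2)] by auto
    ultimately show ?thesis using u(1) uH by blast
  qed
  have "is_equiv_rel C (apex R) \<Theta>"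
  proof (rule reflexive_equiv[OF \<Theta>(1)])
    fix Z r assume r: "r \<in> Hom C Z (apex R)"
    obtain s where s: "s \<in> Hom C Z (apex S)" "leg0 S \<odot> s = leg1 R \<odot> r" "leg1 S \<odot> s = leg1 R \<odot> r"
      using equiv_rel_diagonal[OF S Cmp_Hom[OF r lR(2)]] .
    obtain u where u: "u \<in> Hom C Z P" "a \<odot> u = r" "b \<odot> u = s"
      using pullback_lift[OF P r s(1)] s by metis
    have "p \<odot> u = leg0 R \<odot> r" using p0[OF u(1)] u s by simp
    then show "mem \<Theta> Z r r" using intro[OF u(1) r] u s by simp
  qed
  moreover have "lifts_diagonally R S \<Theta>"
    unfolding lifts_diagonally_def
  proof (intro allI impI, elim conjE)
    fix Z r s assume h: "r \<in> Hom C Z (apex R)" "s \<in> Hom C Z (apex R)" "leg0 R \<odot> r = leg1 R \<odot> r"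
        "leg0 R \<odot> s = leg1 R \<odot> s" "mem S Z (leg1 R \<odot> r) (leg1 R \<odot> s)"
    obtain t where t: "t \<in> Hom C Z (apex S)" "leg0 S \<odot> t = leg1 R \<odot> r" "leg1 S \<odot> t = leg1 R \<odot> s"
      using h(5) by (rule memE)
    obtain u where u: "u \<in> Hom C Z P" "a \<odot> u = r" "b \<odot> u = t"
      using pullback_lift[OF P h(1) t(1)] t by metis
    have "p \<odot> u = leg0 R \<odot> s" using p1[OF u(1)] u t h by simp
    then show "mem \<Theta> Z r s" using intro[OF u(1) h(2)] u t by simp
  qed
  moreover have "mem S Z (leg1 R \<odot> r) (leg1 R \<odot> s)" if m: "mem \<Theta> Z r s" for Z r s
  proof -
    obtain Z' e u where u: "is_regular_epi C Z' Z e" "u \<in> Hom C Z' P" "r \<odot> e = a \<odot> u"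
       "leg1 S \<odot> (b \<odot> u) = leg1 R \<odot> (s \<odot> e)" using elim[OF m] by blast
    note eh = regular_epi_Hom[OF u(1)] and rs = mem_Hom[OF \<Theta>(1) m]
    have "mem S Z' (leg1 R \<odot> (r \<odot> e)) (leg1 R \<odot> (s \<odot> e))"
      using memI[OF Cmp_Hom[OF u(2) h(4)]] pullback_square[OF P u(2)] u(3,4) by simp
    then show ?thesis
      using mem_local[OF Sr u(1) Cmp_Hom[OF rs(1) lR(2)] Cmp_Hom[OF rs(2) lR(2)]]
        Cmp_assoc[OF eh rs(1) lR(2)] Cmp_assoc[OF eh rs(2) lR(2)] by simp
  qed
  moreover have "discrete R \<Theta>"
    unfolding discrete_def
  proof (intro allI impI, elim conjE)
    fix Z r s assume m: "mem \<Theta> Z r s" and eq: "leg1 R \<odot> r = leg1 R \<odot> s"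
    obtain Z' e u where u: "is_regular_epi C Z' Z e" "u \<in> Hom C Z' P" "r \<odot> e = a \<odot> u" "p \<odot> u = leg0 R \<odot> (s \<odot> e)"
       "leg1 S \<odot> (b \<odot> u) = leg1 R \<odot> (s \<odot> e)" using elim[OF m] by blast
    note eh = regular_epi_Hom[OF u(1)] and rs = mem_Hom[OF \<Theta>(1) m]
    have eq': "leg1 R \<odot> (r \<odot> e) = leg1 R \<odot> (s \<odot> e)"
      using eq Cmp_assoc[OF eh rs(1) lR(2)] Cmp_assoc[OF eh rs(2) lR(2)] by simp
    then have "leg0 S \<odot> (b \<odot> u) = leg1 S \<odot> (b \<odot> u)"
      using pullback_square[OF P u(2)] u(3,5) by simp
    then have "leg0 R \<odot> (r \<odot> e) = leg0 R \<odot> (s \<odot> e)" using p0[OF u(2)] u(3,4) by simp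
    then have "r \<odot> e = s \<odot> e"
      using rel_joint_mono[OF Rr Cmp_Hom[OF eh rs(1)] Cmp_Hom[OF eh rs(2)]] eq' by blast
    then show "r = s" using regular_epi_cancel[OF u(1) rs] by blast
  qed
  ultimately show ?thesis using that unfolding transport_def by blast
qed

text \<open>The same p read from the other end: for x R y S z, \<Theta> relates (z, y) to (p(x, y,
  z), x). The roles of the identities are exchanged: p(y, y, z) = z gives reflexivity and
  discreteness, p(x, y, y) = x the diagonal pairs.\<close>

lemma centralizes_transport_swap:
  assumes R: "is_equiv_rel C X R" and S: "is_equiv_rel C X S" and cen: "centralizes C X R S"
  obtains \<Theta> where "transport S R \<Theta>" "discrete S \<Theta>"
proof -
  note Rr = equiv_rel_rel[OF R] and Sr = equiv_rel_rel[OF S]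
  note lR = rel_leg[OF Rr] and lS = rel_leg[OF Sr]
  obtain P a b p where P: "is_pullback C (apex R) (apex S) X (leg1 R) (leg0 S) P a b"
    and p: "p \<in> Hom C P X"
    and p0: "\<And>Z u. u \<in> Hom C Z P \<Longrightarrow> leg0 S \<odot> (b \<odot> u) = leg1 S \<odot> (b \<odot> u) \<Longrightarrow> p \<odot> u = leg0 R \<odot> (a \<odot> u)"
    and p1: "\<And>Z u. u \<in> Hom C Z P \<Longrightarrow> leg0 R \<odot> (a \<odot> u) = leg1 R \<odot> (a \<odot> u) \<Longrightarrow> p \<odot> u = leg1 S \<odot> (b \<odot> u)"
    using cen unfolding centralizes_def by blast
  note h = pullback_Hom[OF P]
  have bS: "leg1 S \<odot> b \<in> Hom C P X" and aR: "leg1 R \<odot> a \<in> Hom C P X" and aR0: "leg0 R \<odot> a \<in> Hom C P X"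
    using h lS lR Cmp_Hom by blast+
  obtain G0 where G0: "rel (apex S) P G0" "\<forall>Z s u. mem G0 Z s u \<longleftrightarrow> s \<in> Hom C Z (apex S) \<and> u \<in> Hom C Z P \<and>
      leg0 S \<odot> s = (leg1 S \<odot> b) \<odot> u" using eq_rel[OF lS(1) bS] .
  obtain G1 where G1: "rel (apex S) P G1" "\<forall>Z s u. mem G1 Z s u \<longleftrightarrow> s \<in> Hom C Z (apex S) \<and> u \<in> Hom C Z P \<and>
      leg1 S \<odot> s = (leg1 R \<odot> a) \<odot> u" using eq_rel[OF lS(2) aR] .
  obtain G where G: "rel (apex S) P G" "\<forall>Z s u. mem G Z s u \<longleftrightarrow> mem G0 Z s u \<and> mem G1 Z s u"
    using meet_rel[OF G0(1) G1(1)] .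
  obtain H0 where H0: "rel P (apex S) H0" "\<forall>Z u t. mem H0 Z u t \<longleftrightarrow> u \<in> Hom C Z P \<and> t \<in> Hom C Z (apex S) \<and>
      p \<odot> u = leg0 S \<odot> t" using eq_rel[OF p lS(1)] .
  obtain H1 where H1: "rel P (apex S) H1" "\<forall>Z u t. mem H1 Z u t \<longleftrightarrow> u \<in> Hom C Z P \<and> t \<in> Hom C Z (apex S) \<and>
      (leg0 R \<odot> a) \<odot> u = leg1 S \<odot> t" using eq_rel[OF aR0 lS(2)] .
  obtain H where H: "rel P (apex S) H" "\<forall>Z u t. mem H Z u t \<longleftrightarrow> mem H0 Z u t \<and> mem H1 Z u t"
    using meet_rel[OF H0(1) H1(1)] .
  obtain \<Theta> where \<Theta>: "rel (apex S) (apex S) \<Theta>"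
    "\<forall>Z s t. mem \<Theta> Z s t \<longleftrightarrow> s \<in> Hom C Z (apex S) \<and> t \<in> Hom C Z (apex S) \<and>
      (\<exists>Z' e u. is_regular_epi C Z' Z e \<and> mem G Z' (s \<odot> e) u \<and> mem H Z' u (t \<odot> e))"
    "\<forall>Z s u t. mem G Z s u \<and> mem H Z u t \<longrightarrow> mem \<Theta> Z s t"
    using comp_rel[OF G(1) H(1)] .
  have memG: "mem G Z s u \<longleftrightarrow> s \<in> Hom C Z (apex S) \<and> u \<in> Hom C Z P \<and>
      leg0 S \<odot> s = leg1 S \<odot> (b \<odot> u) \<and> leg1 S \<odot> s = leg1 R \<odot> (a \<odot> u)" for Z s u
    using G(2) G0(2) G1(2) Cmp_assoc[OF _ h(4) lS(2)] Cmp_assoc[OF _ h(3) lR(2)] by (metis (no_types, lifting))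
  have memH: "mem H Z u t \<longleftrightarrow> u \<in> Hom C Z P \<and> t \<in> Hom C Z (apex S) \<and>
      p \<odot> u = leg0 S \<odot> t \<and> leg0 R \<odot> (a \<odot> u) = leg1 S \<odot> t" for Z u t
    using H(2) H0(2) H1(2) Cmp_assoc[OF _ h(3) lR(1)] by (metis (no_types, lifting))
  have "is_equiv_rel C (apex S) \<Theta>"
  proof (rule reflexive_equiv[OF \<Theta>(1)])
    fix Z s assume s: "s \<in> Hom C Z (apex S)"
    have "mem S Z (leg1 S \<odot> s) (leg0 S \<odot> s)" using equiv_rel_sym[OF S memI[OF s]] .
    then obtain s' where s': "s' \<in> Hom C Z (apex S)" "leg0 S \<odot> s' = leg1 S \<odot> s" "leg1 S \<odot> s' = leg0 S \<odot> s"
      by (rule memE)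
    obtain r where r: "r \<in> Hom C Z (apex R)" "leg0 R \<odot> r = leg1 S \<odot> s" "leg1 R \<odot> r = leg1 S \<odot> s"
      using equiv_rel_diagonal[OF R Cmp_Hom[OF s lS(2)]] .
    obtain u where u: "u \<in> Hom C Z P" "a \<odot> u = r" "b \<odot> u = s'"
      using pullback_lift[OF P r(1) s'(1)] s' r by metis
    have "p \<odot> u = leg0 S \<odot> s" using p1[OF u(1)] u s' r by simp
    then have "mem G Z s u" "mem H Z u s" unfolding memG memH using u r s' s by simp_all
    then show "mem \<Theta> Z s s" using \<Theta>(3) by blast
  qed
  moreover have "lifts_diagonally S R \<Theta>"
    unfolding lifts_diagonally_def
  proof (intro allI impI, elim conjE)
    fix Z s t assume h: "s \<in> Hom C Z (apex S)" "t \<in> Hom C Z (apex S)" "leg0 S \<odot> s = leg1 S \<odot> s"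
        "leg0 S \<odot> t = leg1 S \<odot> t" "mem R Z (leg1 S \<odot> s) (leg1 S \<odot> t)"
    obtain r where r: "r \<in> Hom C Z (apex R)" "leg0 R \<odot> r = leg1 S \<odot> t" "leg1 R \<odot> r = leg1 S \<odot> s"
      using equiv_rel_sym[OF R h(5)] by (rule memE)
    obtain u where u: "u \<in> Hom C Z P" "a \<odot> u = r" "b \<odot> u = s"
      using pullback_lift[OF P r(1) h(1)] r h by metis
    have "p \<odot> u = leg0 S \<odot> t" using p0[OF u(1)] u r h by simp
    then have "mem G Z s u" "mem H Z u t" unfolding memG memH using u r h by simp_all
    then show "mem \<Theta> Z s t" using \<Theta>(3) by blast
  qed
  moreover have "mem R Z (leg1 S \<odot> s) (leg1 S \<odot> t)" if m: "mem \<Theta> Z s t" for Z s t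
  proof -
    obtain Z' e u where u: "is_regular_epi C Z' Z e" "mem G Z' (s \<odot> e) u" "mem H Z' u (t \<odot> e)"
      using \<Theta>(2) m by blast
    note eh = regular_epi_Hom[OF u(1)] and st = mem_Hom[OF \<Theta>(1) m]
    have uH: "u \<in> Hom C Z' P" using u memG by blast
    have "mem R Z' (leg1 S \<odot> (t \<odot> e)) (leg1 S \<odot> (s \<odot> e))"
      using memI[OF Cmp_Hom[OF uH h(3)]] u(2,3) unfolding memG memH by simp
    from equiv_rel_sym[OF R this] show ?thesis
      using mem_local[OF Rr u(1) Cmp_Hom[OF st(1) lS(2)] Cmp_Hom[OF st(2) lS(2)]]
        Cmp_assoc[OF eh st(1) lS(2)] Cmp_assoc[OF eh st(2) lS(2)] by simp
  qed
  moreover have "discrete S \<Theta>"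
    unfolding discrete_def
  proof (intro allI impI, elim conjE)
    fix Z s t assume m: "mem \<Theta> Z s t" and eq: "leg1 S \<odot> s = leg1 S \<odot> t"
    obtain Z' e u where u: "is_regular_epi C Z' Z e" "mem G Z' (s \<odot> e) u" "mem H Z' u (t \<odot> e)"
      using \<Theta>(2) m by blast
    note eh = regular_epi_Hom[OF u(1)] and st = mem_Hom[OF \<Theta>(1) m]
    have uH: "u \<in> Hom C Z' P" using u memG by blast
    have eq': "leg1 S \<odot> (s \<odot> e) = leg1 S \<odot> (t \<odot> e)"
      using eq Cmp_assoc[OF eh st(1) lS(2)] Cmp_assoc[OF eh st(2) lS(2)] by simp
    then have "leg0 R \<odot> (a \<odot> u) = leg1 R \<odot> (a \<odot> u)" using u(2,3) unfolding memG memH by simp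
    then have "leg0 S \<odot> (s \<odot> e) = leg0 S \<odot> (t \<odot> e)" using p1[OF uH] u(2,3) unfolding memG memH by simp
    then have "s \<odot> e = t \<odot> e"
      using rel_joint_mono[OF Sr Cmp_Hom[OF eh st(1)] Cmp_Hom[OF eh st(2)]] eq' by blast
    then show "s = t" using regular_epi_cancel[OF u(1) st] by blast
  qed
  ultimately show ?thesis using that unfolding transport_def by blast
qed

text \<open>With d the diagonal of R, every diagonal pair is a reindexing of the single pair (d
  \<open>leg0 S\<close>, d \<open>leg1 S\<close>), which generates \<Delta>. End points of
  \<Delta>-related elements stay S-related because the inverse image of S along
  \<open>leg1 R\<close> competes with \<Delta>.\<close>

lemma least_transport:
  assumes R: "is_equiv_rel C X R" and S: "is_equiv_rel C X S"
  obtains \<Delta> where "transport R S \<Delta>"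
    "\<forall>\<Xi> Z r s. is_equiv_rel C (apex R) \<Xi> \<and> lifts_diagonally R S \<Xi> \<and> mem \<Delta> Z r s \<longrightarrow> mem \<Xi> Z r s"
proof -
  note Rr = equiv_rel_rel[OF R] and Sr = equiv_rel_rel[OF S]
  note lR = rel_leg[OF Rr] and lS = rel_leg[OF Sr]
  have X: "X \<in> Ob C" using lR Ob_cod by blast
  obtain d where d: "d \<in> Hom C X (apex R)" "leg0 R \<odot> d = Idn C X" "leg1 R \<odot> d = Idn C X"
    using equiv_rel_diagonal[OF R Idn_Hom[OF X]] .
  have dx: "leg0 R \<odot> (d \<odot> x) = x" "leg1 R \<odot> (d \<odot> x) = x" if "x \<in> Hom C Z X" for Z x
    using Cmp_reassoc[OF d(1) lR(1) d(2) that] Cmp_reassoc[OF d(1) lR(2) d(3) that] Idn_left[OF that] by simp_all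
  define u v where uv: "u = d \<odot> leg0 S" "v = d \<odot> leg1 S"
  have uvH: "u \<in> Hom C (apex S) (apex R)" "v \<in> Hom C (apex S) (apex R)" using uv d lS Cmp_Hom by blast+
  obtain \<Delta> where \<Delta>: "is_equiv_rel C (apex R) \<Delta>" "mem \<Delta> (apex S) u v"
    "\<forall>K Z a b. is_equiv_rel C (apex R) K \<and> mem K (apex S) u v \<and> mem \<Delta> Z a b \<longrightarrow> mem K Z a b"
    using equiv_closure[OF uvH] .
  have lift: "lifts_diagonally R S \<Delta>"
    unfolding lifts_diagonally_def
  proof (intro allI impI, elim conjE)
    fix Z r s assume h: "r \<in> Hom C Z (apex R)" "s \<in> Hom C Z (apex R)" "leg0 R \<odot> r = leg1 R \<odot> r"
        "leg0 R \<odot> s = leg1 R \<odot> s" "mem S Z (leg1 R \<odot> r) (leg1 R \<odot> s)"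
    obtain w where w: "w \<in> Hom C Z (apex S)" "leg0 S \<odot> w = leg1 R \<odot> r" "leg1 S \<odot> w = leg1 R \<odot> s"
      using h(5) by (rule memE)
    have "u \<odot> w = d \<odot> (leg1 R \<odot> r)" "v \<odot> w = d \<odot> (leg1 R \<odot> s)"
      using w uv Cmp_assoc[OF w(1) lS(1) d(1)] Cmp_assoc[OF w(1) lS(2) d(1)] by simp_all
    moreover have "d \<odot> (leg1 R \<odot> r) = r"
      using rel_joint_mono[OF Rr Cmp_Hom[OF Cmp_Hom[OF h(1) lR(2)] d(1)] h(1)] dx[OF Cmp_Hom[OF h(1) lR(2)]] h by simp
    moreover have "d \<odot> (leg1 R \<odot> s) = s"
      using rel_joint_mono[OF Rr Cmp_Hom[OF Cmp_Hom[OF h(2) lR(2)] d(1)] h(2)] dx[OF Cmp_Hom[OF h(2) lR(2)]] h by simp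
    ultimately show "mem \<Delta> Z r s" using mem_reindex[OF equiv_rel_rel[OF \<Delta>(1)] \<Delta>(2) w(1)] by simp
  qed
  have min: "mem \<Xi> Z r s" if \<Xi>: "is_equiv_rel C (apex R) \<Xi>" "lifts_diagonally R S \<Xi>" and m: "mem \<Delta> Z r s" for \<Xi> Z r s
  proof -
    have "mem \<Xi> (apex S) u v"
      using lifts_diagonallyD[OF \<Xi>(2) uvH] dx[OF lS(1)] dx[OF lS(2)] mem_generic[OF Sr] uv by simp
    then show ?thesis using \<Delta>(3) \<Xi> m by blast
  qed
  obtain \<Xi> where \<Xi>: "is_equiv_rel C (apex R) \<Xi>" "\<forall>Z a b. mem \<Xi> Z a b \<longleftrightarrow> a \<in> Hom C Z (apex R) \<and> b \<in> Hom C Z (apex R) \<and>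
      mem S Z (leg1 R \<odot> a) (leg1 R \<odot> b)" using equiv_rel_inverse[OF S lR(2)] .
  have "lifts_diagonally R S \<Xi>" unfolding lifts_diagonally_def using \<Xi>(2) by blast
  then have "mem S Z (leg1 R \<odot> r) (leg1 R \<odot> s)" if "mem \<Delta> Z r s" for Z r s
    using min[OF \<Xi>(1) _ that] \<Xi>(2) by blast
  then have "transport R S \<Delta>" unfolding transport_def using \<Delta>(1) lift by blast
  then show ?thesis using that min by blast
qed

text \<open>The inverse image of the discrete \<Theta> along the map from R to R' induced by f
  contains the diagonal pairs, hence contains \<Delta>. Whatever \<Delta> leaves ambiguous is
  therefore sent to equal elements.\<close>

lemma least_transport_kill:
  assumes R: "is_equiv_rel C X R"
    and least: "\<forall>\<Xi> Z r s. is_equiv_rel C (apex R) \<Xi> \<and> lifts_diagonally R S \<Xi> \<and> mem \<Delta> Z r s \<longrightarrow> mem \<Xi> Z r s"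
    and f: "f \<in> Hom C X Y" and R': "is_equiv_rel C Y R'"
    and fR: "\<And>Z x y. mem R Z x y \<Longrightarrow> mem R' Z (f \<odot> x) (f \<odot> y)"
    and fS: "\<And>Z x y. mem S Z x y \<Longrightarrow> mem S' Z (f \<odot> x) (f \<odot> y)"
    and \<Theta>: "transport R' S' \<Theta>" "discrete R' \<Theta>"
    and m: "mem \<Delta> Z a b" "leg1 R \<odot> a = leg1 R \<odot> b" and ab: "a \<in> Hom C Z (apex R)" "b \<in> Hom C Z (apex R)"
  shows "f \<odot> (leg0 R \<odot> a) = f \<odot> (leg0 R \<odot> b)"
proof -
  note Rr = equiv_rel_rel[OF R] and R'r = equiv_rel_rel[OF R']
  obtain \<rho> where \<rho>: "\<rho> \<in> Hom C (apex R) (apex R')"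
    "\<forall>Z r. r \<in> Hom C Z (apex R) \<longrightarrow> leg0 R' \<odot> (\<rho> \<odot> r) = f \<odot> (leg0 R \<odot> r) \<and> leg1 R' \<odot> (\<rho> \<odot> r) = f \<odot> (leg1 R \<odot> r)"
    using image_arrow[OF Rr f R'r fR] .
  obtain \<Xi> where \<Xi>: "is_equiv_rel C (apex R) \<Xi>" "\<forall>Z a b. mem \<Xi> Z a b \<longleftrightarrow> a \<in> Hom C Z (apex R) \<and> b \<in> Hom C Z (apex R) \<and>
      mem \<Theta> Z (\<rho> \<odot> a) (\<rho> \<odot> b)" using equiv_rel_inverse[OF transportD(1)[OF \<Theta>(1)] \<rho>(1)] .
  have "lifts_diagonally R S \<Xi>"
    unfolding lifts_diagonally_def
  proof (intro allI impI, elim conjE)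
    fix Z r s assume h: "r \<in> Hom C Z (apex R)" "s \<in> Hom C Z (apex R)" "leg0 R \<odot> r = leg1 R \<odot> r"
        "leg0 R \<odot> s = leg1 R \<odot> s" "mem S Z (leg1 R \<odot> r) (leg1 R \<odot> s)"
    then have "mem \<Theta> Z (\<rho> \<odot> r) (\<rho> \<odot> s)"
      using lifts_diagonallyD[OF transportD(2)[OF \<Theta>(1)] Cmp_Hom[OF h(1) \<rho>(1)] Cmp_Hom[OF h(2) \<rho>(1)]] \<rho>(2) fS by simp
    then show "mem \<Xi> Z r s" using \<Xi>(2) h by blast
  qed
  then have "mem \<Xi> Z a b" using least \<Xi>(1) m(1) by blast
  then have "mem \<Theta> Z (\<rho> \<odot> a) (\<rho> \<odot> b)" using \<Xi>(2) by blast
  then have "\<rho> \<odot> a = \<rho> \<odot> b" using discreteD[OF \<Theta>(2)] \<rho>(2) ab m(2) by simp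
  then show ?thesis using \<rho>(2) ab by metis
qed

text \<open>The pairs (x, w) are collected as a direct image along \<open>leg0 R\<close>, a split
  epimorphism, so K is an equivalence relation at once. Minimality is recorded against arbitrary
  relations M, which provides the upper bounds used later.\<close>

lemma commutator_exists:
  assumes R: "is_equiv_rel C X R" and S: "is_equiv_rel C X S"
    and \<Delta>: "transport R S \<Delta>"
    and least: "\<forall>\<Xi> Z r s. is_equiv_rel C (apex R) \<Xi> \<and> lifts_diagonally R S \<Xi> \<and> mem \<Delta> Z r s \<longrightarrow> mem \<Xi> Z r s"
  obtains K where "is_commutator C X R S K"
    "\<forall>Z a b. mem \<Delta> Z a b \<and> leg1 R \<odot> a = leg1 R \<odot> b \<longrightarrow> mem K Z (leg0 R \<odot> a) (leg0 R \<odot> b)"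
    "\<forall>M. rel X X M \<and> (\<forall>Z a b. mem \<Delta> Z a b \<and> leg1 R \<odot> a = leg1 R \<odot> b \<longrightarrow> mem M Z (leg0 R \<odot> a) (leg0 R \<odot> b)) \<longrightarrow>
       (\<forall>Z x y. mem K Z x y \<longrightarrow> mem M Z x y)"
proof -
  note Rr = equiv_rel_rel[OF R] and Sr = equiv_rel_rel[OF S]
  note lR = rel_leg[OF Rr] and lS = rel_leg[OF Sr]
  note \<Delta>eq = transportD(1)[OF \<Delta>]
  note \<Delta>r = equiv_rel_rel[OF \<Delta>eq]
  have X: "X \<in> Ob C" using lR Ob_cod by blast
  obtain E0 where E0: "is_equiv_rel C (apex R) E0" "\<forall>Z a b. mem E0 Z a b \<longleftrightarrow> a \<in> Hom C Z (apex R) \<and> b \<in> Hom C Z (apex R) \<and>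
      leg1 R \<odot> a = leg1 R \<odot> b" using equiv_rel_kernel[OF lR(2)] .
  obtain E where E: "is_equiv_rel C (apex R) E" "\<forall>Z a b. mem E Z a b \<longleftrightarrow> mem \<Delta> Z a b \<and> mem E0 Z a b"
    using equiv_rel_meet[OF \<Delta>eq E0(1)] .
  have memE': "mem E Z a b \<longleftrightarrow> mem \<Delta> Z a b \<and> leg1 R \<odot> a = leg1 R \<odot> b" for Z a b
    using E(2) E0(2) mem_Hom[OF \<Delta>r] by blast
  obtain d where d: "d \<in> Hom C X (apex R)" "leg0 R \<odot> d = Idn C X" "leg1 R \<odot> d = Idn C X"
    using equiv_rel_diagonal[OF R Idn_Hom[OF X]] .
  have l0: "is_regular_epi C (apex R) X (leg0 R)"
    using regular_epi_if_lift[OF lR(1) regular_epi_Idn[OF X] d(1,2)] .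
  define K where "K = dir_image C X (leg0 R) E"
  have im: "image_of X (leg0 R) E K"
    unfolding K_def using dir_image_image_of[OF equiv_rel_rel[OF E(1)] lR(1)] .
  have Keq: "is_equiv_rel C X K" using equiv_rel_image[OF l0 E(1) im] .
  have K\<Delta>: "mem K Z (leg0 R \<odot> a) (leg0 R \<odot> b)" if "mem \<Delta> Z a b" "leg1 R \<odot> a = leg1 R \<odot> b" for Z a b
    using image_ofI[OF equiv_rel_rel[OF E(1)] lR(1) im] memE' that by blast
  have Kmin: "mem M Z x y" if M: "rel X X M" "\<And>Z a b. mem \<Delta> Z a b \<Longrightarrow> leg1 R \<odot> a = leg1 R \<odot> b \<Longrightarrow> mem M Z (leg0 R \<odot> a) (leg0 R \<odot> b)"
    and m: "mem K Z x y" for M Z x y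
  proof -
    obtain Z' e a b where e: "is_regular_epi C Z' Z e" "mem E Z' a b" "leg0 R \<odot> a = x \<odot> e" "leg0 R \<odot> b = y \<odot> e"
      using image_ofE[OF im m] .
    then have "mem M Z' (x \<odot> e) (y \<odot> e)" using M(2) memE' by metis
    then show ?thesis using mem_local[OF M(1) e(1)] mem_Hom[OF equiv_rel_rel[OF Keq] m] by blast
  qed
  \<comment> \<open>Passing to the quotient by L makes the images centralize iff L contains the
    ambiguity of \<Delta>. For one direction \<Delta> is compared with the discrete transport on the
    quotient, for the other it is pushed down to the quotient.\<close>
  have qc: "quot_centralizes C X R S L \<longleftrightarrow> rel_le C K L" if L: "is_equiv_rel C X L" for L
  proof -
    obtain Q q where Q: "quot C X L = (Q, q)" by (cases "quot C X L")
    note Qr = equiv_rel_quot(1)[OF L Q] and Qm = equiv_rel_quot(2)[OF L Q]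
    note qh = regular_epi_Hom[OF Qr]
    define R' S' where RS': "R' = dir_image C Q q R" "S' = dir_image C Q q S"
    note iR = dir_image_image_of[OF Rr qh, folded RS'] and iS = dir_image_image_of[OF Sr qh, folded RS']
    note R'eq = equiv_rel_image[OF Qr R iR] and S'eq = equiv_rel_image[OF Qr S iS]
    have u: "quot_centralizes C X R S L \<longleftrightarrow> centralizes C Q R' S'"
      unfolding quot_centralizes_def Q RS' by simp
    show ?thesis unfolding u rel_le_iff[OF equiv_rel_rel[OF Keq] equiv_rel_rel[OF L]]
    proof
      assume c: "centralizes C Q R' S'"
      obtain \<Theta> where \<Theta>: "transport R' S' \<Theta>" "discrete R' \<Theta>" using centralizes_transport[OF R'eq S'eq c] .
      have "mem L Z (leg0 R \<odot> a) (leg0 R \<odot> b)" if m: "mem \<Delta> Z a b" "leg1 R \<odot> a = leg1 R \<odot> b" for Z a b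
      proof -
        note ab = mem_Hom[OF \<Delta>r m(1)]
        have "q \<odot> (leg0 R \<odot> a) = q \<odot> (leg0 R \<odot> b)"
          using least_transport_kill[OF R least qh R'eq image_ofI[OF Rr qh iR] image_ofI[OF Sr qh iS] \<Theta> m ab] .
        then show ?thesis using Qm[OF Cmp_Hom[OF ab(1) lR(1)] Cmp_Hom[OF ab(2) lR(1)]] by blast
      qed
      then show "\<forall>Z a b. mem K Z a b \<longrightarrow> mem L Z a b" using Kmin[OF equiv_rel_rel[OF L]] by blast
    next
      assume le: "\<forall>Z a b. mem K Z a b \<longrightarrow> mem L Z a b"
      have disc: "q \<odot> (leg0 R \<odot> a) = q \<odot> (leg0 R \<odot> b)" if m: "mem \<Delta> Z a b" "leg1 R \<odot> a = leg1 R \<odot> b" for Z a b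
      proof -
        note ab = mem_Hom[OF \<Delta>r m(1)]
        show ?thesis using Qm[OF Cmp_Hom[OF ab(1) lR(1)] Cmp_Hom[OF ab(2) lR(1)]] K\<Delta>[OF m] le by blast
      qed
      obtain \<Delta>' where "transport R' S' \<Delta>'" "discrete R' \<Delta>'"
        using transport_image[OF Qr R S iR iS \<Delta> disc] .
      then show "centralizes C Q R' S'" using transport_centralizes[OF R'eq S'eq] by blast
    qed
  qed
  have "rel_le C K K" unfolding rel_le_iff[OF equiv_rel_rel[OF Keq] equiv_rel_rel[OF Keq]] by blast
  then have "is_commutator C X R S K"
    unfolding is_commutator_def using qc Keq by blast
  then show ?thesis by (rule that) (use K\<Delta> Kmin in blast)+
qed

text \<open>Commutators are determined up to \<open>rel_eq\<close>; this links a constructed one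
  with the chosen representative.\<close>

lemma commutator_mem_eq:
  assumes K: "is_commutator C X R S K"
  shows "is_commutator C X R S (commutator C X R S)" "mem (commutator C X R S) Z x y \<longleftrightarrow> mem K Z x y"
proof -
  show c: "is_commutator C X R S (commutator C X R S)"
    unfolding commutator_def using K by (rule someI)
  have "rel_le C K (commutator C X R S)" "rel_le C (commutator C X R S) K"
    using c K unfolding is_commutator_def by blast+
  moreover have "rel X X K" "rel X X (commutator C X R S)"
    using c K equiv_rel_rel unfolding is_commutator_def by blast+
  ultimately show "mem (commutator C X R S) Z x y \<longleftrightarrow> mem K Z x y" using rel_le_iff by blast
qed

lemma commutator_equiv:
  assumes R: "is_equiv_rel C X R" and S: "is_equiv_rel C X S"
  shows "is_equiv_rel C X (commutator C X R S)"
proof -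
  obtain \<Delta> where \<Delta>: "transport R S \<Delta>"
    "\<forall>\<Xi> Z r s. is_equiv_rel C (apex R) \<Xi> \<and> lifts_diagonally R S \<Xi> \<and> mem \<Delta> Z r s \<longrightarrow> mem \<Xi> Z r s"
    using least_transport[OF R S] .
  obtain K where "is_commutator C X R S K" by (rule commutator_exists[OF R S \<Delta>])
  then show ?thesis using commutator_mem_eq(1) unfolding is_commutator_def by blast
qed

lemma commutator_transport:
  assumes R: "is_equiv_rel C X R" and S: "is_equiv_rel C X S"
  obtains \<Delta> where "transport R S \<Delta>"
    "\<forall>Z a b. mem \<Delta> Z a b \<and> leg1 R \<odot> a = leg1 R \<odot> b \<longrightarrow> mem (commutator C X R S) Z (leg0 R \<odot> a) (leg0 R \<odot> b)"
proof -
  obtain \<Delta> where \<Delta>: "transport R S \<Delta>"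
    "\<forall>\<Xi> Z r s. is_equiv_rel C (apex R) \<Xi> \<and> lifts_diagonally R S \<Xi> \<and> mem \<Delta> Z r s \<longrightarrow> mem \<Xi> Z r s"
    using least_transport[OF R S] .
  obtain K where K: "is_commutator C X R S K"
    "\<forall>Z a b. mem \<Delta> Z a b \<and> leg1 R \<odot> a = leg1 R \<odot> b \<longrightarrow> mem K Z (leg0 R \<odot> a) (leg0 R \<odot> b)"
    by (rule commutator_exists[OF R S \<Delta>])
  then show ?thesis using that[OF \<Delta>(1)] commutator_mem_eq(2)[OF K(1)] by blast
qed

text \<open>The method for bounding commutators: an equivalence relation with the diagonal pairs
  contains the least one, so its own ambiguity dominates [R, S].\<close>

lemma commutator_le:
  assumes R: "is_equiv_rel C X R" and S: "is_equiv_rel C X S"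
    and \<Xi>: "is_equiv_rel C (apex R) \<Xi>" "lifts_diagonally R S \<Xi>" and M: "rel X X M"
    and le: "\<And>Z a b. mem \<Xi> Z a b \<Longrightarrow> leg1 R \<odot> a = leg1 R \<odot> b \<Longrightarrow> mem M Z (leg0 R \<odot> a) (leg0 R \<odot> b)"
    and m: "mem (commutator C X R S) Z x y"
  shows "mem M Z x y"
proof -
  obtain \<Delta> where \<Delta>: "transport R S \<Delta>"
    "\<forall>\<Xi> Z r s. is_equiv_rel C (apex R) \<Xi> \<and> lifts_diagonally R S \<Xi> \<and> mem \<Delta> Z r s \<longrightarrow> mem \<Xi> Z r s"
    using least_transport[OF R S] .
  obtain K where K: "is_commutator C X R S K"
    "\<forall>M. rel X X M \<and> (\<forall>Z a b. mem \<Delta> Z a b \<and> leg1 R \<odot> a = leg1 R \<odot> b \<longrightarrow> mem M Z (leg0 R \<odot> a) (leg0 R \<odot> b)) \<longrightarrow>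
       (\<forall>Z x y. mem K Z x y \<longrightarrow> mem M Z x y)"
    by (rule commutator_exists[OF R S \<Delta>])
  have "\<forall>Z a b. mem \<Delta> Z a b \<and> leg1 R \<odot> a = leg1 R \<odot> b \<longrightarrow> mem M Z (leg0 R \<odot> a) (leg0 R \<odot> b)"
    using \<Delta>(2) \<Xi> le by blast
  then show ?thesis using K(2) M m commutator_mem_eq(2)[OF K(1)] by blast
qed

text \<open>The universal property behind the reflector, for an arbitrary f respecting the relations
  rather than only for quotient maps.\<close>

lemma commutator_kill:
  assumes R: "is_equiv_rel C X R" and S: "is_equiv_rel C X S"
    and f: "f \<in> Hom C X Y" and R': "is_equiv_rel C Y R'" and S': "is_equiv_rel C Y S'"
    and fR: "\<And>Z x y. mem R Z x y \<Longrightarrow> mem R' Z (f \<odot> x) (f \<odot> y)"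
    and fS: "\<And>Z x y. mem S Z x y \<Longrightarrow> mem S' Z (f \<odot> x) (f \<odot> y)"
    and cen: "centralizes C Y R' S'" and m: "mem (commutator C X R S) Z x y"
  shows "f \<odot> x = f \<odot> y"
proof -
  note Rr = equiv_rel_rel[OF R]
  note lR = rel_leg[OF Rr]
  obtain \<Delta> where \<Delta>: "transport R S \<Delta>"
    "\<forall>\<Xi> Z r s. is_equiv_rel C (apex R) \<Xi> \<and> lifts_diagonally R S \<Xi> \<and> mem \<Delta> Z r s \<longrightarrow> mem \<Xi> Z r s"
    using least_transport[OF R S] .
  obtain L where L: "is_equiv_rel C X L" "\<forall>Z a b. mem L Z a b \<longleftrightarrow> a \<in> Hom C Z X \<and> b \<in> Hom C Z X \<and> f \<odot> a = f \<odot> b"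
    using equiv_rel_kernel[OF f] .
  obtain \<Theta> where \<Theta>: "transport R' S' \<Theta>" "discrete R' \<Theta>" using centralizes_transport[OF R' S' cen] .
  have "mem L Z (leg0 R \<odot> a) (leg0 R \<odot> b)" if m: "mem \<Delta> Z a b" "leg1 R \<odot> a = leg1 R \<odot> b" for Z a b
  proof -
    note ab = mem_Hom[OF equiv_rel_rel[OF transportD(1)[OF \<Delta>(1)]] m(1)]
    have "f \<odot> (leg0 R \<odot> a) = f \<odot> (leg0 R \<odot> b)"
      using least_transport_kill[OF R \<Delta>(2) f R' fR fS \<Theta> m ab] .
    then show ?thesis using L(2) Cmp_Hom[OF ab(1) lR(1)] Cmp_Hom[OF ab(2) lR(1)] by blast
  qed
  note \<Delta>L = this
  have "mem L Z x y"
    using commutator_le[OF R S transportD(1,2)[OF \<Delta>(1)] equiv_rel_rel[OF L(1)] \<Delta>L m] by blast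
  then show ?thesis using L(2) by blast
qed

text \<open>As q kills the commutator, a transport with ambiguity inside [R, S] is discrete modulo
  q, and its image is a discrete transport.\<close>

lemma image_centralizes:
  assumes R: "is_equiv_rel C X R" and S: "is_equiv_rel C X S" and q: "is_regular_epi C X Q q"
    and R': "image_of Q q R R'" and S': "image_of Q q S S'"
    and kill: "\<And>Z x y. mem (commutator C X R S) Z x y \<Longrightarrow> q \<odot> x = q \<odot> y"
  shows "centralizes C Q R' S'"
proof -
  obtain \<Delta> where \<Delta>: "transport R S \<Delta>"
    "\<forall>Z a b. mem \<Delta> Z a b \<and> leg1 R \<odot> a = leg1 R \<odot> b \<longrightarrow> mem (commutator C X R S) Z (leg0 R \<odot> a) (leg0 R \<odot> b)"
    using commutator_transport[OF R S] .
  obtain \<Delta>' where "transport R' S' \<Delta>'" "discrete R' \<Delta>'"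
    using transport_image[OF q R S R' S' \<Delta>(1)] kill \<Delta>(2) by blast
  then show ?thesis
    using transport_centralizes[OF equiv_rel_image[OF q R R'] equiv_rel_image[OF q S S']] by blast
qed

text \<open>The form of symmetry needed for central extensions. In the quotient by [R, S] the arrow
  p gives a discrete transport on the image of S along the image of R; comparing the least transport
  on S with it places the ambiguity inside [R, S].\<close>

lemma commutator_transport_swap:
  assumes R: "is_equiv_rel C X R" and S: "is_equiv_rel C X S"
  obtains \<Delta> where "transport S R \<Delta>"
    "\<forall>Z a b. mem \<Delta> Z a b \<and> leg1 S \<odot> a = leg1 S \<odot> b \<longrightarrow> mem (commutator C X R S) Z (leg0 S \<odot> a) (leg0 S \<odot> b)"
proof -
  note Rr = equiv_rel_rel[OF R] and Sr = equiv_rel_rel[OF S]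
  note lS = rel_leg[OF Sr]
  note Keq = commutator_equiv[OF R S]
  obtain \<Delta> where \<Delta>: "transport S R \<Delta>"
    "\<forall>\<Xi> Z r s. is_equiv_rel C (apex S) \<Xi> \<and> lifts_diagonally S R \<Xi> \<and> mem \<Delta> Z r s \<longrightarrow> mem \<Xi> Z r s"
    using least_transport[OF S R] .
  obtain Q q where Q: "quot C X (commutator C X R S) = (Q, q)" by (cases "quot C X (commutator C X R S)")
  note Qr = equiv_rel_quot(1)[OF Keq Q] and Qm = equiv_rel_quot(2)[OF Keq Q]
  note qh = regular_epi_Hom[OF Qr]
  note iR = dir_image_image_of[OF Rr qh] and iS = dir_image_image_of[OF Sr qh]
  note R'eq = equiv_rel_image[OF Qr R iR] and S'eq = equiv_rel_image[OF Qr S iS]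
  have "q \<odot> x = q \<odot> y" if "mem (commutator C X R S) Z x y" for Z x y
    using Qm mem_Hom[OF equiv_rel_rel[OF Keq] that] that by blast
  then have "centralizes C Q (dir_image C Q q R) (dir_image C Q q S)"
    using image_centralizes[OF R S Qr iR iS] by blast
  then obtain \<Theta> where \<Theta>: "transport (dir_image C Q q S) (dir_image C Q q R) \<Theta>" "discrete (dir_image C Q q S) \<Theta>"
    using centralizes_transport_swap[OF R'eq S'eq] by blast
  have "mem (commutator C X R S) Z (leg0 S \<odot> a) (leg0 S \<odot> b)" if m: "mem \<Delta> Z a b" "leg1 S \<odot> a = leg1 S \<odot> b" for Z a b
  proof -
    note ab = mem_Hom[OF equiv_rel_rel[OF transportD(1)[OF \<Delta>(1)]] m(1)]
    have "q \<odot> (leg0 S \<odot> a) = q \<odot> (leg0 S \<odot> b)"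
      using least_transport_kill[OF S \<Delta>(2) qh S'eq image_ofI[OF Sr qh iS] image_ofI[OF Rr qh iR] \<Theta> m ab] .
    then show ?thesis using Qm[OF Cmp_Hom[OF ab(1) lS(1)] Cmp_Hom[OF ab(2) lS(1)]] by blast
  qed
  then show ?thesis using that \<Delta>(1) by blast
qed

end

section \<open>Pairs of equivalence relations and fibrations\<close>


context category
begin

lemma is_pullback_swap:
  "is_pullback C A B D f g P p q \<Longrightarrow> is_pullback C B A D g f P q p"
  unfolding is_pullback_def by metis

section \<open>The category of pairs of equivalence relations and its pullbacks\<close>

lemma two_eq_obs_iff: "(X, R, S) \<in> two_eq_obs C \<longleftrightarrow> is_equiv_rel C X R \<and> is_equiv_rel C X S"
  unfolding two_eq_obs_def using rel_leg(1)[OF equiv_rel_rel] Ob_cod by blast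

lemma TwoEq_simps [simp]: "Ob (TwoEq C) = two_eq_obs C" "Cmp (TwoEq C) = Cmp C" "Idn (TwoEq C) (X, R, S) = Idn C X"
  unfolding TwoEq_def by auto

lemma TwoEq_Hom: "f \<in> Hom (TwoEq C) (X, R, S) (X', R', S') \<longleftrightarrow> f \<in> Hom C X X' \<and>
   is_equiv_rel C X R \<and> is_equiv_rel C X S \<and> is_equiv_rel C X' R' \<and> is_equiv_rel C X' S' \<and>
   (\<forall>Z a b. mem R Z a b \<longrightarrow> mem R' Z (f \<odot> a) (f \<odot> b)) \<and>
   (\<forall>Z a b. mem S Z a b \<longrightarrow> mem S' Z (f \<odot> a) (f \<odot> b))"
proof (cases "f \<in> Hom C X X' \<and> is_equiv_rel C X R \<and> is_equiv_rel C X S \<and> is_equiv_rel C X' R' \<and> is_equiv_rel C X' S'")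
  case True
  then show ?thesis
    using restricts_iff[OF equiv_rel_rel equiv_rel_rel, of X R X' R' f]
      restricts_iff[OF equiv_rel_rel equiv_rel_rel, of X S X' S' f]
    unfolding TwoEq_def by (simp add: two_eq_obs_iff)
next
  case False
  then show ?thesis unfolding TwoEq_def by (auto simp: two_eq_obs_iff)
qed

lemma category_TwoEq: "category (TwoEq C)"
proof
  fix X Y f assume "f \<in> Hom (TwoEq C) X Y"
  then show "X \<in> Ob (TwoEq C) \<and> Y \<in> Ob (TwoEq C)"
    by (cases X; cases Y) (auto simp: TwoEq_Hom two_eq_obs_iff)
next
  fix X assume "X \<in> Ob (TwoEq C)"
  moreover obtain Y R S where X: "X = (Y, R, S)" by (cases X)
  ultimately have h: "is_equiv_rel C Y R" "is_equiv_rel C Y S" by (auto simp: two_eq_obs_iff)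
  note r = equiv_rel_rel[OF h(1)] and s = equiv_rel_rel[OF h(2)]
  have Y: "Y \<in> Ob C" using rel_leg(1)[OF r] Ob_cod by blast
  have "mem R Z (Idn C Y \<odot> a) (Idn C Y \<odot> b)" if "mem R Z a b" for Z a b
    using that Idn_left[OF mem_Hom(1)[OF r that]] Idn_left[OF mem_Hom(2)[OF r that]] by simp
  moreover have "mem S Z (Idn C Y \<odot> a) (Idn C Y \<odot> b)" if "mem S Z a b" for Z a b
    using that Idn_left[OF mem_Hom(1)[OF s that]] Idn_left[OF mem_Hom(2)[OF s that]] by simp
  ultimately show "Idn (TwoEq C) X \<in> Hom (TwoEq C) X X"
    unfolding X TwoEq_simps TwoEq_Hom using h Idn_Hom[OF Y] by simp
next
  fix f X Y g Z assume "f \<in> Hom (TwoEq C) X Y" "g \<in> Hom (TwoEq C) Y Z"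
  moreover obtain X0 R S where X: "X = (X0, R, S)" by (cases X)
  moreover obtain Y0 R' S' where Y: "Y = (Y0, R', S')" by (cases Y)
  moreover obtain Z0 R'' S'' where Z: "Z = (Z0, R'', S'')" by (cases Z)
  ultimately have f: "f \<in> Hom (TwoEq C) (X0, R, S) (Y0, R', S')" and g: "g \<in> Hom (TwoEq C) (Y0, R', S') (Z0, R'', S'')"
    by auto
  have fg: "f \<in> Hom C X0 Y0" "g \<in> Hom C Y0 Z0" and eq: "is_equiv_rel C X0 R" "is_equiv_rel C X0 S"
    using f g unfolding TwoEq_Hom by blast+
  have "mem R'' W ((g \<odot> f) \<odot> a) ((g \<odot> f) \<odot> b)" if m: "mem R W a b" for W a b
  proof -
    note ab = mem_Hom[OF equiv_rel_rel[OF eq(1)] m]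
    have "mem R'' W (g \<odot> (f \<odot> a)) (g \<odot> (f \<odot> b))" using m f g unfolding TwoEq_Hom by blast
    then show ?thesis using Cmp_assoc[OF ab(1) fg] Cmp_assoc[OF ab(2) fg] by simp
  qed
  moreover have "mem S'' W ((g \<odot> f) \<odot> a) ((g \<odot> f) \<odot> b)" if m: "mem S W a b" for W a b
  proof -
    note ab = mem_Hom[OF equiv_rel_rel[OF eq(2)] m]
    have "mem S'' W (g \<odot> (f \<odot> a)) (g \<odot> (f \<odot> b))" using m f g unfolding TwoEq_Hom by blast
    then show ?thesis using Cmp_assoc[OF ab(1) fg] Cmp_assoc[OF ab(2) fg] by simp
  qed
  ultimately show "g \<odot>\<^bsub>TwoEq C\<^esub> f \<in> Hom (TwoEq C) X Z"
    unfolding X Z TwoEq_simps TwoEq_Hom using f g Cmp_Hom[OF fg] unfolding TwoEq_Hom by blast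
next
  fix f X Y assume "f \<in> Hom (TwoEq C) X Y"
  then show "Idn (TwoEq C) Y \<odot>\<^bsub>TwoEq C\<^esub> f = f" "f \<odot>\<^bsub>TwoEq C\<^esub> Idn (TwoEq C) X = f"
    by (cases X; cases Y; auto simp: TwoEq_Hom Idn_left Idn_right)+
next
  fix f X Y g Z h W assume "f \<in> Hom (TwoEq C) X Y" "g \<in> Hom (TwoEq C) Y Z" "h \<in> Hom (TwoEq C) Z W"
  then show "h \<odot>\<^bsub>TwoEq C\<^esub> g \<odot>\<^bsub>TwoEq C\<^esub> f = h \<odot>\<^bsub>TwoEq C\<^esub> (g \<odot>\<^bsub>TwoEq C\<^esub> f)"
    by (cases X; cases Y; cases Z; cases W) (auto simp: TwoEq_Hom intro: Cmp_assoc)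
qed

lemma TwoEq_discrete_Hom:
  assumes a: "a \<in> Hom C Z X" and R: "is_equiv_rel C X R" and S: "is_equiv_rel C X S"
  shows "a \<in> Hom (TwoEq C) (Z, diag_rel C Z, diag_rel C Z) (X, R, S)"
proof -
  have Z: "Z \<in> Ob C" using a Ob_dom by blast
  show ?thesis
    unfolding TwoEq_Hom mem_diag[OF Z] using a R S equiv_rel_diag[OF Z] Cmp_Hom[OF _ a] equiv_rel_refl by blast
qed

text \<open>The forgetful functor to \<open>C\<close> preserves pullbacks because it has a left adjoint, which
  equips an object with its discrete relations.\<close>

lemma TwoEq_pullback_forget:
  assumes pb: "is_pullback (TwoEq C) (A, RA, SA) (B, RB, SB) (D, RD, SD) f g (P, RP, SP) p q"
  shows "is_pullback C A B D f g P p q"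
proof -
  have h: "f \<in> Hom (TwoEq C) (A, RA, SA) (D, RD, SD)" "g \<in> Hom (TwoEq C) (B, RB, SB) (D, RD, SD)"
    "p \<in> Hom (TwoEq C) (P, RP, SP) (A, RA, SA)" "q \<in> Hom (TwoEq C) (P, RP, SP) (B, RB, SB)" "f \<odot> p = g \<odot> q"
    using pb unfolding is_pullback_def by auto
  then have hC: "f \<in> Hom C A D" "g \<in> Hom C B D" "p \<in> Hom C P A" "q \<in> Hom C P B"
    and eqs: "is_equiv_rel C A RA" "is_equiv_rel C A SA" "is_equiv_rel C B RB" "is_equiv_rel C B SB"
      "is_equiv_rel C P RP" "is_equiv_rel C P SP"
    unfolding TwoEq_Hom by blast+
  show ?thesis
  proof (rule is_pullbackI[OF hC h(5)])
    fix Z a b assume ab: "a \<in> Hom C Z A" "b \<in> Hom C Z B" "f \<odot> a = g \<odot> b"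
    have "a \<in> Hom (TwoEq C) (Z, diag_rel C Z, diag_rel C Z) (A, RA, SA)"
       "b \<in> Hom (TwoEq C) (Z, diag_rel C Z, diag_rel C Z) (B, RB, SB)"
      using TwoEq_discrete_Hom ab eqs by blast+
    then obtain h where "h \<in> Hom (TwoEq C) (Z, diag_rel C Z, diag_rel C Z) (P, RP, SP)" "p \<odot> h = a" "q \<odot> h = b"
      using pb ab(3) unfolding is_pullback_def TwoEq_simps by metis
    then show "\<exists>h. h \<in> Hom C Z P \<and> p \<odot> h = a \<and> q \<odot> h = b" unfolding TwoEq_Hom by blast
  next
    fix Z u v assume uv: "u \<in> Hom C Z P" "v \<in> Hom C Z P" "p \<odot> u = p \<odot> v" "q \<odot> u = q \<odot> v"
    interpret T: category "TwoEq C" by (rule category_TwoEq)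
    show "u = v"
      using T.pullback_unique[OF pb TwoEq_discrete_Hom[OF uv(1) eqs(5,6)] TwoEq_discrete_Hom[OF uv(2) eqs(5,6)]]
        uv(3,4) by simp
  qed
qed

text \<open>It suffices that the relations on P contain the inverse images of RA and SA along p.
  This is so in particular for pullbacks along a fibration g, whose relations RB and SB are already
  inverse images from D.\<close>

lemma TwoEq_pullbackI:
  assumes pb: "is_pullback C A B D f g P p q"
    and h: "f \<in> Hom (TwoEq C) (A, RA, SA) (D, RD, SD)" "g \<in> Hom (TwoEq C) (B, RB, SB) (D, RD, SD)"
      "p \<in> Hom (TwoEq C) (P, RP, SP) (A, RA, SA)" "q \<in> Hom (TwoEq C) (P, RP, SP) (B, RB, SB)"
    and R: "\<And>Z a b. a \<in> Hom C Z P \<Longrightarrow> b \<in> Hom C Z P \<Longrightarrow> mem RA Z (p \<odot> a) (p \<odot> b) \<Longrightarrow> mem RP Z a b"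
    and S: "\<And>Z a b. a \<in> Hom C Z P \<Longrightarrow> b \<in> Hom C Z P \<Longrightarrow> mem SA Z (p \<odot> a) (p \<odot> b) \<Longrightarrow> mem SP Z a b"
  shows "is_pullback (TwoEq C) (A, RA, SA) (B, RB, SB) (D, RD, SD) f g (P, RP, SP) p q"
proof -
  interpret T: category "TwoEq C" by (rule category_TwoEq)
  show ?thesis
  proof (rule T.is_pullbackI[OF h])
    show "f \<odot>\<^bsub>TwoEq C\<^esub> p = g \<odot>\<^bsub>TwoEq C\<^esub> q" using pullback_Hom[OF pb] by simp
  next
    fix Z a b assume ab: "a \<in> Hom (TwoEq C) Z (A, RA, SA)" "b \<in> Hom (TwoEq C) Z (B, RB, SB)"
      "f \<odot>\<^bsub>TwoEq C\<^esub> a = g \<odot>\<^bsub>TwoEq C\<^esub> b"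
    obtain Z0 RZ SZ where Z: "Z = (Z0, RZ, SZ)" by (cases Z)
    note a = ab(1)[unfolded Z TwoEq_Hom] and b = ab(2)[unfolded Z TwoEq_Hom]
    obtain k where k: "k \<in> Hom C Z0 P" "p \<odot> k = a" "q \<odot> k = b"
      using pullback_lift[OF pb, of a Z0 b] a b ab(3) by auto
    have px: "p \<odot> (k \<odot> x) = a \<odot> x" if "x \<in> Hom C W Z0" for W x
      using Cmp_reassoc[OF k(1) pullback_Hom(3)[OF pb] k(2) that] .
    have "mem RP W (k \<odot> x) (k \<odot> y)" if m: "mem RZ W x y" for W x y
    proof -
      have xy: "x \<in> Hom C W Z0" "y \<in> Hom C W Z0" using mem_Hom[OF equiv_rel_rel m] a by blast+
      show ?thesis using R[OF Cmp_Hom[OF xy(1) k(1)] Cmp_Hom[OF xy(2) k(1)]] px xy a m by simp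
    qed
    moreover have "mem SP W (k \<odot> x) (k \<odot> y)" if m: "mem SZ W x y" for W x y
    proof -
      have xy: "x \<in> Hom C W Z0" "y \<in> Hom C W Z0" using mem_Hom[OF equiv_rel_rel m] a by blast+
      show ?thesis using S[OF Cmp_Hom[OF xy(1) k(1)] Cmp_Hom[OF xy(2) k(1)]] px xy a m by simp
    qed
    ultimately have "k \<in> Hom (TwoEq C) Z (P, RP, SP)"
      using k(1) a h(3) unfolding Z TwoEq_Hom by blast
    then show "\<exists>h. h \<in> Hom (TwoEq C) Z (P, RP, SP) \<and> p \<odot>\<^bsub>TwoEq C\<^esub> h = a \<and> q \<odot>\<^bsub>TwoEq C\<^esub> h = b"
      using k by auto
  next
    fix Z u v assume uv: "u \<in> Hom (TwoEq C) Z (P, RP, SP)" "v \<in> Hom (TwoEq C) Z (P, RP, SP)"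
      "p \<odot>\<^bsub>TwoEq C\<^esub> u = p \<odot>\<^bsub>TwoEq C\<^esub> v" "q \<odot>\<^bsub>TwoEq C\<^esub> u = q \<odot>\<^bsub>TwoEq C\<^esub> v"
    obtain Z0 RZ SZ where Z: "Z = (Z0, RZ, SZ)" by (cases Z)
    show "u = v" using pullback_unique[OF pb, of u Z0 v] uv unfolding Z TwoEq_Hom by simp
  qed
qed

end

context exact_maltsev
begin

lemma regular_epi_lift2:
  assumes f: "is_regular_epi C X Y f" and y: "y \<in> Hom C Z Y" "y' \<in> Hom C Z Y"
  obtains Z' e x x' where "is_regular_epi C Z' Z e" "x \<in> Hom C Z' X" "x' \<in> Hom C Z' X"
    "f \<odot> x = y \<odot> e" "f \<odot> x' = y' \<odot> e"
proof -
  obtain Z1 e1 x1 where 1: "is_regular_epi C Z1 Z e1" "x1 \<in> Hom C Z1 X" "f \<odot> x1 = y \<odot> e1"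
    using regular_epi_lift[OF f y(1)] .
  note h1 = regular_epi_Hom[OF 1(1)]
  obtain Z2 e2 x2 where 2: "is_regular_epi C Z2 Z1 e2" "x2 \<in> Hom C Z2 X" "f \<odot> x2 = (y' \<odot> e1) \<odot> e2"
    using regular_epi_lift[OF f Cmp_Hom[OF h1 y(2)]] .
  note h2 = regular_epi_Hom[OF 2(1)]
  show ?thesis
  proof (rule that)
    show "is_regular_epi C Z2 Z (e1 \<odot> e2)" using regular_epi_Cmp[OF 2(1) 1(1)] .
    show "x1 \<odot> e2 \<in> Hom C Z2 X" "x2 \<in> Hom C Z2 X" using 1 2 h2 Cmp_Hom by blast+
    show "f \<odot> (x1 \<odot> e2) = y \<odot> (e1 \<odot> e2)"
      using Cmp_assoc[OF h2 1(2) regular_epi_Hom[OF f]] 1(3) Cmp_assoc[OF h2 h1 y(1)] by simp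
    show "f \<odot> x2 = y' \<odot> (e1 \<odot> e2)" using 2(3) Cmp_assoc[OF h2 h1 y(2)] by simp
  qed
qed

text \<open>Membership form of R being the inverse image of R' along f, free of the mediating arrow
  in \<open>is_inverse_image\<close>.\<close>

definition reflects :: "'o \<Rightarrow> 'm \<Rightarrow> ('o, 'm) span \<Rightarrow> ('o, 'm) span \<Rightarrow> bool" where
  "reflects X f R R' \<longleftrightarrow>
     (\<forall>Z. \<forall>a\<in>Hom C Z X. \<forall>b\<in>Hom C Z X. mem R Z a b \<longleftrightarrow> mem R' Z (f \<odot> a) (f \<odot> b))"

lemma reflectsD: "reflects X f R R' \<Longrightarrow> a \<in> Hom C Z X \<Longrightarrow> b \<in> Hom C Z X \<Longrightarrow> mem R Z a b \<longleftrightarrow> mem R' Z (f \<odot> a) (f \<odot> b)"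
  unfolding reflects_def by blast

text \<open>Factor f = m e in C and give the middle object the inverse images of R' and S'. Then e
  is a morphism of pairs that coequalizes u and v, hence factors through f, and the factorization
  splits the monomorphism m.\<close>

lemma regular_epi_TwoEq_imp:
  assumes reg: "is_regular_epi (TwoEq C) (X, R, S) (X', R', S') f"
  shows "is_regular_epi C X X' f"
proof -
  obtain Z0 u v where c: "is_coequalizer (TwoEq C) Z0 (X, R, S) u v (X', R', S') f"
    using reg unfolding is_regular_epi_def by blast
  obtain Z RZ SZ where Z: "Z0 = (Z, RZ, SZ)" by (cases Z0)
  have uvf: "u \<in> Hom (TwoEq C) (Z, RZ, SZ) (X, R, S)" "v \<in> Hom (TwoEq C) (Z, RZ, SZ) (X, R, S)"
    "f \<in> Hom (TwoEq C) (X, R, S) (X', R', S')" "f \<odot> u = f \<odot> v"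
    using c unfolding Z is_coequalizer_def by auto
  have h: "u \<in> Hom C Z X" "v \<in> Hom C Z X" and fh: "f \<in> Hom C X X'"
    and eqs: "is_equiv_rel C X R" "is_equiv_rel C X S" "is_equiv_rel C X' R'" "is_equiv_rel C X' S'"
    using uvf unfolding TwoEq_Hom by blast+
  have X': "X' \<in> Ob C" using fh Ob_cod by blast
  obtain I e m where I: "is_regular_epi C X I e" "mono I X' m" "m \<odot> e = f"
    using regular_epi_mono_factorization[OF fh] .
  have eh: "e \<in> Hom C X I" and mh: "m \<in> Hom C I X'" using I regular_epi_Hom mono_def by blast+
  obtain RI where RI: "is_equiv_rel C I RI" "\<forall>Z a b. mem RI Z a b \<longleftrightarrow> a \<in> Hom C Z I \<and> b \<in> Hom C Z I \<and> mem R' Z (m \<odot> a) (m \<odot> b)"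
    using equiv_rel_inverse[OF eqs(3) mh] .
  obtain SI where SI: "is_equiv_rel C I SI" "\<forall>Z a b. mem SI Z a b \<longleftrightarrow> a \<in> Hom C Z I \<and> b \<in> Hom C Z I \<and> mem S' Z (m \<odot> a) (m \<odot> b)"
    using equiv_rel_inverse[OF eqs(4) mh] .
  have me: "m \<odot> (e \<odot> a) = f \<odot> a" if "a \<in> Hom C W X" for W a using Cmp_reassoc[OF eh mh I(3) that] .
  have "mem RI W (e \<odot> a) (e \<odot> b)" if m: "mem R W a b" for W a b
  proof -
    note ab = mem_Hom[OF equiv_rel_rel[OF eqs(1)] m]
    have "mem R' W (f \<odot> a) (f \<odot> b)" using m uvf(3) unfolding TwoEq_Hom by blast
    then show ?thesis using RI(2) me[OF ab(1)] me[OF ab(2)] Cmp_Hom[OF ab(1) eh] Cmp_Hom[OF ab(2) eh] by simp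
  qed
  moreover have "mem SI W (e \<odot> a) (e \<odot> b)" if m: "mem S W a b" for W a b
  proof -
    note ab = mem_Hom[OF equiv_rel_rel[OF eqs(2)] m]
    have "mem S' W (f \<odot> a) (f \<odot> b)" using m uvf(3) unfolding TwoEq_Hom by blast
    then show ?thesis using SI(2) me[OF ab(1)] me[OF ab(2)] Cmp_Hom[OF ab(1) eh] Cmp_Hom[OF ab(2) eh] by simp
  qed
  ultimately have e2: "e \<in> Hom (TwoEq C) (X, R, S) (I, RI, SI)"
    unfolding TwoEq_Hom using eh eqs RI(1) SI(1) by blast
  have "m \<odot> (e \<odot> u) = m \<odot> (e \<odot> v)" using me h uvf(4) by simp
  then have eu: "e \<odot> u = e \<odot> v" using I(2) Cmp_Hom[OF h(1) eh] Cmp_Hom[OF h(2) eh] unfolding mono_def by blast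
  obtain k where k: "k \<in> Hom (TwoEq C) (X', R', S') (I, RI, SI)" "k \<odot> e = k \<odot> e" "k \<odot> f = e"
    using c e2 eu unfolding is_coequalizer_def Z TwoEq_simps by metis
  have kh: "k \<in> Hom C X' I" using k unfolding TwoEq_Hom by blast
  have "m \<in> Hom (TwoEq C) (I, RI, SI) (X', R', S')" unfolding TwoEq_Hom using mh RI SI eqs by blast
  then have mk: "m \<odot> k \<in> Hom (TwoEq C) (X', R', S') (X', R', S')"
    using category.Cmp_Hom[OF category_TwoEq k(1)] by fastforce
  have id: "Idn C X' \<in> Hom (TwoEq C) (X', R', S') (X', R', S')"
    using category.Idn_Hom[OF category_TwoEq, of "(X', R', S')"] eqs by (simp add: two_eq_obs_iff)
  have "(m \<odot> k) \<odot> f = f" using Cmp_assoc[OF fh kh mh] k(3) I(3) by simp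
  moreover have "Idn C X' \<odot> f = f" using Idn_left fh by blast
  moreover have "\<exists>!l. l \<in> Hom (TwoEq C) (X', R', S') (X', R', S') \<and> l \<odot> f = f"
    using c uvf(3,4) unfolding is_coequalizer_def Z TwoEq_simps by blast
  ultimately have "m \<odot> k = Idn C X'" using mk id by metis
  then have "is_iso C I X' m" using mono_split_iso[OF I(2) kh] by blast
  then show ?thesis using regular_epi_iso[OF I(1)] I(3) by metis
qed

text \<open>f is the coequalizer of its kernel pair, equipped with the inverse images of R and S
  along p. Reflection by f is used twice: q respects these relations, and a factorization k respects
  R' and S' since their elements lift locally to R and S.\<close>

lemma regular_epi_TwoEqI:
  assumes f: "is_regular_epi C X X' f"
    and eqs: "is_equiv_rel C X R" "is_equiv_rel C X S" "is_equiv_rel C X' R'" "is_equiv_rel C X' S'"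
    and rR: "reflects X f R R'" and rS: "reflects X f S S'"
  shows "is_regular_epi (TwoEq C) (X, R, S) (X', R', S') f"
proof -
  note fh = regular_epi_Hom[OF f]
  obtain P p q where P: "is_pullback C X X X' f f P p q" using pullback_exists[OF fh fh] .
  note h = pullback_Hom[OF P]
  obtain RP where RP: "is_equiv_rel C P RP" "\<forall>Z a b. mem RP Z a b \<longleftrightarrow> a \<in> Hom C Z P \<and> b \<in> Hom C Z P \<and> mem R Z (p \<odot> a) (p \<odot> b)"
    using equiv_rel_inverse[OF eqs(1) h(3)] .
  obtain SP where SP: "is_equiv_rel C P SP" "\<forall>Z a b. mem SP Z a b \<longleftrightarrow> a \<in> Hom C Z P \<and> b \<in> Hom C Z P \<and> mem S Z (p \<odot> a) (p \<odot> b)"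
    using equiv_rel_inverse[OF eqs(2) h(3)] .
  have p2: "p \<in> Hom (TwoEq C) (P, RP, SP) (X, R, S)" unfolding TwoEq_Hom using h RP SP eqs by blast
  have "mem R Z (q \<odot> a) (q \<odot> b)" if m: "mem RP Z a b" for Z a b
  proof -
    have ab: "a \<in> Hom C Z P" "b \<in> Hom C Z P" "mem R Z (p \<odot> a) (p \<odot> b)" using m RP(2) by blast+
    then have "mem R' Z (f \<odot> (p \<odot> a)) (f \<odot> (p \<odot> b))"
      using reflectsD[OF rR Cmp_Hom[OF ab(1) h(3)] Cmp_Hom[OF ab(2) h(3)]] by blast
    then show ?thesis
      using reflectsD[OF rR Cmp_Hom[OF ab(1) h(4)] Cmp_Hom[OF ab(2) h(4)]] pullback_square[OF P ab(1)] pullback_square[OF P ab(2)]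
      by simp
  qed
  moreover have "mem S Z (q \<odot> a) (q \<odot> b)" if m: "mem SP Z a b" for Z a b
  proof -
    have ab: "a \<in> Hom C Z P" "b \<in> Hom C Z P" "mem S Z (p \<odot> a) (p \<odot> b)" using m SP(2) by blast+
    then have "mem S' Z (f \<odot> (p \<odot> a)) (f \<odot> (p \<odot> b))"
      using reflectsD[OF rS Cmp_Hom[OF ab(1) h(3)] Cmp_Hom[OF ab(2) h(3)]] by blast
    then show ?thesis
      using reflectsD[OF rS Cmp_Hom[OF ab(1) h(4)] Cmp_Hom[OF ab(2) h(4)]] pullback_square[OF P ab(1)] pullback_square[OF P ab(2)]
      by simp
  qed
  ultimately have q2: "q \<in> Hom (TwoEq C) (P, RP, SP) (X, R, S)" unfolding TwoEq_Hom using h RP SP eqs by blast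
  have f2: "f \<in> Hom (TwoEq C) (X, R, S) (X', R', S')"
    unfolding TwoEq_Hom
    using fh eqs reflectsD[OF rR] reflectsD[OF rS] mem_Hom[OF equiv_rel_rel[OF eqs(1)]] mem_Hom[OF equiv_rel_rel[OF eqs(2)]]
    by blast
  have "\<exists>!k. k \<in> Hom (TwoEq C) (X', R', S') Y \<and> k \<odot> f = g" if g: "g \<in> Hom (TwoEq C) (X, R, S) Y" "g \<odot> p = g \<odot> q" for Y g
  proof -
    obtain Y0 U V where Y: "Y = (Y0, U, V)" by (cases Y)
    have gh: "g \<in> Hom C X Y0" and UV: "is_equiv_rel C Y0 U" "is_equiv_rel C Y0 V"
      and gR: "\<And>Z a b. mem R Z a b \<Longrightarrow> mem U Z (g \<odot> a) (g \<odot> b)" and gS: "\<And>Z a b. mem S Z a b \<Longrightarrow> mem V Z (g \<odot> a) (g \<odot> b)"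
      using g(1) unfolding Y TwoEq_Hom by blast+
    have "g \<odot> a = g \<odot> b" if ab: "a \<in> Hom C Z X" "b \<in> Hom C Z X" "f \<odot> a = f \<odot> b" for Z a b
    proof -
      obtain w where w: "w \<in> Hom C Z P" "p \<odot> w = a" "q \<odot> w = b" using pullback_lift[OF P ab] .
      show ?thesis using Cmp_square[OF h(3) gh h(4) gh g(2) w(1)] w by simp
    qed
    then obtain k where k: "k \<in> Hom C X' Y0" "k \<odot> f = g" using regular_epi_factor[OF f gh] by metis
    have kmem: "mem U' Z (k \<odot> x) (k \<odot> y)" if U': "is_equiv_rel C Y0 U'" and gR: "\<And>Z a b. mem T Z a b \<Longrightarrow> mem U' Z (g \<odot> a) (g \<odot> b)"
      and rT: "reflects X f T T'" and T': "is_equiv_rel C X' T'" and m: "mem T' Z x y" for U' T T' Z x y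
    proof -
      note xy = mem_Hom[OF equiv_rel_rel[OF T'] m]
      obtain Z' e a b where e: "is_regular_epi C Z' Z e" "a \<in> Hom C Z' X" "b \<in> Hom C Z' X" "f \<odot> a = x \<odot> e" "f \<odot> b = y \<odot> e"
        using regular_epi_lift2[OF f xy] .
      note e' = regular_epi_Hom[OF e(1)]
      have "mem T Z' a b" using reflectsD[OF rT e(2,3)] mem_reindex[OF equiv_rel_rel[OF T'] m e'] e by simp
      then have "mem U' Z' (g \<odot> a) (g \<odot> b)" by (rule gR)
      moreover have "g \<odot> a = (k \<odot> x) \<odot> e" "g \<odot> b = (k \<odot> y) \<odot> e"
        using Cmp_reassoc[OF fh k e(2)] Cmp_reassoc[OF fh k e(3)] e Cmp_assoc[OF e' xy(1) k(1)] Cmp_assoc[OF e' xy(2) k(1)] by simp_all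
      ultimately show ?thesis
        using mem_local[OF equiv_rel_rel[OF U'] e(1) Cmp_Hom[OF xy(1) k(1)] Cmp_Hom[OF xy(2) k(1)]] by simp
    qed
    have "k \<in> Hom (TwoEq C) (X', R', S') Y"
      unfolding Y TwoEq_Hom using k(1) eqs UV kmem[OF UV(1) gR rR eqs(3)] kmem[OF UV(2) gS rS eqs(4)] by blast
    moreover have "l = k" if "l \<in> Hom (TwoEq C) (X', R', S') Y" "l \<odot> f = g" for l
      using that regular_epi_cancel[OF f _ k(1)] k(2) unfolding Y TwoEq_Hom by simp
    ultimately show ?thesis using k(2) by blast
  qed
  then have "is_coequalizer (TwoEq C) (P, RP, SP) (X, R, S) p q (X', R', S') f"
    unfolding is_coequalizer_def TwoEq_simps using p2 q2 f2 h(5) by blast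
  then show ?thesis unfolding is_regular_epi_def by blast
qed

lemma fibration_iff:
  "fibration C (X, R, S) (X', R', S') f \<longleftrightarrow>
     is_equiv_rel C X R \<and> is_equiv_rel C X S \<and> is_equiv_rel C X' R' \<and> is_equiv_rel C X' S' \<and>
     is_regular_epi C X X' f \<and> reflects X f R R' \<and> reflects X f S S'"
proof (intro iffI; (elim conjE)?)
  assume fib: "fibration C (X, R, S) (X', R', S') f"
  then have reg: "is_regular_epi (TwoEq C) (X, R, S) (X', R', S') f"
    and inv: "is_inverse_image C X f R' R" "is_inverse_image C X f S' S" by auto
  have "f \<in> Hom (TwoEq C) (X, R, S) (X', R', S')" using category.regular_epi_Hom[OF category_TwoEq reg] .
  then have f: "f \<in> Hom C X X'" and eqs: "is_equiv_rel C X R" "is_equiv_rel C X S" "is_equiv_rel C X' R'" "is_equiv_rel C X' S'"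
    unfolding TwoEq_Hom by blast+
  have "reflects X f R R'" "reflects X f S S'"
    unfolding reflects_def
    using inverse_imageD[OF inv(1) equiv_rel_rel[OF eqs(3)] f equiv_rel_rel[OF eqs(1)]]
      inverse_imageD[OF inv(2) equiv_rel_rel[OF eqs(4)] f equiv_rel_rel[OF eqs(2)]] by blast+
  then show "is_equiv_rel C X R \<and> is_equiv_rel C X S \<and> is_equiv_rel C X' R' \<and> is_equiv_rel C X' S' \<and>
     is_regular_epi C X X' f \<and> reflects X f R R' \<and> reflects X f S S'"
    using eqs regular_epi_TwoEq_imp[OF reg] by blast
next
  assume eqs: "is_equiv_rel C X R" "is_equiv_rel C X S" "is_equiv_rel C X' R'" "is_equiv_rel C X' S'"
    and f: "is_regular_epi C X X' f" and rR: "reflects X f R R'" and rS: "reflects X f S S'"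
  note fh = regular_epi_Hom[OF f]
  show "fibration C (X, R, S) (X', R', S') f"
    using regular_epi_TwoEqI[OF f eqs rR rS]
      inverse_imageI[OF equiv_rel_rel[OF eqs(3)] fh equiv_rel_rel[OF eqs(1)] reflectsD[OF rR]]
      inverse_imageI[OF equiv_rel_rel[OF eqs(4)] fh equiv_rel_rel[OF eqs(2)] reflectsD[OF rS]] by simp
qed

lemma fibrationD:
  assumes "fibration C (X, R, S) (X', R', S') f"
  shows "is_equiv_rel C X R" "is_equiv_rel C X S" "is_equiv_rel C X' R'" "is_equiv_rel C X' S'"
     "is_regular_epi C X X' f" "reflects X f R R'" "reflects X f S S'"
  using assms unfolding fibration_iff by blast+

section \<open>Stability of fibrations under pullback and composition\<close>

lemma fibration_Hom:
  assumes "fibration C A B f" shows "f \<in> Hom (TwoEq C) A B"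
proof -
  have "is_regular_epi (TwoEq C) A B f" using assms by (cases A; cases B) auto
  then show ?thesis by (rule category.regular_epi_Hom[OF category_TwoEq])
qed

text \<open>P carries the relations pulled back from B along q; p respects them because f reflects
  those of D.\<close>

lemma fibration_pullback_exists:
  assumes f: "fibration C A D f" and g: "g \<in> Hom (TwoEq C) B D"
  obtains P p q where "is_pullback (TwoEq C) A B D f g P p q" "fibration C P B q"
proof -
  obtain A0 RA SA where A: "A = (A0, RA, SA)" by (cases A)
  obtain B0 RB SB where B: "B = (B0, RB, SB)" by (cases B)
  obtain D0 RD SD where D: "D = (D0, RD, SD)" by (cases D)
  note F = fibrationD[OF f[unfolded A D]]
  note G = g[unfolded B D TwoEq_Hom]
  then have gh: "g \<in> Hom C B0 D0" and RB: "is_equiv_rel C B0 RB" and SB: "is_equiv_rel C B0 SB" by blast+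
  note fh = regular_epi_Hom[OF F(5)]
  obtain P p q where P: "is_pullback C A0 B0 D0 f g P p q" using pullback_exists[OF fh gh] .
  note h = pullback_Hom[OF P]
  obtain RP where RP: "is_equiv_rel C P RP" "\<forall>Z a b. mem RP Z a b \<longleftrightarrow> a \<in> Hom C Z P \<and> b \<in> Hom C Z P \<and> mem RB Z (q \<odot> a) (q \<odot> b)"
    using equiv_rel_inverse[OF RB h(4)] .
  obtain SP where SP: "is_equiv_rel C P SP" "\<forall>Z a b. mem SP Z a b \<longleftrightarrow> a \<in> Hom C Z P \<and> b \<in> Hom C Z P \<and> mem SB Z (q \<odot> a) (q \<odot> b)"
    using equiv_rel_inverse[OF SB h(4)] .
  have q2: "q \<in> Hom (TwoEq C) (P, RP, SP) (B0, RB, SB)" unfolding TwoEq_Hom using h RP SP RB SB by blast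
  have "mem RA Z (p \<odot> a) (p \<odot> b)" if m: "mem RP Z a b" for Z a b
  proof -
    have ab: "a \<in> Hom C Z P" "b \<in> Hom C Z P" "mem RB Z (q \<odot> a) (q \<odot> b)" using m RP(2) by blast+
    then have "mem RD Z (g \<odot> (q \<odot> a)) (g \<odot> (q \<odot> b))" using G by blast
    then show ?thesis
      using reflectsD[OF F(6) Cmp_Hom[OF ab(1) h(3)] Cmp_Hom[OF ab(2) h(3)]] pullback_square[OF P ab(1)] pullback_square[OF P ab(2)]
      by simp
  qed
  moreover have "mem SA Z (p \<odot> a) (p \<odot> b)" if m: "mem SP Z a b" for Z a b
  proof -
    have ab: "a \<in> Hom C Z P" "b \<in> Hom C Z P" "mem SB Z (q \<odot> a) (q \<odot> b)" using m SP(2) by blast+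
    then have "mem SD Z (g \<odot> (q \<odot> a)) (g \<odot> (q \<odot> b))" using G by blast
    then show ?thesis
      using reflectsD[OF F(7) Cmp_Hom[OF ab(1) h(3)] Cmp_Hom[OF ab(2) h(3)]] pullback_square[OF P ab(1)] pullback_square[OF P ab(2)]
      by simp
  qed
  ultimately have p2: "p \<in> Hom (TwoEq C) (P, RP, SP) (A0, RA, SA)" unfolding TwoEq_Hom using h RP SP F by blast
  have "is_pullback (TwoEq C) B A D g f (P, RP, SP) q p"
    unfolding A B D
    by (rule TwoEq_pullbackI[OF is_pullback_swap[OF P] g[unfolded B D] fibration_Hom[OF f, unfolded A D] q2 p2])
       (use RP SP in blast)+
  then have 1: "is_pullback (TwoEq C) A B D f g (P, RP, SP) p q"
    by (rule category.is_pullback_swap[OF category_TwoEq])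
  have "reflects P q RP RB" "reflects P q SP SB" unfolding reflects_def using RP SP by blast+
  then have "fibration C (P, RP, SP) B q"
    unfolding B fibration_iff using RP SP RB SB regular_epi_stable[OF P F(5)] by blast
  with 1 show ?thesis by (rule that)
qed

text \<open>The property is transferred from the pullback just constructed to an arbitrary one along
  the comparison arrows k and l.\<close>

lemma fibration_pullback:
  assumes f: "fibration C A D f" and pb: "is_pullback (TwoEq C) A B D f g P p q"
  shows "fibration C P B q"
proof -
  interpret T: category "TwoEq C" by (rule category_TwoEq)
  note H = T.pullback_Hom[OF pb]
  obtain P' p' q' where P': "is_pullback (TwoEq C) A B D f g P' p' q'" "fibration C P' B q'"
    using fibration_pullback_exists[OF f H(2)] .
  note H' = T.pullback_Hom[OF P'(1)]
  obtain k where k: "k \<in> Hom (TwoEq C) P' P" "p \<odot> k = p'" "q \<odot> k = q'"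
    using T.pullback_lift[OF pb H'(3,4)] H'(5) by auto
  obtain l where l: "l \<in> Hom (TwoEq C) P P'" "p' \<odot> l = p" "q' \<odot> l = q"
    using T.pullback_lift[OF P'(1) H(3,4)] H(5) by auto
  obtain P0 RP SP where Pe: "P = (P0, RP, SP)" by (cases P)
  obtain P0' RP' SP' where P'e: "P' = (P0', RP', SP')" by (cases P')
  obtain B0 RB SB where B: "B = (B0, RB, SB)" by (cases B)
  note F = fibrationD[OF P'(2)[unfolded P'e B]]
  note K = k(1)[unfolded Pe P'e TwoEq_Hom] and L = l(1)[unfolded Pe P'e TwoEq_Hom]
  note Q = H(4)[unfolded Pe B TwoEq_Hom] and Pp = H(3)
  have kH: "k \<in> Hom C P0' P0" and lH: "l \<in> Hom C P0 P0'" and qH: "q \<in> Hom C P0 B0" using K L Q by blast+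
  have kl: "k \<odot> l = Idn C P0"
  proof -
    have "k \<odot> l \<in> Hom (TwoEq C) P P" using T.Cmp_Hom[OF l(1) k(1)] by simp
    moreover have "Idn C P0 \<in> Hom (TwoEq C) P P" using T.Idn_Hom[of P] T.Ob_dom[OF H(3)] unfolding Pe by simp
    moreover have "p \<odot> (k \<odot> l) = p \<odot> Idn C P0" "q \<odot> (k \<odot> l) = q \<odot> Idn C P0"
      using T.Cmp_reassoc[OF k(1) H(3) _ l(1)] T.Cmp_reassoc[OF k(1) H(4) _ l(1)] k l
        T.Idn_right[OF H(3)] T.Idn_right[OF H(4)] unfolding Pe by simp_all
    ultimately show ?thesis using T.pullback_unique[OF pb] by simp
  qed
  have "k \<odot> (l \<odot> a) = a" if "a \<in> Hom C Z P0" for Z a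
    using Cmp_reassoc[OF lH kH kl that] Idn_left[OF that] by simp
  moreover have "q' \<odot> (l \<odot> a) = q \<odot> a" if "a \<in> Hom C Z P0" for Z a
    using Cmp_reassoc[OF lH regular_epi_Hom[OF F(5)] l(3) that] .
  ultimately have "reflects P0 q RP RB" "reflects P0 q SP SB"
    unfolding reflects_def using K L Q reflectsD[OF F(6)] reflectsD[OF F(7)] Cmp_Hom[OF _ lH] by metis+
  moreover have "is_regular_epi C P0 B0 q"
    using regular_epi_right_cancel[OF _ kH qH] k(3) F(5) by simp
  ultimately show ?thesis unfolding Pe B fibration_iff using Q by blast
qed

lemma fibration_Cmp:
  assumes f: "fibration C A B f" and g: "fibration C B D g"
  shows "fibration C A D (g \<odot> f)"
proof -
  obtain A0 RA SA where A: "A = (A0, RA, SA)" by (cases A)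
  obtain B0 RB SB where B: "B = (B0, RB, SB)" by (cases B)
  obtain D0 RD SD where D: "D = (D0, RD, SD)" by (cases D)
  note F = fibrationD[OF f[unfolded A B]] and G = fibrationD[OF g[unfolded B D]]
  note fh = regular_epi_Hom[OF F(5)] and gh = regular_epi_Hom[OF G(5)]
  have "reflects A0 (g \<odot> f) RA RD" "reflects A0 (g \<odot> f) SA SD"
    unfolding reflects_def using reflectsD[OF F(6)] reflectsD[OF G(6)] reflectsD[OF F(7)] reflectsD[OF G(7)]
      Cmp_assoc[OF _ fh gh] Cmp_Hom[OF _ fh] by metis+
  then show ?thesis unfolding A D fibration_iff using F G regular_epi_Cmp by blast
qed

end

section \<open>Trivial extensions\<close>


context exact_maltsev
begin

section \<open>The reflection into centralizing pairs\<close>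

lemma Gamma_F_simps [simp]: "Tot (Gamma_F C) = TwoEq C" "Refl (Gamma_F C) = conn_reflector C"
  "Unit (Gamma_F C) = conn_unit C" "Ext (Gamma_F C) = fibration C"
  unfolding Gamma_F_def by auto

lemma FO_conn_reflector [simp]: "FO (conn_reflector C) = conn_ob C"
  unfolding conn_reflector_def by simp

text \<open>Unfolds the chosen representatives behind the reflector once, so that later arguments
  rest on these properties alone.\<close>

lemma conn_reflection:
  assumes R: "is_equiv_rel C X R" and S: "is_equiv_rel C X S"
  obtains Q q RQ SQ where "conn_ob C (X, R, S) = (Q, RQ, SQ)" "conn_unit C (X, R, S) = q"
    "is_regular_epi C X Q q"
    "\<forall>Z a b. a \<in> Hom C Z X \<and> b \<in> Hom C Z X \<longrightarrow> (mem (commutator C X R S) Z a b \<longleftrightarrow> q \<odot> a = q \<odot> b)"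
    "image_of Q q R RQ" "image_of Q q S SQ" "is_equiv_rel C Q RQ" "is_equiv_rel C Q SQ" "centralizes C Q RQ SQ"
proof -
  note Rr = equiv_rel_rel[OF R] and Sr = equiv_rel_rel[OF S]
  note Keq = commutator_equiv[OF R S]
  obtain Q q where Q: "quot C X (commutator C X R S) = (Q, q)" by (cases "quot C X (commutator C X R S)")
  note Qr = equiv_rel_quot(1)[OF Keq Q] and Qm = equiv_rel_quot(2)[OF Keq Q]
  note qh = regular_epi_Hom[OF Qr]
  note iR = dir_image_image_of[OF Rr qh] and iS = dir_image_image_of[OF Sr qh]
  have "centralizes C Q (dir_image C Q q R) (dir_image C Q q S)"
  proof (rule image_centralizes[OF R S Qr iR iS])
    fix Z x y assume "mem (commutator C X R S) Z x y"
    then show "q \<odot> x = q \<odot> y" using Qm mem_Hom[OF equiv_rel_rel[OF Keq]] by blast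
  qed
  then show ?thesis
    using that[of Q "dir_image C Q q R" "dir_image C Q q S" q] Qr Qm iR iS
      equiv_rel_image[OF Qr R iR] equiv_rel_image[OF Qr S iS] by (simp add: Q)
qed

text \<open>The definite description in the reflector denotes: q' f lands in a centralizing pair, so
  it kills the commutator and factors uniquely through the quotient q.\<close>

lemma conn_reflector_arrow:
  assumes f: "f \<in> Hom (TwoEq C) A B"
  shows "FA (conn_reflector C) A B f \<in> Hom (TwoEq C) (conn_ob C A) (conn_ob C B)"
    and "FA (conn_reflector C) A B f \<odot> conn_unit C A = conn_unit C B \<odot> f"
proof -
  obtain X R S where A: "A = (X, R, S)" by (cases A)
  obtain Y R' S' where B: "B = (Y, R', S')" by (cases B)
  note F = f[unfolded A B TwoEq_Hom]
  then have fh: "f \<in> Hom C X Y" and eqs: "is_equiv_rel C X R" "is_equiv_rel C X S" "is_equiv_rel C Y R'" "is_equiv_rel C Y S'"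
    and fR: "\<And>Z a b. mem R Z a b \<Longrightarrow> mem R' Z (f \<odot> a) (f \<odot> b)" and fS: "\<And>Z a b. mem S Z a b \<Longrightarrow> mem S' Z (f \<odot> a) (f \<odot> b)"
    by blast+
  obtain Q q RQ SQ where Q: "conn_ob C (X, R, S) = (Q, RQ, SQ)" "conn_unit C (X, R, S) = q"
    "is_regular_epi C X Q q"
    "\<forall>Z a b. a \<in> Hom C Z X \<and> b \<in> Hom C Z X \<longrightarrow> (mem (commutator C X R S) Z a b \<longleftrightarrow> q \<odot> a = q \<odot> b)"
    "image_of Q q R RQ" "image_of Q q S SQ" "is_equiv_rel C Q RQ" "is_equiv_rel C Q SQ" "centralizes C Q RQ SQ"
    by (rule conn_reflection[OF eqs(1,2)])
  obtain Q' q' RQ' SQ' where Q': "conn_ob C (Y, R', S') = (Q', RQ', SQ')" "conn_unit C (Y, R', S') = q'"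
    "is_regular_epi C Y Q' q'"
    "\<forall>Z a b. a \<in> Hom C Z Y \<and> b \<in> Hom C Z Y \<longrightarrow> (mem (commutator C Y R' S') Z a b \<longleftrightarrow> q' \<odot> a = q' \<odot> b)"
    "image_of Q' q' R' RQ'" "image_of Q' q' S' SQ'" "is_equiv_rel C Q' RQ'" "is_equiv_rel C Q' SQ'" "centralizes C Q' RQ' SQ'"
    by (rule conn_reflection[OF eqs(3,4)])
  note qh = regular_epi_Hom[OF Q(3)] and qh' = regular_epi_Hom[OF Q'(3)]
  have q'f: "q' \<odot> f \<in> Hom C X Q'" using fh qh' Cmp_Hom by blast
  have ass: "(q' \<odot> f) \<odot> a = q' \<odot> (f \<odot> a)" if "a \<in> Hom C Z X" for Z a using Cmp_assoc[OF that fh qh'] .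
  have mR: "mem RQ' Z ((q' \<odot> f) \<odot> x) ((q' \<odot> f) \<odot> y)" if m: "mem R Z x y" for Z x y
    using image_ofI[OF equiv_rel_rel[OF eqs(3)] qh' Q'(5) fR[OF m]] ass mem_Hom[OF equiv_rel_rel[OF eqs(1)] m] by simp
  have mS: "mem SQ' Z ((q' \<odot> f) \<odot> x) ((q' \<odot> f) \<odot> y)" if m: "mem S Z x y" for Z x y
    using image_ofI[OF equiv_rel_rel[OF eqs(4)] qh' Q'(6) fS[OF m]] ass mem_Hom[OF equiv_rel_rel[OF eqs(2)] m] by simp
  have "(q' \<odot> f) \<odot> u = (q' \<odot> f) \<odot> v" if "u \<in> Hom C Z X" "v \<in> Hom C Z X" "q \<odot> u = q \<odot> v" for Z u v
    using commutator_kill[OF eqs(1,2) q'f Q'(7,8) mR mS Q'(9)] that Q(4) by blast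
  then obtain h where h: "h \<in> Hom C Q Q'" "h \<odot> q = q' \<odot> f" using regular_epi_factor[OF Q(3) q'f] by metis
  have hmem: "mem T' Z (h \<odot> a) (h \<odot> b)"
    if T: "image_of Q q U T" "is_equiv_rel C X U" and T': "is_equiv_rel C Q' T'"
      and mU: "\<And>Z x y. mem U Z x y \<Longrightarrow> mem T' Z ((q' \<odot> f) \<odot> x) ((q' \<odot> f) \<odot> y)" and m: "mem T Z a b" for T U T' Z a b
  proof -
    note ab = mem_Hom[OF image_of_rel[OF T(1)] m]
    obtain Z' e x y where e: "is_regular_epi C Z' Z e" "mem U Z' x y" "q \<odot> x = a \<odot> e" "q \<odot> y = b \<odot> e"
      using image_ofE[OF T(1) m] .
    note e' = regular_epi_Hom[OF e(1)] and xy = mem_Hom[OF equiv_rel_rel[OF T(2)] e(2)]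
    have "(q' \<odot> f) \<odot> x = (h \<odot> a) \<odot> e" "(q' \<odot> f) \<odot> y = (h \<odot> b) \<odot> e"
      using Cmp_reassoc[OF qh h xy(1)] Cmp_reassoc[OF qh h xy(2)] e Cmp_assoc[OF e' ab(1) h(1)] Cmp_assoc[OF e' ab(2) h(1)] by simp_all
    then show ?thesis
      using mU[OF e(2)] mem_local[OF equiv_rel_rel[OF T'] e(1) Cmp_Hom[OF ab(1) h(1)] Cmp_Hom[OF ab(2) h(1)]] by simp
  qed
  have hT: "h \<in> Hom (TwoEq C) (conn_ob C A) (conn_ob C B)"
    unfolding A B Q(1) Q'(1) TwoEq_Hom
    using h(1) Q(7,8) Q'(7,8) hmem[OF Q(5) eqs(1) Q'(7) mR] hmem[OF Q(6) eqs(2) Q'(8) mS] by blast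
  have Conn_Hom: "k \<in> Hom (Conn C) (conn_ob C A) (conn_ob C B) \<longleftrightarrow> k \<in> Hom (TwoEq C) (conn_ob C A) (conn_ob C B)" for k
    unfolding A B Q(1) Q'(1) Conn_def full_subcat_def using Q(9) Q'(9) by simp
  have "FA (conn_reflector C) A B f = h"
    unfolding conn_reflector_def func.simps Conn_Hom
  proof (rule the_equality, intro conjI)
    show "h \<odot> conn_unit C A = conn_unit C B \<odot> f" unfolding A B Q(2) Q'(2) by (rule h(2))
    fix k assume "k \<in> Hom (TwoEq C) (conn_ob C A) (conn_ob C B) \<and> k \<odot> conn_unit C A = conn_unit C B \<odot> f"
    then show "k = h"
      using regular_epi_cancel[OF Q(3) _ h(1)] h(2) unfolding A B Q(1,2) Q'(1,2) TwoEq_Hom by simp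
  qed (rule hT)
  then show "FA (conn_reflector C) A B f \<in> Hom (TwoEq C) (conn_ob C A) (conn_ob C B)"
    "FA (conn_reflector C) A B f \<odot> conn_unit C A = conn_unit C B \<odot> f"
    using hT h(2) unfolding A B Q(2) Q'(2) by auto
qed

text \<open>In a pullback square f and the unit are jointly monic, and the unit identifies exactly
  the elements related by the commutator.\<close>

lemma trivial_ext_discrete:
  assumes tr: "trivial_ext (Gamma_F C) (X, R, S) (Y, R', S') f"
    and m: "mem (commutator C X R S) Z x y" and eq: "f \<odot> x = f \<odot> y"
  shows "x = y"
proof -
  have fib: "fibration C (X, R, S) (Y, R', S') f"
    and pb: "is_pullback (TwoEq C) (Y, R', S') (conn_ob C (X, R, S)) (conn_ob C (Y, R', S'))
       (conn_unit C (Y, R', S')) (FA (conn_reflector C) (X, R, S) (Y, R', S') f) (X, R, S) f (conn_unit C (X, R, S))"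
    using tr unfolding trivial_ext_def by (simp_all del: conn_ob.simps conn_unit.simps)
  note F = fibrationD[OF fib]
  obtain Q q RQ SQ where Q: "conn_ob C (X, R, S) = (Q, RQ, SQ)" "conn_unit C (X, R, S) = q"
    "is_regular_epi C X Q q"
    "\<forall>Z a b. a \<in> Hom C Z X \<and> b \<in> Hom C Z X \<longrightarrow> (mem (commutator C X R S) Z a b \<longleftrightarrow> q \<odot> a = q \<odot> b)"
    by (rule conn_reflection[OF F(1,2)])
  obtain Q' RQ' SQ' where Q': "conn_ob C (Y, R', S') = (Q', RQ', SQ')" by (cases "conn_ob C (Y, R', S')")
  note pb' = TwoEq_pullback_forget[OF pb[unfolded Q(1,2) Q']]
  have xy: "x \<in> Hom C Z X" "y \<in> Hom C Z X" using mem_Hom[OF equiv_rel_rel[OF commutator_equiv[OF F(1,2)]] m] .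
  then show ?thesis using pullback_unique[OF pb' xy eq] Q(4) m by blast
qed

text \<open>The nontrivial half of f([R, S]) = [R', S']. With \<beta> the quotient by M, the
  composite \<beta> f kills [R, S], so the images of R and S under it centralize. Elements of R' and
  S' lift locally along f, so \<beta> maps them into these images and kills [R', S'].\<close>

lemma commutator_image:
  assumes fib: "fibration C (X, R, S) (Y, R', S') f" and M: "is_equiv_rel C Y M"
    and fM: "\<And>Z x y. mem (commutator C X R S) Z x y \<Longrightarrow> mem M Z (f \<odot> x) (f \<odot> y)"
    and m: "mem (commutator C Y R' S') Z a b"
  shows "mem M Z a b"
proof -
  note F = fibrationD[OF fib]
  note fh = regular_epi_Hom[OF F(5)]
  obtain W \<beta> where W: "quot C Y M = (W, \<beta>)" by (cases "quot C Y M")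
  note Wr = equiv_rel_quot(1)[OF M W] and Wm = equiv_rel_quot(2)[OF M W]
  note \<beta>h = regular_epi_Hom[OF Wr]
  have \<beta>f: "is_regular_epi C X W (\<beta> \<odot> f)" using regular_epi_Cmp[OF F(5) Wr] .
  note \<beta>fh = regular_epi_Hom[OF \<beta>f]
  note iR = dir_image_image_of[OF equiv_rel_rel[OF F(1)] \<beta>fh] and iS = dir_image_image_of[OF equiv_rel_rel[OF F(2)] \<beta>fh]
  have cen: "centralizes C W (dir_image C W (\<beta> \<odot> f) R) (dir_image C W (\<beta> \<odot> f) S)"
  proof (rule image_centralizes[OF F(1,2) \<beta>f iR iS])
    fix Z x y assume k: "mem (commutator C X R S) Z x y"
    note xy = mem_Hom[OF equiv_rel_rel[OF commutator_equiv[OF F(1,2)]] k]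
    show "(\<beta> \<odot> f) \<odot> x = (\<beta> \<odot> f) \<odot> y"
      using Wm[OF Cmp_Hom[OF xy(1) fh] Cmp_Hom[OF xy(2) fh]] fM[OF k] Cmp_assoc[OF xy(1) fh \<beta>h] Cmp_assoc[OF xy(2) fh \<beta>h] by simp
  qed
  have im: "mem U Z (\<beta> \<odot> a) (\<beta> \<odot> b)"
    if U: "image_of W (\<beta> \<odot> f) T U" and T: "reflects X f T T'" "is_equiv_rel C Y T'" and m: "mem T' Z a b" for T T' U Z a b
  proof -
    note ab = mem_Hom[OF equiv_rel_rel[OF T(2)] m]
    obtain Z' e x y where e: "is_regular_epi C Z' Z e" "x \<in> Hom C Z' X" "y \<in> Hom C Z' X" "f \<odot> x = a \<odot> e" "f \<odot> y = b \<odot> e"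
      using regular_epi_lift2[OF F(5) ab] .
    note e' = regular_epi_Hom[OF e(1)]
    have "mem T Z' x y" using reflectsD[OF T(1) e(2,3)] e mem_reindex[OF equiv_rel_rel[OF T(2)] m e'] by simp
    moreover have "(\<beta> \<odot> f) \<odot> x = (\<beta> \<odot> a) \<odot> e" "(\<beta> \<odot> f) \<odot> y = (\<beta> \<odot> b) \<odot> e"
      using Cmp_assoc[OF e(2) fh \<beta>h] Cmp_assoc[OF e(3) fh \<beta>h] e Cmp_assoc[OF e' ab(1) \<beta>h] Cmp_assoc[OF e' ab(2) \<beta>h] by simp_all
    ultimately show ?thesis using image_of_local[OF U e(1)] Cmp_Hom[OF ab(1) \<beta>h] Cmp_Hom[OF ab(2) \<beta>h] by blast
  qed
  have "\<beta> \<odot> a = \<beta> \<odot> b"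
    using commutator_kill[OF F(3,4) \<beta>h equiv_rel_image[OF \<beta>f F(1) iR] equiv_rel_image[OF \<beta>f F(2) iS]
       im[OF iR F(6,3)] im[OF iS F(7,4)] cen m] .
  then show ?thesis using Wm mem_Hom[OF equiv_rel_rel[OF commutator_equiv[OF F(3,4)]] m] by blast
qed

text \<open>The assumption makes (q, f) jointly monic, hence a relation V from Q to Y. The square is
  a pullback once V contains every pair (b, a) with h b = q' a, and V is difunctional.\<close>

lemma discrete_trivial_ext:
  assumes fib: "fibration C (X, R, S) (Y, R', S') f"
    and disc: "\<And>Z x y. mem (commutator C X R S) Z x y \<Longrightarrow> f \<odot> x = f \<odot> y \<Longrightarrow> x = y"
  shows "trivial_ext (Gamma_F C) (X, R, S) (Y, R', S') f"
proof -
  note F = fibrationD[OF fib]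
  note fh = regular_epi_Hom[OF F(5)]
  note Keq = commutator_equiv[OF F(1,2)]
  obtain Q q RQ SQ where Q: "conn_ob C (X, R, S) = (Q, RQ, SQ)" "conn_unit C (X, R, S) = q"
    "is_regular_epi C X Q q"
    "\<forall>Z a b. a \<in> Hom C Z X \<and> b \<in> Hom C Z X \<longrightarrow> (mem (commutator C X R S) Z a b \<longleftrightarrow> q \<odot> a = q \<odot> b)"
    "image_of Q q R RQ" "image_of Q q S SQ" "is_equiv_rel C Q RQ" "is_equiv_rel C Q SQ" "centralizes C Q RQ SQ"
    by (rule conn_reflection[OF F(1,2)])
  obtain Q' q' RQ' SQ' where Q': "conn_ob C (Y, R', S') = (Q', RQ', SQ')" "conn_unit C (Y, R', S') = q'"
    "is_regular_epi C Y Q' q'"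
    "\<forall>Z a b. a \<in> Hom C Z Y \<and> b \<in> Hom C Z Y \<longrightarrow> (mem (commutator C Y R' S') Z a b \<longleftrightarrow> q' \<odot> a = q' \<odot> b)"
    "image_of Q' q' R' RQ'" "image_of Q' q' S' SQ'" "is_equiv_rel C Q' RQ'" "is_equiv_rel C Q' SQ'" "centralizes C Q' RQ' SQ'"
    by (rule conn_reflection[OF F(3,4)])
  note qh = regular_epi_Hom[OF Q(3)] and qh' = regular_epi_Hom[OF Q'(3)]
  have f2: "f \<in> Hom (TwoEq C) (X, R, S) (Y, R', S')" using fibration_Hom[OF fib] .
  define h where "h = FA (conn_reflector C) (X, R, S) (Y, R', S') f"
  have h2: "h \<in> Hom (TwoEq C) (Q, RQ, SQ) (Q', RQ', SQ')" and hq: "h \<odot> q = q' \<odot> f"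
    using conn_reflector_arrow[OF f2] unfolding h_def Q(1,2) Q'(1,2) .
  have hh: "h \<in> Hom C Q Q'" using h2 unfolding TwoEq_Hom by blast
  have q2: "q \<in> Hom (TwoEq C) (X, R, S) (Q, RQ, SQ)"
    unfolding TwoEq_Hom using qh F Q(7,8) image_ofI[OF equiv_rel_rel[OF F(1)] qh Q(5)] image_ofI[OF equiv_rel_rel[OF F(2)] qh Q(6)] by blast
  have q2': "q' \<in> Hom (TwoEq C) (Y, R', S') (Q', RQ', SQ')"
    unfolding TwoEq_Hom using qh' F Q'(7,8) image_ofI[OF equiv_rel_rel[OF F(3)] qh' Q'(5)] image_ofI[OF equiv_rel_rel[OF F(4)] qh' Q'(6)] by blast
  have jm: "x = y" if "x \<in> Hom C Z X" "y \<in> Hom C Z X" "f \<odot> x = f \<odot> y" "q \<odot> x = q \<odot> y" for Z x y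
    using disc Q(4) that by blast
  define V where "V = (X, q, f)"
  have V: "apex V = X" "leg0 V = q" "leg1 V = f" by (simp_all add: V_def)
  have Vr: "rel Q Y V" unfolding rel_def V using qh fh jm by blast
  have memV: "mem V Z (q \<odot> x) (f \<odot> x)" if "x \<in> Hom C Z X" for Z x using memI[of x Z V] that V by simp
  have "is_pullback C Y Q Q' q' h X f q"
  proof (rule is_pullbackI[OF qh' hh fh qh hq[symmetric]])
    fix Z a b assume ab: "a \<in> Hom C Z Y" "b \<in> Hom C Z Q" "q' \<odot> a = h \<odot> b"
    obtain Z1 e x where x: "is_regular_epi C Z1 Z e" "x \<in> Hom C Z1 X" "q \<odot> x = b \<odot> e"
      using regular_epi_lift[OF Q(3) ab(2)] .
    note eh = regular_epi_Hom[OF x(1)]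
    have ae: "a \<odot> e \<in> Hom C Z1 Y" "b \<odot> e \<in> Hom C Z1 Q" and fx: "f \<odot> x \<in> Hom C Z1 Y" using ab eh x fh Cmp_Hom by blast+
    \<comment> \<open>For a lift x of b, the elements f x and a have the same image under q', so
      they are related by [R', S'] and hence by the image of [R, S]: locally they are f y and f z
      with q y = q z.\<close>
    have "q' \<odot> (f \<odot> x) = h \<odot> (q \<odot> x)" using Cmp_square[OF qh hh fh qh' hq x(2)] by simp
    also have "\<dots> = q' \<odot> (a \<odot> e)" using x(3) Cmp_assoc[OF eh ab(1) qh'] Cmp_assoc[OF eh ab(2) hh] ab(3) by simp
    finally have K': "mem (commutator C Y R' S') Z1 (f \<odot> x) (a \<odot> e)" using Q'(4) fx ae by blast
    define M where "M = dir_image C Y f (commutator C X R S)"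
    have iM: "image_of Y f (commutator C X R S) M"
      unfolding M_def using dir_image_image_of[OF equiv_rel_rel[OF Keq] fh] .
    have "mem M Z1 (f \<odot> x) (a \<odot> e)"
      using commutator_image[OF fib equiv_rel_image[OF F(5) Keq iM] image_ofI[OF equiv_rel_rel[OF Keq] fh iM] K'] .
    then obtain Z2 d y z where d: "is_regular_epi C Z2 Z1 d" "mem (commutator C X R S) Z2 y z" "f \<odot> y = (f \<odot> x) \<odot> d" "f \<odot> z = (a \<odot> e) \<odot> d"
      by (rule image_ofE[OF iM])
    note dh = regular_epi_Hom[OF d(1)] and yz = mem_Hom[OF equiv_rel_rel[OF Keq] d(2)]
    have qyz: "q \<odot> y = q \<odot> z" using Q(4) yz d(2) by blast
    have xd: "x \<odot> d \<in> Hom C Z2 X" using x dh Cmp_Hom by blast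
    \<comment> \<open>The zigzag for difunctionality: V relates q x and q y to f y, and q y = q z to
      f z; so it relates q x = b to f z = a.\<close>
    have "mem V Z2 (q \<odot> (x \<odot> d)) (f \<odot> y)" using memV[OF xd] d(3) Cmp_assoc[OF dh x(2) fh] by simp
    moreover have "mem V Z2 (q \<odot> y) (f \<odot> y)" using memV yz by blast
    moreover have "mem V Z2 (q \<odot> y) (f \<odot> z)" using memV[OF yz(2)] qyz by simp
    ultimately have "mem V Z2 (q \<odot> (x \<odot> d)) (f \<odot> z)" using difunctional[OF Vr] by blast
    then have "mem V Z2 ((b \<odot> e) \<odot> d) ((a \<odot> e) \<odot> d)" using Cmp_assoc[OF dh x(2) qh] x(3) d(4) by simp
    then have "mem V Z1 (b \<odot> e) (a \<odot> e)" using mem_local[OF Vr d(1) ae(2,1)] by blast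
    then have "mem V Z b a" using mem_local[OF Vr x(1) ab(2,1)] by blast
    then show "\<exists>k. k \<in> Hom C Z X \<and> f \<odot> k = a \<and> q \<odot> k = b" unfolding mem_def V by blast
  next
    fix Z u v assume "u \<in> Hom C Z X" "v \<in> Hom C Z X" "f \<odot> u = f \<odot> v" "q \<odot> u = q \<odot> v"
    then show "u = v" by (rule jm)
  qed
  then have "is_pullback (TwoEq C) (Y, R', S') (Q, RQ, SQ) (Q', RQ', SQ') q' h (X, R, S) f q"
    by (rule TwoEq_pullbackI[OF _ q2' h2 f2 q2]) (use reflectsD[OF F(6)] reflectsD[OF F(7)] in blast)+
  then show ?thesis
    unfolding trivial_ext_def using fib by (simp add: Q(1,2) Q'(1,2) h_def del: conn_ob.simps conn_unit.simps)
qed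

text \<open>Transport along R followed by S is composition; the issue is discreteness. If a goes by
  \<Theta> to c and by \<Psi> to b, back over the original end point, the end points of a and c are
  related by both R and S. The meet of \<Theta> and \<Psi> transports along the meet of R and S, and
  uniqueness for \<Theta> shows that it also carries a to c.\<close>

lemma transport_join:
  assumes N: "is_equiv_rel C X N" and R: "is_equiv_rel C X R" and S: "is_equiv_rel C X S"
    and \<Theta>: "transport N R \<Theta>" "discrete N \<Theta>" and \<Psi>: "transport N S \<Psi>" "discrete N \<Psi>"
  obtains \<Omega> where "is_equiv_rel C (apex N) \<Omega>" "lifts_diagonally N (rel_join C X R S) \<Omega>" "discrete N \<Omega>"
proof -
  note Nr = equiv_rel_rel[OF N]
  note lN = rel_leg[OF Nr]
  note \<Theta>eq = transportD(1)[OF \<Theta>(1)] and \<Psi>eq = transportD(1)[OF \<Psi>(1)]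
  note \<Theta>r = equiv_rel_rel[OF \<Theta>eq] and \<Psi>r = equiv_rel_rel[OF \<Psi>eq]
  obtain \<Omega> where \<Omega>: "is_equiv_rel C (apex N) \<Omega>"
    "\<forall>Z a c. mem \<Omega> Z a c \<longleftrightarrow> a \<in> Hom C Z (apex N) \<and> c \<in> Hom C Z (apex N) \<and>
      (\<exists>Z' e b. is_regular_epi C Z' Z e \<and> mem \<Theta> Z' (a \<odot> e) b \<and> mem \<Psi> Z' b (c \<odot> e))"
    "\<forall>Z a b c. mem \<Theta> Z a b \<and> mem \<Psi> Z b c \<longrightarrow> mem \<Omega> Z a c"
    using equiv_rel_comp[OF \<Theta>eq \<Psi>eq] .
  obtain T where T: "is_equiv_rel C X T" "\<forall>Z a b. mem T Z a b \<longleftrightarrow> mem R Z a b \<and> mem S Z a b"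
    using equiv_rel_meet[OF R S] .
  obtain \<Phi> where \<Phi>: "is_equiv_rel C (apex N) \<Phi>" "\<forall>Z a b. mem \<Phi> Z a b \<longleftrightarrow> mem \<Theta> Z a b \<and> mem \<Psi> Z a b"
    using equiv_rel_meet[OF \<Theta>eq \<Psi>eq] .
  have "lifts_diagonally N T \<Phi>"
    using transportD(2)[OF \<Theta>(1)] transportD(2)[OF \<Psi>(1)] T(2) \<Phi>(2) unfolding lifts_diagonally_def by blast
  note ex = transport_exists[OF N T(1) \<Phi>(1) this]
  have "lifts_diagonally N (rel_join C X R S) \<Omega>"
    unfolding lifts_diagonally_def
  proof (intro allI impI, elim conjE)
    fix Z r s assume h: "r \<in> Hom C Z (apex N)" "s \<in> Hom C Z (apex N)" "leg0 N \<odot> r = leg1 N \<odot> r"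
        "leg0 N \<odot> s = leg1 N \<odot> s" "mem (rel_join C X R S) Z (leg1 N \<odot> r) (leg1 N \<odot> s)"
    obtain Z' e b where e: "is_regular_epi C Z' Z e" "mem R Z' ((leg1 N \<odot> r) \<odot> e) b" "mem S Z' b ((leg1 N \<odot> s) \<odot> e)"
      using rel_join(2)[OF R S, of Z "leg1 N \<odot> r" "leg1 N \<odot> s"] h(5) by blast
    note eh = regular_epi_Hom[OF e(1)]
    have "b \<in> Hom C Z' X" using mem_Hom[OF equiv_rel_rel[OF R] e(2)] by blast
    then obtain d where d: "d \<in> Hom C Z' (apex N)" "leg0 N \<odot> d = b" "leg1 N \<odot> d = b"
      by (rule equiv_rel_diagonal[OF N])
    have re: "r \<odot> e \<in> Hom C Z' (apex N)" "s \<odot> e \<in> Hom C Z' (apex N)" using h eh Cmp_Hom by blast+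
    have ass: "leg0 N \<odot> (r \<odot> e) = leg1 N \<odot> (r \<odot> e)" "leg0 N \<odot> (s \<odot> e) = leg1 N \<odot> (s \<odot> e)"
      "leg1 N \<odot> (r \<odot> e) = (leg1 N \<odot> r) \<odot> e" "leg1 N \<odot> (s \<odot> e) = (leg1 N \<odot> s) \<odot> e"
      using Cmp_assoc[OF eh h(1) lN(1)] Cmp_assoc[OF eh h(1) lN(2)] Cmp_assoc[OF eh h(2) lN(1)] Cmp_assoc[OF eh h(2) lN(2)] h(3,4)
      by simp_all
    have "mem \<Theta> Z' (r \<odot> e) d"
      using lifts_diagonallyD[OF transportD(2)[OF \<Theta>(1)] re(1) d(1) ass(1)] d ass e by simp
    moreover have "mem \<Psi> Z' d (s \<odot> e)"
      using lifts_diagonallyD[OF transportD(2)[OF \<Psi>(1)] d(1) re(2) _ ass(2)] d ass e by simp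
    ultimately show "mem \<Omega> Z r s" using \<Omega>(2) h e(1) by blast
  qed
  moreover have "discrete N \<Omega>"
    unfolding discrete_def
  proof (intro allI impI, elim conjE)
    fix Z a b assume m: "mem \<Omega> Z a b" and eq: "leg1 N \<odot> a = leg1 N \<odot> b"
    obtain Z' e c where e: "is_regular_epi C Z' Z e" "mem \<Theta> Z' (a \<odot> e) c" "mem \<Psi> Z' c (b \<odot> e)"
      using m \<Omega>(2) by blast
    note ab = mem_Hom[OF equiv_rel_rel[OF \<Omega>(1)] m] and eh = regular_epi_Hom[OF e(1)]
    note c = mem_Hom[OF \<Theta>r e(2)] and be = mem_Hom(2)[OF \<Psi>r e(3)]
    have eq': "leg1 N \<odot> (a \<odot> e) = leg1 N \<odot> (b \<odot> e)"
      using Cmp_assoc[OF eh ab(1) lN(2)] Cmp_assoc[OF eh ab(2) lN(2)] eq by simp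
    have "mem R Z' (leg1 N \<odot> (a \<odot> e)) (leg1 N \<odot> c)" using transportD(3)[OF \<Theta>(1) e(2)] .
    moreover have "mem S Z' (leg1 N \<odot> (a \<odot> e)) (leg1 N \<odot> c)"
      using equiv_rel_sym[OF S transportD(3)[OF \<Psi>(1) e(3)]] eq' by simp
    ultimately have "mem T Z' (leg1 N \<odot> (a \<odot> e)) (leg1 N \<odot> c)" using T(2) by blast
    then obtain Z2 d c' where d: "is_regular_epi C Z2 Z' d" "mem \<Phi> Z2 ((a \<odot> e) \<odot> d) c'" "leg1 N \<odot> c' = (leg1 N \<odot> c) \<odot> d"
      by (rule ex[OF c(1)])
    note dh = regular_epi_Hom[OF d(1)]
    have d\<Theta>: "mem \<Theta> Z2 ((a \<odot> e) \<odot> d) c'" and d\<Psi>: "mem \<Psi> Z2 ((a \<odot> e) \<odot> d) c'" using d(2) \<Phi>(2) by blast+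
    \<comment> \<open>Both c' and c are \<Theta>-related to a over the same end point, hence equal.
      So a is \<Psi>-related to c, thus to b, and discreteness of \<Psi> finishes.\<close>
    have "mem \<Theta> Z2 c' (c \<odot> d)"
      using equiv_rel_trans[OF \<Theta>eq equiv_rel_sym[OF \<Theta>eq d\<Theta>] mem_reindex[OF \<Theta>r e(2) dh]] .
    then have "c' = c \<odot> d"
      by (rule discreteD[OF \<Theta>(2)]) (use d(3) Cmp_assoc[OF dh c(2) lN(2)] in simp)
    then have "mem \<Psi> Z2 ((a \<odot> e) \<odot> d) ((b \<odot> e) \<odot> d)"
      using equiv_rel_trans[OF \<Psi>eq d\<Psi>] mem_reindex[OF \<Psi>r e(3) dh] by simp
    then have "(a \<odot> e) \<odot> d = (b \<odot> e) \<odot> d"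
      by (rule discreteD[OF \<Psi>(2)]) (use Cmp_assoc[OF dh c(1) lN(2)] Cmp_assoc[OF dh be lN(2)] eq' in simp)
    then have "a \<odot> e = b \<odot> e" using regular_epi_cancel[OF d(1) c(1) be] by blast
    then show "a = b" using regular_epi_cancel[OF e(1) ab] by blast
  qed
  ultimately show ?thesis using that \<Omega>(1) by blast
qed

text \<open>A discrete relation leaves no ambiguity, so the bound it gives for the commutator is the
  diagonal.\<close>

lemma transport_commutator_diag:
  assumes N: "is_equiv_rel C X N" and T: "is_equiv_rel C X T"
    and \<Omega>: "is_equiv_rel C (apex N) \<Omega>" "lifts_diagonally N T \<Omega>" "discrete N \<Omega>"
  shows "rel_eq C (commutator C X N T) (diag_rel C X)"
proof -
  have X: "X \<in> Ob C" using rel_leg(1)[OF equiv_rel_rel[OF N]] Ob_cod by blast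
  note D = equiv_rel_diag[OF X]
  note Keq = commutator_equiv[OF N T]
  have le: "mem (diag_rel C X) Z a b" if "mem (commutator C X N T) Z a b" for Z a b
  proof (rule commutator_le[OF N T \<Omega>(1,2) equiv_rel_rel[OF D] _ that])
    fix Z a b assume m: "mem \<Omega> Z a b" "leg1 N \<odot> a = leg1 N \<odot> b"
    then have "a = b" by (rule discreteD[OF \<Omega>(3)])
    then show "mem (diag_rel C X) Z (leg0 N \<odot> a) (leg0 N \<odot> b)"
      unfolding mem_diag[OF X] using mem_Hom[OF equiv_rel_rel[OF \<Omega>(1)] m(1)] rel_leg(1)[OF equiv_rel_rel[OF N]] Cmp_Hom by blast
  qed
  moreover have "mem (commutator C X N T) Z a b" if "mem (diag_rel C X) Z a b" for Z a b
    using that equiv_rel_refl[OF Keq] unfolding mem_diag[OF X] by auto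
  ultimately show ?thesis
    unfolding rel_eq_iff[OF equiv_rel_rel[OF Keq] equiv_rel_rel[OF D]] by blast
qed

section \<open>Kernel pairs as equivalence relations\<close>

lemma ker_rel_kernel_pair:
  assumes f: "f \<in> Hom C X Y"
  shows "is_pullback C X X Y f f (apex (ker_rel C X Y f)) (leg0 (ker_rel C X Y f)) (leg1 (ker_rel C X Y f))"
proof -
  obtain P p q where "is_pullback C X X Y f f P p q" using pullback_exists[OF f f] .
  then have "case (P, p, q) of (P, p, q) \<Rightarrow> is_kernel_pair C X Y f P p q" unfolding is_kernel_pair_def by simp
  then have "case ker_rel C X Y f of (P, p, q) \<Rightarrow> is_kernel_pair C X Y f P p q"
    unfolding ker_rel_def by (rule someI)
  then show ?thesis unfolding is_kernel_pair_def by (simp add: case_prod_beta)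
qed

lemma kernel_pair_equiv_rel:
  assumes P: "is_pullback C X X Y f f (apex N) (leg0 N) (leg1 N)"
  shows "is_equiv_rel C X N" "mem N Z a b \<longleftrightarrow> a \<in> Hom C Z X \<and> b \<in> Hom C Z X \<and> f \<odot> a = f \<odot> b"
proof -
  note h = pullback_Hom[OF P]
  have r: "rel X X N" unfolding rel_def using h pullback_unique[OF P] by blast
  have m: "mem N Z a b \<longleftrightarrow> a \<in> Hom C Z X \<and> b \<in> Hom C Z X \<and> f \<odot> a = f \<odot> b" for Z a b
  proof
    assume "mem N Z a b"
    then show "a \<in> Hom C Z X \<and> b \<in> Hom C Z X \<and> f \<odot> a = f \<odot> b"
      using mem_Hom[OF r, of Z a b] pullback_square[OF P] unfolding mem_def by blast
  next
    assume "a \<in> Hom C Z X \<and> b \<in> Hom C Z X \<and> f \<odot> a = f \<odot> b"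
    then obtain w where "w \<in> Hom C Z (apex N)" "leg0 N \<odot> w = a" "leg1 N \<odot> w = b" using pullback_lift[OF P] by metis
    then show "mem N Z a b" unfolding mem_def by blast
  qed
  show "mem N Z a b \<longleftrightarrow> a \<in> Hom C Z X \<and> b \<in> Hom C Z X \<and> f \<odot> a = f \<odot> b" by (rule m)
  show "is_equiv_rel C X N" by (rule reflexive_equiv[OF r]) (use m in blast)
qed

end

section \<open>Central and normal extensions\<close>


context exact_maltsev
begin

lemma rel_join_upper:
  assumes R: "is_equiv_rel C X R" and S: "is_equiv_rel C X S"
  shows "mem R Z a b \<Longrightarrow> mem (rel_join C X R S) Z a b" "mem S Z a b \<Longrightarrow> mem (rel_join C X R S) Z a b"
proof -
  have *: "mem (rel_join C X R S) Z a c" if "mem R Z a b" "mem S Z b c" for a b c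
  proof -
    note a = mem_Hom(1)[OF equiv_rel_rel[OF R] that(1)] and c = mem_Hom(2)[OF equiv_rel_rel[OF S] that(2)]
    have "is_regular_epi C Z Z (Idn C Z) \<and> mem R Z (a \<odot> Idn C Z) b \<and> mem S Z b (c \<odot> Idn C Z)"
      using regular_epi_Idn[OF mem_Ob[OF that(1)]] that Idn_right[OF a] Idn_right[OF c] by simp
    then show ?thesis using rel_join(2)[OF R S, of Z a c] a c by blast
  qed
  show "mem R Z a b \<Longrightarrow> mem (rel_join C X R S) Z a b"
    using *[of a b b] equiv_rel_refl[OF S] mem_Hom[OF equiv_rel_rel[OF R]] by blast
  show "mem S Z a b \<Longrightarrow> mem (rel_join C X R S) Z a b"
    using *[of a a b] equiv_rel_refl[OF R] mem_Hom[OF equiv_rel_rel[OF S]] by blast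
qed

text \<open>The inverse image of \<Delta> along the inclusion of N in R. Two start points over one
  end point are then related by K and both N-related to that end point, which \<open>disc\<close>
  turns into equality.\<close>

lemma transport_restrict:
  assumes N: "is_equiv_rel C X N" and R: "is_equiv_rel C X R"
    and le: "\<And>Z a b. mem N Z a b \<Longrightarrow> mem R Z a b"
    and \<Delta>: "transport R S \<Delta>"
    and K: "\<forall>Z a b. mem \<Delta> Z a b \<and> leg1 R \<odot> a = leg1 R \<odot> b \<longrightarrow> mem K Z (leg0 R \<odot> a) (leg0 R \<odot> b)"
    and disc: "\<And>Z x y z. mem N Z x z \<Longrightarrow> mem N Z y z \<Longrightarrow> mem K Z x y \<Longrightarrow> x = y"
  obtains \<Theta> where "transport N S \<Theta>" "discrete N \<Theta>"
proof -
  note Nr = equiv_rel_rel[OF N] and Rr = equiv_rel_rel[OF R]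
  note lN = rel_leg[OF Nr]
  note \<Delta>eq = transportD(1)[OF \<Delta>]
  obtain j where j: "j \<in> Hom C (apex N) (apex R)" "leg0 R \<odot> j = leg0 N" "leg1 R \<odot> j = leg1 N"
    using le[OF mem_generic[OF Nr]] by (rule memE)
  have ja: "leg0 R \<odot> (j \<odot> r) = leg0 N \<odot> r" "leg1 R \<odot> (j \<odot> r) = leg1 N \<odot> r" if "r \<in> Hom C Z (apex N)" for Z r
    using Cmp_reassoc[OF j(1) rel_leg(1)[OF Rr] j(2) that] Cmp_reassoc[OF j(1) rel_leg(2)[OF Rr] j(3) that] by auto
  obtain \<Theta> where \<Theta>: "is_equiv_rel C (apex N) \<Theta>" "\<forall>Z a b. mem \<Theta> Z a b \<longleftrightarrow> a \<in> Hom C Z (apex N) \<and> b \<in> Hom C Z (apex N) \<and>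
      mem \<Delta> Z (j \<odot> a) (j \<odot> b)" using equiv_rel_inverse[OF \<Delta>eq j(1)] .
  have "lifts_diagonally N S \<Theta>"
    unfolding lifts_diagonally_def
  proof (intro allI impI, elim conjE)
    fix Z r s assume h: "r \<in> Hom C Z (apex N)" "s \<in> Hom C Z (apex N)" "leg0 N \<odot> r = leg1 N \<odot> r"
        "leg0 N \<odot> s = leg1 N \<odot> s" "mem S Z (leg1 N \<odot> r) (leg1 N \<odot> s)"
    then have "mem \<Delta> Z (j \<odot> r) (j \<odot> s)"
      using lifts_diagonallyD[OF transportD(2)[OF \<Delta>] Cmp_Hom[OF h(1) j(1)] Cmp_Hom[OF h(2) j(1)]] ja by simp
    then show "mem \<Theta> Z r s" using \<Theta>(2) h by blast
  qed
  moreover have "mem S Z (leg1 N \<odot> r) (leg1 N \<odot> s)" if m: "mem \<Theta> Z r s" for Z r s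
  proof -
    have h: "r \<in> Hom C Z (apex N)" "s \<in> Hom C Z (apex N)" "mem \<Delta> Z (j \<odot> r) (j \<odot> s)" using m \<Theta>(2) by blast+
    show ?thesis using transportD(3)[OF \<Delta> h(3)] ja h by simp
  qed
  moreover have "discrete N \<Theta>"
    unfolding discrete_def
  proof (intro allI impI, elim conjE)
    fix Z r s assume m: "mem \<Theta> Z r s" and eq: "leg1 N \<odot> r = leg1 N \<odot> s"
    have h: "r \<in> Hom C Z (apex N)" "s \<in> Hom C Z (apex N)" "mem \<Delta> Z (j \<odot> r) (j \<odot> s)" using m \<Theta>(2) by blast+
    have "mem K Z (leg0 N \<odot> r) (leg0 N \<odot> s)" using K h(3) ja[OF h(1)] ja[OF h(2)] eq by metis
    then have "leg0 N \<odot> r = leg0 N \<odot> s" using disc memI[OF h(1)] memI[OF h(2)] eq by metis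
    then show "r = s" using rel_joint_mono[OF Nr h(1,2)] eq by blast
  qed
  ultimately show ?thesis using that \<Theta>(1) unfolding transport_def by blast
qed

lemma image_of_reflects:
  assumes f: "is_regular_epi C X Y f" and R': "is_equiv_rel C Y R'" and R: "is_equiv_rel C X R" and r: "reflects X f R R'"
  shows "image_of Y f R R'"
  unfolding image_of_def
proof (intro conjI allI iffI; (elim conjE exE)?)
  note fh = regular_epi_Hom[OF f]
  fix Z a b
  {
    assume m: "mem R' Z a b"
    note ab = mem_Hom[OF equiv_rel_rel[OF R'] m]
    then show "a \<in> Hom C Z Y" "b \<in> Hom C Z Y" .
    obtain Z' e x y where e: "is_regular_epi C Z' Z e" "x \<in> Hom C Z' X" "y \<in> Hom C Z' X" "f \<odot> x = a \<odot> e" "f \<odot> y = b \<odot> e"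
      using regular_epi_lift2[OF f ab] .
    have "mem R Z' x y"
      using reflectsD[OF r e(2,3)] e mem_reindex[OF equiv_rel_rel[OF R'] m regular_epi_Hom[OF e(1)]] by simp
    then show "\<exists>Z' e x y. is_regular_epi C Z' Z e \<and> mem R Z' x y \<and> f \<odot> x = a \<odot> e \<and> f \<odot> y = b \<odot> e"
      using e by blast
  next
    fix Z' e x y assume h: "a \<in> Hom C Z Y" "b \<in> Hom C Z Y" "is_regular_epi C Z' Z e" "mem R Z' x y" "f \<odot> x = a \<odot> e" "f \<odot> y = b \<odot> e"
    have "mem R' Z' (a \<odot> e) (b \<odot> e)" using reflectsD[OF r mem_Hom[OF equiv_rel_rel[OF R] h(4)]] h by simp
    then show "mem R' Z a b" using mem_local[OF equiv_rel_rel[OF R'] h(3,1,2)] by blast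
  }
qed (rule equiv_rel_rel[OF R'])

lemma central_ext_commutator:
  assumes fib: "fibration C (X, R, S) (X', R', S') f"
    and cen: "central_ext (Gamma_F C) (X, R, S) (X', R', S') f"
  shows "rel_eq C (commutator C X (ker_rel C X X' f) (rel_join C X R S)) (diag_rel C X)"
proof -
  note F = fibrationD[OF fib]
  note fh = regular_epi_Hom[OF F(5)]
  obtain E g P p q where g: "fibration C E (X', R', S') g"
    and pb: "is_pullback (TwoEq C) (X, R, S) E (X', R', S') f g P p q" and tr: "trivial_ext (Gamma_F C) P E q"
    using cen unfolding central_ext_def monadic_ext_def by auto
  obtain P0 RP SP where P: "P = (P0, RP, SP)" by (cases P)
  obtain E0 RE SE where E: "E = (E0, RE, SE)" by (cases E)
  \<comment> \<open>Up to swapping legs, p is the pullback of the fibration g; it carries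
    conclusions about P down to X.\<close>
  have fp: "fibration C P (X, R, S) p"
    using fibration_pullback[OF g category.is_pullback_swap[OF category_TwoEq pb]] .
  note Fp = fibrationD[OF fp[unfolded P]]
  have "fibration C P E q" using tr unfolding trivial_ext_def by simp
  note Fq = fibrationD[OF this[unfolded P E]]
  note ph = regular_epi_Hom[OF Fp(5)] and qh = regular_epi_Hom[OF Fq(5)]
  note pbC = TwoEq_pullback_forget[OF pb[unfolded P E]]
  define Nf where "Nf = ker_rel C X X' f"
  note kp = ker_rel_kernel_pair[OF fh, folded Nf_def]
  note Nf = kernel_pair_equiv_rel[OF kp]
  obtain N where N: "is_equiv_rel C P0 N" "\<forall>Z a b. mem N Z a b \<longleftrightarrow> a \<in> Hom C Z P0 \<and> b \<in> Hom C Z P0 \<and> q \<odot> a = q \<odot> b"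
    using equiv_rel_kernel[OF qh] .
  \<comment> \<open>q is a fibration, so its kernel pair N lies below both relations of P and each
    transport can be restricted to it.\<close>
  have NRP: "mem RP Z a b" and NSP: "mem SP Z a b" if "mem N Z a b" for Z a b
  proof -
    have h: "a \<in> Hom C Z P0" "b \<in> Hom C Z P0" "q \<odot> a = q \<odot> b" using that N(2) by blast+
    show "mem RP Z a b" "mem SP Z a b"
      using reflectsD[OF Fq(6) h(1,2)] reflectsD[OF Fq(7) h(1,2)] h(3)
        equiv_rel_refl[OF Fq(3) Cmp_Hom[OF h(2) qh]] equiv_rel_refl[OF Fq(4) Cmp_Hom[OF h(2) qh]] by simp_all
  qed
  have disc: "x = y" if "mem N Z x z" "mem N Z y z" "mem (commutator C P0 RP SP) Z x y" for Z x y z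
    using trivial_ext_discrete[OF tr[unfolded P E] that(3)] that(1,2) N(2) by simp
  obtain \<Delta>1 where \<Delta>1: "transport RP SP \<Delta>1" "\<forall>Z a b. mem \<Delta>1 Z a b \<and> leg1 RP \<odot> a = leg1 RP \<odot> b \<longrightarrow>
      mem (commutator C P0 RP SP) Z (leg0 RP \<odot> a) (leg0 RP \<odot> b)"
    using commutator_transport[OF Fp(1,2)] .
  obtain \<Theta>1 where \<Theta>1: "transport N SP \<Theta>1" "discrete N \<Theta>1"
    using transport_restrict[OF N(1) Fp(1) NRP \<Delta>1 disc] .
  \<comment> \<open>Both transports have their ambiguity in the same commutator [RP, SP], which
    meets N in the diagonal because q is trivial.\<close>
  obtain \<Delta>2 where \<Delta>2: "transport SP RP \<Delta>2" "\<forall>Z a b. mem \<Delta>2 Z a b \<and> leg1 SP \<odot> a = leg1 SP \<odot> b \<longrightarrow>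
      mem (commutator C P0 RP SP) Z (leg0 SP \<odot> a) (leg0 SP \<odot> b)"
    using commutator_transport_swap[OF Fp(1,2)] .
  obtain \<Theta>2 where \<Theta>2: "transport N RP \<Theta>2" "discrete N \<Theta>2"
    using transport_restrict[OF N(1) Fp(2) NSP \<Delta>2 disc] .
  \<comment> \<open>p maps Eq[q] onto Eq[f]: if f a = f b and x lies over a, the pullback supplies y
    over b with q y = q x.\<close>
  have iN: "image_of X p N Nf"
    unfolding image_of_def
  proof (intro conjI allI iffI; (elim conjE exE)?)
    fix Z a b
    {
      assume m: "mem Nf Z a b"
      then show ab: "a \<in> Hom C Z X" "b \<in> Hom C Z X" using Nf(2) by blast+
      have fab: "f \<odot> a = f \<odot> b" using m Nf(2) by blast
      obtain Z' e x where x: "is_regular_epi C Z' Z e" "x \<in> Hom C Z' P0" "p \<odot> x = a \<odot> e"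
        using regular_epi_lift[OF Fp(5) ab(1)] .
      note eh = regular_epi_Hom[OF x(1)]
      have be: "b \<odot> e \<in> Hom C Z' X" and qx: "q \<odot> x \<in> Hom C Z' E0" using ab eh x qh Cmp_Hom by blast+
      have "f \<odot> (b \<odot> e) = g \<odot> (q \<odot> x)"
        using pullback_square[OF pbC x(2)] x(3) fab Cmp_assoc[OF eh ab(1) fh] Cmp_assoc[OF eh ab(2) fh] by simp
      then obtain y where y: "y \<in> Hom C Z' P0" "p \<odot> y = b \<odot> e" "q \<odot> y = q \<odot> x"
        using pullback_lift[OF pbC be qx] by metis
      then have "mem N Z' x y" using N(2) x by simp
      then show "\<exists>Z' e x y. is_regular_epi C Z' Z e \<and> mem N Z' x y \<and> p \<odot> x = a \<odot> e \<and> p \<odot> y = b \<odot> e"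
        using x y by blast
    next
      fix Z' e x y assume h: "a \<in> Hom C Z X" "b \<in> Hom C Z X" "is_regular_epi C Z' Z e" "mem N Z' x y" "p \<odot> x = a \<odot> e" "p \<odot> y = b \<odot> e"
      have xy: "x \<in> Hom C Z' P0" "y \<in> Hom C Z' P0" "q \<odot> x = q \<odot> y" using h(4) N(2) by blast+
      note eh = regular_epi_Hom[OF h(3)]
      have "f \<odot> (a \<odot> e) = f \<odot> (b \<odot> e)"
        using pullback_square[OF pbC xy(1)] pullback_square[OF pbC xy(2)] xy(3) h by simp
      then have "(f \<odot> a) \<odot> e = (f \<odot> b) \<odot> e" using Cmp_assoc[OF eh h(1) fh] Cmp_assoc[OF eh h(2) fh] by simp
      then have "f \<odot> a = f \<odot> b"
        using regular_epi_cancel[OF h(3) Cmp_Hom[OF h(1) fh] Cmp_Hom[OF h(2) fh]] by blast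
      then show "mem Nf Z a b" using Nf(2) h by blast
    }
  qed (rule equiv_rel_rel[OF Nf(1)])
  note iR = image_of_reflects[OF Fp(5,3,1,6)] and iS = image_of_reflects[OF Fp(5,4,2,7)]
  have "p \<odot> (leg0 N \<odot> a) = p \<odot> (leg0 N \<odot> b)" if "mem \<Theta>1 Z a b" "leg1 N \<odot> a = leg1 N \<odot> b" for Z a b
    using discreteD[OF \<Theta>1(2) that] by simp
  then obtain \<Psi> where \<Psi>: "transport Nf S \<Psi>" "discrete Nf \<Psi>"
    using transport_image[OF Fp(5) N(1) Fp(2) iN iS \<Theta>1(1)] by blast
  have "p \<odot> (leg0 N \<odot> a) = p \<odot> (leg0 N \<odot> b)" if "mem \<Theta>2 Z a b" "leg1 N \<odot> a = leg1 N \<odot> b" for Z a b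
    using discreteD[OF \<Theta>2(2) that] by simp
  then obtain \<Theta> where \<Theta>: "transport Nf R \<Theta>" "discrete Nf \<Theta>"
    using transport_image[OF Fp(5) N(1) Fp(1) iN iR \<Theta>2(1)] by blast
  obtain \<Omega> where "is_equiv_rel C (apex Nf) \<Omega>" "lifts_diagonally Nf (rel_join C X R S) \<Omega>" "discrete Nf \<Omega>"
    using transport_join[OF Nf(1) F(1,2) \<Theta> \<Psi>] .
  then show ?thesis
    unfolding Nf_def[symmetric] by (rule transport_commutator_diag[OF Nf(1) rel_join(1)[OF F(1,2)]])
qed

lemma commutator_kernel_pair_trivial:
  assumes fib: "fibration C (X, R, S) (X', R', S') f"
    and comm: "rel_eq C (commutator C X (ker_rel C X X' f) (rel_join C X R S)) (diag_rel C X)"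
  obtains P p q where "is_kernel_pair (TwoEq C) (X, R, S) (X', R', S') f P p q"
    "trivial_ext (Gamma_F C) P (X, R, S) p" "trivial_ext (Gamma_F C) P (X, R, S) q"
proof -
  note F = fibrationD[OF fib]
  note fh = regular_epi_Hom[OF F(5)]
  have X: "X \<in> Ob C" using fh Ob_dom by blast
  define N where "N = ker_rel C X X' f"
  define T where "T = rel_join C X R S"
  note kp = ker_rel_kernel_pair[OF fh, folded N_def]
  note N = kernel_pair_equiv_rel[OF kp]
  note Nr = equiv_rel_rel[OF N(1)]
  note lN = rel_leg[OF Nr]
  have T: "is_equiv_rel C X T" unfolding T_def using rel_join(1)[OF F(1,2)] .
  have RT: "mem R Z a b \<Longrightarrow> mem T Z a b" and ST: "mem S Z a b \<Longrightarrow> mem T Z a b" for Z a b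
    unfolding T_def using rel_join_upper[OF F(1,2)] by blast+
  have comm0: "x = y" if "mem (commutator C X N T) Z x y" for Z x y
    using comm that mem_diag[OF X]
    unfolding N_def[symmetric] T_def[symmetric]
      rel_eq_iff[OF equiv_rel_rel[OF commutator_equiv[OF N(1) T]] rel_diag[OF X]] by blast
  obtain \<Delta> where \<Delta>: "transport N T \<Delta>" "\<forall>Z a b. mem \<Delta> Z a b \<and> leg1 N \<odot> a = leg1 N \<odot> b \<longrightarrow>
      mem (commutator C X N T) Z (leg0 N \<odot> a) (leg0 N \<odot> b)"
    using commutator_transport[OF N(1) T] .
  note \<Delta>eq = transportD(1)[OF \<Delta>(1)]
  have \<Delta>disc: "a = b" if "mem \<Delta> Z a b" "leg1 N \<odot> a = leg1 N \<odot> b" for Z a b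
    using rel_joint_mono[OF Nr mem_Hom[OF equiv_rel_rel[OF \<Delta>eq] that(1)]] comm0 \<Delta>(2) that by blast
  \<comment> \<open>\<sigma> exchanges the two entries of an element of Eq[f]. Meeting \<Delta> with
    its conjugate under \<sigma> makes \<Theta> discrete at both ends and keeps the diagonal pairs,
    as \<sigma> fixes diagonal elements.\<close>
  obtain \<sigma> where \<sigma>: "\<sigma> \<in> Hom C (apex N) (apex N)" "leg0 N \<odot> \<sigma> = leg1 N" "leg1 N \<odot> \<sigma> = leg0 N"
    using equiv_rel_sym[OF N(1) mem_generic[OF Nr]] by (rule memE)
  have \<sigma>a: "leg0 N \<odot> (\<sigma> \<odot> a) = leg1 N \<odot> a" "leg1 N \<odot> (\<sigma> \<odot> a) = leg0 N \<odot> a" if "a \<in> Hom C Z (apex N)" for Z a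
    using Cmp_reassoc[OF \<sigma>(1) lN(1) \<sigma>(2) that] Cmp_reassoc[OF \<sigma>(1) lN(2) \<sigma>(3) that] by auto
  obtain \<Delta>' where \<Delta>': "is_equiv_rel C (apex N) \<Delta>'" "\<forall>Z a b. mem \<Delta>' Z a b \<longleftrightarrow> a \<in> Hom C Z (apex N) \<and> b \<in> Hom C Z (apex N) \<and>
      mem \<Delta> Z (\<sigma> \<odot> a) (\<sigma> \<odot> b)" using equiv_rel_inverse[OF \<Delta>eq \<sigma>(1)] .
  obtain \<Theta> where \<Theta>: "is_equiv_rel C (apex N) \<Theta>" "\<forall>Z a b. mem \<Theta> Z a b \<longleftrightarrow> mem \<Delta> Z a b \<and> mem \<Delta>' Z a b"
    using equiv_rel_meet[OF \<Delta>eq \<Delta>'(1)] .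
  note \<Theta>r = equiv_rel_rel[OF \<Theta>(1)]
  have \<Theta>lift: "lifts_diagonally N T \<Theta>"
    unfolding lifts_diagonally_def
  proof (intro allI impI, elim conjE)
    fix Z r s assume h: "r \<in> Hom C Z (apex N)" "s \<in> Hom C Z (apex N)" "leg0 N \<odot> r = leg1 N \<odot> r"
        "leg0 N \<odot> s = leg1 N \<odot> s" "mem T Z (leg1 N \<odot> r) (leg1 N \<odot> s)"
    have "mem \<Delta> Z r s" using lifts_diagonallyD[OF transportD(2)[OF \<Delta>(1)] h] .
    moreover have "mem \<Delta> Z (\<sigma> \<odot> r) (\<sigma> \<odot> s)"
      using lifts_diagonallyD[OF transportD(2)[OF \<Delta>(1)] Cmp_Hom[OF h(1) \<sigma>(1)] Cmp_Hom[OF h(2) \<sigma>(1)]] \<sigma>a h by simp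
    ultimately show "mem \<Theta> Z r s" using \<Theta>(2) \<Delta>'(2) h by blast
  qed
  have disc1: "a = b" if "mem \<Theta> Z a b" "leg1 N \<odot> a = leg1 N \<odot> b" for Z a b
    using \<Delta>disc \<Theta>(2) that by blast
  have disc0: "a = b" if m: "mem \<Theta> Z a b" "leg0 N \<odot> a = leg0 N \<odot> b" for Z a b
  proof -
    note ab = mem_Hom[OF \<Theta>r m(1)]
    have "mem \<Delta> Z (\<sigma> \<odot> a) (\<sigma> \<odot> b)" using m \<Theta>(2) \<Delta>'(2) by blast
    then have "\<sigma> \<odot> a = \<sigma> \<odot> b" by (rule \<Delta>disc) (use \<sigma>a ab m in simp)
    then have "leg1 N \<odot> a = leg1 N \<odot> b" using \<sigma>a ab by metis
    then show "a = b" by (rule disc1[OF m(1)])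
  qed
  define P where "P = apex N"
  define p where "p = leg0 N"
  define q where "q = leg1 N"
  note pq = P_def[symmetric] p_def[symmetric] q_def[symmetric]
  note kp = kp[unfolded pq]
  have ph: "p \<in> Hom C P X" and qh: "q \<in> Hom C P X" using lN unfolding pq by blast+
  have jm: "u = v" if "u \<in> Hom C Z P" "v \<in> Hom C Z P" "p \<odot> u = p \<odot> v" "q \<odot> u = q \<odot> v" for Z u v
    using pullback_unique[OF kp that] .
  obtain d0 where d0: "d0 \<in> Hom C X P" "p \<odot> d0 = Idn C X" "q \<odot> d0 = Idn C X"
    using equiv_rel_diagonal[OF N(1) Idn_Hom[OF X], unfolded pq] .
  have pr: "is_regular_epi C P X p" and qr: "is_regular_epi C P X q"
    using regular_epi_if_lift[OF ph regular_epi_Idn[OF X] d0(1,2)] regular_epi_if_lift[OF qh regular_epi_Idn[OF X] d0(1,3)] .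
  obtain RP where RP: "is_equiv_rel C P RP" "\<forall>Z a b. mem RP Z a b \<longleftrightarrow> a \<in> Hom C Z P \<and> b \<in> Hom C Z P \<and> mem R Z (p \<odot> a) (p \<odot> b)"
    using equiv_rel_inverse[OF F(1) ph] .
  obtain SP where SP: "is_equiv_rel C P SP" "\<forall>Z a b. mem SP Z a b \<longleftrightarrow> a \<in> Hom C Z P \<and> b \<in> Hom C Z P \<and> mem S Z (p \<odot> a) (p \<odot> b)"
    using equiv_rel_inverse[OF F(2) ph] .
  \<comment> \<open>Since f p = f q and f reflects R and S, the relations RP and SP are inverse
    images along q as well as along p; so both projections are fibrations.\<close>
  have qp: "mem U Z (q \<odot> a) (q \<odot> b) \<longleftrightarrow> mem U Z (p \<odot> a) (p \<odot> b)"
    if "a \<in> Hom C Z P" "b \<in> Hom C Z P" "reflects X f U U'" for Z a b U U'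
    using reflectsD[OF that(3) Cmp_Hom[OF that(1) ph] Cmp_Hom[OF that(2) ph]]
      reflectsD[OF that(3) Cmp_Hom[OF that(1) qh] Cmp_Hom[OF that(2) qh]]
      pullback_square[OF kp that(1)] pullback_square[OF kp that(2)] by simp
  have fibp: "fibration C (P, RP, SP) (X, R, S) p"
    unfolding fibration_iff reflects_def using RP SP F pr by blast
  have fibq: "fibration C (P, RP, SP) (X, R, S) q"
    unfolding fibration_iff reflects_def using RP SP F(1,2) qr qp[OF _ _ F(6)] qp[OF _ _ F(7)] by blast
  have "is_pullback (TwoEq C) (X, R, S) (X, R, S) (X', R', S') f f (P, RP, SP) p q"
    by (rule TwoEq_pullbackI[OF kp fibration_Hom[OF fib] fibration_Hom[OF fib] fibration_Hom[OF fibp] fibration_Hom[OF fibq]])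
       (use RP SP in blast)+
  then have KP: "is_kernel_pair (TwoEq C) (X, R, S) (X', R', S') f (P, RP, SP) p q"
    unfolding is_kernel_pair_def .
  note RPr = equiv_rel_rel[OF RP(1)]
  note lRP = rel_leg[OF RPr]
  note \<Theta>eq = \<Theta>(1)[unfolded pq] and \<Theta>r = \<Theta>r[unfolded pq] and disc1 = disc1[unfolded pq] and disc0 = disc0[unfolded pq]
  \<comment> \<open>A pair \<open>(x, y) R\<^sub>P (u, v)\<close> has a difference in the kernel of \<open>f\<close>: transport \<open>(x, y)\<close> to
    \<open>c = (x', v)\<close>, and take \<open>n = (x', u)\<close>.\<close>
  define \<Phi> where "\<Phi> Z r n \<longleftrightarrow> (\<exists>c. mem \<Theta> Z (leg0 RP \<odot> r) c \<and> q \<odot> c = q \<odot> (leg1 RP \<odot> r) \<and>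
     p \<odot> n = p \<odot> c \<and> q \<odot> n = p \<odot> (leg1 RP \<odot> r))" for Z r n
  have apRP: "apex RP \<in> Ob C" using lRP Ob_dom by blast
  have "mem R (apex RP) (p \<odot> leg0 RP) (p \<odot> leg1 RP)" using mem_generic[OF RPr] RP(2) by blast
  then have "mem T (apex RP) (q \<odot> leg0 RP) (q \<odot> leg1 RP)" using RT qp[OF lRP F(6)] by blast
  then obtain Z0 e c where c: "is_regular_epi C Z0 (apex RP) e" "mem \<Theta> Z0 (leg0 RP \<odot> e) c" "q \<odot> c = (q \<odot> leg1 RP) \<odot> e"
    by (rule transport_exists[OF N(1) T \<Theta>(1) \<Theta>lift, unfolded pq, OF lRP(1)])
  note eh = regular_epi_Hom[OF c(1)] and cH = mem_Hom(2)[OF \<Theta>r c(2)]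
  have re: "leg1 RP \<odot> e \<in> Hom C Z0 P" using eh lRP Cmp_Hom by blast
  have qc: "q \<odot> c = q \<odot> (leg1 RP \<odot> e)" using c(3) Cmp_assoc[OF eh lRP(2) qh] by simp
  \<comment> \<open>c = (x', v) and (u, v) both lie in Eq[f], so f x' = f v = f u and (x', u) is
    again an element of Eq[f].\<close>
  have "f \<odot> (p \<odot> c) = f \<odot> (p \<odot> (leg1 RP \<odot> e))"
    using pullback_square[OF kp cH] pullback_square[OF kp re] qc by simp
  then obtain n where n: "n \<in> Hom C Z0 P" "p \<odot> n = p \<odot> c" "q \<odot> n = p \<odot> (leg1 RP \<odot> e)"
    using pullback_lift[OF kp Cmp_Hom[OF cH ph] Cmp_Hom[OF re ph]] by metis
  have loc: "\<Phi> Z0 e n" unfolding \<Phi>_def using c qc n by blast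
  have \<Phi>re: "\<Phi> Z' (u \<odot> k) (t \<odot> k)" if uk: "u \<in> Hom C Z (apex RP)" "t \<in> Hom C Z P" "\<Phi> Z u t" "k \<in> Hom C Z' Z" for Z u t Z' k
  proof -
    obtain c where c: "mem \<Theta> Z (leg0 RP \<odot> u) c" "q \<odot> c = q \<odot> (leg1 RP \<odot> u)" "p \<odot> t = p \<odot> c" "q \<odot> t = p \<odot> (leg1 RP \<odot> u)"
      using uk(3) unfolding \<Phi>_def by blast
    note cH = mem_Hom(2)[OF \<Theta>r c(1)]
    have l1u: "leg1 RP \<odot> u \<in> Hom C Z P" using uk lRP Cmp_Hom by blast
    have "mem \<Theta> Z' (leg0 RP \<odot> (u \<odot> k)) (c \<odot> k)" using mem_reindex[OF \<Theta>r c(1) uk(4)] Cmp_assoc[OF uk(4,1) lRP(1)] by simp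
    moreover have "q \<odot> (c \<odot> k) = q \<odot> (leg1 RP \<odot> (u \<odot> k))"
      using Cmp_assoc[OF uk(4) cH qh] Cmp_assoc[OF uk(4) l1u qh] Cmp_assoc[OF uk(4,1) lRP(2)] c(2) by simp
    moreover have "p \<odot> (t \<odot> k) = p \<odot> (c \<odot> k)"
      using Cmp_assoc[OF uk(4) cH ph] Cmp_assoc[OF uk(4,2) ph] c(3) by simp
    moreover have "q \<odot> (t \<odot> k) = p \<odot> (leg1 RP \<odot> (u \<odot> k))"
      using Cmp_assoc[OF uk(4,2) qh] Cmp_assoc[OF uk(4) l1u ph] Cmp_assoc[OF uk(4,1) lRP(2)] c(4) by simp
    ultimately show ?thesis unfolding \<Phi>_def by blast
  qed
  have \<Phi>un: "t = t'" if h: "u \<in> Hom C Z (apex RP)" "t \<in> Hom C Z P" "t' \<in> Hom C Z P" "\<Phi> Z u t" "\<Phi> Z u t'" for Z u t t'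
  proof -
    obtain c where c: "mem \<Theta> Z (leg0 RP \<odot> u) c" "q \<odot> c = q \<odot> (leg1 RP \<odot> u)" "p \<odot> t = p \<odot> c" "q \<odot> t = p \<odot> (leg1 RP \<odot> u)"
      using h(4) unfolding \<Phi>_def by blast
    obtain c' where c': "mem \<Theta> Z (leg0 RP \<odot> u) c'" "q \<odot> c' = q \<odot> (leg1 RP \<odot> u)" "p \<odot> t' = p \<odot> c'" "q \<odot> t' = p \<odot> (leg1 RP \<odot> u)"
      using h(5) unfolding \<Phi>_def by blast
    have "c = c'" using disc1[OF equiv_rel_trans[OF \<Theta>eq equiv_rel_sym[OF \<Theta>eq c(1)] c'(1)]] c c' by simp
    then show "t = t'" using jm[OF h(2,3)] c c' by simp
  qed
  obtain d where d: "d \<in> Hom C (apex RP) P"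
    "\<forall>Z u t. u \<in> Hom C Z (apex RP) \<and> t \<in> Hom C Z P \<and> \<Phi> Z u t \<longrightarrow> d \<odot> u = t"
    "\<forall>Z u. u \<in> Hom C Z (apex RP) \<longrightarrow> (\<exists>Z' e. is_regular_epi C Z' Z e \<and> \<Phi> Z' (u \<odot> e) (d \<odot> (u \<odot> e)))"
    by (rule unique_choice[of Z0 "apex RP" e n P \<Phi>, OF c(1) n(1) loc \<Phi>re \<Phi>un])
  \<comment> \<open>\<Xi> compares differences by \<Theta>. A diagonal element of RP at (u, v) has
    difference (u, u), so the diagonal pairs required of \<Xi> come from those of \<Theta>.\<close>
  obtain \<Xi> where \<Xi>: "is_equiv_rel C (apex RP) \<Xi>" "\<forall>Z a b. mem \<Xi> Z a b \<longleftrightarrow> a \<in> Hom C Z (apex RP) \<and> b \<in> Hom C Z (apex RP) \<and>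
      mem \<Theta> Z (d \<odot> a) (d \<odot> b)" using equiv_rel_inverse[OF \<Theta>eq d(1)] .
  have dd: "p \<odot> (d \<odot> r) = p \<odot> (leg1 RP \<odot> r) \<and> q \<odot> (d \<odot> r) = p \<odot> (leg1 RP \<odot> r)"
    if h: "r \<in> Hom C Z (apex RP)" "leg0 RP \<odot> r = leg1 RP \<odot> r" for Z r
  proof -
    have r1: "leg1 RP \<odot> r \<in> Hom C Z P" using h lRP Cmp_Hom by blast
    obtain n where n: "n \<in> Hom C Z P" "p \<odot> n = p \<odot> (leg1 RP \<odot> r)" "q \<odot> n = p \<odot> (leg1 RP \<odot> r)"
      by (rule equiv_rel_diagonal[OF N(1) Cmp_Hom[OF r1 ph], unfolded pq])
    have "\<Phi> Z r n" unfolding \<Phi>_def using equiv_rel_refl[OF \<Theta>eq r1] h(2) n by auto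
    then have "d \<odot> r = n" using d(2) h n by blast
    then show ?thesis using n by simp
  qed
  have \<Xi>lift: "lifts_diagonally RP SP \<Xi>"
    unfolding lifts_diagonally_def
  proof (intro allI impI, elim conjE)
    fix Z r s assume h: "r \<in> Hom C Z (apex RP)" "s \<in> Hom C Z (apex RP)" "leg0 RP \<odot> r = leg1 RP \<odot> r"
        "leg0 RP \<odot> s = leg1 RP \<odot> s" "mem SP Z (leg1 RP \<odot> r) (leg1 RP \<odot> s)"
    have "mem T Z (p \<odot> (leg1 RP \<odot> r)) (p \<odot> (leg1 RP \<odot> s))" using h(5) SP(2) ST by blast
    then have "mem \<Theta> Z (d \<odot> r) (d \<odot> s)"
      using lifts_diagonallyD[OF \<Theta>lift, unfolded pq, OF Cmp_Hom[OF h(1) d(1)] Cmp_Hom[OF h(2) d(1)]]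
        dd[OF h(1,3)] dd[OF h(2,4)] by simp
    then show "mem \<Xi> Z r s" using \<Xi>(2) h by blast
  qed
  have \<Xi>le: "mem \<Theta> Z (leg0 RP \<odot> r) (leg0 RP \<odot> s)" if m: "mem \<Xi> Z r s" and eq: "leg1 RP \<odot> r = leg1 RP \<odot> s" for Z r s
  proof -
    have rs: "r \<in> Hom C Z (apex RP)" "s \<in> Hom C Z (apex RP)" "mem \<Theta> Z (d \<odot> r) (d \<odot> s)" using m \<Xi>(2) by blast+
    obtain Z1 e1 where 1: "is_regular_epi C Z1 Z e1" "\<Phi> Z1 (r \<odot> e1) (d \<odot> (r \<odot> e1))" using d(3) rs(1) by blast
    note h1 = regular_epi_Hom[OF 1(1)]
    have re1: "r \<odot> e1 \<in> Hom C Z1 (apex RP)" and se1: "s \<odot> e1 \<in> Hom C Z1 (apex RP)" using rs h1 Cmp_Hom by blast+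
    obtain Z2 e2 where 2: "is_regular_epi C Z2 Z1 e2" "\<Phi> Z2 ((s \<odot> e1) \<odot> e2) (d \<odot> ((s \<odot> e1) \<odot> e2))" using d(3) se1 by blast
    note h2 = regular_epi_Hom[OF 2(1)]
    define \<epsilon> where "\<epsilon> = e1 \<odot> e2"
    have \<epsilon>: "is_regular_epi C Z2 Z \<epsilon>" unfolding \<epsilon>_def using regular_epi_Cmp[OF 2(1) 1(1)] .
    note \<epsilon>h = regular_epi_Hom[OF \<epsilon>]
    have "\<Phi> Z2 ((r \<odot> e1) \<odot> e2) ((d \<odot> (r \<odot> e1)) \<odot> e2)" using \<Phi>re[OF re1 Cmp_Hom[OF re1 d(1)] 1(2) h2] .
    then have \<Phi>r: "\<Phi> Z2 (r \<odot> \<epsilon>) (d \<odot> (r \<odot> \<epsilon>))"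
      unfolding \<epsilon>_def using Cmp_assoc[OF h2 h1 rs(1)] Cmp_assoc[OF h2 re1 d(1)] by simp
    have \<Phi>s: "\<Phi> Z2 (s \<odot> \<epsilon>) (d \<odot> (s \<odot> \<epsilon>))" unfolding \<epsilon>_def using 2(2) Cmp_assoc[OF h2 h1 rs(2)] by simp
    obtain c where c: "mem \<Theta> Z2 (leg0 RP \<odot> (r \<odot> \<epsilon>)) c" "q \<odot> c = q \<odot> (leg1 RP \<odot> (r \<odot> \<epsilon>))" "p \<odot> (d \<odot> (r \<odot> \<epsilon>)) = p \<odot> c"
       "q \<odot> (d \<odot> (r \<odot> \<epsilon>)) = p \<odot> (leg1 RP \<odot> (r \<odot> \<epsilon>))" using \<Phi>r unfolding \<Phi>_def by blast
    obtain c' where c': "mem \<Theta> Z2 (leg0 RP \<odot> (s \<odot> \<epsilon>)) c'" "q \<odot> c' = q \<odot> (leg1 RP \<odot> (s \<odot> \<epsilon>))" "p \<odot> (d \<odot> (s \<odot> \<epsilon>)) = p \<odot> c'"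
       "q \<odot> (d \<odot> (s \<odot> \<epsilon>)) = p \<odot> (leg1 RP \<odot> (s \<odot> \<epsilon>))" using \<Phi>s unfolding \<Phi>_def by blast
    have eq2: "leg1 RP \<odot> (r \<odot> \<epsilon>) = leg1 RP \<odot> (s \<odot> \<epsilon>)"
      using Cmp_assoc[OF \<epsilon>h rs(1) lRP(2)] Cmp_assoc[OF \<epsilon>h rs(2) lRP(2)] eq by simp
    have "mem \<Theta> Z2 (d \<odot> (r \<odot> \<epsilon>)) (d \<odot> (s \<odot> \<epsilon>))"
      using mem_reindex[OF \<Theta>r rs(3) \<epsilon>h] Cmp_assoc[OF \<epsilon>h rs(1) d(1)] Cmp_assoc[OF \<epsilon>h rs(2) d(1)] by simp
    \<comment> \<open>The differences (x', u) and (x'', u) have the same second entry, so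
      discreteness gives x' = x''. Then the first components of r and s are both \<Theta>-related to
      the one element (x', v).\<close>
    then have "d \<odot> (r \<odot> \<epsilon>) = d \<odot> (s \<odot> \<epsilon>)" by (rule disc1) (use c(4) c'(4) eq2 in simp)
    then have "c = c'"
      using jm[OF mem_Hom(2)[OF \<Theta>r c(1)] mem_Hom(2)[OF \<Theta>r c'(1)]] c c' eq2 by simp
    then have "mem \<Theta> Z2 (leg0 RP \<odot> (r \<odot> \<epsilon>)) (leg0 RP \<odot> (s \<odot> \<epsilon>))"
      using equiv_rel_trans[OF \<Theta>eq c(1) equiv_rel_sym[OF \<Theta>eq]] c'(1) by blast
    then show ?thesis
      using mem_local[OF \<Theta>r \<epsilon> Cmp_Hom[OF rs(1) lRP(1)] Cmp_Hom[OF rs(2) lRP(1)]]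
        Cmp_assoc[OF \<epsilon>h rs(1) lRP(1)] Cmp_assoc[OF \<epsilon>h rs(2) lRP(1)] by simp
  qed
  \<comment> \<open>Thus [RP, SP] lies below \<Theta>, which meets the kernels of both projections
    in the diagonal.\<close>
  have le: "mem \<Theta> Z x y" if "mem (commutator C P RP SP) Z x y" for Z x y
    using commutator_le[OF RP(1) SP(1) \<Xi>(1) \<Xi>lift \<Theta>r \<Xi>le that] .
  have "trivial_ext (Gamma_F C) (P, RP, SP) (X, R, S) p"
    by (rule discrete_trivial_ext[OF fibp]) (use disc0 le in blast)
  moreover have "trivial_ext (Gamma_F C) (P, RP, SP) (X, R, S) q"
    by (rule discrete_trivial_ext[OF fibq]) (use disc1 le in blast)
  ultimately show ?thesis using that KP by blast
qed

end

section \<open>Monadicity of extensions\<close>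


lemma functorD:
  assumes "is_functor C D F"
  shows "X \<in> Ob C \<Longrightarrow> FO F X \<in> Ob D"
    "f \<in> Hom C X Y \<Longrightarrow> FA F X Y f \<in> Hom D (FO F X) (FO F Y)"
    "X \<in> Ob C \<Longrightarrow> FA F X X (Idn C X) = Idn D (FO F X)"
    "f \<in> Hom C X Y \<Longrightarrow> g \<in> Hom C Y Z \<Longrightarrow> FA F X Z (g \<odot>\<^bsub>C\<^esub> f) = FA F Y Z g \<odot>\<^bsub>D\<^esub> FA F X Y f"
  using assms unfolding is_functor_def by blast+

text \<open>A quasi-inverse is chosen objectwise as G0 with isomorphisms \<beta> and inverses
  \<gamma>; on arrows it takes the unique preimage under K of the conjugate \<gamma> h \<beta>.
  Equations in D are checked after applying the faithful K.\<close>

lemma equivalence_criterion: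
  assumes D: "category D" and E: "category E" and K: "is_functor D E K"
    and ff: "\<And>A B h. A \<in> Ob D \<Longrightarrow> B \<in> Ob D \<Longrightarrow> h \<in> Hom E (FO K A) (FO K B) \<Longrightarrow> \<exists>!k. k \<in> Hom D A B \<and> FA K A B k = h"
    and es: "\<And>Y. Y \<in> Ob E \<Longrightarrow> \<exists>A\<in>Ob D. \<exists>i. is_iso E (FO K A) Y i"
  shows "is_equivalence D E K"
proof -
  interpret D: category D by (rule D)
  interpret E: category E by (rule E)
  note K1 = functorD(1)[OF K] and K2 = functorD(2)[OF K] and K3 = functorD(3)[OF K] and K4 = functorD(4)[OF K]
  have "\<forall>Y\<in>Ob E. \<exists>A i j. A \<in> Ob D \<and> i \<in> Hom E (FO K A) Y \<and> j \<in> Hom E Y (FO K A) \<and>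
      j \<odot>\<^bsub>E\<^esub> i = Idn E (FO K A) \<and> i \<odot>\<^bsub>E\<^esub> j = Idn E Y"
    using es unfolding is_iso_def by blast
  then obtain G0 \<beta> \<gamma> where "\<forall>Y\<in>Ob E. G0 Y \<in> Ob D \<and> \<beta> Y \<in> Hom E (FO K (G0 Y)) Y \<and> \<gamma> Y \<in> Hom E Y (FO K (G0 Y)) \<and>
      \<gamma> Y \<odot>\<^bsub>E\<^esub> \<beta> Y = Idn E (FO K (G0 Y)) \<and> \<beta> Y \<odot>\<^bsub>E\<^esub> \<gamma> Y = Idn E Y"
    unfolding bchoice_iff by blast
  then have G0: "\<And>Y. Y \<in> Ob E \<Longrightarrow> G0 Y \<in> Ob D" and \<beta>: "\<And>Y. Y \<in> Ob E \<Longrightarrow> \<beta> Y \<in> Hom E (FO K (G0 Y)) Y"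
    and \<gamma>: "\<And>Y. Y \<in> Ob E \<Longrightarrow> \<gamma> Y \<in> Hom E Y (FO K (G0 Y))"
    and \<gamma>\<beta>: "\<And>Y. Y \<in> Ob E \<Longrightarrow> \<gamma> Y \<odot>\<^bsub>E\<^esub> \<beta> Y = Idn E (FO K (G0 Y))"
    and \<beta>\<gamma>: "\<And>Y. Y \<in> Ob E \<Longrightarrow> \<beta> Y \<odot>\<^bsub>E\<^esub> \<gamma> Y = Idn E Y" by blast+
  define L where "L A B h = (THE k. k \<in> Hom D A B \<and> FA K A B k = h)" for A B h
  have L: "L A B h \<in> Hom D A B" "FA K A B (L A B h) = h"
    if "A \<in> Ob D" "B \<in> Ob D" "h \<in> Hom E (FO K A) (FO K B)" for A B h
    using theI'[OF ff[OF that]] unfolding L_def by blast+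
  have faithful: "k = l" if "k \<in> Hom D A B" "l \<in> Hom D A B" "FA K A B k = FA K A B l" for A B k l
    using ff[OF D.Ob_dom[OF that(1)] D.Ob_cod[OF that(1)] K2[OF that(1)]] that by metis
  define G where "G = \<lparr>FO = G0, FA = (\<lambda>Y Y' h. L (G0 Y) (G0 Y') (\<gamma> Y' \<odot>\<^bsub>E\<^esub> (h \<odot>\<^bsub>E\<^esub> \<beta> Y)))\<rparr>"
  have Gh: "\<gamma> Y' \<odot>\<^bsub>E\<^esub> (h \<odot>\<^bsub>E\<^esub> \<beta> Y) \<in> Hom E (FO K (G0 Y)) (FO K (G0 Y'))" if h: "h \<in> Hom E Y Y'" for h Y Y'
    using E.Cmp_Hom[OF E.Cmp_Hom[OF \<beta>[OF E.Ob_dom[OF h]] h] \<gamma>[OF E.Ob_cod[OF h]]] .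
  have GA: "FA G Y Y' h \<in> Hom D (G0 Y) (G0 Y')" "FA K (G0 Y) (G0 Y') (FA G Y Y' h) = \<gamma> Y' \<odot>\<^bsub>E\<^esub> (h \<odot>\<^bsub>E\<^esub> \<beta> Y)"
    if h: "h \<in> Hom E Y Y'" for h Y Y'
    using L[OF G0[OF E.Ob_dom[OF h]] G0[OF E.Ob_cod[OF h]] Gh[OF h]] unfolding G_def by simp_all
  have GO: "FO G Y = G0 Y" for Y unfolding G_def by simp
  have G: "is_functor E D G"
    unfolding is_functor_def GO
  proof (intro conjI allI ballI)
    fix Y assume Y: "Y \<in> Ob E"
    show "G0 Y \<in> Ob D" using G0[OF Y] .
    show "FA G Y Y (Idn E Y) = Idn D (G0 Y)"
    proof (rule faithful[OF GA(1)[OF E.Idn_Hom[OF Y]] D.Idn_Hom[OF G0[OF Y]]])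
      show "FA K (G0 Y) (G0 Y) (FA G Y Y (Idn E Y)) = FA K (G0 Y) (G0 Y) (Idn D (G0 Y))"
        unfolding GA(2)[OF E.Idn_Hom[OF Y]] E.Idn_left[OF \<beta>[OF Y]] \<gamma>\<beta>[OF Y] K3[OF G0[OF Y]] ..
    qed
  next
    fix X Y f assume f: "f \<in> Hom E X Y"
    show "FA G X Y f \<in> Hom D (G0 X) (G0 Y)" using GA(1)[OF f] .
  next
    fix X Y Z f g assume f: "f \<in> Hom E X Y" and g: "g \<in> Hom E Y Z"
    note fg = E.Cmp_Hom[OF f g]
    note X = E.Ob_dom[OF f] and Y = E.Ob_cod[OF f] and Z = E.Ob_cod[OF g]
    show "FA G X Z (g \<odot>\<^bsub>E\<^esub> f) = FA G Y Z g \<odot>\<^bsub>D\<^esub> FA G X Y f"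
    proof (rule faithful[OF GA(1)[OF fg] D.Cmp_Hom[OF GA(1)[OF f] GA(1)[OF g]]])
      have "FA K (G0 X) (G0 Z) (FA G Y Z g \<odot>\<^bsub>D\<^esub> FA G X Y f) =
         (\<gamma> Z \<odot>\<^bsub>E\<^esub> (g \<odot>\<^bsub>E\<^esub> \<beta> Y)) \<odot>\<^bsub>E\<^esub> (\<gamma> Y \<odot>\<^bsub>E\<^esub> (f \<odot>\<^bsub>E\<^esub> \<beta> X))"
        unfolding K4[OF GA(1)[OF f] GA(1)[OF g]] GA(2)[OF f] GA(2)[OF g] ..
      also have "\<dots> = \<gamma> Z \<odot>\<^bsub>E\<^esub> ((g \<odot>\<^bsub>E\<^esub> \<beta> Y) \<odot>\<^bsub>E\<^esub> (\<gamma> Y \<odot>\<^bsub>E\<^esub> (f \<odot>\<^bsub>E\<^esub> \<beta> X)))"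
        using E.Cmp_assoc[OF Gh[OF f] E.Cmp_Hom[OF \<beta>[OF Y] g] \<gamma>[OF Z]] .
      also have "(g \<odot>\<^bsub>E\<^esub> \<beta> Y) \<odot>\<^bsub>E\<^esub> (\<gamma> Y \<odot>\<^bsub>E\<^esub> (f \<odot>\<^bsub>E\<^esub> \<beta> X)) = g \<odot>\<^bsub>E\<^esub> (\<beta> Y \<odot>\<^bsub>E\<^esub> (\<gamma> Y \<odot>\<^bsub>E\<^esub> (f \<odot>\<^bsub>E\<^esub> \<beta> X)))"
        using E.Cmp_assoc[OF Gh[OF f] \<beta>[OF Y] g] .
      also have "\<beta> Y \<odot>\<^bsub>E\<^esub> (\<gamma> Y \<odot>\<^bsub>E\<^esub> (f \<odot>\<^bsub>E\<^esub> \<beta> X)) = f \<odot>\<^bsub>E\<^esub> \<beta> X"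
        using E.Cmp_reassoc[OF \<gamma>[OF Y] \<beta>[OF Y] \<beta>\<gamma>[OF Y] E.Cmp_Hom[OF \<beta>[OF X] f]]
          E.Idn_left[OF E.Cmp_Hom[OF \<beta>[OF X] f]] by simp
      also have "g \<odot>\<^bsub>E\<^esub> (f \<odot>\<^bsub>E\<^esub> \<beta> X) = (g \<odot>\<^bsub>E\<^esub> f) \<odot>\<^bsub>E\<^esub> \<beta> X" using E.Cmp_assoc[OF \<beta>[OF X] f g] by simp
      finally show "FA K (G0 X) (G0 Z) (FA G X Z (g \<odot>\<^bsub>E\<^esub> f)) = FA K (G0 X) (G0 Z) (FA G Y Z g \<odot>\<^bsub>D\<^esub> FA G X Y f)"
        unfolding GA(2)[OF fg] by simp
    qed
  qed
  define \<alpha> where "\<alpha> A = L A (G0 (FO K A)) (\<gamma> (FO K A))" for A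
  have \<alpha>: "\<alpha> A \<in> Hom D A (G0 (FO K A))" "FA K A (G0 (FO K A)) (\<alpha> A) = \<gamma> (FO K A)" if "A \<in> Ob D" for A
    using L[OF that G0[OF K1[OF that]] \<gamma>[OF K1[OF that]]] unfolding \<alpha>_def .
  have "is_nat_iso D D id_func (comp_func G K) \<alpha>"
    unfolding is_nat_iso_def is_nat_trans_def id_func_def comp_func_def func.simps GO
  proof (intro conjI allI ballI)
    fix A assume A: "A \<in> Ob D"
    show "\<alpha> A \<in> Hom D A (G0 (FO K A))" using \<alpha>(1)[OF A] .
    note KA = K1[OF A]
    define l where "l = L (G0 (FO K A)) A (\<beta> (FO K A))"
    have l: "l \<in> Hom D (G0 (FO K A)) A" "FA K (G0 (FO K A)) A l = \<beta> (FO K A)"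
      using L[OF G0[OF KA] A \<beta>[OF KA]] unfolding l_def .
    have "l \<odot>\<^bsub>D\<^esub> \<alpha> A = Idn D A"
    proof (rule faithful[OF D.Cmp_Hom[OF \<alpha>(1)[OF A] l(1)] D.Idn_Hom[OF A]])
      show "FA K A A (l \<odot>\<^bsub>D\<^esub> \<alpha> A) = FA K A A (Idn D A)"
        unfolding K4[OF \<alpha>(1)[OF A] l(1)] l(2) \<alpha>(2)[OF A] \<beta>\<gamma>[OF KA] K3[OF A] ..
    qed
    moreover have "\<alpha> A \<odot>\<^bsub>D\<^esub> l = Idn D (G0 (FO K A))"
    proof (rule faithful[OF D.Cmp_Hom[OF l(1) \<alpha>(1)[OF A]] D.Idn_Hom[OF G0[OF KA]]])
      show "FA K (G0 (FO K A)) (G0 (FO K A)) (\<alpha> A \<odot>\<^bsub>D\<^esub> l) = FA K (G0 (FO K A)) (G0 (FO K A)) (Idn D (G0 (FO K A)))"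
        unfolding K4[OF l(1) \<alpha>(1)[OF A]] l(2) \<alpha>(2)[OF A] \<gamma>\<beta>[OF KA] K3[OF G0[OF KA]] ..
    qed
    ultimately show "is_iso D A (G0 (FO K A)) (\<alpha> A)" unfolding is_iso_def using l(1) \<alpha>(1)[OF A] by blast
  next
    fix A B f assume f: "f \<in> Hom D A B"
    note A = D.Ob_dom[OF f] and B = D.Ob_cod[OF f]
    note Kf = K2[OF f] and KA = K1[OF A] and KB = K1[OF B]
    show "\<alpha> B \<odot>\<^bsub>D\<^esub> f = FA G (FO K A) (FO K B) (FA K A B f) \<odot>\<^bsub>D\<^esub> \<alpha> A"
    proof (rule faithful[OF D.Cmp_Hom[OF f \<alpha>(1)[OF B]] D.Cmp_Hom[OF \<alpha>(1)[OF A] GA(1)[OF Kf]]])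
      have "(\<gamma> (FO K B) \<odot>\<^bsub>E\<^esub> (FA K A B f \<odot>\<^bsub>E\<^esub> \<beta> (FO K A))) \<odot>\<^bsub>E\<^esub> \<gamma> (FO K A) =
          \<gamma> (FO K B) \<odot>\<^bsub>E\<^esub> ((FA K A B f \<odot>\<^bsub>E\<^esub> \<beta> (FO K A)) \<odot>\<^bsub>E\<^esub> \<gamma> (FO K A))"
        using E.Cmp_assoc[OF \<gamma>[OF KA] E.Cmp_Hom[OF \<beta>[OF KA] Kf] \<gamma>[OF KB]] .
      also have "(FA K A B f \<odot>\<^bsub>E\<^esub> \<beta> (FO K A)) \<odot>\<^bsub>E\<^esub> \<gamma> (FO K A) = FA K A B f"
        using E.Cmp_assoc[OF \<gamma>[OF KA] \<beta>[OF KA] Kf] \<beta>\<gamma>[OF KA] E.Idn_right[OF Kf] by simp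
      finally show "FA K A (G0 (FO K B)) (\<alpha> B \<odot>\<^bsub>D\<^esub> f) =
          FA K A (G0 (FO K B)) (FA G (FO K A) (FO K B) (FA K A B f) \<odot>\<^bsub>D\<^esub> \<alpha> A)"
        unfolding K4[OF f \<alpha>(1)[OF B]] K4[OF \<alpha>(1)[OF A] GA(1)[OF Kf]] \<alpha>(2)[OF A] \<alpha>(2)[OF B] GA(2)[OF Kf] by simp
    qed
  qed
  moreover have "is_nat_iso E E (comp_func K G) id_func \<beta>"
    unfolding is_nat_iso_def is_nat_trans_def id_func_def comp_func_def func.simps GO
  proof (intro conjI allI ballI)
    fix Y assume Y: "Y \<in> Ob E"
    show "\<beta> Y \<in> Hom E (FO K (G0 Y)) Y" using \<beta>[OF Y] .
    show "is_iso E (FO K (G0 Y)) Y (\<beta> Y)" unfolding is_iso_def using \<beta>[OF Y] \<gamma>[OF Y] \<beta>\<gamma>[OF Y] \<gamma>\<beta>[OF Y] by blast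
  next
    fix Y Y' h assume h: "h \<in> Hom E Y Y'"
    note Y = E.Ob_dom[OF h] and Y' = E.Ob_cod[OF h]
    note h\<beta> = E.Cmp_Hom[OF \<beta>[OF Y] h]
    show "\<beta> Y' \<odot>\<^bsub>E\<^esub> FA K (G0 Y) (G0 Y') (FA G Y Y' h) = h \<odot>\<^bsub>E\<^esub> \<beta> Y"
      unfolding GA(2)[OF h]
      using E.Cmp_reassoc[OF \<gamma>[OF Y'] \<beta>[OF Y'] \<beta>\<gamma>[OF Y'] h\<beta>] E.Idn_left[OF h\<beta>] by simp
  qed
  ultimately show ?thesis unfolding is_equivalence_def using K G by blast
qed

lemma EM_simps:
  "(A, a) \<in> Ob (EM X T \<eta> \<mu>) \<longleftrightarrow> is_algebra X T \<eta> \<mu> A a"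
  "h \<in> Hom (EM X T \<eta> \<mu>) (A, a) (B, b) \<longleftrightarrow> h \<in> Hom X A B \<and> is_algebra X T \<eta> \<mu> A a \<and> is_algebra X T \<eta> \<mu> B b \<and>
      h \<odot>\<^bsub>X\<^esub> a = b \<odot>\<^bsub>X\<^esub> FA T A B h"
  "Idn (EM X T \<eta> \<mu>) (A, a) = Idn X A" "Cmp (EM X T \<eta> \<mu>) = Cmp X"
  unfolding EM_def by auto

lemma is_algebraD:
  assumes "is_algebra X T \<eta> \<mu> A a"
  shows "A \<in> Ob X" "a \<in> Hom X (FO T A) A" "a \<odot>\<^bsub>X\<^esub> \<eta> A = Idn X A" "a \<odot>\<^bsub>X\<^esub> \<mu> A = a \<odot>\<^bsub>X\<^esub> FA T (FO T A) A a"
  using assms unfolding is_algebra_def by blast+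

lemma category_EM:
  assumes X: "category X" and T: "is_functor X X T"
  shows "category (EM X T \<eta> \<mu>)"
proof -
  interpret X: category X by (rule X)
  show ?thesis
  proof
    fix f U V assume "f \<in> Hom (EM X T \<eta> \<mu>) U V"
    then show "U \<in> Ob (EM X T \<eta> \<mu>) \<and> V \<in> Ob (EM X T \<eta> \<mu>)" by (cases U; cases V) (simp add: EM_simps)
  next
    fix U assume U: "U \<in> Ob (EM X T \<eta> \<mu>)"
    obtain A a where Ua: "U = (A, a)" by (cases U)
    have al: "is_algebra X T \<eta> \<mu> A a" using U unfolding Ua EM_simps .
    note a = is_algebraD[OF al]
    show "Idn (EM X T \<eta> \<mu>) U \<in> Hom (EM X T \<eta> \<mu>) U U"
      unfolding Ua EM_simps using al X.Idn_Hom[OF a(1)] X.Idn_left[OF a(2)] functorD(3)[OF T a(1)] X.Idn_right[OF a(2)] by simp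
  next
    fix f U V g W assume fg: "f \<in> Hom (EM X T \<eta> \<mu>) U V" "g \<in> Hom (EM X T \<eta> \<mu>) V W"
    obtain A a where U: "U = (A, a)" by (cases U)
    obtain B b where V: "V = (B, b)" by (cases V)
    obtain D d where W: "W = (D, d)" by (cases W)
    note f = fg(1)[unfolded U V EM_simps] and g = fg(2)[unfolded V W EM_simps]
    have al: "is_algebra X T \<eta> \<mu> A a" "is_algebra X T \<eta> \<mu> B b" "is_algebra X T \<eta> \<mu> D d" using f g by blast+
    have fh: "f \<in> Hom X A B" and gh: "g \<in> Hom X B D" using f g by blast+
    note a = is_algebraD(2)[OF al(1)] and b = is_algebraD(2)[OF al(2)] and d = is_algebraD(2)[OF al(3)]
    note Tf = functorD(2)[OF T fh] and Tg = functorD(2)[OF T gh]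
    have "(g \<odot>\<^bsub>X\<^esub> f) \<odot>\<^bsub>X\<^esub> a = g \<odot>\<^bsub>X\<^esub> (b \<odot>\<^bsub>X\<^esub> FA T A B f)" using X.Cmp_assoc[OF a fh gh] f by simp
    also have "\<dots> = d \<odot>\<^bsub>X\<^esub> (FA T B D g \<odot>\<^bsub>X\<^esub> FA T A B f)" using X.Cmp_square[OF b gh Tg d _ Tf] g by blast
    finally have "(g \<odot>\<^bsub>X\<^esub> f) \<odot>\<^bsub>X\<^esub> a = d \<odot>\<^bsub>X\<^esub> FA T A D (g \<odot>\<^bsub>X\<^esub> f)" using functorD(4)[OF T fh gh] by simp
    then show "g \<odot>\<^bsub>EM X T \<eta> \<mu>\<^esub> f \<in> Hom (EM X T \<eta> \<mu>) U W"
      unfolding U W EM_simps using X.Cmp_Hom[OF fh gh] al by simp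
  next
    fix f U V assume f: "f \<in> Hom (EM X T \<eta> \<mu>) U V"
    obtain A a where U: "U = (A, a)" by (cases U)
    obtain B b where V: "V = (B, b)" by (cases V)
    have "f \<in> Hom X A B" using f unfolding U V EM_simps by blast
    then show "Idn (EM X T \<eta> \<mu>) V \<odot>\<^bsub>EM X T \<eta> \<mu>\<^esub> f = f" "f \<odot>\<^bsub>EM X T \<eta> \<mu>\<^esub> Idn (EM X T \<eta> \<mu>) U = f"
      unfolding U V EM_simps by (rule X.Idn_left, rule X.Idn_right)
  next
    fix f U V g W h S assume "f \<in> Hom (EM X T \<eta> \<mu>) U V" "g \<in> Hom (EM X T \<eta> \<mu>) V W" "h \<in> Hom (EM X T \<eta> \<mu>) W S"
    then show "h \<odot>\<^bsub>EM X T \<eta> \<mu>\<^esub> g \<odot>\<^bsub>EM X T \<eta> \<mu>\<^esub> f = h \<odot>\<^bsub>EM X T \<eta> \<mu>\<^esub> (g \<odot>\<^bsub>EM X T \<eta> \<mu>\<^esub> f)"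
      by (cases U; cases V; cases W; cases S) (auto simp: EM_simps intro: X.Cmp_assoc)
  qed
qed

lemma functor_comp:
  assumes F: "is_functor X D F" and U: "is_functor D Y U"
  shows "is_functor X Y (comp_func U F)"
  unfolding is_functor_def comp_func_def func.simps
  using functorD[OF F] functorD[OF U] by (simp)

text \<open>Applying U to naturality of \<epsilon> at f says that U f is compatible with the
  actions; the instance f = \<epsilon> B is associativity of the action on U B, and a triangle
  identity is its unit law.\<close>

lemma comparison_functor:
  assumes X: "category X" and D: "category D" and adj: "is_adjunction X D F U \<eta> \<epsilon>"
  shows "is_functor D (EM X (comp_func U F) \<eta> (\<lambda>A. FA U (FO F (FO U (FO F A))) (FO F A) (\<epsilon> (FO F A)))) (comparison U F \<epsilon>)"
proof -
  interpret X: category X by (rule X)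
  interpret D: category D by (rule D)
  have F: "is_functor X D F" and U: "is_functor D X U"
    and \<epsilon>: "\<And>B. B \<in> Ob D \<Longrightarrow> \<epsilon> B \<in> Hom D (FO F (FO U B)) B"
    and \<epsilon>nat: "\<And>B B' f. f \<in> Hom D B B' \<Longrightarrow> \<epsilon> B' \<odot>\<^bsub>D\<^esub> FA F (FO U B) (FO U B') (FA U B B' f) = f \<odot>\<^bsub>D\<^esub> \<epsilon> B"
    and tri: "\<And>B. B \<in> Ob D \<Longrightarrow> FA U (FO F (FO U B)) B (\<epsilon> B) \<odot>\<^bsub>X\<^esub> \<eta> (FO U B) = Idn X (FO U B)"
    using adj unfolding is_adjunction_def is_nat_trans_def comp_func_def id_func_def func.simps by blast+
  note F = functorD[OF F] and U = functorD[OF U]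
  have nat: "FA U B B' f \<odot>\<^bsub>X\<^esub> FA U (FO F (FO U B)) B (\<epsilon> B) =
      FA U (FO F (FO U B')) B' (\<epsilon> B') \<odot>\<^bsub>X\<^esub> FA U (FO F (FO U B)) (FO F (FO U B')) (FA F (FO U B) (FO U B') (FA U B B' f))"
    if f: "f \<in> Hom D B B'" for B B' f
  proof -
    note B = D.Ob_dom[OF f] and B' = D.Ob_cod[OF f]
    note FUf = F(2)[OF U(2)[OF f]]
    show ?thesis using U(4)[OF \<epsilon>[OF B] f] U(4)[OF FUf \<epsilon>[OF B']] \<epsilon>nat[OF f] by simp
  qed
  define T where "T = comp_func U F"
  define \<mu> where "\<mu> A = FA U (FO F (FO U (FO F A))) (FO F A) (\<epsilon> (FO F A))" for A
  have T: "FO T A = FO U (FO F A)" "FA T A B h = FA U (FO F A) (FO F B) (FA F A B h)" for A B h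
    unfolding T_def comp_func_def by simp_all
  have alg: "is_algebra X T \<eta> \<mu> (FO U B) (FA U (FO F (FO U B)) B (\<epsilon> B))" if B: "B \<in> Ob D" for B
    unfolding is_algebra_def T \<mu>_def
    using U(1)[OF B] U(2)[OF \<epsilon>[OF B]] tri[OF B] nat[OF \<epsilon>[OF B]] by simp
  have "is_functor D (EM X T \<eta> \<mu>) (comparison U F \<epsilon>)"
    unfolding is_functor_def comparison_def func.simps EM_simps
  proof (intro conjI allI ballI)
    fix B assume B: "B \<in> Ob D"
    show "is_algebra X T \<eta> \<mu> (FO U B) (FA U (FO F (FO U B)) B (\<epsilon> B))" by (rule alg[OF B])
    show "FA U B B (Idn D B) = Idn X (FO U B)" by (rule U(3)[OF B])
  next
    fix B B' f assume f: "f \<in> Hom D B B'"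
    show "FA U B B' f \<in> Hom X (FO U B) (FO U B')" by (rule U(2)[OF f])
    show "is_algebra X T \<eta> \<mu> (FO U B) (FA U (FO F (FO U B)) B (\<epsilon> B))" by (rule alg[OF D.Ob_dom[OF f]])
    show "is_algebra X T \<eta> \<mu> (FO U B') (FA U (FO F (FO U B')) B' (\<epsilon> B'))" by (rule alg[OF D.Ob_cod[OF f]])
    show "FA U B B' f \<odot>\<^bsub>X\<^esub> FA U (FO F (FO U B)) B (\<epsilon> B) =
        FA U (FO F (FO U B')) B' (\<epsilon> B') \<odot>\<^bsub>X\<^esub> FA T (FO U B) (FO U B') (FA U B B' f)"
      unfolding T by (rule nat[OF f])
  next
    fix X' Y Z f g assume "f \<in> Hom D X' Y" "g \<in> Hom D Y Z"
    then show "FA U X' Z (g \<odot>\<^bsub>D\<^esub> f) = FA U Y Z g \<odot>\<^bsub>X\<^esub> FA U X' Y f" by (rule U(4))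
  qed
  then show ?thesis unfolding T_def \<mu>_def .
qed

text \<open>The descent axiom asks that an action of the monad of \<open>g\<close> on an extension \<open>f\<close> comes from an extension \<open>z\<close>
  of the codomain of \<open>g\<close>. It is stated for unital actions; associativity is automatic in the
  Mal'tsev setting.\<close>

locale extension_class =
  fixes G :: "('o, 'm) galois_structure"
  assumes category_Tot: "category (Tot G)"
    and Ext_regular_epi: "Ext G A B f \<Longrightarrow> is_regular_epi (Tot G) A B f"
    and Ext_Cmp: "Ext G A B f \<Longrightarrow> Ext G B D g \<Longrightarrow> Ext G A D (g \<odot>\<^bsub>Tot G\<^esub> f)"
    and Ext_pullback_exists: "Ext G A D f \<Longrightarrow> Ext G B D g \<Longrightarrow> \<exists>P p q. is_pullback (Tot G) A B D f g P p q"
    and Ext_pullback: "Ext G A D f \<Longrightarrow> is_pullback (Tot G) A B D f g P p q \<Longrightarrow> Ext G P B q"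
    and Ext_descent: "\<lbrakk>Ext G Y A f; Ext G A B g; is_pullback (Tot G) Y A B (g \<odot>\<^bsub>Tot G\<^esub> f) g W p q;
        a \<in> Hom (Tot G) W Y; f \<odot>\<^bsub>Tot G\<^esub> a = q; e \<in> Hom (Tot G) Y W; p \<odot>\<^bsub>Tot G\<^esub> e = Idn (Tot G) Y;
        q \<odot>\<^bsub>Tot G\<^esub> e = f; a \<odot>\<^bsub>Tot G\<^esub> e = Idn (Tot G) Y\<rbrakk>
      \<Longrightarrow> \<exists>Z c z. Ext G Z B z \<and> is_pullback (Tot G) Z A B z g Y c f \<and> c \<odot>\<^bsub>Tot G\<^esub> a = c \<odot>\<^bsub>Tot G\<^esub> p"
begin

section \<open>Slices of extensions and the pullback functor between them\<close>

sublocale T: category "Tot G" by (rule category_Tot)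

abbreviation compose (infixl "\<bullet>" 70) where "g \<bullet> f \<equiv> g \<odot>\<^bsub>Tot G\<^esub> f"

lemma Ext_Hom: "Ext G A B f \<Longrightarrow> f \<in> Hom (Tot G) A B"
  using T.regular_epi_Hom[OF Ext_regular_epi] .

lemma ext_slice_simps:
  "(Y, f) \<in> Ob (ext_slice G B) \<longleftrightarrow> Ext G Y B f"
  "h \<in> Hom (ext_slice G B) (Y, f) (Y', f') \<longleftrightarrow> h \<in> Hom (Tot G) Y Y' \<and> Ext G Y B f \<and> Ext G Y' B f' \<and> f' \<bullet> h = f"
  "Idn (ext_slice G B) (Y, f) = Idn (Tot G) Y" "Cmp (ext_slice G B) = Cmp (Tot G)"
  unfolding ext_slice_def using Ext_Hom by auto

lemma category_ext_slice: "category (ext_slice G B)"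
proof
  fix f U V assume "f \<in> Hom (ext_slice G B) U V"
  then show "U \<in> Ob (ext_slice G B) \<and> V \<in> Ob (ext_slice G B)" by (cases U; cases V) (simp add: ext_slice_simps)
next
  fix U assume "U \<in> Ob (ext_slice G B)"
  then show "Idn (ext_slice G B) U \<in> Hom (ext_slice G B) U U"
    by (cases U) (auto simp: ext_slice_simps T.Idn_Hom[OF T.Ob_dom[OF Ext_Hom]] T.Idn_right[OF Ext_Hom])
next
  fix f U V g W assume fg: "f \<in> Hom (ext_slice G B) U V" "g \<in> Hom (ext_slice G B) V W"
  obtain X x where U: "U = (X, x)" by (cases U)
  obtain Y y where V: "V = (Y, y)" by (cases V)
  obtain Z z where W: "W = (Z, z)" by (cases W)
  note f = fg(1)[unfolded U V ext_slice_simps] and g = fg(2)[unfolded V W ext_slice_simps]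
  have fh: "f \<in> Hom (Tot G) X Y" and gh: "g \<in> Hom (Tot G) Y Z" and zh: "z \<in> Hom (Tot G) Z B" using f g Ext_Hom by blast+
  have "z \<bullet> (g \<bullet> f) = x" using T.Cmp_reassoc[OF gh zh _ fh] f g by simp
  then show "g \<odot>\<^bsub>ext_slice G B\<^esub> f \<in> Hom (ext_slice G B) U W"
    unfolding U W ext_slice_simps using T.Cmp_Hom[OF fh gh] f g by simp
next
  fix f U V assume f: "f \<in> Hom (ext_slice G B) U V"
  obtain X x where U: "U = (X, x)" by (cases U)
  obtain Y y where V: "V = (Y, y)" by (cases V)
  have "f \<in> Hom (Tot G) X Y" using f unfolding U V ext_slice_simps by blast
  then show "Idn (ext_slice G B) V \<odot>\<^bsub>ext_slice G B\<^esub> f = f" "f \<odot>\<^bsub>ext_slice G B\<^esub> Idn (ext_slice G B) U = f"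
    unfolding U V ext_slice_simps by (rule T.Idn_left, rule T.Idn_right)
next
  fix f U V g W h S assume "f \<in> Hom (ext_slice G B) U V" "g \<in> Hom (ext_slice G B) V W" "h \<in> Hom (ext_slice G B) W S"
  then show "h \<odot>\<^bsub>ext_slice G B\<^esub> g \<odot>\<^bsub>ext_slice G B\<^esub> f = h \<odot>\<^bsub>ext_slice G B\<^esub> (g \<odot>\<^bsub>ext_slice G B\<^esub> f)"
    by (cases U; cases V; cases W; cases S) (auto simp: ext_slice_simps intro: T.Cmp_assoc)
qed

text \<open>Composition with g is left adjoint to pullback along g, with counit the projection
  \<open>p1\<close>. The comparison functor is fully faithful because \<open>p1\<close> is a regular
  epimorphism, and essentially surjective by \<open>Ext_descent\<close>.\<close>

lemma Ext_monadic:
  assumes g: "Ext G A B g"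
  shows "monadic_ext G A B g"
proof -
  note gh = Ext_Hom[OF g]
  define PB where "PB Y f = fst (chosen_pullback (Tot G) Y A B f g)" for Y f
  define p1 where "p1 Y f = fst (snd (chosen_pullback (Tot G) Y A B f g))" for Y f
  define p2 where "p2 Y f = snd (snd (chosen_pullback (Tot G) Y A B f g))" for Y f
  have chosen: "chosen_pullback (Tot G) Y A B f g = (PB Y f, p1 Y f, p2 Y f)" for Y f
    unfolding PB_def p1_def p2_def by simp
  have pb: "is_pullback (Tot G) Y A B f g (PB Y f) (p1 Y f) (p2 Y f)" if f: "Ext G Y B f" for Y f
  proof -
    obtain P p q where "is_pullback (Tot G) Y A B f g P p q" using Ext_pullback_exists[OF f g] by blast
    then have "case (P, p, q) of (P, p, q) \<Rightarrow> is_pullback (Tot G) Y A B f g P p q" by simp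
    then have "case chosen_pullback (Tot G) Y A B f g of (P, p, q) \<Rightarrow> is_pullback (Tot G) Y A B f g P p q"
      unfolding chosen_pullback_def by (rule someI)
    then show ?thesis unfolding chosen by simp
  qed
  have p1h: "p1 Y f \<in> Hom (Tot G) (PB Y f) Y" and p2h: "p2 Y f \<in> Hom (Tot G) (PB Y f) A"
    and psq: "f \<bullet> p1 Y f = g \<bullet> p2 Y f" if "Ext G Y B f" for Y f
    using T.pullback_Hom[OF pb[OF that]] by blast+
  have p2E: "Ext G (PB Y f) A (p2 Y f)" if "Ext G Y B f" for Y f using Ext_pullback[OF that pb[OF that]] .
  have p1E: "Ext G (PB Y f) Y (p1 Y f)" if "Ext G Y B f" for Y f
    using Ext_pullback[OF g T.is_pullback_swap[OF pb[OF that]]] .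
  have jm: "u = v" if "Ext G Y B f" "u \<in> Hom (Tot G) Z (PB Y f)" "v \<in> Hom (Tot G) Z (PB Y f)"
    "p1 Y f \<bullet> u = p1 Y f \<bullet> v" "p2 Y f \<bullet> u = p2 Y f \<bullet> v" for Y f Z u v
    using T.pullback_unique[OF pb[OF that(1)] that(2-5)] .
  define U where "U = pullback_functor G A B g"
  define sA where "sA = ext_slice G A"
  define sB where "sB = ext_slice G B"
  interpret sA: category sA unfolding sA_def by (rule category_ext_slice)
  interpret sB: category sB unfolding sB_def by (rule category_ext_slice)
  note sl = ext_slice_simps[where B = A, folded sA_def] ext_slice_simps[where B = B, folded sB_def]
  have UO: "FO U (Y, f) = (PB Y f, p2 Y f)" for Y f
    unfolding U_def pullback_functor_def by (simp add: chosen)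
  have UA: "FA U (Y, f) (Y', f') h \<in> Hom (Tot G) (PB Y f) (PB Y' f')"
      "p1 Y' f' \<bullet> FA U (Y, f) (Y', f') h = h \<bullet> p1 Y f" "p2 Y' f' \<bullet> FA U (Y, f) (Y', f') h = p2 Y f"
    if h: "h \<in> Hom sB (Y, f) (Y', f')" for Y f Y' f' h
  proof -
    note h' = h[unfolded sl]
    have f: "Ext G Y B f" and f': "Ext G Y' B f'" and hh: "h \<in> Hom (Tot G) Y Y'" and hf: "f' \<bullet> h = f" using h' by blast+
    have "f' \<bullet> (h \<bullet> p1 Y f) = g \<bullet> p2 Y f" using T.Cmp_reassoc[OF hh Ext_Hom[OF f'] hf p1h[OF f]] psq[OF f] by simp
    then obtain k where k: "k \<in> Hom (Tot G) (PB Y f) (PB Y' f')" "p1 Y' f' \<bullet> k = h \<bullet> p1 Y f" "p2 Y' f' \<bullet> k = p2 Y f"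
      using T.pullback_lift[OF pb[OF f'] T.Cmp_Hom[OF p1h[OF f] hh] p2h[OF f]] by metis
    have "FA U (Y, f) (Y', f') h = (THE k. k \<in> Hom (Tot G) (PB Y f) (PB Y' f') \<and> p1 Y' f' \<bullet> k = h \<bullet> p1 Y f \<and> p2 Y' f' \<bullet> k = p2 Y f)"
      unfolding U_def pullback_functor_def by (simp add: chosen)
    also have "\<dots> = k" by (rule the_equality) (use k jm[OF f'] in auto)
    finally show "FA U (Y, f) (Y', f') h \<in> Hom (Tot G) (PB Y f) (PB Y' f')"
      "p1 Y' f' \<bullet> FA U (Y, f) (Y', f') h = h \<bullet> p1 Y f" "p2 Y' f' \<bullet> FA U (Y, f) (Y', f') h = p2 Y f" using k by simp_all
  qed
  have U: "is_functor sB sA U"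
    unfolding is_functor_def
  proof (intro conjI allI ballI)
    fix V assume V: "V \<in> Ob sB"
    obtain Y f where Vf: "V = (Y, f)" by (cases V)
    have f: "Ext G Y B f" using V unfolding Vf sl .
    show "FO U V \<in> Ob sA" unfolding Vf UO sl using p2E[OF f] .
    have id: "Idn sB V \<in> Hom sB V V" using sB.Idn_Hom[OF V] .
    note id' = id[unfolded Vf sl(7)]
    have P: "PB Y f \<in> Ob (Tot G)" using T.Ob_dom[OF p1h[OF f]] .
    show "FA U V V (Idn sB V) = Idn sA (FO U V)"
      unfolding Vf UO sl
      using jm[OF f UA(1)[OF id'] T.Idn_Hom[OF P]] UA(2,3)[OF id'] T.Idn_left[OF p1h[OF f]] T.Idn_right[OF p1h[OF f]]
        T.Idn_right[OF p2h[OF f]] by simp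
  next
    fix V V' h assume h: "h \<in> Hom sB V V'"
    obtain Y f where V: "V = (Y, f)" by (cases V)
    obtain Y' f' where V': "V' = (Y', f')" by (cases V')
    note h' = h[unfolded V V']
    show "FA U V V' h \<in> Hom sA (FO U V) (FO U V')"
      unfolding V V' UO sl using UA[OF h'] h'[unfolded sl] p2E by blast
  next
    fix V V' V'' h k assume hk: "h \<in> Hom sB V V'" "k \<in> Hom sB V' V''"
    obtain Y f where V: "V = (Y, f)" by (cases V)
    obtain Y' f' where V': "V' = (Y', f')" by (cases V')
    obtain Y'' f'' where V'': "V'' = (Y'', f'')" by (cases V'')
    note h = hk(1)[unfolded V V'] and k = hk(2)[unfolded V' V'']
    note kh = sB.Cmp_Hom[OF h k, unfolded sl(8)]
    have f: "Ext G Y B f" and f': "Ext G Y' B f'" and f'': "Ext G Y'' B f''" and hh: "h \<in> Hom (Tot G) Y Y'" and kk: "k \<in> Hom (Tot G) Y' Y''"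
      using h k unfolding sl by blast+
    have "FA U (Y, f) (Y'', f'') (k \<bullet> h) = FA U (Y', f') (Y'', f'') k \<bullet> FA U (Y, f) (Y', f') h"
    proof (rule jm[OF f'' UA(1)[OF kh] T.Cmp_Hom[OF UA(1)[OF h] UA(1)[OF k]]])
      have "p1 Y'' f'' \<bullet> (FA U (Y', f') (Y'', f'') k \<bullet> FA U (Y, f) (Y', f') h) = k \<bullet> (p1 Y' f' \<bullet> FA U (Y, f) (Y', f') h)"
        using T.Cmp_square[OF UA(1)[OF k] p1h[OF f''] p1h[OF f'] kk UA(2)[OF k] UA(1)[OF h]] .
      also have "\<dots> = (k \<bullet> h) \<bullet> p1 Y f" unfolding UA(2)[OF h] using T.Cmp_assoc[OF p1h[OF f] hh kk] by simp
      finally show "p1 Y'' f'' \<bullet> FA U (Y, f) (Y'', f'') (k \<bullet> h) = p1 Y'' f'' \<bullet> (FA U (Y', f') (Y'', f'') k \<bullet> FA U (Y, f) (Y', f') h)"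
        unfolding UA(2)[OF kh] by simp
      show "p2 Y'' f'' \<bullet> FA U (Y, f) (Y'', f'') (k \<bullet> h) = p2 Y'' f'' \<bullet> (FA U (Y', f') (Y'', f'') k \<bullet> FA U (Y, f) (Y', f') h)"
        unfolding UA(3)[OF kh] T.Cmp_reassoc[OF UA(1)[OF k] p2h[OF f''] UA(3)[OF k] UA(1)[OF h]] UA(3)[OF h] ..
    qed
    then show "FA U V V'' (k \<odot>\<^bsub>sB\<^esub> h) = FA U V' V'' k \<odot>\<^bsub>sA\<^esub> FA U V V' h" unfolding V V' V'' sl .
  qed
  define F :: "('o \<times> 'm, 'm, 'o \<times> 'm, 'm) func" where "F = \<lparr>FO = (\<lambda>(Y, f). (Y, g \<bullet> f)), FA = (\<lambda>_ _ h. h)\<rparr>"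
  have FO: "FO F (Y, f) = (Y, g \<bullet> f)" and FA: "FA F V V' h = h" for Y f V V' h unfolding F_def by simp_all
  have gE: "Ext G Y B (g \<bullet> f)" if "Ext G Y A f" for Y f using Ext_Cmp[OF that g] .
  have FH: "h \<in> Hom sB (Y, g \<bullet> f) (Y', g \<bullet> f')" if h: "h \<in> Hom sA (Y, f) (Y', f')" for h Y f Y' f'
    using h gE T.Cmp_assoc[OF _ _ gh] Ext_Hom unfolding sl by metis
  have F: "is_functor sA sB F"
    unfolding is_functor_def FA
  proof (intro conjI allI ballI)
    fix V assume "V \<in> Ob sA" then show "FO F V \<in> Ob sB" by (cases V) (simp add: FO sl gE)
    show "Idn sA V = Idn sB (FO F V)" by (cases V) (simp add: FO sl)
  next
    fix V V' h assume "h \<in> Hom sA V V'" then show "h \<in> Hom sB (FO F V) (FO F V')" by (cases V; cases V') (simp add: FO FH)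
  qed (simp add: sl)
  \<comment> \<open>The unit at f is the arrow (id, f) into the pullback of g f along g.\<close>
  define \<eta>0 where "\<eta>0 Y f = (THE k. k \<in> Hom (Tot G) Y (PB Y (g \<bullet> f)) \<and> p1 Y (g \<bullet> f) \<bullet> k = Idn (Tot G) Y \<and> p2 Y (g \<bullet> f) \<bullet> k = f)" for Y f
  have \<eta>0: "\<eta>0 Y f \<in> Hom (Tot G) Y (PB Y (g \<bullet> f))" "p1 Y (g \<bullet> f) \<bullet> \<eta>0 Y f = Idn (Tot G) Y" "p2 Y (g \<bullet> f) \<bullet> \<eta>0 Y f = f"
    if f: "Ext G Y A f" for Y f
  proof -
    note gf = gE[OF f] and fh = Ext_Hom[OF f]
    obtain k where k: "k \<in> Hom (Tot G) Y (PB Y (g \<bullet> f))" "p1 Y (g \<bullet> f) \<bullet> k = Idn (Tot G) Y" "p2 Y (g \<bullet> f) \<bullet> k = f"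
      using T.pullback_lift[OF pb[OF gf] T.Idn_Hom[OF T.Ob_dom[OF fh]] fh T.Idn_right[OF Ext_Hom[OF gf]]] .
    have "\<eta>0 Y f = k" unfolding \<eta>0_def by (rule the_equality) (use k jm[OF gf] in auto)
    then show "\<eta>0 Y f \<in> Hom (Tot G) Y (PB Y (g \<bullet> f))" "p1 Y (g \<bullet> f) \<bullet> \<eta>0 Y f = Idn (Tot G) Y" "p2 Y (g \<bullet> f) \<bullet> \<eta>0 Y f = f"
      using k by simp_all
  qed
  define \<eta> where "\<eta> = (\<lambda>(Y, f). \<eta>0 Y f)"
  define \<epsilon> where "\<epsilon> = (\<lambda>(Z, z). p1 Z z)"
  have \<epsilon>H: "p1 Z z \<in> Hom sB (PB Z z, g \<bullet> p2 Z z) (Z, z)" if z: "Ext G Z B z" for Z z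
    unfolding sl using p1h[OF z] gE[OF p2E[OF z]] z psq[OF z] by blast
  have adj: "is_adjunction sA sB F U \<eta> \<epsilon>"
    unfolding is_adjunction_def
  proof (intro conjI F U)
    show "is_nat_trans sA sA id_func (comp_func U F) \<eta>"
      unfolding is_nat_trans_def id_func_def comp_func_def func.simps FA
    proof (intro conjI allI ballI)
      fix V assume V: "V \<in> Ob sA"
      obtain Y f where Vf: "V = (Y, f)" by (cases V)
      have f: "Ext G Y A f" using V unfolding Vf sl .
      show "\<eta> V \<in> Hom sA V (FO U (FO F V))"
        unfolding Vf FO UO \<eta>_def sl prod.case using \<eta>0[OF f] f p2E[OF gE[OF f]] by blast
    next
      fix V V' h assume h: "h \<in> Hom sA V V'"
      obtain Y f where V: "V = (Y, f)" by (cases V)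
      obtain Y' f' where V': "V' = (Y', f')" by (cases V')
      note h' = h[unfolded V V']
      have f: "Ext G Y A f" and f': "Ext G Y' A f'" and hh: "h \<in> Hom (Tot G) Y Y'" and hf: "f' \<bullet> h = f" using h' unfolding sl by blast+
      note UF = UA[OF FH[OF h']]
      have "\<eta>0 Y' f' \<bullet> h = FA U (Y, g \<bullet> f) (Y', g \<bullet> f') h \<bullet> \<eta>0 Y f"
      proof (rule jm[OF gE[OF f'] T.Cmp_Hom[OF hh \<eta>0(1)[OF f']] T.Cmp_Hom[OF \<eta>0(1)[OF f] UF(1)]])
        have "p1 Y' (g \<bullet> f') \<bullet> (\<eta>0 Y' f' \<bullet> h) = h"
          using T.Cmp_reassoc[OF \<eta>0(1)[OF f'] p1h[OF gE[OF f']] \<eta>0(2)[OF f'] hh] T.Idn_left[OF hh] by simp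
        moreover have "p1 Y' (g \<bullet> f') \<bullet> (FA U (Y, g \<bullet> f) (Y', g \<bullet> f') h \<bullet> \<eta>0 Y f) = h"
          using T.Cmp_square[OF UF(1) p1h[OF gE[OF f']] p1h[OF gE[OF f]] hh UF(2) \<eta>0(1)[OF f]] \<eta>0(2)[OF f] T.Idn_right[OF hh] by simp
        ultimately show "p1 Y' (g \<bullet> f') \<bullet> (\<eta>0 Y' f' \<bullet> h) = p1 Y' (g \<bullet> f') \<bullet> (FA U (Y, g \<bullet> f) (Y', g \<bullet> f') h \<bullet> \<eta>0 Y f)" by simp
        show "p2 Y' (g \<bullet> f') \<bullet> (\<eta>0 Y' f' \<bullet> h) = p2 Y' (g \<bullet> f') \<bullet> (FA U (Y, g \<bullet> f) (Y', g \<bullet> f') h \<bullet> \<eta>0 Y f)"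
          using T.Cmp_reassoc[OF \<eta>0(1)[OF f'] p2h[OF gE[OF f']] \<eta>0(3)[OF f'] hh] hf
            T.Cmp_reassoc[OF UF(1) p2h[OF gE[OF f']] UF(3) \<eta>0(1)[OF f]] \<eta>0(3)[OF f] by simp
      qed
      then show "\<eta> V' \<odot>\<^bsub>sA\<^esub> h = FA U (FO F V) (FO F V') h \<odot>\<^bsub>sA\<^esub> \<eta> V" unfolding V V' FO \<eta>_def sl by simp
    qed
    show "is_nat_trans sB sB (comp_func F U) id_func \<epsilon>"
      unfolding is_nat_trans_def id_func_def comp_func_def func.simps FA
    proof (intro conjI allI ballI)
      fix V assume V: "V \<in> Ob sB"
      then show "\<epsilon> V \<in> Hom sB (FO F (FO U V)) V" by (cases V) (simp add: UO FO \<epsilon>_def \<epsilon>H sl(5))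
    next
      fix V V' h assume h: "h \<in> Hom sB V V'"
      then show "\<epsilon> V' \<odot>\<^bsub>sB\<^esub> FA U V V' h = h \<odot>\<^bsub>sB\<^esub> \<epsilon> V" by (cases V; cases V') (simp add: \<epsilon>_def UA(2) sl(8))
    qed
    show "\<forall>V\<in>Ob sA. \<epsilon> (FO F V) \<odot>\<^bsub>sB\<^esub> FA F V (FO U (FO F V)) (\<eta> V) = Idn sB (FO F V)"
    proof
      fix V assume "V \<in> Ob sA"
      then show "\<epsilon> (FO F V) \<odot>\<^bsub>sB\<^esub> FA F V (FO U (FO F V)) (\<eta> V) = Idn sB (FO F V)"
        by (cases V) (simp add: FO FA \<epsilon>_def \<eta>_def sl \<eta>0)
    qed
    show "\<forall>V\<in>Ob sB. FA U (FO F (FO U V)) V (\<epsilon> V) \<odot>\<^bsub>sA\<^esub> \<eta> (FO U V) = Idn sA (FO U V)"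
    proof
      fix V assume V: "V \<in> Ob sB"
      obtain Z z where Vz: "V = (Z, z)" by (cases V)
      have z: "Ext G Z B z" using V unfolding Vz sl .
      note \<epsilon>z = UA[OF \<epsilon>H[OF z]] and e = \<eta>0[OF p2E[OF z]] and gz = gE[OF p2E[OF z]]
      have P: "PB Z z \<in> Ob (Tot G)" using T.Ob_dom[OF p1h[OF z]] .
      have "FA U (PB Z z, g \<bullet> p2 Z z) (Z, z) (p1 Z z) \<bullet> \<eta>0 (PB Z z) (p2 Z z) = Idn (Tot G) (PB Z z)"
        using jm[OF z T.Cmp_Hom[OF e(1) \<epsilon>z(1)] T.Idn_Hom[OF P]]
          T.Cmp_square[OF \<epsilon>z(1) p1h[OF z] p1h[OF gz] p1h[OF z] \<epsilon>z(2) e(1)] e(2,3) T.Idn_right[OF p1h[OF z]]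
          T.Cmp_reassoc[OF \<epsilon>z(1) p2h[OF z] \<epsilon>z(3) e(1)] T.Idn_right[OF p2h[OF z]] by simp
      then show "FA U (FO F (FO U V)) V (\<epsilon> V) \<odot>\<^bsub>sA\<^esub> \<eta> (FO U V) = Idn sA (FO U V)"
        unfolding Vz UO FO \<epsilon>_def \<eta>_def sl by simp
    qed
  qed
  define M where "M = comp_func U F"
  define \<mu> where "\<mu> = (\<lambda>V. FA U (FO F (FO U (FO F V))) (FO F V) (\<epsilon> (FO F V)))"
  have MO: "FO M (Y, f) = (PB Y (g \<bullet> f), p2 Y (g \<bullet> f))" and MA: "FA M (Y, f) (Y', f') h = FA U (Y, g \<bullet> f) (Y', g \<bullet> f') h" for Y f Y' f' h
    unfolding M_def comp_func_def by (simp_all add: FO FA UO)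
  \<comment> \<open>The canonical action on a pulled back extension. In elements it sends ((s, t),
    t'), with s in Z and t, t' in A, to (s, t'): the entry in A is replaced.\<close>
  define a0 where "a0 Z z = FA U (PB Z z, g \<bullet> p2 Z z) (Z, z) (p1 Z z)" for Z z
  have a0: "a0 Z z \<in> Hom (Tot G) (PB (PB Z z) (g \<bullet> p2 Z z)) (PB Z z)"
    "p1 Z z \<bullet> a0 Z z = p1 Z z \<bullet> p1 (PB Z z) (g \<bullet> p2 Z z)" "p2 Z z \<bullet> a0 Z z = p2 (PB Z z) (g \<bullet> p2 Z z)"
    if z: "Ext G Z B z" for Z z
    unfolding a0_def using UA[OF \<epsilon>H[OF z]] .
  define K where "K = comparison U F \<epsilon>"
  have KO: "FO K (Z, z) = ((PB Z z, p2 Z z), a0 Z z)" and KA: "FA K = FA U" for Z z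
    unfolding K_def comparison_def a0_def by (simp_all add: UO FO \<epsilon>_def)
  define E where "E = EM sA M \<eta> \<mu>"
  have Mf: "is_functor sA sA M" unfolding M_def by (rule functor_comp[OF F U])
  have Ec: "category E" unfolding E_def by (rule category_EM[OF sA.category_axioms Mf])
  have Kf: "is_functor sB E K"
    unfolding K_def E_def M_def \<mu>_def by (rule comparison_functor[OF sA.category_axioms sB.category_axioms adj])
  have "is_equivalence sB E K"
  proof (rule equivalence_criterion[OF sB.category_axioms Ec Kf])
    fix V V' h assume V: "V \<in> Ob sB" and V': "V' \<in> Ob sB" and h: "h \<in> Hom E (FO K V) (FO K V')"
    obtain Z z where Vz: "V = (Z, z)" by (cases V)
    obtain Z' z' where Vz': "V' = (Z', z')" by (cases V')
    have z: "Ext G Z B z" and z': "Ext G Z' B z'" using V V' unfolding Vz Vz' sl by blast+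
    have hA: "h \<in> Hom sA (PB Z z, p2 Z z) (PB Z' z', p2 Z' z')"
      and halg: "h \<bullet> a0 Z z = a0 Z' z' \<bullet> FA U (PB Z z, g \<bullet> p2 Z z) (PB Z' z', g \<bullet> p2 Z' z') h"
      using h unfolding Vz Vz' KO E_def EM_simps MA sl(4) by blast+
    have hh: "h \<in> Hom (Tot G) (PB Z z) (PB Z' z')" and hp: "p2 Z' z' \<bullet> h = p2 Z z" using hA unfolding sl by blast+
    note Mh = UA[OF FH[OF hA]]
    note gz = gE[OF p2E[OF z]] and gz' = gE[OF p2E[OF z']]
    have p1h': "p1 Z' z' \<bullet> h \<in> Hom (Tot G) (PB Z z) Z'" using T.Cmp_Hom[OF hh p1h[OF z']] .
    \<comment> \<open>Let u and v have the same entry in Z. The element w formed from u and the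
      A-entry of v is projected to u and acted on to v; compatibility of h with the actions then
      gives equal Z'-entries of h u and h v.\<close>
    have "(p1 Z' z' \<bullet> h) \<bullet> u = (p1 Z' z' \<bullet> h) \<bullet> v"
      if uv: "u \<in> Hom (Tot G) W (PB Z z)" "v \<in> Hom (Tot G) W (PB Z z)" "p1 Z z \<bullet> u = p1 Z z \<bullet> v" for W u v
    proof -
      have "(g \<bullet> p2 Z z) \<bullet> u = g \<bullet> (p2 Z z \<bullet> v)"
        using T.Cmp_assoc[OF uv(1) p2h[OF z] gh] T.pullback_square[OF pb[OF z] uv(1)] T.pullback_square[OF pb[OF z] uv(2)] uv(3) by simp
      then obtain w where w: "w \<in> Hom (Tot G) W (PB (PB Z z) (g \<bullet> p2 Z z))" "p1 (PB Z z) (g \<bullet> p2 Z z) \<bullet> w = u"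
         "p2 (PB Z z) (g \<bullet> p2 Z z) \<bullet> w = p2 Z z \<bullet> v"
        using T.pullback_lift[OF pb[OF gz] uv(1) T.Cmp_Hom[OF uv(2) p2h[OF z]]] by metis
      have "a0 Z z \<bullet> w = v"
        using jm[OF z T.Cmp_Hom[OF w(1) a0(1)[OF z]] uv(2)]
          T.Cmp_square[OF a0(1)[OF z] p1h[OF z] p1h[OF gz] p1h[OF z] a0(2)[OF z] w(1)] w uv(3)
          T.Cmp_reassoc[OF a0(1)[OF z] p2h[OF z] a0(3)[OF z] w(1)] by simp
      then have "h \<bullet> v = a0 Z' z' \<bullet> (FA U (PB Z z, g \<bullet> p2 Z z) (PB Z' z', g \<bullet> p2 Z' z') h \<bullet> w)"
        using T.Cmp_square[OF a0(1)[OF z] hh Mh(1) a0(1)[OF z'] halg w(1)] by simp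
      then have "p1 Z' z' \<bullet> (h \<bullet> v) = p1 Z' z' \<bullet> (p1 (PB Z' z') (g \<bullet> p2 Z' z') \<bullet> (FA U (PB Z z, g \<bullet> p2 Z z) (PB Z' z', g \<bullet> p2 Z' z') h \<bullet> w))"
        using T.Cmp_square[OF a0(1)[OF z'] p1h[OF z'] p1h[OF gz'] p1h[OF z'] a0(2)[OF z'] T.Cmp_Hom[OF w(1) Mh(1)]] by simp
      also have "\<dots> = p1 Z' z' \<bullet> (h \<bullet> u)"
        using T.Cmp_square[OF Mh(1) p1h[OF gz'] p1h[OF gz] hh Mh(2) w(1)] w(2) by simp
      finally show ?thesis using T.Cmp_assoc[OF uv(1) hh p1h[OF z']] T.Cmp_assoc[OF uv(2) hh p1h[OF z']] by simp
    qed
    then obtain k where k: "k \<in> Hom (Tot G) Z Z'" "k \<bullet> p1 Z z = p1 Z' z' \<bullet> h"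
      using T.regular_epi_factor[OF Ext_regular_epi[OF p1E[OF z]] p1h'] by metis
    have "(z' \<bullet> k) \<bullet> p1 Z z = z \<bullet> p1 Z z"
    proof -
      have "(z' \<bullet> k) \<bullet> p1 Z z = z' \<bullet> (p1 Z' z' \<bullet> h)" using T.Cmp_assoc[OF p1h[OF z] k(1) Ext_Hom[OF z']] k(2) by simp
      also have "\<dots> = g \<bullet> p2 Z z" using T.pullback_square[OF pb[OF z'] hh] hp by simp
      finally show ?thesis using psq[OF z] by simp
    qed
    then have "z' \<bullet> k = z"
      using T.regular_epi_cancel[OF Ext_regular_epi[OF p1E[OF z]] T.Cmp_Hom[OF k(1) Ext_Hom[OF z']] Ext_Hom[OF z]] by blast
    then have k': "k \<in> Hom sB (Z, z) (Z', z')" unfolding sl using k z z' by blast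
    have "FA U (Z, z) (Z', z') k = h" using jm[OF z' UA(1)[OF k'] hh] UA(2,3)[OF k'] k(2) hp by simp
    moreover have "l = k" if l: "l \<in> Hom sB (Z, z) (Z', z')" "FA U (Z, z) (Z', z') l = h" for l
    proof -
      have "l \<bullet> p1 Z z = k \<bullet> p1 Z z" using UA(2)[OF l(1)] l(2) k(2) by simp
      then show ?thesis
        using T.regular_epi_cancel[OF Ext_regular_epi[OF p1E[OF z]] _ k(1)] l(1) unfolding sl by blast
    qed
    ultimately show "\<exists>!k. k \<in> Hom sB V V' \<and> FA K V V' k = h" unfolding Vz Vz' KA using k' by blast
  next
    fix W assume W: "W \<in> Ob E"
    obtain Y f a where Wa: "W = ((Y, f), a)" by (metis prod.exhaust)
    have alg: "is_algebra sA M \<eta> \<mu> (Y, f) a" using W unfolding Wa E_def EM_simps .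
    note al = is_algebraD(1-3)[OF alg, unfolded MO sl]
    have f: "Ext G Y A f" and ah: "a \<in> Hom (Tot G) (PB Y (g \<bullet> f)) Y" and fa: "f \<bullet> a = p2 Y (g \<bullet> f)"
      and a\<eta>: "a \<bullet> \<eta>0 Y f = Idn (Tot G) Y" using al unfolding \<eta>_def by auto
    note gf = gE[OF f]
    \<comment> \<open>An action on f is the datum required for descent, with the unit of the monad
      as e.\<close>
    obtain Z c z where z: "Ext G Z B z" and Y: "is_pullback (Tot G) Z A B z g Y c f" and ca: "c \<bullet> a = c \<bullet> p1 Y (g \<bullet> f)"
      using Ext_descent[OF f g pb[OF gf] ah fa \<eta>0[OF f] a\<eta>] by blast
    note c = T.pullback_Hom[OF Y] and fh = Ext_Hom[OF f]
    note gz = gE[OF p2E[OF z]]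
    obtain i where i: "i \<in> Hom (Tot G) (PB Z z) Y" "c \<bullet> i = p1 Z z" "f \<bullet> i = p2 Z z"
      using T.pullback_lift[OF Y p1h[OF z] p2h[OF z] psq[OF z]] .
    obtain j where j: "j \<in> Hom (Tot G) Y (PB Z z)" "p1 Z z \<bullet> j = c" "p2 Z z \<bullet> j = f"
      using T.pullback_lift[OF pb[OF z] c(3,4,5)] .
    have P: "PB Z z \<in> Ob (Tot G)" and Yo: "Y \<in> Ob (Tot G)" using T.Ob_dom p1h[OF z] fh by blast+
    have ij: "i \<bullet> j = Idn (Tot G) Y"
      using T.pullback_unique[OF Y T.Cmp_Hom[OF j(1) i(1)] T.Idn_Hom[OF Yo]]
        T.Cmp_reassoc[OF i(1) c(3) i(2) j(1)] T.Cmp_reassoc[OF i(1) c(4) i(3) j(1)] j T.Idn_right[OF c(3)] T.Idn_right[OF c(4)] by simp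
    have ji: "j \<bullet> i = Idn (Tot G) (PB Z z)"
      using jm[OF z T.Cmp_Hom[OF i(1) j(1)] T.Idn_Hom[OF P]]
        T.Cmp_reassoc[OF j(1) p1h[OF z] j(2) i(1)] T.Cmp_reassoc[OF j(1) p2h[OF z] j(3) i(1)] i
        T.Idn_right[OF p1h[OF z]] T.Idn_right[OF p2h[OF z]] by simp
    have iA: "i \<in> Hom sA (PB Z z, p2 Z z) (Y, f)" and jA: "j \<in> Hom sA (Y, f) (PB Z z, p2 Z z)"
      unfolding sl using i j f p2E[OF z] by blast+
    note Ti = UA[OF FH[OF iA]] and Tj = UA[OF FH[OF jA]]
    \<comment> \<open>i and j respect the actions because c takes the same value on the action and
      on the projection; this is tested against the jointly monic pair (c, f), and for j against the
      projections of the pullback.\<close>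
    have iE: "i \<bullet> a0 Z z = a \<bullet> FA U (PB Z z, g \<bullet> p2 Z z) (Y, g \<bullet> f) i"
    proof (rule T.pullback_unique[OF Y T.Cmp_Hom[OF a0(1)[OF z] i(1)] T.Cmp_Hom[OF Ti(1) ah]])
      have "c \<bullet> (i \<bullet> a0 Z z) = p1 Z z \<bullet> p1 (PB Z z) (g \<bullet> p2 Z z)"
        using T.Cmp_reassoc[OF i(1) c(3) i(2) a0(1)[OF z]] a0(2)[OF z] by simp
      also have "\<dots> = c \<bullet> (i \<bullet> p1 (PB Z z) (g \<bullet> p2 Z z))" using T.Cmp_reassoc[OF i(1) c(3) i(2) p1h[OF gz]] by simp
      also have "\<dots> = c \<bullet> (p1 Y (g \<bullet> f) \<bullet> FA U (PB Z z, g \<bullet> p2 Z z) (Y, g \<bullet> f) i)" using Ti(2) by simp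
      also have "\<dots> = c \<bullet> (a \<bullet> FA U (PB Z z, g \<bullet> p2 Z z) (Y, g \<bullet> f) i)"
        using T.Cmp_square[OF ah c(3) p1h[OF gf] c(3) ca Ti(1)] by simp
      finally show "c \<bullet> (i \<bullet> a0 Z z) = c \<bullet> (a \<bullet> FA U (PB Z z, g \<bullet> p2 Z z) (Y, g \<bullet> f) i)" .
      show "f \<bullet> (i \<bullet> a0 Z z) = f \<bullet> (a \<bullet> FA U (PB Z z, g \<bullet> p2 Z z) (Y, g \<bullet> f) i)"
        using T.Cmp_reassoc[OF i(1) fh i(3) a0(1)[OF z]] a0(3)[OF z] T.Cmp_reassoc[OF ah fh fa Ti(1)] Ti(3) by simp
    qed
    have jE: "j \<bullet> a = a0 Z z \<bullet> FA U (Y, g \<bullet> f) (PB Z z, g \<bullet> p2 Z z) j"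
    proof (rule jm[OF z T.Cmp_Hom[OF ah j(1)] T.Cmp_Hom[OF Tj(1) a0(1)[OF z]]])
      have "p1 Z z \<bullet> (j \<bullet> a) = c \<bullet> p1 Y (g \<bullet> f)" using T.Cmp_reassoc[OF j(1) p1h[OF z] j(2) ah] ca by simp
      also have "\<dots> = p1 Z z \<bullet> (j \<bullet> p1 Y (g \<bullet> f))" using T.Cmp_reassoc[OF j(1) p1h[OF z] j(2) p1h[OF gf]] by simp
      also have "\<dots> = p1 Z z \<bullet> (p1 (PB Z z) (g \<bullet> p2 Z z) \<bullet> FA U (Y, g \<bullet> f) (PB Z z, g \<bullet> p2 Z z) j)" using Tj(2) by simp
      also have "\<dots> = p1 Z z \<bullet> (a0 Z z \<bullet> FA U (Y, g \<bullet> f) (PB Z z, g \<bullet> p2 Z z) j)"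
        using T.Cmp_square[OF a0(1)[OF z] p1h[OF z] p1h[OF gz] p1h[OF z] a0(2)[OF z] Tj(1)] by simp
      finally show "p1 Z z \<bullet> (j \<bullet> a) = p1 Z z \<bullet> (a0 Z z \<bullet> FA U (Y, g \<bullet> f) (PB Z z, g \<bullet> p2 Z z) j)" .
      show "p2 Z z \<bullet> (j \<bullet> a) = p2 Z z \<bullet> (a0 Z z \<bullet> FA U (Y, g \<bullet> f) (PB Z z, g \<bullet> p2 Z z) j)"
        using T.Cmp_reassoc[OF j(1) p2h[OF z] j(3) ah] fa T.Cmp_reassoc[OF a0(1)[OF z] p2h[OF z] a0(3)[OF z] Tj(1)] Tj(3) by simp
    qed
    have zB: "(Z, z) \<in> Ob sB" unfolding sl using z .
    have algZ: "is_algebra sA M \<eta> \<mu> (PB Z z, p2 Z z) (a0 Z z)"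
      using functorD(1)[OF Kf zB] unfolding KO E_def EM_simps .
    have "is_iso E (FO K (Z, z)) W i"
      unfolding is_iso_def Wa KO E_def EM_simps MA sl(4)
      using iA jA algZ alg iE jE ij ji by (auto simp: sl EM_simps MA)
    then show "\<exists>V\<in>Ob sB. \<exists>i. is_iso E (FO K V) W i" using zB by blast
  qed
  then have "is_monadic sB sA U"
    unfolding is_monadic_def E_def M_def \<mu>_def K_def using adj by blast
  then show ?thesis unfolding monadic_ext_def U_def sA_def sB_def using g by blast
qed

end

section \<open>Fibrations are monadic\<close>


context exact_maltsev
begin

text \<open>The relation is (p, a) on Y: it is jointly monic since f a = q and (p, q) comes from a
  pullback, and e witnesses reflexivity. Z is its quotient and z is the factorization of g f through
  it.\<close>

lemma fibration_descent:
  assumes f: "fibration C Y A f" and g: "fibration C A B g"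
    and pb: "is_pullback (TwoEq C) Y A B (g \<odot> f) g W p q"
    and a: "a \<in> Hom (TwoEq C) W Y" "f \<odot> a = q"
    and e: "e \<in> Hom (TwoEq C) Y W" "p \<odot> e = Idn (TwoEq C) Y" "q \<odot> e = f" "a \<odot> e = Idn (TwoEq C) Y"
  shows "\<exists>Z c z. fibration C Z B z \<and> is_pullback (TwoEq C) Z A B z g Y c f \<and> c \<odot> a = c \<odot> p"
proof -
  obtain Y0 RY SY where Y: "Y = (Y0, RY, SY)" by (cases Y)
  obtain A0 RA SA where A: "A = (A0, RA, SA)" by (cases A)
  obtain B0 RB SB where B: "B = (B0, RB, SB)" by (cases B)
  obtain W0 RW SW where W: "W = (W0, RW, SW)" by (cases W)
  note F = fibrationD[OF f[unfolded Y A]] and G = fibrationD[OF g[unfolded A B]]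
  note fh = regular_epi_Hom[OF F(5)] and gh = regular_epi_Hom[OF G(5)]
  note pbC = TwoEq_pullback_forget[OF pb[unfolded Y A B W]]
  note h = pullback_Hom[OF pbC]
  have ah: "a \<in> Hom C W0 Y0" and eh: "e \<in> Hom C Y0 W0" using a(1) e(1) unfolding Y W TwoEq_Hom by blast+
  have pe: "p \<odot> e = Idn C Y0" "a \<odot> e = Idn C Y0" using e unfolding Y by simp_all
  have gf: "(g \<odot> f) \<odot> x = g \<odot> (f \<odot> x)" if "x \<in> Hom C V Y0" for V x using Cmp_assoc[OF that fh gh] .
  have fa: "f \<odot> (a \<odot> w) = q \<odot> w" if "w \<in> Hom C V W0" for V w using Cmp_reassoc[OF ah fh a(2) that] .
  define D where "D = (W0, p, a)"
  have D: "apex D = W0" "leg0 D = p" "leg1 D = a" unfolding D_def by simp_all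
  have Dr: "rel Y0 Y0 D"
    unfolding rel_def D
  proof (intro conjI ballI allI impI h(3) ah, elim conjE)
    fix V u v assume uv: "u \<in> Hom C V W0" "v \<in> Hom C V W0" "p \<odot> u = p \<odot> v" "a \<odot> u = a \<odot> v"
    then show "u = v" using pullback_unique[OF pbC uv(1,2,3)] fa[OF uv(1)] fa[OF uv(2)] by simp
  qed
  have ex: "e \<odot> x \<in> Hom C V W0" "p \<odot> (e \<odot> x) = x" "a \<odot> (e \<odot> x) = x" "q \<odot> (e \<odot> x) = f \<odot> x" if x: "x \<in> Hom C V Y0" for V x
    using Cmp_Hom[OF x eh] Cmp_reassoc[OF eh h(3) pe(1) x] Cmp_reassoc[OF eh ah pe(2) x] Idn_left[OF x]
      Cmp_reassoc[OF eh h(4) e(3) x] by simp_all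
  have "mem D V x x" if "x \<in> Hom C V Y0" for V x using memI[of "e \<odot> x" V D] ex[OF that] D by simp
  then have Deq: "is_equiv_rel C Y0 D" using reflexive_equiv[OF Dr] by blast
  obtain Z0 c where Q: "quot C Y0 D = (Z0, c)" by (cases "quot C Y0 D")
  note cr = equiv_rel_quot(1)[OF Deq Q] and cm = equiv_rel_quot(2)[OF Deq Q]
  note ch = regular_epi_Hom[OF cr]
  have "mem D W0 p a" using mem_generic[OF Dr] unfolding D .
  then have ca: "c \<odot> a = c \<odot> p" using cm[OF h(3) ah] by simp
  have gfh: "g \<odot> f \<in> Hom C Y0 B0" using fh gh Cmp_Hom by blast
  \<comment> \<open>Elements identified by c have the form p w and a w, and g f p w = g q w = g f a
    w.\<close>
  have "(g \<odot> f) \<odot> x = (g \<odot> f) \<odot> y" if xy: "x \<in> Hom C V Y0" "y \<in> Hom C V Y0" "c \<odot> x = c \<odot> y" for V x y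
  proof -
    obtain w where w: "w \<in> Hom C V W0" "p \<odot> w = x" "a \<odot> w = y" using cm[OF xy(1,2)] xy(3) D unfolding mem_def by auto
    show ?thesis using pullback_square[OF pbC w(1)] w fa[OF w(1)] gf[OF xy(2)] by simp
  qed
  then obtain z where z: "z \<in> Hom C Z0 B0" "z \<odot> c = g \<odot> f" using regular_epi_factor[OF cr gfh] by metis
  have zr: "is_regular_epi C Z0 B0 z"
    using regular_epi_right_cancel[OF _ ch z(1)] z(2) regular_epi_Cmp[OF F(5) G(5)] by simp
  have zc: "z \<odot> (c \<odot> x) = g \<odot> (f \<odot> x)" if "x \<in> Hom C V Y0" for V x using Cmp_reassoc[OF ch z that] gf[OF that] by simp
  obtain RZ where RZ: "is_equiv_rel C Z0 RZ" "\<forall>V x y. mem RZ V x y \<longleftrightarrow> x \<in> Hom C V Z0 \<and> y \<in> Hom C V Z0 \<and> mem RB V (z \<odot> x) (z \<odot> y)"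
    using equiv_rel_inverse[OF G(3) z(1)] .
  obtain SZ where SZ: "is_equiv_rel C Z0 SZ" "\<forall>V x y. mem SZ V x y \<longleftrightarrow> x \<in> Hom C V Z0 \<and> y \<in> Hom C V Z0 \<and> mem SB V (z \<odot> x) (z \<odot> y)"
    using equiv_rel_inverse[OF G(4) z(1)] .
  have fz: "fibration C (Z0, RZ, SZ) (B0, RB, SB) z"
    unfolding fibration_iff reflects_def using RZ SZ G(3,4) zr by blast
  \<comment> \<open>Write x = p w and y = a w. If also f x = f y, then w and e x have the same two
    projections, so w = e x and y = a e x = x.\<close>
  have jm: "x = y" if xy: "x \<in> Hom C V Y0" "y \<in> Hom C V Y0" "c \<odot> x = c \<odot> y" "f \<odot> x = f \<odot> y" for V x y
  proof -
    obtain w where w: "w \<in> Hom C V W0" "p \<odot> w = x" "a \<odot> w = y" using cm[OF xy(1,2)] xy(3) D unfolding mem_def by auto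
    have "w = e \<odot> x" using pullback_unique[OF pbC w(1) ex(1)[OF xy(1)]] w ex[OF xy(1)] fa[OF w(1)] xy(4) by simp
    then show ?thesis using w(3) ex(3)[OF xy(1)] by simp
  qed
  define V where "V = (Y0, c, f)"
  have V: "apex V = Y0" "leg0 V = c" "leg1 V = f" unfolding V_def by simp_all
  have Vr: "rel Z0 A0 V" unfolding rel_def V using ch fh jm by blast
  have pbY: "is_pullback C Z0 A0 B0 z g Y0 c f"
  proof (rule is_pullbackI[OF z(1) gh ch fh z(2)])
    fix U \<alpha> \<beta> assume ab: "\<alpha> \<in> Hom C U Z0" "\<beta> \<in> Hom C U A0" "z \<odot> \<alpha> = g \<odot> \<beta>"
    \<comment> \<open>To reach a given point (\<alpha>, \<beta>) of the pullback, lift \<alpha> to y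
      and let \<beta> act on y: the result lies over \<beta> and keeps the class of y under c. Joint
      monicity of (c, f) lets this local solution descend.\<close>
    obtain U' d y where d: "is_regular_epi C U' U d" "y \<in> Hom C U' Y0" "c \<odot> y = \<alpha> \<odot> d"
      using regular_epi_lift[OF cr ab(1)] .
    note dh = regular_epi_Hom[OF d(1)]
    have "(g \<odot> f) \<odot> y = g \<odot> (\<beta> \<odot> d)"
      using zc[OF d(2)] gf[OF d(2)] d(3) Cmp_assoc[OF dh ab(1) z(1)] Cmp_assoc[OF dh ab(2) gh] ab(3) by simp
    then obtain w where w: "w \<in> Hom C U' W0" "p \<odot> w = y" "q \<odot> w = \<beta> \<odot> d"
      using pullback_lift[OF pbC d(2) Cmp_Hom[OF dh ab(2)]] by metis
    have "c \<odot> (a \<odot> w) = \<alpha> \<odot> d" using Cmp_square[OF ah ch h(3) ch ca w(1)] w(2) d(3) by simp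
    then have "mem V U' (\<alpha> \<odot> d) (\<beta> \<odot> d)"
      using memI[of "a \<odot> w" U' V] Cmp_Hom[OF w(1) ah] fa[OF w(1)] w(3) V by simp
    then have "mem V U \<alpha> \<beta>" using mem_local[OF Vr d(1) ab(1,2)] by blast
    then show "\<exists>k. k \<in> Hom C U Y0 \<and> c \<odot> k = \<alpha> \<and> f \<odot> k = \<beta>" unfolding mem_def V by blast
  qed (rule jm)
  have memc: "mem T' U (c \<odot> x) (c \<odot> y)"
    if T': "\<forall>V x y. mem T' V x y \<longleftrightarrow> x \<in> Hom C V Z0 \<and> y \<in> Hom C V Z0 \<and> mem TB V (z \<odot> x) (z \<odot> y)"
      and r: "is_equiv_rel C Y0 TY" "reflects Y0 f TY TA" "reflects A0 g TA TB" and m: "mem TY U x y" for T' TY TA TB U x y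
  proof -
    note xy = mem_Hom[OF equiv_rel_rel[OF r(1)] m]
    have "mem TB U (g \<odot> (f \<odot> x)) (g \<odot> (f \<odot> y))"
      using m reflectsD[OF r(2) xy] reflectsD[OF r(3) Cmp_Hom[OF xy(1) fh] Cmp_Hom[OF xy(2) fh]] by blast
    then show ?thesis using T' zc[OF xy(1)] zc[OF xy(2)] Cmp_Hom[OF xy(1) ch] Cmp_Hom[OF xy(2) ch] by simp
  qed
  have c2: "c \<in> Hom (TwoEq C) (Y0, RY, SY) (Z0, RZ, SZ)"
    unfolding TwoEq_Hom using ch F(1,2) RZ(1) SZ(1) memc[OF RZ(2) F(1,6) G(6)] memc[OF SZ(2) F(2,7) G(7)] by blast
  have "is_pullback (TwoEq C) (A0, RA, SA) (Z0, RZ, SZ) (B0, RB, SB) g z (Y0, RY, SY) f c"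
    by (rule TwoEq_pullbackI[OF is_pullback_swap[OF pbY] fibration_Hom[OF g[unfolded A B]] fibration_Hom[OF fz]
        fibration_Hom[OF f[unfolded Y A]] c2])
       (use reflectsD[OF F(6)] reflectsD[OF F(7)] in blast)+
  then have "is_pullback (TwoEq C) (Z0, RZ, SZ) A B z g Y c f"
    unfolding A B Y by (rule category.is_pullback_swap[OF category_TwoEq])
  then show ?thesis using fz ca unfolding B by blast
qed

lemma extension_class_Gamma_F: "extension_class (Gamma_F C)"
proof (rule extension_class.intro, unfold Gamma_F_simps TwoEq_simps)
  fix A B f assume "fibration C A B f"
  then show "is_regular_epi (TwoEq C) A B f" by (cases A; cases B) simp
next
  fix A D f B g assume "fibration C A D f" "fibration C B D g"
  then show "\<exists>P p q. is_pullback (TwoEq C) A B D f g P p q"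
    using fibration_pullback_exists fibration_Hom by metis
qed (fact category_TwoEq fibration_Cmp fibration_pullback fibration_descent)+

end

theorem theorem1:
  fixes C :: "('o, 'm) cat"
    and X X' :: 'o
    and R S R' S' :: "('o, 'm) span"
    and f :: 'm
  assumes "exact_category C"
    and "maltsev_category C"
    and "has_coequalizers C"
    and "fibration C (X, R, S) (X', R', S') f"
  shows "(central_ext (Gamma_F C) (X, R, S) (X', R', S') f
            \<longleftrightarrow> normal_ext (Gamma_F C) (X, R, S) (X', R', S') f)
       \<and> (normal_ext (Gamma_F C) (X, R, S) (X', R', S') f
            \<longleftrightarrow> rel_eq C (commutator C X (ker_rel C X X' f) (rel_join C X R S)) (diag_rel C X))"
proof -
  interpret exact_maltsev C
    by (rule exact_maltsev.intro[OF assms(1,2)]) (unfold_locales, rule assms(3))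
  let ?G = "Gamma_F C" and ?A = "(X, R, S)" and ?B = "(X', R', S')"
  let ?c = "rel_eq C (commutator C X (ker_rel C X X' f) (rel_join C X R S)) (diag_rel C X)"
  have mon: "monadic_ext ?G ?A ?B f"
    using extension_class.Ext_monadic[OF extension_class_Gamma_F] assms(4) by simp
  \<comment> \<open>f is its own witness for centrality: its pullback along itself is the kernel
    pair, whose second projection is trivial.\<close>
  have "central_ext ?G ?A ?B f" if "normal_ext ?G ?A ?B f"
    using that assms(4) mon unfolding normal_ext_def central_ext_def is_kernel_pair_def Gamma_F_simps by blast
  moreover have "?c" if "central_ext ?G ?A ?B f" using central_ext_commutator[OF assms(4) that] .
  moreover have "normal_ext ?G ?A ?B f" if c: "?c"
  proof -
    obtain P p q where "is_kernel_pair (TwoEq C) ?A ?B f P p q" "trivial_ext ?G P ?A p" "trivial_ext ?G P ?A q"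
      using commutator_kernel_pair_trivial[OF assms(4) c] .
    then show ?thesis unfolding normal_ext_def Gamma_F_simps using mon by blast
  qed
  ultimately show ?thesis by blast
qed

end
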